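(* Let $k\ge0$, $s<k$, and $\phi\in W_2^s(\mathbb{R}^d)$. Suppose that, for some $\eta_1,\eta_2>0$ and for some ball $\Omega$ centered at the origin, $$\eta_1\le|\widehat\phi|\le\eta_2\quad\text{a.e. on }\Omega,$$ and $$\sum_{\beta\in2\pi\mathbb{Z}^d\setminus\{0\}}|\beta|^{2s}\max_{\gamma:\,|\gamma|\le k}\|D^\gamma\widehat\phi\|^2_{L_\infty(\beta+\Omega)}<\infty.$$ Then $S_\phi(W_2^s)$ provides approximation order $k$ (in $W_2^s(\mathbb{R}^d)$) if and only if, near the origin, $$|\widehat\phi(\cdot+\alpha)|=O(|\cdot|^k)\qquad\text{for all }\alpha\in2\pi\mathbb{Z}^d\setminus\{0\}.$$
   Context: $|\cdot|$ is the Euclidean norm on $\mathbb{R}^d$; for a multi-index $\gamma\in\mathbb{Z}_+^d$, $|\gamma|=\gamma_1+\dots+\gamma_d$ and $D^\gamma=\partial^\gamma/\gamma!$ is the normalized monomial derivative. $\widehat f(\omega)=\int f(x)e^{-i\omega\cdot x}dx$. For $s\in\mathbb{R}$, $W_2^s=W_2^s(\mathbb{R}^d)$ is the space of tempered distributions $f$ with $\widehat f$ locally in $L_2$ and $\|f\|_{W_2^s}^2=\int(1+|\omega|)^{2s}|\widehat f(\omega)|^2d\omega<\infty$. $S_\phi(W_2^s)$ is the smallest closed subspace of $W_2^s$ containing $\phi$ and invariant under integer translations. "$S_\phi(W_2^s)$ provides approximation order $k$" ($k>s$) means: with $S^h=\{g(\cdot/h):g\in S_\phi(W_2^s)\}$,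 there is a constant $C$ such that $\inf_{g\in S^h}\|f-g\|_{W_2^s}\le Ch^{k-s}\|f\|_{W_2^k}$ for every $f\in W_2^k(\mathbb{R}^d)$ and every $h>0$.
   Formalization: The order k is taken to be a nonnegative integer; for fractional k the "if" direction fails, since derivatives with |γ| ≤ k do not make the constants in O(|·|^k) uniform over the lattice points α. *)

theory Defs
  imports "HOL-Analysis.Analysis" "HOL-Probability.Essential_Supremum"
begin

definition mi_abs :: "nat ^ 'd \<Rightarrow> nat" where
  "mi_abs \<gamma> = (\<Sum>i\<in>UNIV. \<gamma> $ i)"

definition mi_fact :: "nat ^ 'd \<Rightarrow> nat" where
  "mi_fact \<gamma> = (\<Prod>i\<in>UNIV. fact (\<gamma> $ i))"

definition pderivative :: "'d \<Rightarrow> (real ^ 'd \<Rightarrow> complex) \<Rightarrow> real ^ 'd \<Rightarrow> complex" where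
  "pderivative i f x = frechet_derivative f (at x) (axis i 1)"

definition pderivatives :: "'d list \<Rightarrow> (real ^ 'd \<Rightarrow> complex) \<Rightarrow> real ^ 'd \<Rightarrow> complex" where
  "pderivatives is f = foldr pderivative is f"

definition smooth :: "(real ^ 'd \<Rightarrow> complex) \<Rightarrow> bool" where
  "smooth f \<longleftrightarrow> (\<forall>is x. pderivatives is f differentiable (at x))"

text \<open>The (unnormalized) derivative of multi-order \<open>\<gamma>\<close>, only ever applied to smooth functions.
  The partial derivatives of those commute, so that the chosen order of differentiation is
  irrelevant.\<close>

definition mderiv :: "nat ^ 'd \<Rightarrow> (real ^ 'd \<Rightarrow> complex) \<Rightarrow> real ^ 'd \<Rightarrow> complex" where
  "mderiv \<gamma> f = pderivatives (SOME is. \<forall>i. count_list is i = \<gamma> $ i) f"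

definition test_functions :: "(real ^ 'd) set \<Rightarrow> (real ^ 'd \<Rightarrow> complex) set" where
  "test_functions U =
     {\<psi>. smooth \<psi> \<and> compact (closure {x. \<psi> x \<noteq> 0}) \<and> closure {x. \<psi> x \<noteq> 0} \<subseteq> U}"

definition schwartz :: "(real ^ 'd \<Rightarrow> complex) set" where
  "schwartz =
     {\<psi>. smooth \<psi> \<and>
         (\<forall>N \<gamma>. bdd_above (range (\<lambda>x. (1 + norm x) ^ N * norm (mderiv \<gamma> \<psi> x))))}"

definition schwartz_seminorm :: "nat \<Rightarrow> (real ^ 'd \<Rightarrow> complex) \<Rightarrow> real" where
  "schwartz_seminorm N \<psi> =
     (SUP (\<gamma>, x) \<in> {\<gamma>. mi_abs \<gamma> \<le> N} \<times> UNIV. (1 + norm x) ^ N * norm (mderiv \<gamma> \<psi> x))"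

definition fourier :: "(real ^ 'd \<Rightarrow> complex) \<Rightarrow> real ^ 'd \<Rightarrow> complex" where
  "fourier f \<omega> = (LINT x|lborel. f x * exp (- (\<i> * complex_of_real (\<omega> \<bullet> x))))"

text \<open>A distribution is a functional on all functions that vanishes off the Schwartz space, so that
  equality of functionals is equality of distributions.\<close>

type_synonym 'd dist = "(real ^ 'd \<Rightarrow> complex) \<Rightarrow> complex"

definition tempered_distributions :: "'d::finite dist set" where
  "tempered_distributions =
     {T. (\<forall>\<psi>. \<psi> \<notin> schwartz \<longrightarrow> T \<psi> = 0) \<and>
         (\<forall>\<psi>\<in>schwartz. \<forall>\<theta>\<in>schwartz. T (\<lambda>x. \<psi> x + \<theta> x) = T \<psi> + T \<theta>) \<and>
         (\<forall>c. \<forall>\<psi>\<in>schwartz. T (\<lambda>x. c * \<psi> x) = c * T \<psi>) \<and>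
         (\<exists>C N. \<forall>\<psi>\<in>schwartz. norm (T \<psi>) \<le> C * schwartz_seminorm N \<psi>)}"

definition fourier_dist :: "'d::finite dist \<Rightarrow> 'd dist" where
  "fourier_dist T = (\<lambda>\<psi>. if \<psi> \<in> schwartz then T (fourier \<psi>) else 0)"

definition locally_L2 :: "(real ^ 'd \<Rightarrow> complex) \<Rightarrow> bool" where
  "locally_L2 F \<longleftrightarrow> F \<in> borel_measurable lborel \<and>
     (\<forall>K. compact K \<longrightarrow> set_integrable lborel K (\<lambda>\<omega>. (norm (F \<omega>))\<^sup>2))"

definition represents :: "(real ^ 'd \<Rightarrow> complex) \<Rightarrow> 'd::finite dist \<Rightarrow> bool" where
  "represents F T \<longleftrightarrow> (\<forall>\<psi>\<in>test_functions UNIV. T \<psi> = (LINT \<omega>|lborel. F \<omega> * \<psi> \<omega>))"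

text \<open>The Fourier transform as a locally square-integrable function, determined up to a null set
  whenever such a function exists.\<close>

definition fhat :: "'d::finite dist \<Rightarrow> real ^ 'd \<Rightarrow> complex" where
  "fhat T = (SOME F. locally_L2 F \<and> represents F (fourier_dist T))"

definition sobolev :: "real \<Rightarrow> 'd::finite dist set" where
  "sobolev s =
     {T \<in> tempered_distributions. (\<exists>F. locally_L2 F \<and> represents F (fourier_dist T)) \<and>
        integrable lborel (\<lambda>\<omega>. (1 + norm \<omega>) powr (2 * s) * (norm (fhat T \<omega>))\<^sup>2)}"

definition sobolev_norm :: "real \<Rightarrow> 'd::finite dist \<Rightarrow> real" where
  "sobolev_norm s T =
     sqrt (LINT \<omega>|lborel. (1 + norm \<omega>) powr (2 * s) * (norm (fhat T \<omega>))\<^sup>2)"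

definition sobolev_closed_subspace :: "real \<Rightarrow> 'd::finite dist set \<Rightarrow> bool" where
  "sobolev_closed_subspace s V \<longleftrightarrow>
     V \<subseteq> sobolev s \<and> (\<lambda>\<psi>. 0) \<in> V \<and>
     (\<forall>f\<in>V. \<forall>g\<in>V. (\<lambda>\<psi>. f \<psi> + g \<psi>) \<in> V) \<and>
     (\<forall>c. \<forall>f\<in>V. (\<lambda>\<psi>. c * f \<psi>) \<in> V) \<and>
     (\<forall>g f. (\<forall>n. g n \<in> V) \<and> f \<in> sobolev s \<and>
        (\<lambda>n::nat. sobolev_norm s (\<lambda>\<psi>. g n \<psi> - f \<psi>)) \<longlonglongrightarrow> 0 \<longrightarrow> f \<in> V)"

definition integer_points :: "(real ^ 'd) set" where
  "integer_points = {j. \<forall>i. j $ i \<in> \<int>}"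

text \<open>\<open>translate j g\<close> is \<open>g(\<cdot> - j)\<close> and \<open>dilate h g\<close> is \<open>g(\<cdot> / h)\<close>.\<close>

definition translate :: "real ^ 'd \<Rightarrow> 'd::finite dist \<Rightarrow> 'd dist" where
  "translate j g = (\<lambda>\<psi>. g (\<lambda>x. \<psi> (x + j)))"

definition dilate :: "real \<Rightarrow> 'd::finite dist \<Rightarrow> 'd dist" where
  "dilate h g = (\<lambda>\<psi>. complex_of_real (h ^ CARD('d)) * g (\<lambda>x. \<psi> (h *\<^sub>R x)))"

definition PSI_space :: "real \<Rightarrow> 'd::finite dist \<Rightarrow> 'd dist set" where
  "PSI_space s \<phi> =
     \<Inter>{V. sobolev_closed_subspace s V \<and> \<phi> \<in> V \<and>
          (\<forall>j\<in>integer_points. \<forall>g\<in>V. translate j g \<in> V)}"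

definition provides_approximation_order :: "real \<Rightarrow> 'd::finite dist set \<Rightarrow> real \<Rightarrow> bool" where
  "provides_approximation_order s S k \<longleftrightarrow>
     (\<exists>C. \<forall>f\<in>sobolev k. \<forall>h>0.
        (INF g\<in>dilate h ` S. sobolev_norm s (\<lambda>\<psi>. f \<psi> - g \<psi>))
          \<le> C * h powr (k - s) * sobolev_norm k f)"

definition weak_deriv_on ::
  "(real ^ 'd::finite) set \<Rightarrow> nat ^ 'd \<Rightarrow> (real ^ 'd \<Rightarrow> complex) \<Rightarrow> (real ^ 'd \<Rightarrow> complex) \<Rightarrow> bool" where
  "weak_deriv_on U \<gamma> F G \<longleftrightarrow>
     G \<in> borel_measurable lborel \<and>
     (\<forall>K. compact K \<and> K \<subseteq> U \<longrightarrow> set_integrable lborel K G) \<and>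
     (\<forall>\<psi>\<in>test_functions U.
        (LINT x|lborel. F x * mderiv \<gamma> \<psi> x) = (- 1) ^ mi_abs \<gamma> * (LINT x|lborel. G x * \<psi> x))"

text \<open>The \<open>L\<^sub>\<infinity>(U)\<close> norm of the normalized derivative \<open>\<partial>\<^sup>\<gamma>F / \<gamma>!\<close>, taken in the sense of
  distributions on the open set \<open>U\<close>. Weak derivatives are unique almost everywhere on \<open>U\<close>, hence the
  infimum ranges over at most one value; it is \<open>\<infinity>\<close> if there is no weak derivative.\<close>

definition Linf_norm_D ::
  "nat ^ 'd \<Rightarrow> (real ^ 'd::finite \<Rightarrow> complex) \<Rightarrow> (real ^ 'd) set \<Rightarrow> ennreal" where
  "Linf_norm_D \<gamma> F U =
     (INF G\<in>{G. weak_deriv_on U \<gamma> F G}.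
        esssup (restrict_space lborel U) (\<lambda>x. ennreal (norm (G x / of_nat (mi_fact \<gamma>)))))"

definition dual_lattice :: "(real ^ 'd) set" where
  "dual_lattice = (\<lambda>j. (2 * pi) *\<^sub>R j) ` integer_points"

end

theory Submission
  imports Defs "HOL-Probability.Characteristic_Functions"
begin

text \<open>
All norms are weighted \<open>L\<^sub>2\<close> norms on the Fourier side. Write \<open>g^\<close> for the transform of \<open>g\<close>. Integer translations
multiply \<open>g^\<close> by characters of period \<open>2 \<pi> \<int>\<^sup>d\<close>, so the shift-invariant space generated by \<open>\<phi>\<close> contains all
distributions with transform \<open>p \<phi>^\<close>, \<open>p\<close> a trigonometric polynomial, and each of its elements \<open>g\<close> satisfies
\<open>g^(u) \<phi>^(u + \<alpha>) = g^(u + \<alpha>) \<phi>^(u)\<close> almost everywhere for every dual lattice point \<open>\<alpha>\<close>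
(\<open>PSI_space_multiplier\<close>, \<open>PSI_space_proportional\<close>).

Necessity. An approximant on the scale \<open>h\<close> has values at \<open>\<omega>\<close> and at \<open>\<omega> + \<alpha>/h\<close> that are tied together in the ratio
of \<open>\<phi>^(h \<omega>)\<close> and \<open>\<phi>^(h \<omega> + \<alpha>)\<close>. A target living near the origin only cannot be met at \<open>\<omega>\<close> without an error at
\<open>\<omega> + \<alpha>/h\<close>, unless \<open>\<phi>^(h \<omega> + \<alpha>)\<close> is small (\<open>two_point_lower_bound\<close>). The order inequality, used for the transform
of a bump function cut off to an arbitrary Borel set, converts this into a pointwise estimate on an
annulus (\<open>annulus_estimate\<close>), and letting \<open>h\<close> run through the powers of \<open>1/2\<close> gives
\<open>\<phi>^(\<omega> + \<alpha>) = O(|\<omega>|\<^sup>k)\<close> (\<open>approximation_order_necessary\<close>).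

Sufficiency. The periodic extension of the quotient \<open>f^(u/h) / \<phi>^(u)\<close> from a small ball is approximated by
trigonometric polynomials (\<open>trigonometric_density\<close>). The resulting element of the space reproduces \<open>f^\<close> for
\<open>|\<omega>| < r/h\<close>, and the copies of the quotient at the other lattice points are damped by \<open>\<phi>^(h \<omega> + \<alpha>)\<close>
(\<open>approximation_step\<close>). To add up these contributions the constants in \<open>\<phi>^(\<omega> + \<alpha>) = O(|\<omega>|\<^sup>k)\<close> and the
neighbourhoods where this holds have to be uniform in \<open>\<alpha>\<close>. This is what the bounds on the derivatives provide:
by \<open>Linf_taylor\<close>, a function that vanishes to order \<open>k\<close> at a point is bounded on a whole ball by the weak derivatives of
order \<open>k\<close> there. Since these derivatives are weak and \<open>\<phi>^\<close> need not have a Taylor polynomial in any classical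
sense, the proof replaces Taylor expansions by iterated differences along \<open>x, x/2, x/4, \<dots>\<close> and passes
through mollifications.

The supporting analysis rests on one principle: a class of bounded functions that is closed under
linear combinations and bounded pointwise limits and contains the exponentials contains all bounded
Borel functions (\<open>bounded_limit_space_all\<close>, and \<open>bounded_limit_space_periodic\<close> for periodic functions). It yields
the density of exponential sums, the uniqueness theorem for Fourier transforms, the fact that
test functions separate locally integrable functions, and the \<open>L\<^sub>1\<close> convergence of mollifications.
\<close>

section \<open>Partial derivatives of smooth functions\<close>

lemma pderivative_eqI:
  "(f has_derivative f') (at x) \<Longrightarrow> pderivative i f x = f' (axis i 1)"
  unfolding pderivative_def using frechet_derivative_at by metis

lemma has_derivative_pderivative:
  fixes f :: "real ^ 'd::finite \<Rightarrow> complex"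
  assumes "f differentiable (at x)"
  shows "(f has_derivative (\<lambda>v. \<Sum>i\<in>UNIV. of_real (v $ i) * pderivative i f x)) (at x)"
proof -
  obtain f' where f': "(f has_derivative f') (at x)"
    using assms by (auto simp: differentiable_def)
  then interpret bounded_linear f' by (rule has_derivative_bounded_linear)
  have "f' v = (\<Sum>i\<in>UNIV. of_real (v $ i) * pderivative i f x)" for v
  proof -
    have "f' v = f' (\<Sum>i\<in>UNIV. (v $ i) *\<^sub>R axis i 1)"
      by (simp add: basis_expansion[of v, unfolded scalar_mult_eq_scaleR])
    also have "\<dots> = (\<Sum>i\<in>UNIV. of_real (v $ i) * pderivative i f x)"
      by (simp only: sum scaleR pderivative_eqI[OF f'] scaleR_conv_of_real[where 'a=complex])
    finally show ?thesis .
  qed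
  then show ?thesis using f' by presburger
qed

lemma pderivatives_snoc: "pderivatives (is @ [i]) f = pderivatives is (pderivative i f)"
  by (simp add: pderivatives_def)

lemma pderivatives_Cons: "pderivatives (i # is) f = pderivative i (pderivatives is f)"
  by (simp add: pderivatives_def)

lemma pderivatives_Nil [simp]: "pderivatives [] f = f"
  by (simp add: pderivatives_def)

text \<open>Smoothness quantifies over lists of directions, which is awkward under products. Recursion on the
order of differentiability, derivative first, makes the closure properties plain inductions.\<close>

primrec times_differentiable :: "nat \<Rightarrow> (real ^ 'd::finite \<Rightarrow> complex) \<Rightarrow> bool" where
  "times_differentiable 0 f = True"
| "times_differentiable (Suc n) f =
     ((\<forall>x. f differentiable (at x)) \<and> (\<forall>i. times_differentiable n (pderivative i f)))"

lemma times_differentiable_iff: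
  "times_differentiable n f \<longleftrightarrow>
     (\<forall>is x. length is < n \<longrightarrow> pderivatives is f differentiable (at x))"
proof (induction n arbitrary: f)
  case (Suc n)
  show ?case
  proof
    assume L: "times_differentiable (Suc n) f"
    show "\<forall>is x. length is < Suc n \<longrightarrow> pderivatives is f differentiable (at x)"
    proof (intro allI impI)
      fix "is" :: "'a list" and x assume "length is < Suc n"
      then show "pderivatives is f differentiable (at x)"
        using L by (cases "is" rule: rev_cases) (auto simp: Suc pderivatives_snoc)
    qed
  next
    assume R: "\<forall>is x. length is < Suc n \<longrightarrow> pderivatives is f differentiable (at x)"
    have "pderivatives is (pderivative i f) differentiable (at x)" if "length is < n" for "is" i x
      using R that by (simp flip: pderivatives_snoc)
    moreover have "f differentiable (at x)" for x
      using R[rule_format, of "[]"] by simp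
    ultimately show "times_differentiable (Suc n) f" by (simp add: Suc)
  qed
qed auto

lemma smooth_iff_times: "smooth f \<longleftrightarrow> (\<forall>n. times_differentiable n f)"
  by (auto simp: smooth_def times_differentiable_iff)

lemma times_differentiable_SucD: "times_differentiable (Suc n) f \<Longrightarrow> times_differentiable n f"
  unfolding times_differentiable_iff by auto

lemma smooth_differentiable: "smooth f \<Longrightarrow> f differentiable (at x)"
  unfolding smooth_def using pderivatives_Nil by metis

lemma smooth_pderivative: "smooth f \<Longrightarrow> smooth (pderivative i f)"
  unfolding smooth_def by (metis pderivatives_snoc)

lemma smooth_pderivatives: "smooth f \<Longrightarrow> smooth (pderivatives is f)"
  by (induction "is") (auto simp: pderivatives_Cons smooth_pderivative)

lemma smooth_continuous: "smooth f \<Longrightarrow> continuous_on A f"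
  by (meson continuous_at_imp_continuous_on differentiable_imp_continuous_within smooth_differentiable)

lemma smooth_measurable [measurable_dest]: "smooth f \<Longrightarrow> f \<in> borel_measurable borel"
  by (intro borel_measurable_continuous_onI smooth_continuous)

lemma pderivative_add:
  assumes "f differentiable (at x)" "g differentiable (at x)"
  shows "pderivative i (\<lambda>x. f x + g x) x = pderivative i f x + pderivative i g x"
  using pderivative_eqI[OF has_derivative_add[OF assms[unfolded frechet_derivative_works]]]
  by (simp add: pderivative_def)

lemma pderivative_mult:
  assumes "f differentiable (at x)" "g differentiable (at x)"
  shows "pderivative i (\<lambda>x. f x * g x) x = f x * pderivative i g x + pderivative i f x * g x"
  using pderivative_eqI[OF has_derivative_mult[OF assms[unfolded frechet_derivative_works]]]
  by (simp add: pderivative_def)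

lemma pderivative_const [simp]: "pderivative i (\<lambda>x. c) = (\<lambda>x. 0)"
  by (rule ext, rule pderivative_eqI) simp

lemma times_differentiable_add:
  "times_differentiable n f \<Longrightarrow> times_differentiable n g \<Longrightarrow> times_differentiable n (\<lambda>x. f x + g x)"
proof (induction n arbitrary: f g)
  case (Suc n)
  then have "pderivative i (\<lambda>x. f x + g x) = (\<lambda>x. pderivative i f x + pderivative i g x)" for i
    by (auto simp: pderivative_add)
  with Suc show ?case by auto
qed auto

lemma times_differentiable_mult:
  "times_differentiable n f \<Longrightarrow> times_differentiable n g \<Longrightarrow> times_differentiable n (\<lambda>x. f x * g x)"
proof (induction n arbitrary: f g)
  case (Suc n)
  then have "pderivative i (\<lambda>x. f x * g x) = (\<lambda>x. f x * pderivative i g x + pderivative i f x * g x)" for i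
    by (auto simp: pderivative_mult)
  moreover have "times_differentiable n f" "times_differentiable n g"
    using Suc.prems times_differentiable_SucD by blast+
  ultimately show ?case using Suc by (auto intro!: times_differentiable_add)
qed auto

lemma smooth_const [simp]: "smooth (\<lambda>x::real^'d::finite. c)"
proof -
  have "times_differentiable n (\<lambda>x::real^'d. c)" for n and c :: complex
    by (induction n arbitrary: c) auto
  then show ?thesis by (simp add: smooth_iff_times)
qed

lemma smooth_add: "smooth f \<Longrightarrow> smooth g \<Longrightarrow> smooth (\<lambda>x. f x + g x)"
  by (simp add: smooth_iff_times times_differentiable_add)

lemma smooth_mult: "smooth f \<Longrightarrow> smooth g \<Longrightarrow> smooth (\<lambda>x. f x * g x)"
  by (simp add: smooth_iff_times times_differentiable_mult)

lemma smooth_coord [simp]: "smooth (\<lambda>x::real^'d::finite. of_real (x $ i))"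
proof -
  have der: "((\<lambda>x::real^'d. complex_of_real (x $ i)) has_derivative (\<lambda>v. of_real (v $ i))) (at x)" for x
    by (intro bounded_linear_imp_has_derivative bounded_linear_compose[OF bounded_linear_of_real]
        bounded_linear_vec_nth)
  have "pderivative j (\<lambda>x::real^'d. complex_of_real (x $ i)) = (\<lambda>x. of_real ((axis j 1 :: real^'d) $ i))" for j
    by (rule ext, rule pderivative_eqI[OF der])
  moreover have "times_differentiable n (\<lambda>x::real^'d. c)" for n and c
    using smooth_const smooth_iff_times by blast
  ultimately have "times_differentiable n (\<lambda>x::real^'d. of_real (x $ i))" for n
    using differentiableI[OF der] by (cases n) auto
  then show ?thesis by (simp add: smooth_iff_times)
qed

lemma pderivative_cmult:
  "f differentiable (at x) \<Longrightarrow> pderivative i (\<lambda>x. c * f x) x = c * pderivative i f x"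
  by (simp add: pderivative_mult)

lemma pderivative_affine:
  fixes f :: "real ^ 'd::finite \<Rightarrow> complex"
  assumes "f differentiable (at (c *\<^sub>R x + a))"
  shows "pderivative i (\<lambda>x. f (c *\<^sub>R x + a)) x = of_real c * pderivative i f (c *\<^sub>R x + a)"
    and "(\<lambda>x. f (c *\<^sub>R x + a)) differentiable (at x)"
proof -
  obtain f' where f': "(f has_derivative f') (at (c *\<^sub>R x + a))"
    using assms by (auto simp: differentiable_def)
  then have lin: "f' (c *\<^sub>R v) = of_real c * f' v" for v
    using linear_cmul[OF has_derivative_linear[OF f']] by (simp only: scaleR_conv_of_real[where 'a=complex])
  have "((\<lambda>x. c *\<^sub>R x + a) has_derivative (\<lambda>v. c *\<^sub>R v)) (at x)"
    by (auto intro!: derivative_eq_intros)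
  from has_derivative_compose[OF this f']
  have d: "((\<lambda>x. f (c *\<^sub>R x + a)) has_derivative (\<lambda>v. of_real c * f' v)) (at x)"
    by (simp add: lin)
  show "pderivative i (\<lambda>x. f (c *\<^sub>R x + a)) x = of_real c * pderivative i f (c *\<^sub>R x + a)"
    by (simp add: pderivative_eqI[OF d] pderivative_eqI[OF f'])
  show "(\<lambda>x. f (c *\<^sub>R x + a)) differentiable (at x)"
    using d by (auto simp: differentiable_def)
qed

lemma smooth_affine:
  assumes "smooth f"
  shows "smooth (\<lambda>x. f (c *\<^sub>R x + a))"
    and "pderivatives is (\<lambda>x. f (c *\<^sub>R x + a)) = (\<lambda>x. of_real c ^ length is * pderivatives is f (c *\<^sub>R x + a))"
proof -
  have d: "pderivatives is f differentiable (at x)" for "is" x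
    using assms by (simp add: smooth_def)
  have *: "pderivatives is (\<lambda>x. f (c *\<^sub>R x + a)) = (\<lambda>x. of_real c ^ length is * pderivatives is f (c *\<^sub>R x + a))" for "is"
  proof (induction "is")
    case (Cons i "is")
    have "pderivative i (\<lambda>x. of_real c ^ length is * pderivatives is f (c *\<^sub>R x + a)) x
        = of_real c ^ length (i # is) * pderivatives (i # is) f (c *\<^sub>R x + a)" for x
      by (subst pderivative_cmult) (simp_all add: pderivative_affine d pderivatives_Cons)
    then show ?case by (simp add: Cons.IH pderivatives_Cons[of i "is"] fun_eq_iff)
  qed simp
  then show "pderivatives is (\<lambda>x. f (c *\<^sub>R x + a)) = (\<lambda>x. of_real c ^ length is * pderivatives is f (c *\<^sub>R x + a))" .
  have "(\<lambda>x. of_real c ^ length is * pderivatives is f (c *\<^sub>R x + a)) differentiable (at x)" for "is" x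
    by (intro derivative_intros pderivative_affine(2) d)
  then show "smooth (\<lambda>x. f (c *\<^sub>R x + a))"
    by (simp add: smooth_def *)
qed

lemma has_derivative_cis_inner:
  "((\<lambda>x. cis (\<xi> \<bullet> x)) has_derivative (\<lambda>v. \<i> * of_real (\<xi> \<bullet> v) * cis (\<xi> \<bullet> x))) (at x)"
proof -
  have "(cis has_vector_derivative (\<i> * cis t)) (at t)" for t
    unfolding cis_conv_exp has_vector_derivative_def
    by (rule has_derivative_eq_rhs, rule has_derivative_compose[of "\<lambda>t. \<i> * complex_of_real t" "\<lambda>t. \<i> * complex_of_real t" _ _ exp "\<lambda>v. exp (\<i> * complex_of_real t) * v"])
      (auto intro!: derivative_eq_intros simp: has_field_derivative_def[symmetric] scaleR_conv_of_real fun_eq_iff)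
  then have "(cis has_derivative (\<lambda>u. u *\<^sub>R (\<i> * cis (\<xi> \<bullet> x)))) (at (\<xi> \<bullet> x))"
    by (simp add: has_vector_derivative_def)
  moreover have "((\<lambda>x. \<xi> \<bullet> x) has_derivative (\<lambda>v. \<xi> \<bullet> v)) (at x)"
    by (auto intro!: derivative_eq_intros)
  ultimately have "((\<lambda>x. cis (\<xi> \<bullet> x)) has_derivative (\<lambda>v. (\<xi> \<bullet> v) *\<^sub>R (\<i> * cis (\<xi> \<bullet> x)))) (at x)"
    using has_derivative_compose by fast
  then show ?thesis
    by (simp only: scaleR_conv_of_real[where 'a=complex] mult_ac)
qed

lemma smooth_cis_inner: "smooth (\<lambda>x. cis (\<xi> \<bullet> x))"
proof -
  have p: "pderivative i (\<lambda>x. cis (\<xi> \<bullet> x)) = (\<lambda>x. (\<i> * of_real (\<xi> $ i)) * cis (\<xi> \<bullet> x))" for i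
    by (rule ext, subst pderivative_eqI[OF has_derivative_cis_inner]) (simp add: inner_axis)
  have c: "times_differentiable n (\<lambda>x::real^'a. c)" for n and c
    using smooth_const smooth_iff_times by blast
  have "times_differentiable n (\<lambda>x. cis (\<xi> \<bullet> x))" for n
  proof (induction n)
    case (Suc n)
    then show ?case using has_derivative_cis_inner
      by (auto simp: p differentiable_def intro!: times_differentiable_mult c)
  qed simp
  then show ?thesis by (simp add: smooth_iff_times)
qed

section \<open>A bump function\<close>

text \<open>Multiples of the classical function \<open>exp (- 1 / t)\<close> by polynomials in \<open>1 / t\<close>. The family is closed
under differentiation, so that its members are smooth, across \<open>t = 0\<close> too.\<close>

definition flat :: "real poly \<Rightarrow> real \<Rightarrow> real" where
  "flat p t = (if t > 0 then poly p (1 / t) * exp (- (1 / t)) else 0)"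

lemma poly_times_exp_tendsto_0: "((\<lambda>x::real. poly p x * exp (- x)) \<longlongrightarrow> 0) at_top"
proof -
  have "((\<lambda>x::real. x ^ i * exp (- x)) \<longlongrightarrow> 0) at_top" for i
    using tendsto_power_div_exp_0[of i] by (simp add: exp_minus field_simps)
  then have "((\<lambda>x::real. \<Sum>i\<le>degree p. coeff p i * (x ^ i * exp (- x))) \<longlongrightarrow> 0) at_top"
    by (intro tendsto_null_sum tendsto_mult_right_zero)
  then show ?thesis by (simp add: poly_altdef sum_distrib_right mult.assoc)
qed

text \<open>At \<open>t = 0\<close> the difference quotient of \<open>flat p\<close> is \<open>q (1 / t) * exp (- 1 / t)\<close> with \<open>q(x) = x p(x)\<close>, and
the exponential wins against any polynomial.\<close>

lemma flat_has_derivative: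
  "(flat p has_real_derivative flat ([:0, 0, 1:] * (p - pderiv p)) t) (at t)"
proof -
  consider "t > 0" | "t < 0" | "t = 0" by linarith
  then show ?thesis
  proof cases
    case 1
    have "((\<lambda>t. poly p (1 / t) * exp (- (1 / t))) has_real_derivative flat ([:0, 0, 1:] * (p - pderiv p)) t) (at t)"
      unfolding flat_def using 1
      by (auto intro!: derivative_eq_intros DERIV_chain2[OF poly_DERIV] simp: field_simps power2_eq_square)
    then show ?thesis
      by (rule DERIV_cong_ev[THEN iffD1, rotated 3])
         (use 1 in \<open>auto simp: flat_def eventually_nhds_metric dist_real_def intro!: exI[of _ t]\<close>)
  next
    case 2
    have "((\<lambda>t. 0) has_real_derivative flat ([:0, 0, 1:] * (p - pderiv p)) t) (at t)"
      using 2 by (simp add: flat_def)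
    then show ?thesis
      by (rule DERIV_cong_ev[THEN iffD1, rotated 3])
         (use 2 in \<open>auto simp: flat_def eventually_nhds_metric dist_real_def intro!: exI[of _ "-t"]\<close>)
  next
    case 3
    have "((\<lambda>h. poly (pCons 0 p) (inverse h) * exp (- inverse h)) \<longlongrightarrow> 0) (at_right 0)"
      by (rule filterlim_compose[OF poly_times_exp_tendsto_0 filterlim_inverse_at_top_right])
    then have "((\<lambda>h. flat p h / h) \<longlongrightarrow> 0) (at_right 0)"
      by (rule Lim_transform_eventually)
         (auto simp: flat_def eventually_at_filter inverse_eq_divide)
    moreover have "((\<lambda>h. flat p h / h) \<longlongrightarrow> 0) (at_left 0)"
      by (rule tendsto_eventually) (auto simp: flat_def eventually_at_filter)
    ultimately have "((\<lambda>h. flat p h / h) \<longlongrightarrow> 0) (at 0)"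
      by (simp add: filterlim_at_split)
    then show ?thesis using 3 by (simp add: DERIV_def flat_def)
  qed
qed

lemma smooth_flat_norm: "smooth (\<lambda>x::real^'d::finite. of_real (flat p (1 - x \<bullet> x)))"
proof -
  have d: "((\<lambda>x::real^'d. complex_of_real (flat p (1 - x \<bullet> x))) has_derivative
      (\<lambda>v. of_real (- 2 * (x \<bullet> v)) * of_real (flat ([:0, 0, 1:] * (p - pderiv p)) (1 - x \<bullet> x)))) (at x)" for p x
  proof -
    have "((\<lambda>x::real^'d. flat p (1 - x \<bullet> x)) has_derivative
      (\<lambda>v. - 2 * (x \<bullet> v) * flat ([:0, 0, 1:] * (p - pderiv p)) (1 - x \<bullet> x))) (at x)"
      by (rule has_derivative_eq_rhs, rule DERIV_compose_FDERIV[OF flat_has_derivative])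
        (auto intro!: derivative_eq_intros simp: inner_commute)
    from has_derivative_of_real[OF this] show ?thesis by simp
  qed
  have pd: "pderivative i (\<lambda>x::real^'d. complex_of_real (flat p (1 - x \<bullet> x))) =
     (\<lambda>x. ((- 2) * of_real (x $ i)) * of_real (flat ([:0, 0, 1:] * (p - pderiv p)) (1 - x \<bullet> x)))" for i p
    by (rule ext, subst pderivative_eqI[OF d]) (simp add: inner_axis)
  have c: "times_differentiable n (\<lambda>x::real^'d. (- 2) * complex_of_real (x $ i))" for n i
    using smooth_mult[OF smooth_const smooth_coord] smooth_iff_times by blast
  have "times_differentiable n (\<lambda>x::real^'d. of_real (flat p (1 - x \<bullet> x)))" for n
  proof (induction n arbitrary: p)
    case (Suc n)
    show ?case
      unfolding times_differentiable.simps pd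
      by (intro conjI allI times_differentiable_mult c Suc.IH differentiableI[OF d])
  qed simp
  then show ?thesis by (simp add: smooth_iff_times)
qed

definition bump :: "real ^ 'd::finite \<Rightarrow> real" where
  "bump x = flat 1 (1 - x \<bullet> x)"

lemma bump_nonneg: "bump x \<ge> 0"
  by (simp add: bump_def flat_def)

lemma bump_pos_iff: "bump x > 0 \<longleftrightarrow> norm x < 1"
proof -
  have "x \<bullet> x < 1 \<longleftrightarrow> norm x < 1"
    by (simp add: dot_square_norm abs_square_less_1)
  then show ?thesis by (simp add: bump_def flat_def)
qed

lemma bump_eq_0: "norm x \<ge> 1 \<Longrightarrow> bump x = 0"
  using bump_pos_iff[of x] bump_nonneg[of x] by linarith

section \<open>Test functions\<close>

lemma test_functionsI:
  assumes "smooth f" "compact K" "K \<subseteq> U" "\<And>x. x \<notin> K \<Longrightarrow> f x = 0"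
  shows "f \<in> test_functions U"
proof -
  have "closure {x. f x \<noteq> 0} \<subseteq> K"
    by (rule closure_minimal) (use assms in \<open>auto intro: compact_imp_closed\<close>)
  moreover from this have "compact (closure {x. f x \<noteq> 0})"
    using assms(2) compact_closure bounded_subset closure_subset compact_imp_bounded
    by (metis (lifting) dual_order.trans)
  ultimately show ?thesis using assms by (auto simp: test_functions_def)
qed

lemma test_functionsE:
  assumes "f \<in> test_functions U"
  obtains K where "smooth f" "compact K" "K \<subseteq> U" "\<And>x. x \<notin> K \<Longrightarrow> f x = 0"
proof
  show "smooth f" "compact (closure {x. f x \<noteq> 0})" "closure {x. f x \<noteq> 0} \<subseteq> U"
    using assms by (auto simp: test_functions_def)
  show "f x = 0" if "x \<notin> closure {x. f x \<noteq> 0}" for x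
    using that closure_subset[of "{x. f x \<noteq> 0}"] by blast
qed

lemma test_functions_mono: "f \<in> test_functions U \<Longrightarrow> U \<subseteq> V \<Longrightarrow> f \<in> test_functions V"
  by (auto simp: test_functions_def)

lemma test_functions_smooth: "f \<in> test_functions U \<Longrightarrow> smooth f"
  by (auto simp: test_functions_def)

lemma bump_test: "(\<lambda>x. of_real (bump x)) \<in> test_functions UNIV"
  by (rule test_functionsI[of _ "cball 0 1"])
     (auto simp: bump_def[abs_def] smooth_flat_norm bump_eq_0[unfolded bump_def])

lemma pderivative_test:
  assumes "f \<in> test_functions U"
  shows "pderivative i f \<in> test_functions U"
proof -
  obtain K where K: "smooth f" "compact K" "K \<subseteq> U" "\<And>x. x \<notin> K \<Longrightarrow> f x = 0"
    by (rule test_functionsE[OF assms]) (rule that)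
  have "pderivative i f x = 0" if "x \<notin> K" for x
  proof -
    have "(f has_derivative (\<lambda>v. 0)) (at x)"
    proof (rule has_derivative_transform_within_open)
      show "((\<lambda>x. 0) has_derivative (\<lambda>v. 0)) (at x)" by simp
      show "open (- K)" using K by (simp add: compact_imp_closed open_Compl)
    qed (use that K in auto)
    then show ?thesis by (rule pderivative_eqI)
  qed
  then show ?thesis using K by (intro test_functionsI[of _ K]) (auto intro: smooth_pderivative)
qed

lemma pderivatives_test: "f \<in> test_functions U \<Longrightarrow> pderivatives is f \<in> test_functions U"
proof (induction "is")
  case (Cons i "is")
  then have "pderivatives is f \<in> test_functions U" by blast
  then show ?case by (simp only: pderivatives_Cons pderivative_test)
qed simp

lemma test_mult:
  assumes "smooth f" "g \<in> test_functions U" shows "(\<lambda>x. f x * g x) \<in> test_functions U"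
proof -
  obtain K where K: "smooth g" "compact K" "K \<subseteq> U" "\<And>x. x \<notin> K \<Longrightarrow> g x = 0"
    by (rule test_functionsE[OF assms(2)]) (rule that)
  show ?thesis by (rule test_functionsI[of _ K]) (simp_all add: K smooth_mult assms(1))
qed

lemma test_affine:
  assumes "f \<in> test_functions UNIV" "c \<noteq> 0"
  shows "(\<lambda>x. f (c *\<^sub>R x + a)) \<in> test_functions UNIV"
proof -
  obtain K where K: "smooth f" "compact K" "K \<subseteq> UNIV" "\<And>x. x \<notin> K \<Longrightarrow> f x = 0"
    by (rule test_functionsE[OF assms(1)]) (rule that)
  let ?K = "(\<lambda>y. (1/c) *\<^sub>R (y - a)) ` K"
  have "compact ?K" by (intro compact_continuous_image continuous_intros K)
  moreover have "f (c *\<^sub>R x + a) = 0" if "x \<notin> ?K" for x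
  proof (rule K(4), rule notI)
    assume "c *\<^sub>R x + a \<in> K"
    then have "(1/c) *\<^sub>R ((c *\<^sub>R x + a) - a) \<in> ?K" by blast
    then show False using that assms(2) by simp
  qed
  ultimately show ?thesis by (intro test_functionsI[of _ ?K]) (auto intro: smooth_affine K)
qed

lemma test_integrable:
  assumes "f \<in> test_functions U"
  shows "integrable lborel f"
proof -
  obtain K where K: "smooth f" "compact K" "K \<subseteq> U" "\<And>x. x \<notin> K \<Longrightarrow> f x = 0"
    by (rule test_functionsE[OF assms]) (rule that)
  have "integrable lborel (\<lambda>x. indicator K x *\<^sub>R f x)"
    by (intro borel_integrable_compact K smooth_continuous)
  moreover have "(\<lambda>x. indicator K x *\<^sub>R f x) = f"
    using K(4) by (auto simp: fun_eq_iff indicator_def)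
  ultimately show ?thesis by simp
qed

lemma test_bounded:
  assumes "f \<in> test_functions U"
  obtains B where "B > 0" "\<And>x. norm (f x) \<le> B"
proof -
  obtain K where K: "smooth f" "compact K" "K \<subseteq> U" "\<And>x. x \<notin> K \<Longrightarrow> f x = 0"
    by (rule test_functionsE[OF assms]) (rule that)
  have "bounded (f ` K)"
    by (intro compact_imp_bounded compact_continuous_image smooth_continuous K)
  then obtain B where "B > 0" "\<And>x. x \<in> K \<Longrightarrow> norm (f x) \<le> B"
    by (auto simp: bounded_pos)
  then have "norm (f x) \<le> B" for x
    using K(4)[of x] by (cases "x \<in> K") auto
  with \<open>B > 0\<close> show thesis by (rule that)
qed

lemma norm_sum_pderivative_le:
  fixes v :: "real ^ 'd::finite" and a :: "'d \<Rightarrow> complex"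
  assumes "\<And>i. norm (a i) \<le> B"
  shows "norm (\<Sum>i\<in>UNIV. of_real (v $ i) * a i) \<le> real CARD('d) * B * norm v"
proof -
  have "norm (\<Sum>i\<in>UNIV. of_real (v $ i) * a i) \<le> (\<Sum>i\<in>(UNIV::'d set). norm v * B)"
    by (intro sum_norm_le) (auto simp: norm_mult intro!: mult_mono component_le_norm_cart assms)
  then show ?thesis by (simp add: mult_ac)
qed

lemma test_Lipschitz:
  fixes f :: "real ^ 'd::finite \<Rightarrow> complex"
  assumes "f \<in> test_functions U"
  obtains L where "L \<ge> 0" "\<And>x y. norm (f x - f y) \<le> L * norm (x - y)"
proof -
  have "\<exists>B. \<forall>x. norm (pderivative i f x) \<le> B" for i
    by (rule test_bounded[OF pderivative_test[OF assms], of i]) blast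
  then obtain B where B: "\<And>i x. norm (pderivative i f x) \<le> B i" by metis
  define M where "M = (\<Sum>i\<in>UNIV. B i)"
  have B0: "B i \<ge> 0" for i using B[of i 0] norm_ge_zero order_trans by blast
  have BM: "norm (pderivative i f x) \<le> M" for i x
  proof -
    have "B i \<le> M" unfolding M_def by (rule member_le_sum) (auto simp: B0)
    then show ?thesis using B[of i x] by linarith
  qed
  have M0: "M \<ge> 0" unfolding M_def by (simp add: B0 sum_nonneg)
  have "norm (f x - f y) \<le> (real CARD('d) * M) * norm (x - y)" for x y
  proof (rule differentiable_bound[of UNIV])
    show "(f has_derivative (\<lambda>v. \<Sum>i\<in>UNIV. of_real (v $ i) * pderivative i f z)) (at z within UNIV)" for z
      using has_derivative_pderivative smooth_differentiable test_functions_smooth[OF assms] by auto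
    show "onorm (\<lambda>v. \<Sum>i\<in>UNIV. of_real (v $ i) * pderivative i f z) \<le> real CARD('d) * M" for z
      by (rule onorm_le) (rule norm_sum_pderivative_le[OF BM])
  qed auto
  moreover have "real CARD('d) * M \<ge> 0" using M0 by simp
  ultimately show thesis using that by blast
qed

text \<open>A uniform first order Taylor remainder: all derivatives of a test function are Lipschitz. It is what
permits differentiation of convolutions under the integral sign, and it shows that partial derivatives
have integral \<open>0\<close>.\<close>

lemma test_first_order:
  fixes f :: "real ^ 'd::finite \<Rightarrow> complex"
  assumes "f \<in> test_functions U"
  obtains C where "C \<ge> 0"
    "\<And>x v. norm (f (x + v) - f x - (\<Sum>i\<in>UNIV. of_real (v $ i) * pderivative i f x)) \<le> C * (norm v)\<^sup>2"
proof -
  have "\<exists>L. L \<ge> 0 \<and> (\<forall>x y. norm (pderivative i f x - pderivative i f y) \<le> L * norm (x - y))" for i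
    by (rule test_Lipschitz[OF pderivative_test[OF assms], of i]) blast
  then obtain L where L: "\<And>i. L i \<ge> 0"
    "\<And>i x y. norm (pderivative i f x - pderivative i f y) \<le> L i * norm (x - y)" by metis
  define M where "M = (\<Sum>i\<in>UNIV. L i)"
  have LM: "norm (pderivative i f x - pderivative i f y) \<le> M * norm (x - y)" for i x y
  proof -
    have "L i \<le> M" unfolding M_def by (rule member_le_sum) (auto simp: L)
    then have "L i * norm (x - y) \<le> M * norm (x - y)" by (intro mult_right_mono) auto
    then show ?thesis using L(2)[of i x y] by linarith
  qed
  have M0: "M \<ge> 0" unfolding M_def by (simp add: L sum_nonneg)
  let ?C = "real CARD('d) * M"
  have "norm (f (x + v) - f x - (\<Sum>i\<in>UNIV. of_real (v $ i) * pderivative i f x)) \<le> ?C * (norm v)\<^sup>2" for x v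
  proof -
    let ?l = "\<lambda>x v. \<Sum>i\<in>UNIV. of_real (v $ i) * pderivative i f x"
    have "norm (f (x + v) - f x - ?l x ((x + v) - x)) \<le> norm ((x + v) - x) * (?C * norm v)"
    proof (rule differentiable_bound_linearization)
      show "x + t *\<^sub>R (x + v - x) \<in> cball x (norm v)" if "t \<in> {0..1}" for t
        using that by (auto simp: dist_norm mult_left_le_one_le)
      show "(f has_derivative ?l z) (at z within cball x (norm v))" for z
        using has_derivative_pderivative smooth_differentiable test_functions_smooth[OF assms]
        by (blast intro: has_derivative_at_withinI)
      fix z assume z: "z \<in> cball x (norm v)"
      have "norm (?l z u - ?l x u) \<le> real CARD('d) * (M * norm v) * norm u" for u
      proof -
        have "?l z u - ?l x u = (\<Sum>i\<in>UNIV. of_real (u $ i) * (pderivative i f z - pderivative i f x))"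
          by (simp add: sum_subtractf algebra_simps)
        also have "norm \<dots> \<le> real CARD('d) * (M * norm v) * norm u"
        proof (rule norm_sum_pderivative_le)
          have "norm (z - x) \<le> norm v" using z by (simp add: dist_norm norm_minus_commute)
          then show "norm (pderivative i f z - pderivative i f x) \<le> M * norm v" for i
            using order_trans[OF LM mult_left_mono[OF _ M0]] by blast
        qed
        finally show ?thesis .
      qed
      then show "onorm (?l z - ?l x) \<le> ?C * norm v"
        by (intro onorm_le) (simp add: mult_ac)
    qed auto
    then show ?thesis by (simp add: power2_eq_square mult_ac)
  qed
  moreover have "real CARD('d) * M \<ge> 0" using M0 by simp
  ultimately show thesis using that by blast
qed

lemma nn_integral_lborel_affine:
  fixes f :: "real ^ 'd::finite \<Rightarrow> ennreal"
  assumes [measurable]: "f \<in> borel_measurable borel" and "c \<noteq> 0"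
  shows "(\<integral>\<^sup>+ x. f x \<partial>lborel) = ennreal (\<bar>c\<bar> ^ CARD('d)) * (\<integral>\<^sup>+ x. f (t + c *\<^sub>R x) \<partial>lborel)"
  by (subst lborel_affine[OF \<open>c \<noteq> 0\<close>, of t])
     (simp add: nn_integral_density nn_integral_distr nn_integral_cmult)

lemma integral_lborel_affine:
  fixes f :: "real ^ 'd::finite \<Rightarrow> complex"
  assumes [measurable]: "f \<in> borel_measurable borel" and "c \<noteq> 0"
  shows "(LINT x|lborel. f x) = of_real (\<bar>c\<bar> ^ CARD('d)) * (LINT x|lborel. f (t + c *\<^sub>R x))"
  by (subst lborel_affine[OF \<open>c \<noteq> 0\<close>, of t])
     (simp add: integral_density integral_distr scaleR_conv_of_real[where 'a=complex])

section \<open>Classes closed under bounded pointwise limits\<close>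

lemma borel_measurable_vec_nth [measurable]: "(\<lambda>x::('a::euclidean_space)^'d. x $ i) \<in> borel_measurable borel"
  by (intro borel_measurable_continuous_onI continuous_intros)

lemma borel_measurable_vec_lambda:
  fixes f :: "'a \<Rightarrow> 'd::finite \<Rightarrow> real"
  assumes [measurable]: "\<And>i. (\<lambda>x. f x i) \<in> borel_measurable M"
  shows "(\<lambda>x. \<chi> i. f x i) \<in> borel_measurable M"
proof (subst borel_measurable_euclidean_space, intro ballI)
  fix b :: "real^'d" assume "b \<in> Basis"
  then obtain i where "b = axis i 1" by (auto simp: Basis_vec_def)
  then show "(\<lambda>x. (\<chi> i. f x i) \<bullet> b) \<in> borel_measurable M"
    by (simp add: inner_axis)
qed

text \<open>A functional form of the monotone class argument. Spaces of bounded functions with a property that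
is preserved by linear combinations and by bounded pointwise limits arise three times: functions
approximated in \<open>L\<^sub>2\<close> by exponential sums, functions annihilated by an integrable function, and
functions well approximated by their mollifications. Such a space contains all bounded Borel
functions as soon as it contains the exponentials.\<close>

locale bounded_limit_space =
  fixes H :: "('a \<Rightarrow> complex) set"
  assumes add: "f \<in> H \<Longrightarrow> g \<in> H \<Longrightarrow> (\<lambda>x. f x + g x) \<in> H"
    and scale: "f \<in> H \<Longrightarrow> (\<lambda>x. c * f x) \<in> H"
    and lim: "(\<And>n::nat. F n \<in> H) \<Longrightarrow> (\<And>n x. norm (F n x) \<le> B) \<Longrightarrow> (\<And>x. (\<lambda>n. F n x) \<longlonglongrightarrow> f x) \<Longrightarrow> f \<in> H"
begin

lemma zero: "f \<in> H \<Longrightarrow> (\<lambda>x. 0) \<in> H"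
  using scale[of f 0] by simp

lemma sum: "finite I \<Longrightarrow> h \<in> H \<Longrightarrow> (\<And>i. i \<in> I \<Longrightarrow> f i \<in> H) \<Longrightarrow> (\<lambda>x. \<Sum>i\<in>I. f i x) \<in> H"
  by (induction I rule: finite_induct) (auto intro: add zero)

text \<open>Continuous functions give closed sets, these give Borel sets by the \<open>\<pi>\<close>-\<open>\<lambda>\<close> theorem, and simple
functions give the rest. The map \<open>E\<close> will be the torus map, so that only functions on the compact
torus need to be approximated by polynomials.\<close>

lemma borel_comp_in_space:
  fixes E :: "'a \<Rightarrow> 'b::metric_space"
  assumes cont: "\<And>g::'b \<Rightarrow> real. continuous_on UNIV g \<Longrightarrow> (\<And>z. 0 \<le> g z \<and> g z \<le> 1) \<Longrightarrow> (\<lambda>x. of_real (g (E x))) \<in> H"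
    and f [measurable]: "f \<in> borel_measurable borel" and fB: "\<And>z. norm (f z) \<le> B"
  shows "(\<lambda>x. f (E x)) \<in> H"
proof -
  have closed: "(\<lambda>x. indicator C (E x)) \<in> H" if "closed C" for C
  proof (cases "C = {}")
    case True
    then show ?thesis using cont[of "\<lambda>_. 0"] by simp
  next
    case False
    (* Lipschitz cut-offs decreasing to the indicator of C. *)
    define g where "g n z = max 0 (1 - real n * infdist z C)" for n z
    show ?thesis
    proof (rule lim[where F = "\<lambda>n x. of_real (g n (E x))" and B = 1])
      show "(\<lambda>x. of_real (g n (E x))) \<in> H" for n
        by (rule cont) (auto simp: g_def infdist_nonneg intro!: continuous_intros)
      show "norm (complex_of_real (g n (E x))) \<le> 1" for n x
        by (auto simp: g_def infdist_nonneg)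
      show "(\<lambda>n. complex_of_real (g n (E x))) \<longlonglongrightarrow> indicator C (E x)" for x
      proof (cases "E x \<in> C")
        case True
        then show ?thesis by (simp add: g_def)
      next
        case notin: False
        then have d: "infdist (E x) C > 0"
          using infdist_pos_not_in_closed that False by blast
        have "eventually (\<lambda>n. g n (E x) = 0) sequentially"
        proof -
          obtain N where "inverse (infdist (E x) C) < real N" using reals_Archimedean2 by blast
          then have "1 \<le> real n * infdist (E x) C" if "n \<ge> N" for n
            using d that by (simp add: field_simps)
              (metis less_eq_real_def mult.commute mult_right_mono of_nat_mono order_trans)
          then show ?thesis by (auto simp: g_def eventually_sequentially intro!: exI[of _ N])
        qed
        then show ?thesis using notin by (simp add: tendsto_eventually eventually_mono)
      qed
    qed
  qed
  have one: "(\<lambda>x. 1) \<in> H" using closed[of UNIV] by simp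
  have borel: "(\<lambda>x. indicator A (E x)) \<in> H" if "A \<in> sets borel" for A
  proof -
    have "Int_stable (Collect closed :: 'b set set)" by (auto simp: Int_stable_def)
    moreover have "Collect closed \<subseteq> Pow (UNIV :: 'b set)" by simp
    moreover have "A \<in> sigma_sets UNIV (Collect closed)"
      using that by (subst (asm) borel_eq_closed) simp
    ultimately show ?thesis
    proof (induction rule: sigma_sets_induct_disjoint)
      case (basic A)
      then show ?case using closed by simp
    next
      case empty
      then show ?case using zero[OF one] by simp
    next
      case (compl A)
      from add[OF one scale[OF compl(2), of "-1"]]
      show ?case by (rule back_subst[of "\<lambda>f. f \<in> H"]) (auto simp: indicator_def fun_eq_iff)
    next
      case (union A)
      have eq: "(\<Sum>i<n. indicator (A i) z) = (indicator (\<Union>i<n. A i) z :: complex)" for n z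
        using union(1) by (subst indicator_UN_disjoint) (auto simp: disjoint_family_on_def)
      show ?case
      proof (rule lim[where F = "\<lambda>n x. \<Sum>i<n. indicator (A i) (E x)" and B = 1])
        show "(\<lambda>x. \<Sum>i<n. indicator (A i) (E x)) \<in> H" for n
          by (rule sum[OF _ one union(3)]) auto
        show "norm (\<Sum>i<n. indicator (A i) (E x) :: complex) \<le> 1" for n x
          unfolding eq by (simp add: indicator_def)
        show "(\<lambda>n. \<Sum>i<n. indicator (A i) (E x) :: complex) \<longlonglongrightarrow> indicator (\<Union>i. A i) (E x)" for x
          unfolding eq by (rule LIMSEQ_indicator_UN)
      qed
    qed
  qed
  obtain F where F: "\<And>i. simple_function borel (F i)" "\<And>z. (\<lambda>i. F i z) \<longlonglongrightarrow> f z"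
    "\<And>i z. dist (F i z) 0 \<le> 2 * dist (f z) 0"
    using borel_measurable_implies_sequence_metric[OF f, of 0] by auto
  show ?thesis
  proof (rule lim[where F = "\<lambda>n x. F n (E x)" and B = "2 * B"])
    fix n
    have fin: "finite (range (F n))"
      using F(1)[of n] by (simp add: simple_function_def)
    have eq: "F n z = (\<Sum>y\<in>range (F n). y * indicator (F n -` {y}) z)" for z
      using fin by (simp add: indicator_def sum.delta vimage_def mult_if_delta cong: if_cong)
    have "(\<lambda>x. \<Sum>y\<in>range (F n). y * indicator (F n -` {y}) (E x)) \<in> H"
      by (rule sum[OF fin one], rule scale, rule borel)
         (use F(1)[of n] in \<open>auto simp: simple_function_def\<close>)
    then show "(\<lambda>x. F n (E x)) \<in> H" unfolding eq[symmetric] .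
  next
    show "norm (F n (E x)) \<le> 2 * B" for n x
      using F(3)[of n "E x"] fB[of "E x"] by simp
  qed (rule F(2))
qed

end

section \<open>Exponential sums\<close>

inductive_set exp_sums :: "(real ^ 'd::finite) set \<Rightarrow> (real ^ 'd \<Rightarrow> complex) set" for \<Lambda> where
  exp_sums_cis: "l \<in> \<Lambda> \<Longrightarrow> (\<lambda>x. cis (l \<bullet> x)) \<in> exp_sums \<Lambda>"
| exp_sums_add: "f \<in> exp_sums \<Lambda> \<Longrightarrow> g \<in> exp_sums \<Lambda> \<Longrightarrow> (\<lambda>x. f x + g x) \<in> exp_sums \<Lambda>"
| exp_sums_scale: "f \<in> exp_sums \<Lambda> \<Longrightarrow> (\<lambda>x. c * f x) \<in> exp_sums \<Lambda>"

lemma exp_sums_mult: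
  assumes "\<And>a b. a \<in> \<Lambda> \<Longrightarrow> b \<in> \<Lambda> \<Longrightarrow> a + b \<in> \<Lambda>"
    and "f \<in> exp_sums \<Lambda>" "g \<in> exp_sums \<Lambda>"
  shows "(\<lambda>x. f x * g x) \<in> exp_sums \<Lambda>"
  using assms(2)
proof induction
  case (exp_sums_cis a)
  show ?case using assms(3)
  proof induction
    case (exp_sums_cis b)
    from exp_sums.exp_sums_cis[OF assms(1)[OF \<open>a \<in> \<Lambda>\<close> exp_sums_cis]]
    show ?case by (simp add: cis_mult inner_add_left)
  next
    case (exp_sums_add f g)
    from exp_sums.exp_sums_add[OF exp_sums_add(3,4)] show ?case by (simp add: distrib_left)
  next
    case (exp_sums_scale f c)
    from exp_sums.exp_sums_scale[OF exp_sums_scale(2), of c] show ?case by (simp add: mult_ac)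
  qed
next
  case (exp_sums_add f g)
  from exp_sums.exp_sums_add[OF exp_sums_add(3,4)] show ?case by (simp add: distrib_right)
next
  case (exp_sums_scale f c)
  from exp_sums.exp_sums_scale[OF exp_sums_scale(2), of c] show ?case by (simp add: mult_ac)
qed

lemma exp_sums_sum:
  assumes "finite I" "0 \<in> \<Lambda>" "\<And>i. i \<in> I \<Longrightarrow> f i \<in> exp_sums \<Lambda>"
  shows "(\<lambda>x. \<Sum>i\<in>I. f i x) \<in> exp_sums \<Lambda>"
  using assms(1,3)
proof (induction I rule: finite_induct)
  case empty
  from exp_sums_scale[OF exp_sums_cis[OF assms(2)], of 0] show ?case by simp
qed (auto intro: exp_sums_add)

lemma exp_sums_bounded: "f \<in> exp_sums \<Lambda> \<Longrightarrow> \<exists>B. \<forall>x. norm (f x) \<le> B"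
proof (induction rule: exp_sums.induct)
  case (exp_sums_add f g)
  then obtain A B where "\<forall>x. norm (f x) \<le> A" "\<forall>x. norm (g x) \<le> B" by blast
  then show ?case by (intro exI[of _ "A + B"]) (meson add_mono norm_triangle_le)
next
  case (exp_sums_scale f c)
  then obtain A where "\<forall>x. norm (f x) \<le> A" by blast
  then show ?case by (intro exI[of _ "norm c * A"]) (simp add: norm_mult mult_left_mono)
qed auto

lemma exp_sums_measurable: "f \<in> exp_sums \<Lambda> \<Longrightarrow> f \<in> borel_measurable borel"
proof (induction rule: exp_sums.induct)
  case (exp_sums_cis l)
  show ?case by (rule smooth_measurable[OF smooth_cis_inner])
qed auto

lemma integer_points_simps [simp]:
  "0 \<in> integer_points"
  "a \<in> integer_points \<Longrightarrow> b \<in> integer_points \<Longrightarrow> a + b \<in> integer_points"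
  "a \<in> integer_points \<Longrightarrow> b \<in> integer_points \<Longrightarrow> a - b \<in> integer_points"
  "a \<in> integer_points \<Longrightarrow> - a \<in> integer_points"
  "axis i 1 \<in> integer_points"
  by (auto simp: integer_points_def axis_def)

definition torus_map :: "real \<Rightarrow> real ^ 'd::finite \<Rightarrow> complex ^ 'd" where
  "torus_map c x = (\<chi> i. cis (c * x $ i))"

lemma polynomial_torus_map:
  fixes p :: "complex ^ 'd::finite \<Rightarrow> real"
  assumes "real_polynomial_function p"
  shows "(\<lambda>x. of_real (p (torus_map c x))) \<in> exp_sums ((*\<^sub>R) c ` integer_points)" (is "_ \<in> exp_sums ?L")
  using assms
proof induction
  case (linear f)
  have L0: "0 \<in> ?L" by (rule image_eqI[of _ _ 0]) auto
  have cisL: "(\<lambda>x. cis (c * x $ i)) \<in> exp_sums ?L" "(\<lambda>x. cis (- (c * x $ i))) \<in> exp_sums ?L" for i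
  proof -
    have "(\<lambda>x. cis ((c *\<^sub>R axis i 1) \<bullet> x)) \<in> exp_sums ?L"
      "(\<lambda>x. cis ((c *\<^sub>R (- axis i 1)) \<bullet> x)) \<in> exp_sums ?L"
      by (intro exp_sums_cis imageI integer_points_simps)+
    then show "(\<lambda>x. cis (c * x $ i)) \<in> exp_sums ?L" "(\<lambda>x. cis (- (c * x $ i))) \<in> exp_sums ?L"
      by (simp_all add: inner_axis')
  qed
  (* Real and imaginary parts of the coordinates are cosines and sines; both
     frequencies \<plusminus> c e_i lie in the lattice. *)
  have cosL: "(\<lambda>x. complex_of_real (cos (c * x $ i))) \<in> exp_sums ?L" for i
  proof -
    have "(\<lambda>x. (1/2) * (cis (c * x $ i) + cis (- (c * x $ i)))) \<in> exp_sums ?L"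
      by (intro exp_sums_scale exp_sums_add cisL)
    then show ?thesis by (rule back_subst[of "\<lambda>f. f \<in> exp_sums ?L"]) (simp add: fun_eq_iff complex_eq_iff)
  qed
  have sinL: "(\<lambda>x. complex_of_real (sin (c * x $ i))) \<in> exp_sums ?L" for i
  proof -
    have "(\<lambda>x. (- \<i>/2) * (cis (c * x $ i) + (- 1) * cis (- (c * x $ i)))) \<in> exp_sums ?L"
      by (intro exp_sums_scale exp_sums_add cisL)
    then show ?thesis by (rule back_subst[of "\<lambda>f. f \<in> exp_sums ?L"]) (simp add: fun_eq_iff complex_eq_iff)
  qed
  interpret f: bounded_linear f by (rule linear)
  have "f (torus_map c x) = (\<Sum>i\<in>UNIV. f (axis i 1) * cos (c * x $ i) + f (axis i \<i>) * sin (c * x $ i))" for x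
  proof -
    (* The real Basis of complex ^ d consists of axis i 1 and axis i \<i>. *)
    have "torus_map c x = (\<Sum>i\<in>UNIV. cos (c * x $ i) *\<^sub>R axis i 1 + sin (c * x $ i) *\<^sub>R axis i \<i>)"
      by (simp add: vec_eq_iff torus_map_def axis_def complex_eq_iff if_distrib sum.distrib if_distribR cong: if_cong)
    then show ?thesis by (simp add: f.sum f.add f.scaleR mult_ac)
  qed
  moreover have "(\<lambda>x. \<Sum>i\<in>UNIV. of_real (f (axis i 1)) * complex_of_real (cos (c * x $ i))
       + of_real (f (axis i \<i>)) * complex_of_real (sin (c * x $ i))) \<in> exp_sums ?L"
    by (intro exp_sums_sum L0 exp_sums_add exp_sums_scale cosL sinL) simp
  ultimately show ?case by simp
next
  case (const a)
  have "(\<lambda>x. of_real a * cis ((c *\<^sub>R 0) \<bullet> x)) \<in> exp_sums ?L"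
    by (intro exp_sums_scale exp_sums_cis imageI integer_points_simps)
  then show ?case by simp
next
  case (add f g)
  then show ?case using exp_sums_add by fastforce
next
  case (mult f g)
  have "\<And>a b. a \<in> ?L \<Longrightarrow> b \<in> ?L \<Longrightarrow> a + b \<in> ?L"
    by (auto simp flip: scaleR_add_right)
  then have "(\<lambda>x. of_real (f (torus_map c x)) * of_real (g (torus_map c x))) \<in> exp_sums ?L"
    using mult.IH by (rule exp_sums_mult)
  then show ?case by (simp only: of_real_mult)
qed

lemma torus_map_in_space:
  fixes f :: "complex ^ 'd::finite \<Rightarrow> complex" and H :: "(real ^ 'd \<Rightarrow> complex) set"
  assumes "bounded_limit_space H"
    and sub: "exp_sums ((*\<^sub>R) c ` integer_points) \<subseteq> H"
    and f: "f \<in> borel_measurable borel" "\<And>z. norm (f z) \<le> B"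
  shows "(\<lambda>x. f (torus_map c x)) \<in> H"
proof -
  interpret bounded_limit_space H by fact
  (* Stone-Weierstrass needs a compact set; this ball contains the torus. *)
  let ?K = "cball (0 :: complex^'d) (real CARD('d))"
  have inK: "torus_map c x \<in> ?K" for x
  proof -
    have "norm (torus_map c x) \<le> (\<Sum>i\<in>(UNIV::'d set). norm (torus_map c x $ i))"
      unfolding norm_vec_def by (rule L2_set_le_sum) auto
    then show ?thesis by (simp add: torus_map_def)
  qed
  show ?thesis
  proof (rule borel_comp_in_space[OF _ f])
    fix g :: "complex^'d \<Rightarrow> real"
    assume g: "continuous_on UNIV g" "\<And>z. 0 \<le> g z \<and> g z \<le> 1"
    have "\<exists>p. real_polynomial_function p \<and> (\<forall>z\<in>?K. \<bar>g z - p z\<bar> < inverse (real (Suc n)))" for n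
      by (rule Stone_Weierstrass_real_polynomial_function[of ?K g "inverse (real (Suc n))"])
         (use g in \<open>auto intro: continuous_on_subset\<close>)
    then obtain p where p: "\<And>n. real_polynomial_function (p n)"
      "\<And>n z. z \<in> ?K \<Longrightarrow> \<bar>g z - p n z\<bar> < inverse (real (Suc n))" by metis
    show "(\<lambda>x. of_real (g (torus_map c x))) \<in> H"
    proof (rule lim[where F = "\<lambda>n x. of_real (p n (torus_map c x))" and B = 2])
      show "(\<lambda>x. complex_of_real (p n (torus_map c x))) \<in> H" for n
        using polynomial_torus_map[OF p(1)] sub by blast
      show "norm (complex_of_real (p n (torus_map c x))) \<le> 2" for n x
      proof -
        have "inverse (real (Suc n)) \<le> 1" by (simp add: inverse_le_1_iff)
        then show ?thesis using p(2)[OF inK, of x n] g(2)[of "torus_map c x"] by (simp only: norm_of_real) linarith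
      qed
      show "(\<lambda>n. complex_of_real (p n (torus_map c x))) \<longlonglongrightarrow> of_real (g (torus_map c x))" for x
      proof (rule tendsto_of_real, rule LIM_zero_cancel, rule Lim_null_comparison)
        show "\<forall>\<^sub>F n in sequentially. norm (p n (torus_map c x) - g (torus_map c x)) \<le> inverse (real (Suc n))"
          using p(2)[OF inK, of x] by (intro always_eventually allI) (simp add: abs_minus_commute less_imp_le)
      qed (rule LIMSEQ_inverse_real_of_nat)
    qed
  qed
qed

text \<open>A Borel inverse of \<open>cis\<close> on the unit circle. The case distinction singles out the branch cut, off which
\<open>Arg\<close> is continuous.\<close>

definition angle :: "complex \<Rightarrow> real" where
  "angle z = (if z \<in> - \<real>\<^sub>\<le>\<^sub>0 then Arg z else pi)"

lemma angle_measurable [measurable]: "angle \<in> borel_measurable borel"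
  unfolding angle_def[abs_def]
  by (rule borel_measurable_continuous_on_if)
     (auto intro!: continuous_at_imp_continuous_on continuous_at_Arg)

lemma angle_cis:
  assumes "- pi < t" "t < pi" shows "angle (cis t) = t"
proof -
  have "Arg (cis t) = t" using assms by (intro Arg_cis) auto
  moreover have "cis t \<notin> \<real>\<^sub>\<le>\<^sub>0"
  proof
    assume "cis t \<in> \<real>\<^sub>\<le>\<^sub>0"
    then have "cos t \<le> 0" "sin t = 0" by (auto simp: complex_nonpos_Reals_iff)
    moreover from this have "cos t \<noteq> 0" using sin_cos_squared_add[of t] by auto
    ultimately have "Arg (cis t) = pi" by (simp add: Arg_eq_pi)
    then show False using \<open>Arg (cis t) = t\<close> assms by simp
  qed
  ultimately show ?thesis by (simp add: angle_def)
qed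

lemma angle_cis_periodic: "\<exists>n::int. angle (cis t) = t - 2 * pi * of_int n"
proof -
  have "cis (angle (cis t)) = cis t"
  proof (cases "cis t \<in> \<real>\<^sub>\<le>\<^sub>0")
    case True
    then have *: "cos t \<le> 0" "sin t = 0" by (auto simp: complex_nonpos_Reals_iff)
    then have "cos t = -1" using sin_cos_squared_add[of t] by (auto simp: power2_eq_1_iff)
    then have "cis t = -1" using * by (simp add: complex_eq_iff)
    then show ?thesis using True by (simp add: angle_def)
  next
    case False
    then show ?thesis by (simp add: angle_def cis_Arg)
  qed
  then have "exp (\<i> * complex_of_real t) = exp (\<i> * complex_of_real (angle (cis t)))"
    by (simp add: cis_conv_exp)
  then obtain n :: int where n: "\<i> * complex_of_real t = \<i> * complex_of_real (angle (cis t)) + of_int (2 * n) * pi * \<i>"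
    unfolding exp_eq by blast
  have "t = angle (cis t) + 2 * pi * of_int n"
    using arg_cong[OF n, of Im] by (simp add: mult_ac)
  then show ?thesis by (intro exI[of _ n]) simp
qed

text \<open>A periodic function is a function on the torus, where polynomials in the coordinates are
trigonometric polynomials and are uniformly dense among continuous functions.\<close>

theorem bounded_limit_space_periodic:
  fixes f :: "real ^ 'd::finite \<Rightarrow> complex" and H :: "(real ^ 'd \<Rightarrow> complex) set"
  assumes H: "bounded_limit_space H" "exp_sums integer_points \<subseteq> H"
    and f [measurable]: "f \<in> borel_measurable borel" and B: "\<And>z. norm (f z) \<le> B"
    and periodic: "\<And>x j. j \<in> integer_points \<Longrightarrow> f (x + (2 * pi) *\<^sub>R j) = f x"
  shows "f \<in> H"
proof -
  have [measurable]: "(\<lambda>z. \<chi> i::'d. angle (z $ i)) \<in> borel_measurable borel"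
    by (intro borel_measurable_vec_lambda) measurable
  (* Taking the angle of each coordinate is a Borel section of the torus map, and it changes
     x only by a period. *)
  have "(\<lambda>x. f ((\<lambda>z. \<chi> i. angle (z $ i)) (torus_map 1 x))) \<in> H"
    by (rule torus_map_in_space[OF H(1), where B = B]) (use H(2) in \<open>auto intro: B\<close>)
  moreover have "f (\<chi> i. angle (torus_map 1 x $ i)) = f x" for x
  proof -
    obtain n :: "'d \<Rightarrow> int" where n: "\<And>i. angle (cis (x $ i)) = x $ i - 2 * pi * of_int (n i)"
      using choice[of "\<lambda>i n. angle (cis (x $ i)) = x $ i - 2 * pi * real_of_int n"] angle_cis_periodic by blast
    define j :: "real^'d" where "j = (\<chi> i. of_int (- n i))"
    have "j \<in> integer_points" by (simp add: j_def integer_points_def)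
    moreover have "(\<chi> i. angle (torus_map 1 x $ i)) = x + (2 * pi) *\<^sub>R j"
      by (simp add: vec_eq_iff torus_map_def n j_def)
    ultimately show ?thesis using periodic by simp
  qed
  ultimately show ?thesis by simp
qed

text \<open>Frequencies in the finer lattice \<open>\<int>\<^sup>d / (n + 1)\<close> reach functions of period \<open>2 \<pi> (n + 1)\<close>, and every
function is the pointwise limit of the periodic extensions of its restrictions to growing cubes.\<close>

theorem bounded_limit_space_all:
  fixes f :: "real ^ 'd::finite \<Rightarrow> complex" and H :: "(real ^ 'd \<Rightarrow> complex) set"
  assumes H: "bounded_limit_space H" "exp_sums UNIV \<subseteq> H"
    and f [measurable]: "f \<in> borel_measurable borel" and B: "\<And>z. norm (f z) \<le> B"
  shows "f \<in> H"
proof -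
  interpret bounded_limit_space H by fact
  have mono: "g \<in> exp_sums UNIV" if "g \<in> exp_sums \<Lambda>" for g :: "real^'d \<Rightarrow> complex" and \<Lambda>
    using that by induction (auto intro: exp_sums.intros)
  (* On the torus of period 2 \<pi> (n + 1) the Borel section recovers x as soon as that period
     exceeds the size of x, so the periodic extensions of f converge to f pointwise. *)
  let ?e = "\<lambda>n z. \<chi> i::'d. real (Suc n) * angle (z $ i)"
  show ?thesis
  proof (rule lim[where F = "\<lambda>n x. f (?e n (torus_map (inverse (real (Suc n))) x))" and B = B])
    fix n
    have [measurable]: "?e n \<in> borel_measurable borel"
      by (intro borel_measurable_vec_lambda) measurable
    have m: "(\<lambda>z. f (?e n z)) \<in> borel_measurable borel" by measurable
    show "(\<lambda>x. f (?e n (torus_map (inverse (real (Suc n))) x))) \<in> H"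
      by (rule torus_map_in_space[OF H(1) _ m B]) (use H(2) mono in blast)
  next
    fix x :: "real^'d"
    obtain N where N: "norm x < real N" using reals_Archimedean2 by blast
    have "f (?e n (torus_map (inverse (real (Suc n))) x)) = f x" if "n \<ge> N" for n
    proof -
      have "angle (cis (inverse (real (Suc n)) * x $ i)) = inverse (real (Suc n)) * x $ i" for i
      proof -
        have "\<bar>x $ i\<bar> < real (Suc n) * 1"
          using component_le_norm_cart[of x i] N that by simp
        also have "\<dots> \<le> real (Suc n) * pi" using pi_ge_two by (intro mult_left_mono) auto
        finally have "\<bar>inverse (real (Suc n)) * x $ i\<bar> < pi" 
          by (simp add: abs_mult field_simps)
        then show ?thesis by (intro angle_cis) linarith+
      qed
      then have "?e n (torus_map (inverse (real (Suc n))) x) = x"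
        by (simp add: vec_eq_iff torus_map_def del: of_nat_Suc)
      then show ?thesis by simp
    qed
    then show "(\<lambda>n. f (?e n (torus_map (inverse (real (Suc n))) x))) \<longlonglongrightarrow> f x"
      by (intro tendsto_eventually) (auto simp: eventually_sequentially)
  qed (rule B)
qed

section \<open>Density of exponential sums in square-integrable functions\<close>

lemma norm_diff_square_le:
  fixes a b c :: complex
  shows "(norm (a - c))\<^sup>2 \<le> 2 * (norm (a - b))\<^sup>2 + 2 * (norm (b - c))\<^sup>2"
proof -
  have "(norm (a - c))\<^sup>2 \<le> (norm (a - b) + norm (b - c))\<^sup>2"
    using norm_triangle_ineq[of "a - b" "b - c"] by (intro power_mono) auto
  also have "\<dots> \<le> 2 * (norm (a - b))\<^sup>2 + 2 * (norm (b - c))\<^sup>2"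
    using sum_squares_bound[of "norm (a - b)" "norm (b - c)"] by (simp add: power2_sum)
  finally show ?thesis .
qed

lemma nn_integral_diff_square_le:
  fixes a b c :: "'a \<Rightarrow> complex"
  assumes [measurable]: "a \<in> borel_measurable M" "b \<in> borel_measurable M" "c \<in> borel_measurable M"
  shows "(\<integral>\<^sup>+x. ennreal ((norm (a x - c x))\<^sup>2) \<partial>M) \<le>
    2 * (\<integral>\<^sup>+x. ennreal ((norm (a x - b x))\<^sup>2) \<partial>M) + 2 * (\<integral>\<^sup>+x. ennreal ((norm (b x - c x))\<^sup>2) \<partial>M)"
proof -
  have "(\<integral>\<^sup>+x. ennreal ((norm (a x - c x))\<^sup>2) \<partial>M) \<le>
    (\<integral>\<^sup>+x. 2 * ennreal ((norm (a x - b x))\<^sup>2) + 2 * ennreal ((norm (b x - c x))\<^sup>2) \<partial>M)"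
  proof (rule nn_integral_mono)
    fix x
    have "ennreal ((norm (a x - c x))\<^sup>2) \<le> ennreal (2 * (norm (a x - b x))\<^sup>2 + 2 * (norm (b x - c x))\<^sup>2)"
      by (rule ennreal_leI norm_diff_square_le)+
    then show "ennreal ((norm (a x - c x))\<^sup>2) \<le> 2 * ennreal ((norm (a x - b x))\<^sup>2) + 2 * ennreal ((norm (b x - c x))\<^sup>2)"
      by (simp add: ennreal_mult ennreal_plus)
  qed
  then show ?thesis by (simp add: nn_integral_add nn_integral_cmult)
qed

lemma ennreal_double_sum_less:
  assumes "A < ennreal (e / 4)" "B < ennreal (e / 4)" "e > 0"
  shows "2 * A + 2 * B < ennreal e"
proof -
  obtain a where a: "A = ennreal a" "a \<ge> 0" using assms(1) by (cases A) auto
  obtain b where b: "B = ennreal b" "b \<ge> 0" using assms(2) by (cases B) auto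
  have "2 * A + 2 * B = ennreal (2 * a + 2 * b)"
    using a b by (simp add: ennreal_plus ennreal_mult)
  also have "\<dots> < ennreal e" using assms a b by (intro ennreal_lessI) (simp_all add: ennreal_less_iff)
  finally show ?thesis .
qed

lemma ennreal_mult_less_divide:
  assumes "A < ennreal (e / d)" "e > 0" "d > 0"
  shows "ennreal d * A < ennreal e"
proof -
  obtain a where a: "A = ennreal a" "a \<ge> 0" using assms(1) by (cases A) auto
  then have "a < e / d" using assms by (simp add: ennreal_less_iff)
  then have "d * a < e" using assms by (simp add: field_simps)
  then show ?thesis using a assms by (simp add: ennreal_less_iff flip: ennreal_mult)
qed

text \<open>Only bounded functions are admitted, as the limits in \<open>bounded_limit_space\<close> are dominated ones.\<close>

definition exp_closure :: "(real ^ 'd::finite) measure \<Rightarrow> (real ^ 'd) set \<Rightarrow> (real ^ 'd \<Rightarrow> complex) set" where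
  "exp_closure \<mu> \<Lambda> = {f. f \<in> borel_measurable borel \<and> (\<exists>B. \<forall>x. norm (f x) \<le> B) \<and>
     (\<forall>\<epsilon>>0. \<exists>p\<in>exp_sums \<Lambda>. (\<integral>\<^sup>+x. ennreal ((norm (f x - p x))\<^sup>2) \<partial>\<mu>) < ennreal \<epsilon>)}"

lemma exp_closureD:
  assumes "f \<in> exp_closure \<mu> \<Lambda>"
  shows "f \<in> borel_measurable borel" "\<exists>B. \<forall>x. norm (f x) \<le> B"
    "\<epsilon> > 0 \<Longrightarrow> \<exists>p\<in>exp_sums \<Lambda>. (\<integral>\<^sup>+x. ennreal ((norm (f x - p x))\<^sup>2) \<partial>\<mu>) < ennreal \<epsilon>"
  using assms by (auto simp: exp_closure_def)

lemma exp_closureI: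
  assumes "f \<in> borel_measurable borel" "\<And>x. norm (f x) \<le> B"
    "\<And>\<epsilon>. \<epsilon> > 0 \<Longrightarrow> \<exists>p\<in>exp_sums \<Lambda>. (\<integral>\<^sup>+x. ennreal ((norm (f x - p x))\<^sup>2) \<partial>\<mu>) < ennreal \<epsilon>"
  shows "f \<in> exp_closure \<mu> \<Lambda>"
  using assms by (auto simp: exp_closure_def)

lemma bounded_limit_space_L2_closure:
  fixes \<mu> :: "(real ^ 'd::finite) measure"
  assumes "finite_measure \<mu>" and sets: "sets \<mu> = sets borel"
  shows "bounded_limit_space (exp_closure \<mu> \<Lambda>)"
    (is "bounded_limit_space ?H")
proof
  note [measurable_cong] = sets
  fix f g assume f: "f \<in> ?H" and g: "g \<in> ?H"
  then have [measurable]: "f \<in> borel_measurable borel" "g \<in> borel_measurable borel"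
    by (auto dest: exp_closureD)
  obtain A where A: "\<And>x. norm (f x) \<le> A" using exp_closureD(2)[OF f] by blast
  obtain B where B: "\<And>x. norm (g x) \<le> B" using exp_closureD(2)[OF g] by blast
  have "\<exists>r\<in>exp_sums \<Lambda>. (\<integral>\<^sup>+x. ennreal ((norm (f x + g x - r x))\<^sup>2) \<partial>\<mu>) < ennreal \<epsilon>" if "\<epsilon> > 0" for \<epsilon>
  proof -
    from that have "\<epsilon> / 4 > 0" by simp
    obtain p q where p: "p \<in> exp_sums \<Lambda>" "(\<integral>\<^sup>+x. ennreal ((norm (f x - p x))\<^sup>2) \<partial>\<mu>) < ennreal (\<epsilon> / 4)"
      and q: "q \<in> exp_sums \<Lambda>" "(\<integral>\<^sup>+x. ennreal ((norm (g x - q x))\<^sup>2) \<partial>\<mu>) < ennreal (\<epsilon> / 4)"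
      using exp_closureD(3)[OF f \<open>\<epsilon> / 4 > 0\<close>] exp_closureD(3)[OF g \<open>\<epsilon> / 4 > 0\<close>] by blast
    note [measurable] = exp_sums_measurable[OF p(1)] exp_sums_measurable[OF q(1)]
    have "(\<integral>\<^sup>+x. ennreal ((norm ((f x + g x) - (p x + q x)))\<^sup>2) \<partial>\<mu>)
      \<le> 2 * (\<integral>\<^sup>+x. ennreal ((norm ((f x + g x) - (p x + g x)))\<^sup>2) \<partial>\<mu>) +
        2 * (\<integral>\<^sup>+x. ennreal ((norm ((p x + g x) - (p x + q x)))\<^sup>2) \<partial>\<mu>)"
      by (rule nn_integral_diff_square_le) measurable
    also have "\<dots> < ennreal \<epsilon>"
      using p(2) q(2) that by (intro ennreal_double_sum_less) simp_all
    finally show ?thesis by (rule bexI[OF _ exp_sums_add[OF p(1) q(1)]])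
  qed
  moreover have "norm (f x + g x) \<le> A + B" for x by (rule norm_triangle_le) (intro add_mono A B)
  ultimately show "(\<lambda>x. f x + g x) \<in> ?H" by (intro exp_closureI) measurable
next
  note [measurable_cong] = sets
  fix f c assume f: "f \<in> ?H"
  then have [measurable]: "f \<in> borel_measurable borel" by (rule exp_closureD)
  obtain A where A: "\<And>x. norm (f x) \<le> A" using exp_closureD(2)[OF f] by blast
  have "\<exists>r\<in>exp_sums \<Lambda>. (\<integral>\<^sup>+x. ennreal ((norm (c * f x - r x))\<^sup>2) \<partial>\<mu>) < ennreal \<epsilon>" if "\<epsilon> > 0" for \<epsilon>
  proof -
    (* The summand 1 avoids a division by zero when c = 0. *)
    let ?d = "(norm c)\<^sup>2 + 1"
    have d: "?d > 0" by (simp add: add_nonneg_pos)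
    with that have d': "\<epsilon> / ?d > 0" by simp
    obtain p where p: "p \<in> exp_sums \<Lambda>" "(\<integral>\<^sup>+x. ennreal ((norm (f x - p x))\<^sup>2) \<partial>\<mu>) < ennreal (\<epsilon> / ?d)"
      using exp_closureD(3)[OF f d'] by blast
    note [measurable] = exp_sums_measurable[OF p(1)]
    have "(\<integral>\<^sup>+x. ennreal ((norm (c * f x - c * p x))\<^sup>2) \<partial>\<mu>)
      = (\<integral>\<^sup>+x. ennreal ((norm c)\<^sup>2) * ennreal ((norm (f x - p x))\<^sup>2) \<partial>\<mu>)"
      by (intro nn_integral_cong) (simp flip: right_diff_distrib ennreal_mult add: norm_mult power_mult_distrib)
    also have "\<dots> = ennreal ((norm c)\<^sup>2) * (\<integral>\<^sup>+x. ennreal ((norm (f x - p x))\<^sup>2) \<partial>\<mu>)"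
      by (rule nn_integral_cmult) measurable
    also have "\<dots> \<le> ennreal ?d * (\<integral>\<^sup>+x. ennreal ((norm (f x - p x))\<^sup>2) \<partial>\<mu>)"
      by (intro mult_right_mono ennreal_leI) auto
    also have "\<dots> < ennreal \<epsilon>"
      using p(2) that d by (intro ennreal_mult_less_divide)
    finally show ?thesis by (rule bexI[OF _ exp_sums_scale[OF p(1), of c]])
  qed
  moreover have "norm (c * f x) \<le> norm c * A" for x by (simp add: norm_mult mult_left_mono A)
  ultimately show "(\<lambda>x. c * f x) \<in> ?H" by (intro exp_closureI) measurable
next
  note [measurable_cong] = sets
  interpret finite_measure \<mu> by fact
  fix F :: "nat \<Rightarrow> _" and f B
  assume F: "\<And>n. F n \<in> ?H" and B: "\<And>n x. norm (F n x) \<le> B" and l: "\<And>x. (\<lambda>n. F n x) \<longlonglongrightarrow> f x"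
  have [measurable]: "F n \<in> borel_measurable borel" for n using F by (rule exp_closureD)
  have [measurable]: "f \<in> borel_measurable borel"
    by (rule borel_measurable_LIMSEQ_metric[where f = F]) (auto intro: l)
  have fB: "norm (f x) \<le> B" for x
    using B by (intro LIMSEQ_le_const2[OF tendsto_norm[OF l]]) auto
  have B0: "B \<ge> 0" using norm_ge_zero[of "f undefined"] fB[of undefined] by linarith
  have "(\<lambda>n. \<integral>\<^sup>+x. ennreal ((norm (f x - F n x))\<^sup>2) \<partial>\<mu>) \<longlonglongrightarrow> (\<integral>\<^sup>+x. 0 \<partial>\<mu>)"
  proof (rule nn_integral_dominated_convergence)
    show "AE x in \<mu>. ennreal ((norm (f x - F n x))\<^sup>2) \<le> ennreal ((2 * B)\<^sup>2)" for n
    proof (rule AE_I2, rule ennreal_leI, rule power_mono)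
      show "norm (f x - F n x) \<le> 2 * B" for x
        using norm_triangle_ineq4[of "f x" "F n x"] fB[of x] B[of n x] by linarith
    qed auto
    show "(\<integral>\<^sup>+x. ennreal ((2 * B)\<^sup>2) \<partial>\<mu>) < \<infinity>"
      by (simp add: ennreal_mult_less_top) (metis emeasure_finite top.not_eq_extremum infinity_ennreal_def)
    show "AE x in \<mu>. (\<lambda>n. ennreal ((norm (f x - F n x))\<^sup>2)) \<longlonglongrightarrow> 0"
    proof (rule AE_I2)
      fix x
      have "(\<lambda>n. ennreal ((norm (f x - F n x))\<^sup>2)) \<longlonglongrightarrow> ennreal ((norm (f x - f x))\<^sup>2)"
        by (intro tendsto_intros l)
      then show "(\<lambda>n. ennreal ((norm (f x - F n x))\<^sup>2)) \<longlonglongrightarrow> 0" by simp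
    qed
  qed measurable
  then have L: "(\<lambda>n. \<integral>\<^sup>+x. ennreal ((norm (f x - F n x))\<^sup>2) \<partial>\<mu>) \<longlonglongrightarrow> 0" by simp
  have "\<exists>r\<in>exp_sums \<Lambda>. (\<integral>\<^sup>+x. ennreal ((norm (f x - r x))\<^sup>2) \<partial>\<mu>) < ennreal \<epsilon>" if "\<epsilon> > 0" for \<epsilon>
  proof -
    have "\<forall>\<^sub>F n in sequentially. (\<integral>\<^sup>+x. ennreal ((norm (f x - F n x))\<^sup>2) \<partial>\<mu>) < ennreal (\<epsilon> / 4)"
      using that by (intro order_tendstoD(2)[OF L]) simp
    then obtain n where n: "(\<integral>\<^sup>+x. ennreal ((norm (f x - F n x))\<^sup>2) \<partial>\<mu>) < ennreal (\<epsilon> / 4)"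
      using eventually_happens'[OF sequentially_bot] by blast
    obtain p where p: "p \<in> exp_sums \<Lambda>" "(\<integral>\<^sup>+x. ennreal ((norm (F n x - p x))\<^sup>2) \<partial>\<mu>) < ennreal (\<epsilon> / 4)"
      using exp_closureD(3)[OF F[of n], of "\<epsilon> / 4"] \<open>\<epsilon> > 0\<close> by auto
    note [measurable] = exp_sums_measurable[OF p(1)]
    have "(\<integral>\<^sup>+x. ennreal ((norm (f x - p x))\<^sup>2) \<partial>\<mu>)
      \<le> 2 * (\<integral>\<^sup>+x. ennreal ((norm (f x - F n x))\<^sup>2) \<partial>\<mu>) + 2 * (\<integral>\<^sup>+x. ennreal ((norm (F n x - p x))\<^sup>2) \<partial>\<mu>)"
      by (rule nn_integral_diff_square_le) measurable
    also have "\<dots> < ennreal \<epsilon>"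
      using p(2) n that by (intro ennreal_double_sum_less)
    finally show ?thesis using p(1) by blast
  qed
  then show "f \<in> ?H" using fB by (intro exp_closureI) measurable
qed

lemma exp_sums_in_L2_closure:
  assumes "f \<in> exp_sums \<Lambda>"
  shows "f \<in> exp_closure \<mu> \<Lambda>"
proof -
  have "(\<integral>\<^sup>+x. ennreal ((norm (f x - f x))\<^sup>2) \<partial>\<mu>) < ennreal \<epsilon>" if "\<epsilon> > 0" for \<epsilon>
    using that by simp
  moreover obtain B where "\<And>x. norm (f x) \<le> B" using exp_sums_bounded[OF assms] by blast
  ultimately show ?thesis using exp_sums_measurable[OF assms] assms by (intro exp_closureI) blast+
qed

text \<open>The measure will be built from the transform of the generator, about which little is known; this is
why density is wanted for an arbitrary finite measure.\<close>

theorem trigonometric_density: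
  fixes \<mu> :: "(real ^ 'd::finite) measure"
  assumes "finite_measure \<mu>" "sets \<mu> = sets borel"
    and "f \<in> borel_measurable borel" "\<And>x. norm (f x) \<le> B"
    and "\<And>x j. j \<in> integer_points \<Longrightarrow> f (x + (2 * pi) *\<^sub>R j) = f x"
    and "\<epsilon> > 0"
  obtains p where "p \<in> exp_sums integer_points" "(\<integral>\<^sup>+x. ennreal ((norm (f x - p x))\<^sup>2) \<partial>\<mu>) < ennreal \<epsilon>"
  using exp_closureD(3)[OF bounded_limit_space_periodic[OF bounded_limit_space_L2_closure[OF assms(1,2)]
      subsetI[OF exp_sums_in_L2_closure] assms(3,4,5)] assms(6)] that by blast

theorem exponential_density:
  fixes \<mu> :: "(real ^ 'd::finite) measure"
  assumes "finite_measure \<mu>" "sets \<mu> = sets borel"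
    and "f \<in> borel_measurable borel" "\<And>x. norm (f x) \<le> B"
    and "\<epsilon> > 0"
  obtains p where "p \<in> exp_sums UNIV" "(\<integral>\<^sup>+x. ennreal ((norm (f x - p x))\<^sup>2) \<partial>\<mu>) < ennreal \<epsilon>"
  using exp_closureD(3)[OF bounded_limit_space_all[OF bounded_limit_space_L2_closure[OF assms(1,2)]
      subsetI[OF exp_sums_in_L2_closure] assms(3,4)] assms(5)] that by blast

section \<open>Uniqueness of the Fourier transform\<close>

lemma exp_sums_subset:
  assumes "bounded_limit_space H" "\<And>l. l \<in> \<Lambda> \<Longrightarrow> (\<lambda>x. cis (l \<bullet> x)) \<in> H"
  shows "exp_sums \<Lambda> \<subseteq> H"
proof
  interpret bounded_limit_space H by fact
  fix f assume "f \<in> exp_sums \<Lambda>"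
  then show "f \<in> H" by induction (auto intro: add scale assms(2))
qed

lemma integrable_bounded_mult:
  fixes f g :: "'a \<Rightarrow> complex"
  assumes "integrable M g" "f \<in> borel_measurable M" "\<And>x. norm (f x) \<le> B"
  shows "integrable M (\<lambda>x. f x * g x)"
proof (rule Bochner_Integration.integrable_bound)
  show "integrable M (\<lambda>x. of_real B * g x)" by (intro integrable_mult_right assms)
  have "norm (f x * g x) \<le> norm (of_real B * g x)" for x
  proof -
    have "0 \<le> B" using assms(3)[of x] norm_ge_zero order_trans by blast
    then show ?thesis using assms(3)[of x] by (simp add: norm_mult mult_right_mono)
  qed
  then show "AE x in M. norm (f x * g x) \<le> norm (of_real B * g x)" by simp
qed (use assms in measurable)

text \<open>Dominated convergence, with dominating function \<open>B |g|\<close>.\<close>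

lemma bounded_limit_space_annihilator:
  fixes g :: "'a \<Rightarrow> complex"
  assumes g: "integrable M g"
  shows "bounded_limit_space {f. f \<in> borel_measurable M \<and> (\<exists>B. \<forall>x. norm (f x) \<le> B) \<and> (LINT x|M. f x * g x) = 0}"
    (is "bounded_limit_space ?H")
proof
  fix f f' assume f: "f \<in> ?H" and f': "f' \<in> ?H"
  obtain A where A: "\<And>x. norm (f x) \<le> A" using f by blast
  obtain B where B: "\<And>x. norm (f' x) \<le> B" using f' by blast
  have m [measurable]: "f \<in> borel_measurable M" "f' \<in> borel_measurable M" using f f' by blast+
  have "(LINT x|M. (f x + f' x) * g x) = (LINT x|M. f x * g x) + (LINT x|M. f' x * g x)"
    unfolding distrib_right
    by (intro Bochner_Integration.integral_add integrable_bounded_mult[OF g] m) (rule A B)+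
  then have "(LINT x|M. (f x + f' x) * g x) = 0" using f f' by simp
  moreover have "norm (f x + f' x) \<le> A + B" for x by (rule norm_triangle_le) (intro add_mono A B)
  ultimately show "(\<lambda>x. f x + f' x) \<in> ?H" by (intro CollectI conjI exI[of _ "A + B"] allI) measurable
next
  fix f c assume f: "f \<in> ?H"
  obtain A where A: "\<And>x. norm (f x) \<le> A" using f by blast
  have m [measurable]: "f \<in> borel_measurable M" using f by blast
  have "(LINT x|M. c * f x * g x) = 0" using f by (simp add: mult.assoc)
  moreover have "norm (c * f x) \<le> norm c * A" for x by (simp add: norm_mult mult_left_mono A)
  ultimately show "(\<lambda>x. c * f x) \<in> ?H" by (intro CollectI conjI exI[of _ "norm c * A"] allI) measurable
next
  fix F :: "nat \<Rightarrow> _" and f B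
  assume F: "\<And>n. F n \<in> ?H" and B: "\<And>n x. norm (F n x) \<le> B" and l: "\<And>x. (\<lambda>n. F n x) \<longlonglongrightarrow> f x"
  have m [measurable]: "F n \<in> borel_measurable M" for n using F by blast
  have [measurable]: "f \<in> borel_measurable M"
    by (rule borel_measurable_LIMSEQ_metric[where f = F]) (auto intro: l)
  have fB: "norm (f x) \<le> B" for x
    using B by (intro LIMSEQ_le_const2[OF tendsto_norm[OF l]]) auto
  have [measurable]: "g \<in> borel_measurable M" using g by auto
  have "(\<lambda>n. LINT x|M. F n x * g x) \<longlonglongrightarrow> (LINT x|M. f x * g x)"
  proof (rule integral_dominated_convergence[where w = "\<lambda>x. B * norm (g x)"])
    show "integrable M (\<lambda>x. B * norm (g x))" using g by simp
    show "AE x in M. (\<lambda>n. F n x * g x) \<longlonglongrightarrow> f x * g x" by (intro AE_I2 tendsto_intros l)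
    show "AE x in M. norm (F n x * g x) \<le> B * norm (g x)" for n
      by (intro AE_I2) (simp add: norm_mult mult_right_mono B)
  qed measurable
  moreover have "(LINT x|M. F n x * g x) = 0" for n using F by blast
  ultimately have "(LINT x|M. f x * g x) = 0" by (simp add: LIMSEQ_const_iff)
  then show "f \<in> ?H" using fB by (intro CollectI conjI exI[of _ B] allI) measurable
qed

text \<open>An integrable function with vanishing Fourier transform is annihilated by all exponentials, hence by
all bounded Borel functions.\<close>

theorem fourier_uniqueness:
  fixes g :: "real ^ 'd::finite \<Rightarrow> complex"
  assumes g: "integrable lborel g" and z: "\<And>\<xi>. (LINT x|lborel. cis (\<xi> \<bullet> x) * g x) = 0"
  shows "AE x in lborel. g x = 0"
proof -
  let ?H = "{f. f \<in> borel_measurable lborel \<and> (\<exists>B. \<forall>x. norm (f x) \<le> B) \<and> (LINT x|lborel. f x * g x) = 0}"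
  have [measurable]: "g \<in> borel_measurable borel" using g by auto
  (* Testing against the conjugate phase of g turns the vanishing integral into the L1 norm of g. *)
  define s where "s x = cnj (sgn (g x))" for x
  have cnjm: "cnj \<in> borel_measurable borel" by (intro borel_measurable_continuous_onI continuous_intros)
  have "s \<in> ?H"
  proof (rule bounded_limit_space_all[OF bounded_limit_space_annihilator[OF g], where B = 1])
    show "exp_sums UNIV \<subseteq> ?H"
    proof (rule exp_sums_subset[OF bounded_limit_space_annihilator[OF g]])
      fix l :: "real^'d"
      have "\<forall>x. norm (cis (l \<bullet> x)) \<le> 1" by simp
      moreover have "(\<lambda>x. cis (l \<bullet> x)) \<in> borel_measurable lborel"
        using smooth_measurable[OF smooth_cis_inner] by simp
      ultimately show "(\<lambda>x. cis (l \<bullet> x)) \<in> ?H" using z by blast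
    qed
    show "s \<in> borel_measurable borel" unfolding s_def sgn_div_norm
      by (intro measurable_compose[OF _ cnjm]) measurable
    show "norm (s x) \<le> 1" for x by (simp add: s_def norm_sgn)
  qed
  then have "(LINT x|lborel. s x * g x) = 0" by blast
  moreover have "s x * g x = of_real (norm (g x))" for x
  proof (cases "g x = 0")
    case False
    have "s x * g x = g x * cnj (g x) / norm (g x)"
      by (simp add: s_def sgn_eq)
    also have "\<dots> = complex_of_real ((norm (g x))\<^sup>2) / complex_of_real (norm (g x))"
      by (simp only: complex_norm_square)
    finally show ?thesis by (simp add: power2_eq_square)
  qed (simp add: s_def)
  ultimately have "(LINT x|lborel. norm (g x)) = 0" by simp
  then have "AE x in lborel. norm (g x) = 0"
    using g by (subst (asm) integral_nonneg_eq_0_iff_AE) auto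
  then show ?thesis by simp
qed

lemma integrable_mult_support:
  fixes F \<psi> :: "real ^ 'd::finite \<Rightarrow> complex"
  assumes "set_integrable lborel K F" "\<psi> \<in> borel_measurable borel" "\<And>x. norm (\<psi> x) \<le> B" "\<And>x. x \<notin> K \<Longrightarrow> \<psi> x = 0"
  shows "integrable lborel (\<lambda>x. F x * \<psi> x)"
proof -
  have "integrable lborel (\<lambda>x. \<psi> x * (indicator K x *\<^sub>R F x))"
    using assms by (intro integrable_bounded_mult[where B = B]) (auto simp: set_integrable_def)
  moreover have "(\<lambda>x. \<psi> x * (indicator K x *\<^sub>R F x)) = (\<lambda>x. F x * \<psi> x)"
    using assms(4) by (auto simp: indicator_def fun_eq_iff)
  ultimately show ?thesis by simp
qed

lemma integrable_mult_test:
  fixes F \<psi> :: "real ^ 'd::finite \<Rightarrow> complex"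
  assumes "\<And>K. compact K \<Longrightarrow> K \<subseteq> U \<Longrightarrow> set_integrable lborel K F" "\<psi> \<in> test_functions U"
  shows "integrable lborel (\<lambda>x. F x * \<psi> x)"
proof -
  obtain K where K: "smooth \<psi>" "compact K" "K \<subseteq> U" "\<And>x. x \<notin> K \<Longrightarrow> \<psi> x = 0"
    by (rule test_functionsE[OF assms(2)]) (rule that)
  obtain B where B: "\<And>x. norm (\<psi> x) \<le> B" using test_bounded[OF assms(2)] by blast
  show ?thesis
    by (rule integrable_mult_support[OF assms(1)[OF K(2,3)] smooth_measurable[OF K(1)] B K(4)])
qed

lemma locally_L2_set_integrable:
  assumes "locally_L2 F" "compact K"
  shows "set_integrable lborel K F"
proof -
  have [measurable]: "F \<in> borel_measurable borel" using assms by (simp add: locally_L2_def)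
  have Kb [measurable]: "K \<in> sets borel" using assms(2) by (simp add: borel_compact)
  have 1: "integrable lborel (\<lambda>x. indicator K x * (1 + (norm (F x))\<^sup>2))"
  proof -
    have "integrable lborel (\<lambda>x. indicator K x *\<^sub>R (1::real))"
      by (intro borel_integrable_compact assms) auto
    moreover have "integrable lborel (\<lambda>x. indicator K x *\<^sub>R (norm (F x))\<^sup>2)"
      using assms by (simp add: locally_L2_def set_integrable_def)
    ultimately have "integrable lborel (\<lambda>x. indicator K x *\<^sub>R 1 + indicator K x *\<^sub>R (norm (F x))\<^sup>2)"
      by (rule Bochner_Integration.integrable_add)
    then show ?thesis by (simp add: distrib_left)
  qed
  show ?thesis unfolding set_integrable_def
  proof (rule Bochner_Integration.integrable_bound[OF 1])
    have "norm (F x) \<le> 1 + (norm (F x))\<^sup>2" for x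
      using zero_le_square[of "norm (F x) - 1/2"] by (simp add: power2_eq_square algebra_simps)
    then show "AE x in lborel. norm (indicator K x *\<^sub>R F x) \<le> norm (indicator K x * (1 + (norm (F x))\<^sup>2))"
      by (auto simp: indicator_def)
  qed measurable
qed

lemma locally_L2_mult_test:
  "locally_L2 F \<Longrightarrow> \<psi> \<in> test_functions U \<Longrightarrow> integrable lborel (\<lambda>x. F x * \<psi> x)"
  by (rule integrable_mult_test) (auto intro: locally_L2_set_integrable)

text \<open>The fundamental lemma of the calculus of variations, deduced from uniqueness of Fourier transforms
because a test function times a character is a test function.\<close>

theorem test_functions_separate:
  fixes F :: "real ^ 'd::finite \<Rightarrow> complex"
  assumes "\<And>K. compact K \<Longrightarrow> set_integrable lborel K F"
    and z: "\<And>\<psi>. \<psi> \<in> test_functions UNIV \<Longrightarrow> (LINT x|lborel. F x * \<psi> x) = 0"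
  shows "AE x in lborel. F x = 0"
proof -
  (* A bump of radius n + 1 multiplied by a character is again a test function, so F times
     the bump has vanishing Fourier transform. *)
  define \<theta> where "\<theta> n x = complex_of_real (bump (inverse (real (Suc n)) *\<^sub>R x + 0))" for n and x :: "real^'d"
  have \<theta>: "\<theta> n \<in> test_functions UNIV" for n
    unfolding \<theta>_def[abs_def] by (rule test_affine[OF bump_test]) simp
  have "AE x in lborel. F x * \<theta> n x = 0" for n
  proof (rule fourier_uniqueness)
    show "integrable lborel (\<lambda>x. F x * \<theta> n x)" by (rule integrable_mult_test[OF assms(1) \<theta>])
    fix \<xi>
    have "(LINT x|lborel. F x * (cis (\<xi> \<bullet> x) * \<theta> n x)) = 0"
      by (rule z[OF test_mult[OF smooth_cis_inner \<theta>]])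
    then show "(LINT x|lborel. cis (\<xi> \<bullet> x) * (F x * \<theta> n x)) = 0"
      by (simp add: mult_ac)
  qed
  then have "AE x in lborel. \<forall>n. F x * \<theta> n x = 0" unfolding AE_all_countable by blast
  then show ?thesis
  proof (rule AE_mp, intro AE_I2 impI)
    fix x assume *: "\<forall>n. F x * \<theta> n x = 0"
    obtain n where "norm x < real n" using reals_Archimedean2 by blast
    then have "norm (inverse (real (Suc n)) *\<^sub>R x) < 1" by (simp add: field_simps)
    then have "\<theta> n x \<noteq> 0" using bump_pos_iff[of "inverse (real (Suc n)) *\<^sub>R x"] by (simp add: \<theta>_def)
    moreover have "F x * \<theta> n x = 0" using * by blast
    ultimately show "F x = 0" by simp
  qed
qed

section \<open>The Fourier transform of test functions\<close>

lemma fourier_eq: "fourier f \<omega> = (LINT x|lborel. f x * cis ((- \<omega>) \<bullet> x))"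
  by (simp add: fourier_def cis_conv_exp)

lemma integral_pderivative_0:
  fixes f :: "real ^ 'd::finite \<Rightarrow> complex"
  assumes f: "f \<in> test_functions UNIV"
  shows "(LINT x|lborel. pderivative i f x) = 0"
proof -
  obtain K where K: "smooth f" "compact K" "K \<subseteq> UNIV" "\<And>x. x \<notin> K \<Longrightarrow> f x = 0"
    by (rule test_functionsE[OF f]) (rule that)
  obtain K' where K': "smooth (pderivative i f)" "compact K'" "K' \<subseteq> UNIV" "\<And>x. x \<notin> K' \<Longrightarrow> pderivative i f x = 0"
    by (rule test_functionsE[OF pderivative_test[OF f]]) (rule that)
  have "bounded (K \<union> K')" using K(2) K'(2) by (simp add: compact_imp_bounded)
  then obtain R where R: "\<And>x. x \<in> K \<union> K' \<Longrightarrow> norm x \<le> R" by (auto simp: bounded_iff)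
  obtain C where C: "C \<ge> 0" "\<And>x v. norm (f (x + v) - f x - (\<Sum>i\<in>UNIV. of_real (v $ i) * pderivative i f x)) \<le> C * (norm v)\<^sup>2"
    using test_first_order[OF f] by blast
  let ?B = "cball (0 :: real^'d) (R + 1)"
  define D where "D = C * measure lborel ?B"
  let ?I = "LINT x|lborel. pderivative i f x"
  (* The integral of a difference quotient vanishes by translation invariance, and the
     quotient differs from the derivative by O(t) on a fixed ball. *)
  have "norm ?I \<le> D * t" if t: "0 < t" "t \<le> 1" for t
  proof -
    let ?v = "t *\<^sub>R axis i 1 :: real^'d"
    have sum: "(\<Sum>j\<in>UNIV. of_real (?v $ j) * pderivative j f x) = of_real t * pderivative i f x" for x
      by (simp add: axis_def if_distrib if_distribR cong: if_cong)
    have nv: "norm ?v = t" using t by simp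
    have if1: "integrable lborel f" by (rule test_integrable[OF f])
    have if2: "integrable lborel (\<lambda>x. f (x + ?v))"
      using test_integrable[OF test_affine[OF f, of 1 ?v]] by simp
    have if3: "integrable lborel (\<lambda>x. of_real t * pderivative i f x)"
      by (intro integrable_mult_right test_integrable[OF pderivative_test[OF f]])
    have shift: "(LINT x|lborel. f (x + ?v)) = (LINT x|lborel. f x)"
      using integral_lborel_affine[of f 1 ?v] smooth_measurable[OF K(1)] by (simp add: add.commute)
    have "(LINT x|lborel. f (x + ?v) - f x - of_real t * pderivative i f x) = - (of_real t * ?I)"
      using if1 if2 if3 shift by simp
    then have "t * norm ?I = norm (LINT x|lborel. f (x + ?v) - f x - of_real t * pderivative i f x)"
      using t by (simp add: norm_mult)
    also have "\<dots> \<le> (LINT x|lborel. indicator ?B x * (C * t\<^sup>2))"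
    proof (rule Bochner_Integration.integral_norm_bound_integral)
      show "integrable lborel (\<lambda>x. f (x + ?v) - f x - of_real t * pderivative i f x)"
        using if1 if2 if3 by simp
      show "integrable lborel (\<lambda>x. indicator ?B x * (C * t\<^sup>2))"
        by (intro integrable_mult_left integrable_real_indicator emeasure_bounded_finite[OF bounded_cball]) simp
      show "norm (f (x + ?v) - f x - of_real t * pderivative i f x) \<le> indicator ?B x * (C * t\<^sup>2)" for x
      proof (cases "x \<in> ?B")
        case True
        then show ?thesis using C(2)[of x ?v] True unfolding sum nv by simp
      next
        case False
        then have n: "norm x > R + 1" by simp
        have "norm x \<le> norm (x + ?v) + norm ?v" by (metis add_diff_cancel_right' norm_triangle_ineq4)
        then have "norm (x + ?v) > R" using n t nv by linarith
        then have "f (x + ?v) = 0" "f x = 0" "pderivative i f x = 0"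
          using n R[of "x + ?v"] R[of x] by (auto intro!: K(4) K'(4))
        then show ?thesis using False by simp
      qed
    qed
    also have "\<dots> = t * (D * t)" by (simp add: D_def power2_eq_square)
    finally show ?thesis using t by simp
  qed
  then have "norm ?I \<le> 0"
    by (intro tendsto_lowerbound[of "\<lambda>t. D * t" 0 "at_right 0"])
       (auto intro!: tendsto_eq_intros eventually_at_rightI[of 0 1])
  then show ?thesis by simp
qed

lemma pderivative_cis_inner:
  "pderivative i (\<lambda>x. cis (\<xi> \<bullet> x)) x = \<i> * of_real (\<xi> $ i) * cis (\<xi> \<bullet> x)"
  by (subst pderivative_eqI[OF has_derivative_cis_inner]) (simp add: inner_axis)

lemma fourier_pderivative:
  assumes f: "f \<in> test_functions UNIV"
  shows "fourier (pderivative i f) \<omega> = \<i> * of_real (\<omega> $ i) * fourier f \<omega>"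
proof -
  let ?e = "\<lambda>x. cis ((- \<omega>) \<bullet> x)"
  have t: "(\<lambda>x. ?e x * f x) \<in> test_functions UNIV" by (intro test_mult smooth_cis_inner f)
  have t': "(\<lambda>x. ?e x * pderivative i f x) \<in> test_functions UNIV"
    by (intro test_mult smooth_cis_inner pderivative_test f)
  have "pderivative i (\<lambda>x. ?e x * f x) x = ?e x * pderivative i f x - \<i> * of_real (\<omega> $ i) * (?e x * f x)" for x
    by (subst pderivative_mult)
       (simp_all add: smooth_differentiable smooth_cis_inner test_functions_smooth[OF f] pderivative_cis_inner
         del: inner_minus_left)
  then have "(LINT x|lborel. ?e x * pderivative i f x - \<i> * of_real (\<omega> $ i) * (?e x * f x)) = 0"
    using integral_pderivative_0[OF t, of i] by simp
  then have "(LINT x|lborel. ?e x * pderivative i f x) = (LINT x|lborel. \<i> * of_real (\<omega> $ i) * (?e x * f x))"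
    using test_integrable[OF t] test_integrable[OF t'] by (subst (asm) Bochner_Integration.integral_diff) auto
  also have "\<dots> = \<i> * of_real (\<omega> $ i) * (LINT x|lborel. ?e x * f x)"
    by (rule integral_mult_right_zero)
  finally show ?thesis by (simp only: fourier_eq mult.commute[of _ "cis _"])
qed

lemma fourier_pderivatives:
  assumes f: "f \<in> test_functions UNIV"
  shows "fourier (pderivatives is f) \<omega> = (\<Prod>i\<leftarrow>is. \<i> * of_real (\<omega> $ i)) * fourier f \<omega>"
  by (induction "is") (auto simp: pderivatives_Cons fourier_pderivative pderivatives_test[OF f])

lemma norm_fourier_le: "norm (fourier f \<omega>) \<le> (LINT x|lborel. norm (f x))"
  unfolding fourier_eq
  by (rule order_trans[OF integral_norm_bound]) (simp add: norm_mult)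

text \<open>Every factor \<open>1 + |\<omega>|\<close> is paid for by one more derivative on the test function.\<close>

lemma fourier_decay:
  fixes f :: "real ^ 'd::finite \<Rightarrow> complex"
  assumes f: "f \<in> test_functions UNIV"
  shows "\<exists>C. \<forall>\<omega>. (1 + norm \<omega>) ^ N * norm (fourier f \<omega>) \<le> C"
  using f
proof (induction N arbitrary: f)
  case 0
  then show ?case using norm_fourier_le[of f] by auto
next
  case (Suc N)
  obtain C where C: "\<And>\<omega>. (1 + norm \<omega>) ^ N * norm (fourier f \<omega>) \<le> C" using Suc by blast
  have "\<forall>i. \<exists>C. \<forall>\<omega>. (1 + norm \<omega>) ^ N * norm (fourier (pderivative i f) \<omega>) \<le> C"
    using Suc.IH[OF pderivative_test[OF Suc.prems]] by blast
  then obtain D where D: "\<And>i \<omega>. (1 + norm \<omega>) ^ N * norm (fourier (pderivative i f) \<omega>) \<le> D i"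
    by metis
  have "(1 + norm \<omega>) ^ Suc N * norm (fourier f \<omega>) \<le> C + (\<Sum>i\<in>UNIV. D i)" for \<omega>
  proof -
    have "(1 + norm \<omega>) * norm (fourier f \<omega>) \<le> norm (fourier f \<omega>) + (\<Sum>i\<in>UNIV. \<bar>\<omega> $ i\<bar>) * norm (fourier f \<omega>)"
      using mult_right_mono[OF norm_le_l1_cart[of \<omega>], of "norm (fourier f \<omega>)"] by (simp add: distrib_right)
    also have "\<dots> = norm (fourier f \<omega>) + (\<Sum>i\<in>UNIV. norm (fourier (pderivative i f) \<omega>))"
      by (simp add: fourier_pderivative[OF Suc.prems] norm_mult sum_distrib_right)
    finally have "(1 + norm \<omega>) ^ N * ((1 + norm \<omega>) * norm (fourier f \<omega>)) \<le>
      (1 + norm \<omega>) ^ N * (norm (fourier f \<omega>) + (\<Sum>i\<in>UNIV. norm (fourier (pderivative i f) \<omega>)))"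
      by (intro mult_left_mono) auto
    also have "\<dots> \<le> C + (\<Sum>i\<in>UNIV. D i)"
      unfolding distrib_left sum_distrib_left by (intro add_mono sum_mono C D)
    finally show ?thesis by (simp add: mult_ac)
  qed
  then show ?case by blast
qed

lemma has_derivative_quadratic:
  fixes f :: "'a::real_normed_vector \<Rightarrow> 'b::real_normed_vector"
  assumes "bounded_linear L" "\<And>v. norm (f (x + v) - f x - L v) \<le> C * (norm v)\<^sup>2"
  shows "(f has_derivative L) (at x)"
  unfolding has_derivative_at
proof (intro conjI assms(1))
  show "(\<lambda>v. norm (f (x + v) - f x - L v) / norm v) \<midarrow>0\<rightarrow> 0"
  proof (rule Lim_null_comparison)
    have "norm (f (x + v) - f x - L v) / norm v \<le> C * norm v" if "v \<noteq> 0" for v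
      using assms(2)[of v] that by (simp add: power2_eq_square divide_le_eq mult_ac)
    then show "\<forall>\<^sub>F v in at 0. norm (norm (f (x + v) - f x - L v) / norm v) \<le> C * norm v"
      by (auto simp: eventually_at_filter)
    show "(\<lambda>v. C * norm v) \<midarrow>0\<rightarrow> 0" by (auto intro!: tendsto_eq_intros)
  qed
qed

lemma norm_cis_quadratic: "norm (cis t - 1 - \<i> * of_real t) \<le> t\<^sup>2 / 2"
  using iexp_approx1[of t 1] by (simp add: cis_conv_exp diff_diff_eq power2_eq_square numeral_2_eq_2[symmetric])

lemma fourier_has_derivative:
  fixes f :: "real ^ 'd::finite \<Rightarrow> complex"
  assumes f: "f \<in> test_functions UNIV"
  shows "(fourier f has_derivative (\<lambda>v. \<Sum>i\<in>UNIV. of_real (v $ i) * fourier (\<lambda>x. (- \<i>) * of_real (x $ i) * f x) \<omega>)) (at \<omega>)"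
proof (rule has_derivative_quadratic)
  show "bounded_linear (\<lambda>v::real^'d. \<Sum>i\<in>UNIV. of_real (v $ i) * fourier (\<lambda>x. (- \<i>) * of_real (x $ i) * f x) \<omega>)"
    by (intro bounded_linear_sum bounded_linear_mult_const bounded_linear_compose[OF bounded_linear_of_real]
        bounded_linear_vec_nth)
  fix v :: "real^'d"
  let ?e = "\<lambda>\<omega> x. cis ((- \<omega>) \<bullet> x)"
  have ti: "(\<lambda>x. (- \<i>) * of_real (x $ i) * f x) \<in> test_functions UNIV" for i
    by (rule test_mult[OF smooth_mult[OF smooth_const smooth_coord] f])
  have int: "integrable lborel (\<lambda>x. g x * ?e \<omega> x)" if "g \<in> test_functions UNIV" for g \<omega>
    using test_integrable[OF test_mult[OF smooth_cis_inner that, of "-\<omega>"]] by (simp add: mult.commute)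
  have inner: "v \<bullet> x = (\<Sum>i\<in>UNIV. v $ i * x $ i)" for x by (simp add: inner_vec_def)
  have xx: "(\<lambda>x. (x \<bullet> x) *\<^sub>R f x) \<in> test_functions UNIV"
  proof -
    have "smooth (\<lambda>x::real^'d. \<Sum>i\<in>I. complex_of_real (x $ i) * complex_of_real (x $ i))" if "finite I" for I
      using that by (induction I rule: finite_induct) (auto intro!: smooth_add smooth_mult)
    from test_mult[OF this[of UNIV] f] show ?thesis
      by (simp add: inner_vec_def scaleR_conv_of_real)
  qed
  let ?r = "\<lambda>x. f x * ?e (\<omega> + v) x - f x * ?e \<omega> x - (\<Sum>i\<in>UNIV. of_real (v $ i) * ((- \<i>) * of_real (x $ i) * f x * ?e \<omega> x))"
  have r: "?r x = f x * ?e \<omega> x * (cis (- (v \<bullet> x)) - 1 - \<i> * of_real (- (v \<bullet> x)))" for x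
  proof -
    have 1: "?e (\<omega> + v) x = ?e \<omega> x * cis (- (v \<bullet> x))"
      by (simp add: cis_mult inner_add_left inner_diff_left)
    have 2: "(\<Sum>i\<in>UNIV. of_real (v $ i) * ((- \<i>) * of_real (x $ i) * f x * ?e \<omega> x)) = f x * ?e \<omega> x * (\<i> * of_real (- (v \<bullet> x)))"
      by (simp add: inner sum_distrib_left sum_distrib_right sum_negf mult_ac del: inner_minus_left)
    show ?thesis unfolding 1 2 by (simp only: right_diff_distrib mult.assoc mult_1_right)
  qed
  have ri: "integrable lborel ?r"
    by (intro Bochner_Integration.integrable_diff Bochner_Integration.integrable_sum integrable_mult_right int f ti)
  have "fourier f (\<omega> + v) - fourier f \<omega> - (\<Sum>i\<in>UNIV. of_real (v $ i) * fourier (\<lambda>x. (- \<i>) * of_real (x $ i) * f x) \<omega>)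
    = (LINT x|lborel. ?r x)"
  proof -
    have "(LINT x|lborel. ?r x) = (LINT x|lborel. f x * ?e (\<omega> + v) x - f x * ?e \<omega> x) -
       (LINT x|lborel. (\<Sum>i\<in>UNIV. of_real (v $ i) * ((- \<i>) * of_real (x $ i) * f x * ?e \<omega> x)))"
      by (intro Bochner_Integration.integral_diff Bochner_Integration.integrable_diff
          Bochner_Integration.integrable_sum integrable_mult_right int f ti)
    also have "(LINT x|lborel. f x * ?e (\<omega> + v) x - f x * ?e \<omega> x) = fourier f (\<omega> + v) - fourier f \<omega>"
      unfolding fourier_eq by (intro Bochner_Integration.integral_diff int f)
    also have "(LINT x|lborel. (\<Sum>i\<in>UNIV. of_real (v $ i) * ((- \<i>) * of_real (x $ i) * f x * ?e \<omega> x)))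
       = (\<Sum>i\<in>UNIV. LINT x|lborel. of_real (v $ i) * ((- \<i>) * of_real (x $ i) * f x * ?e \<omega> x))"
      by (intro Bochner_Integration.integral_sum integrable_mult_right int ti)
    also have "\<dots> = (\<Sum>i\<in>UNIV. of_real (v $ i) * fourier (\<lambda>x. (- \<i>) * of_real (x $ i) * f x) \<omega>)"
      unfolding fourier_eq by (intro sum.cong refl integral_mult_right_zero)
    finally show ?thesis by (rule sym)
  qed
  also have "norm \<dots> \<le> (LINT x|lborel. norm ((x \<bullet> x) *\<^sub>R f x) * (norm v)\<^sup>2)"
  proof (rule Bochner_Integration.integral_norm_bound_integral)
    show "integrable lborel ?r" by (rule ri)
    show "integrable lborel (\<lambda>x. norm ((x \<bullet> x) *\<^sub>R f x) * (norm v)\<^sup>2)"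
      by (intro integrable_mult_left integrable_norm test_integrable[OF xx])
    fix x :: "real^'d"
    have "norm (cis (- (v \<bullet> x)) - 1 - \<i> * of_real (- (v \<bullet> x))) \<le> (- (v \<bullet> x))\<^sup>2 / 2"
      by (rule norm_cis_quadratic)
    also have "\<dots> \<le> (v \<bullet> v) * (x \<bullet> x)"
      using Cauchy_Schwarz_ineq[of v x] zero_le_power2[of "v \<bullet> x"] unfolding power2_minus by linarith
    finally have "norm (f x) * norm (cis (- (v \<bullet> x)) - 1 - \<i> * of_real (- (v \<bullet> x))) \<le> norm (f x) * ((v \<bullet> v) * (x \<bullet> x))"
      by (intro mult_left_mono) auto
    then show "norm (?r x) \<le> norm ((x \<bullet> x) *\<^sub>R f x) * (norm v)\<^sup>2"
      unfolding r by (simp add: norm_mult power2_norm_eq_inner mult_ac del: of_real_minus)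
  qed
  also have "\<dots> = (LINT x|lborel. norm ((x \<bullet> x) *\<^sub>R f x)) * (norm v)\<^sup>2" by simp
  finally show "norm (fourier f (\<omega> + v) - fourier f \<omega> - (\<Sum>i\<in>UNIV. of_real (v $ i) * fourier (\<lambda>x. (- \<i>) * of_real (x $ i) * f x) \<omega>))
    \<le> (LINT x|lborel. norm ((x \<bullet> x) *\<^sub>R f x)) * (norm v)\<^sup>2" .
qed

lemma pderivative_fourier:
  assumes f: "f \<in> test_functions UNIV"
  shows "pderivative i (fourier f) = fourier (\<lambda>x. (- \<i>) * of_real (x $ i) * f x)"
proof
  fix \<omega>
  show "pderivative i (fourier f) \<omega> = fourier (\<lambda>x. (- \<i>) * of_real (x $ i) * f x) \<omega>"
    by (subst pderivative_eqI[OF fourier_has_derivative[OF f]])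
       (simp add: axis_def if_distrib if_distribR cong: if_cong)
qed

lemma pderivatives_fourier:
  assumes f: "f \<in> test_functions UNIV"
  shows "\<exists>g\<in>test_functions UNIV. pderivatives is (fourier f) = fourier g"
proof (induction "is")
  case (Cons i "is")
  then obtain g where g: "g \<in> test_functions UNIV" "pderivatives is (fourier f) = fourier g" by blast
  show ?case
    by (rule bexI[OF _ test_mult[OF smooth_mult[OF smooth_const smooth_coord] g(1)]])
       (simp only: pderivatives_Cons g(2) pderivative_fourier[OF g(1)])
qed (use f in auto)

lemma smooth_fourier:
  assumes f: "f \<in> test_functions UNIV" shows "smooth (fourier f)"
  unfolding smooth_def
proof (intro allI)
  fix "is" x
  obtain g where g: "g \<in> test_functions UNIV" "pderivatives is (fourier f) = fourier g"
    using pderivatives_fourier[OF f] by blast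
  show "pderivatives is (fourier f) differentiable at x"
    unfolding g(2) by (rule differentiableI[OF fourier_has_derivative[OF g(1)]])
qed

lemma fourier_schwartz:
  assumes f: "f \<in> test_functions UNIV" shows "fourier f \<in> schwartz"
proof -
  have "bdd_above (range (\<lambda>x. (1 + norm x) ^ N * norm (mderiv \<gamma> (fourier f) x)))" for N \<gamma>
  proof -
    obtain g where g: "g \<in> test_functions UNIV" "mderiv \<gamma> (fourier f) = fourier g"
      unfolding mderiv_def using pderivatives_fourier[OF f] by blast
    show ?thesis unfolding g(2) using fourier_decay[OF g(1), of N] by (auto simp: bdd_above_def)
  qed
  then show ?thesis using smooth_fourier[OF f] by (simp add: schwartz_def)
qed

lemma test_schwartz:
  fixes f :: "real ^ 'd::finite \<Rightarrow> complex"
  assumes f: "f \<in> test_functions UNIV" shows "f \<in> schwartz"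
proof -
  have "bdd_above (range (\<lambda>x. (1 + norm x) ^ N * norm (mderiv \<gamma> f x)))" for N \<gamma>
  proof -
    have t: "mderiv \<gamma> f \<in> test_functions UNIV" unfolding mderiv_def by (rule pderivatives_test[OF f])
    obtain K where K: "smooth (mderiv \<gamma> f)" "compact K" "K \<subseteq> UNIV" "\<And>x. x \<notin> K \<Longrightarrow> mderiv \<gamma> f x = 0"
      by (rule test_functionsE[OF t]) (rule that)
    obtain B where B: "B > 0" "\<And>x. norm (mderiv \<gamma> f x) \<le> B" using test_bounded[OF t] by blast
    obtain R where R: "\<And>x. x \<in> K \<Longrightarrow> norm x \<le> R" using compact_imp_bounded[OF K(2)] by (auto simp: bounded_iff)
    have "(1 + norm x) ^ N * norm (mderiv \<gamma> f x) \<le> (1 + \<bar>R\<bar>) ^ N * B" for x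
    proof (cases "x \<in> K")
      case True
      then have "1 + norm x \<le> 1 + \<bar>R\<bar>" using R[of x] by linarith
      then show ?thesis using B by (intro mult_mono power_mono) auto
    next
      case False
      then show ?thesis using K(4) B by simp
    qed
    then show ?thesis by (auto simp: bdd_above_def)
  qed
  then show ?thesis using test_functions_smooth[OF f] by (simp add: schwartz_def)
qed

lemma continuous_AE_zero:
  fixes g :: "real ^ 'd::finite \<Rightarrow> complex"
  assumes "continuous_on UNIV g" "AE x in lborel. g x = 0"
  shows "g x = 0"
proof (rule ccontr)
  assume "g x \<noteq> 0"
  let ?S = "{x. g x \<noteq> 0}"
  have "open ?S" using assms(1) by (intro open_Collect_neq) auto
  moreover have "negligible ?S"
  proof -
    have "?S \<in> null_sets lborel"
      using assms(2) \<open>open ?S\<close> by (subst (asm) AE_iff_null) auto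
    then show ?thesis by (simp add: negligible_iff_null_sets null_sets_completionI)
  qed
  ultimately show False using open_not_negligible[of ?S] \<open>g x \<noteq> 0\<close> by blast
qed

lemma prod_list_count_list:
  fixes a :: "'d::finite \<Rightarrow> 'b::comm_monoid_mult"
  shows "(\<Prod>i\<leftarrow>is. a i) = (\<Prod>i\<in>UNIV. a i ^ count_list is i)"
proof (induction "is")
  case (Cons j "is")
  have "(\<Prod>i\<in>UNIV. a i ^ count_list (j # is) i) = (\<Prod>i\<in>UNIV. (if i = j then a i else 1) * a i ^ count_list is i)"
    by (intro prod.cong) auto
  also have "\<dots> = a j * (\<Prod>i\<in>UNIV. a i ^ count_list is i)"
    by (simp add: prod.distrib)
  finally show ?case by (simp add: Cons)
qed simp

text \<open>Both sides have the same Fourier transform, namely a monomial times that of \<open>f\<close>, and are continuous.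
Thus Schwarz's theorem follows from uniqueness of Fourier transforms.\<close>

lemma pderivatives_commute:
  fixes f :: "real ^ 'd::finite \<Rightarrow> complex"
  assumes f: "f \<in> test_functions UNIV" and c: "\<And>i. count_list is i = count_list is' i"
  shows "pderivatives is f = pderivatives is' f"
proof
  fix x
  let ?g = "\<lambda>x. pderivatives is f x - pderivatives is' f x"
  have int: "integrable lborel (\<lambda>x. pderivatives is f x * cis (\<xi> \<bullet> x))" for "is" \<xi>
    using test_integrable[OF test_mult[OF smooth_cis_inner pderivatives_test[OF f]]] by (simp add: mult.commute)
  have "AE x in lborel. ?g x = 0"
  proof (rule fourier_uniqueness)
    show "integrable lborel ?g" by (intro Bochner_Integration.integrable_diff test_integrable[OF pderivatives_test[OF f]])
    fix \<xi> :: "real^'d"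
    have "fourier (pderivatives is f) (- \<xi>) = fourier (pderivatives is' f) (- \<xi>)"
      by (simp only: fourier_pderivatives[OF f] prod_list_count_list c)
    then show "(LINT x|lborel. cis (\<xi> \<bullet> x) * ?g x) = 0"
      using int[of "is" \<xi>] int[of is' \<xi>] by (simp add: fourier_eq right_diff_distrib mult.commute)
  qed
  moreover have "continuous_on UNIV ?g"
    by (intro continuous_on_diff smooth_continuous smooth_pderivatives test_functions_smooth[OF f])
  ultimately show "pderivatives is f x = pderivatives is' f x"
    using continuous_AE_zero[of ?g x] by simp
qed

lemma ex_list_count: "\<exists>is. \<forall>i::'d::finite. count_list is i = \<gamma> $ i"
proof -
  obtain "is" where "mset is = (\<Sum>i\<in>UNIV. replicate_mset (\<gamma> $ i) (i::'d))" using ex_mset by blast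
  then have "count (mset is) i = (\<Sum>j\<in>UNIV. count (replicate_mset (\<gamma> $ j) j) i)" for i
    by (simp add: count_sum)
  then show ?thesis by (auto simp: count_mset if_distrib cong: if_cong)
qed

text \<open>The choice operator in the definition picks some listing of the multi-index.\<close>

lemma mderiv_eq:
  "\<exists>is. mderiv \<gamma> = pderivatives is \<and> (\<forall>i. count_list is i = \<gamma> $ i) \<and> length is = mi_abs \<gamma>"
proof -
  define "is" where "is = (SOME is. \<forall>i. count_list is i = \<gamma> $ i)"
  have c: "\<forall>i. count_list is i = \<gamma> $ i" unfolding is_def by (rule someI_ex[OF ex_list_count])
  have "length is = mi_abs \<gamma>"
    using sum_count_set[of "is" UNIV] c by (simp add: mi_abs_def)
  moreover have "mderiv \<gamma> = pderivatives is" by (rule ext) (simp add: mderiv_def is_def)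
  ultimately show ?thesis using c by blast
qed

lemma mderiv_test:
  assumes f: "f \<in> test_functions UNIV" and c: "\<And>i. count_list is i = \<gamma> $ i"
  shows "mderiv \<gamma> f = pderivatives is f"
proof -
  obtain is' where "mderiv \<gamma> = pderivatives is'" "\<And>i. count_list is' i = \<gamma> $ i" using mderiv_eq by metis
  then show ?thesis using pderivatives_commute[OF f] c by metis
qed

section \<open>Weights and energies\<close>

text \<open>A uniform treatment of both signs of the exponent: comparable bases have comparable powers.\<close>

lemma powr_comparable:
  fixes a b m :: real
  assumes "a > 0" "b > 0" "a \<le> m * b" "b \<le> m * a"
  shows "a powr t \<le> m powr \<bar>t\<bar> * b powr t"
proof -
  have m: "m > 0" using assms by (metis less_le_trans zero_less_mult_pos2)
  show ?thesis
  proof (cases "t \<ge> 0")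
    case True
    have "a powr t \<le> (m * b) powr t" by (rule powr_mono2) (use assms True in auto)
    then show ?thesis using True m assms by (simp add: powr_mult)
  next
    case False
    have "(m * a) powr t \<le> b powr t" by (rule powr_mono2') (use assms m False in auto)
    then have "m powr (- t) * ((m * a) powr t) \<le> m powr (- t) * b powr t" by (intro mult_left_mono) auto
    moreover have "m powr (- t) * ((m * a) powr t) = a powr t"
      using m assms by (simp add: powr_mult powr_minus field_simps)
    ultimately show ?thesis using False by simp
  qed
qed

definition weight :: "real \<Rightarrow> real ^ 'd::finite \<Rightarrow> real" where
  "weight s \<omega> = (1 + norm \<omega>) powr (2 * s)"

text \<open>The squared Sobolev norm on the Fourier side, with values in \<open>[0, \<infinity>]\<close> so that estimates can be
added up before anything is known to be finite.\<close>

definition energy :: "real \<Rightarrow> (real ^ 'd::finite \<Rightarrow> complex) \<Rightarrow> ennreal" where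
  "energy s F = (\<integral>\<^sup>+\<omega>. ennreal (weight s \<omega> * (norm (F \<omega>))\<^sup>2) \<partial>lborel)"

lemma weight_pos [simp]: "weight s \<omega> > 0"
proof -
  have "1 + norm \<omega> > 0" by (simp add: add_pos_nonneg)
  then show ?thesis by (simp add: weight_def)
qed

lemma weight_nonneg [simp]: "weight s \<omega> \<ge> 0"
  using weight_pos less_imp_le by blast

lemma weight_measurable [measurable]: "weight s \<in> borel_measurable borel"
  unfolding weight_def[abs_def] by measurable

lemma weight_mono: "s \<le> t \<Longrightarrow> weight s \<omega> \<le> weight t \<omega>"
  unfolding weight_def by (intro powr_mono) auto

lemma weight_scale:
  assumes "c > 0"
  shows "weight s (c *\<^sub>R u) \<le> max c (1 / c) powr \<bar>2 * s\<bar> * weight s u"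
  unfolding weight_def
proof (rule powr_comparable)
  have m: "1 \<le> max c (1 / c)" "c \<le> max c (1 / c)" "1 / c \<le> max c (1 / c)"
  proof -
    have "1 \<le> c \<or> 1 \<le> 1 / c" using assms by (cases "c \<ge> 1") auto
    then show "1 \<le> max c (1 / c)" by (simp add: le_max_iff_disj)
  qed auto
  have "1 + c * norm u \<le> max c (1 / c) * 1 + max c (1 / c) * norm u"
    by (intro add_mono mult_right_mono) (use m in auto)
  then show "1 + norm (c *\<^sub>R u) \<le> max c (1 / c) * (1 + norm u)"
    using assms by (simp add: distrib_left)
  have "1 + (1 / c) * norm (c *\<^sub>R u) \<le> max c (1 / c) * 1 + max c (1 / c) * norm (c *\<^sub>R u)"
    by (intro add_mono mult_right_mono) (use m in auto)
  then show "1 + norm u \<le> max c (1 / c) * (1 + norm (c *\<^sub>R u))"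
    using assms by (simp add: distrib_left)
qed (auto intro: add_pos_nonneg)

lemma energy_cong: "AE \<omega> in lborel. F \<omega> = G \<omega> \<Longrightarrow> energy s F = energy s G"
  unfolding energy_def by (intro nn_integral_cong_AE) auto

lemma energy_eq_density:
  assumes [measurable]: "F \<in> borel_measurable borel"
  shows "energy s F = (\<integral>\<^sup>+\<omega>. ennreal ((norm (F \<omega>))\<^sup>2) \<partial>density lborel (\<lambda>\<omega>. ennreal (weight s \<omega>)))"
  unfolding energy_def by (simp add: nn_integral_density ennreal_mult)

lemma energy_diff_le:
  assumes [measurable]: "F \<in> borel_measurable borel" "G \<in> borel_measurable borel" "H \<in> borel_measurable borel"
  shows "energy s (\<lambda>\<omega>. F \<omega> - H \<omega>) \<le> 2 * energy s (\<lambda>\<omega>. F \<omega> - G \<omega>) + 2 * energy s (\<lambda>\<omega>. G \<omega> - H \<omega>)"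
  by (simp add: energy_eq_density) (rule nn_integral_diff_square_le; simp)

lemma energy_add_le:
  assumes [measurable]: "F \<in> borel_measurable borel" "G \<in> borel_measurable borel"
  shows "energy s (\<lambda>\<omega>. F \<omega> + G \<omega>) \<le> 2 * energy s F + 2 * energy s G"
  using energy_diff_le[of F "\<lambda>_. 0" "\<lambda>\<omega>. - G \<omega>" s] by simp

lemma energy_cmult:
  assumes [measurable]: "F \<in> borel_measurable borel"
  shows "energy s (\<lambda>\<omega>. c * F \<omega>) = ennreal ((norm c)\<^sup>2) * energy s F"
proof -
  have "energy s (\<lambda>\<omega>. c * F \<omega>) = (\<integral>\<^sup>+\<omega>. ennreal ((norm c)\<^sup>2) * ennreal (weight s \<omega> * (norm (F \<omega>))\<^sup>2) \<partial>lborel)"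
    unfolding energy_def
    by (intro nn_integral_cong) (simp add: norm_mult power_mult_distrib mult_ac flip: ennreal_mult)
  then show ?thesis by (simp add: nn_integral_cmult energy_def)
qed

lemma energy_mono: "s \<le> t \<Longrightarrow> energy s F \<le> energy t F"
  unfolding energy_def by (intro nn_integral_mono ennreal_leI mult_right_mono weight_mono) auto

lemma energy_norm_cong: "(\<And>\<omega>. norm (F \<omega>) = norm (G \<omega>)) \<Longrightarrow> energy s F = energy s G"
  by (simp add: energy_def)

lemma energy_scale:
  fixes F :: "real ^ 'd::finite \<Rightarrow> complex"
  assumes [measurable]: "F \<in> borel_measurable borel" and h: "h > 0"
  shows "energy s F < \<infinity> \<Longrightarrow> energy s (\<lambda>\<omega>. F (h *\<^sub>R \<omega>)) < \<infinity>"
proof -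
  assume fin: "energy s F < \<infinity>"
  let ?K = "max (1/h) (1 / (1/h)) powr \<bar>2 * s\<bar>"
  have "ennreal (h ^ CARD('d)) * energy s (\<lambda>\<omega>. F (h *\<^sub>R \<omega>))
     = (\<integral>\<^sup>+u. ennreal (weight s ((1/h) *\<^sub>R u) * (norm (F u))\<^sup>2) \<partial>lborel)"
    unfolding energy_def using h
    by (subst nn_integral_lborel_affine[of "\<lambda>u. ennreal (weight s ((1/h) *\<^sub>R u) * (norm (F u))\<^sup>2)" h 0]) simp_all
  also have "\<dots> \<le> (\<integral>\<^sup>+u. ennreal ?K * ennreal (weight s u * (norm (F u))\<^sup>2) \<partial>lborel)"
  proof (rule nn_integral_mono)
    fix u :: "real^'d"
    have "weight s ((1/h) *\<^sub>R u) * (norm (F u))\<^sup>2 \<le> (?K * weight s u) * (norm (F u))\<^sup>2"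
      using h by (intro mult_right_mono weight_scale) auto
    then show "ennreal (weight s ((1/h) *\<^sub>R u) * (norm (F u))\<^sup>2) \<le> ennreal ?K * ennreal (weight s u * (norm (F u))\<^sup>2)"
      by (simp add: mult.assoc ennreal_leI flip: ennreal_mult)
  qed
  also have "\<dots> = ennreal ?K * energy s F" by (simp add: nn_integral_cmult energy_def)
  also have "\<dots> < \<infinity>" using fin by (simp add: ennreal_mult_less_top)
  finally show ?thesis using h by (auto simp: ennreal_mult_less_top)
qed

lemma locally_L2_if_energy:
  fixes F :: "real ^ 'd::finite \<Rightarrow> complex"
  assumes [measurable]: "F \<in> borel_measurable borel" and fin: "energy s F < \<infinity>"
  shows "locally_L2 F"
  unfolding locally_L2_def
proof (intro conjI allI impI)
  fix K :: "(real^'d) set" assume K: "compact K"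
  then have [measurable]: "K \<in> sets borel" by (simp add: borel_compact)
  obtain R where R: "R \<ge> 0" "\<And>x. x \<in> K \<Longrightarrow> norm x \<le> R"
    using compact_imp_bounded[OF K] by (metis bounded_iff norm_ge_zero abs_ge_self abs_ge_zero order_trans)
  define c where "c = (1 + R) powr (- \<bar>2 * s\<bar>)"
  have c: "c > 0" using R by (simp add: c_def)
  have wc: "c \<le> weight s x" if "x \<in> K" for x
  proof -
    have x: "1 \<le> 1 + norm x" "1 + norm x \<le> 1 + R" using R that by auto
    have "c \<le> (1 + norm x) powr (- \<bar>2 * s\<bar>)" unfolding c_def by (rule powr_mono2') (use x in \<open>auto simp: add_pos_nonneg\<close>)
    also have "\<dots> \<le> weight s x" unfolding weight_def by (rule powr_mono) (use x in auto)
    finally show ?thesis .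
  qed
  have "ennreal c * (\<integral>\<^sup>+x. ennreal (indicator K x * (norm (F x))\<^sup>2) \<partial>lborel) = (\<integral>\<^sup>+x. ennreal c * ennreal (indicator K x * (norm (F x))\<^sup>2) \<partial>lborel)"
    by (rule nn_integral_cmult[symmetric]) measurable
  also have "\<dots> \<le> energy s F"
    unfolding energy_def
  proof (rule nn_integral_mono)
    fix x
    show "ennreal c * ennreal (indicator K x * (norm (F x))\<^sup>2) \<le> ennreal (weight s x * (norm (F x))\<^sup>2)"
      using c wc[of x] by (auto simp: indicator_def simp flip: ennreal_mult intro!: ennreal_leI mult_right_mono)
  qed
  finally have "ennreal c * (\<integral>\<^sup>+x. ennreal (indicator K x * (norm (F x))\<^sup>2) \<partial>lborel) < \<infinity>" using fin by auto
  then have "(\<integral>\<^sup>+x. ennreal (indicator K x * (norm (F x))\<^sup>2) \<partial>lborel) < \<infinity>"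
    using c by (auto simp: ennreal_mult_less_top)
  then show "set_integrable lborel K (\<lambda>x. (norm (F x))\<^sup>2)"
    unfolding set_integrable_def by (intro integrableI_bounded) (auto simp: abs_mult)
qed measurable

section \<open>Schwartz seminorms\<close>

lemma finite_multi_indices: "finite {\<gamma>::nat^'d::finite. mi_abs \<gamma> \<le> N}"
proof (rule finite_subset)
  show "{\<gamma>::nat^'d. mi_abs \<gamma> \<le> N} \<subseteq> vec_lambda ` (\<Pi>\<^sub>E i\<in>UNIV. {..N})"
  proof
    fix \<gamma> :: "nat^'d" assume "\<gamma> \<in> {\<gamma>. mi_abs \<gamma> \<le> N}"
    then have "\<gamma> $ i \<le> N" for i
      unfolding mi_abs_def using member_le_sum[of i UNIV "($) \<gamma>"] by fastforce
    then show "\<gamma> \<in> vec_lambda ` (\<Pi>\<^sub>E i\<in>UNIV. {..N})"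
      by (intro image_eqI[of _ _ "($) \<gamma>"]) (auto simp: vec_lambda_eta)
  qed
qed (intro finite_imageI finite_PiE, auto)

lemma schwartz_bdd_above:
  assumes "\<psi> \<in> schwartz"
  shows "bdd_above ((\<lambda>(\<gamma>, x). (1 + norm x) ^ N * norm (mderiv \<gamma> \<psi> x)) ` ({\<gamma>. mi_abs \<gamma> \<le> N} \<times> UNIV))"
proof -
  have "(\<lambda>(\<gamma>, x). (1 + norm x) ^ N * norm (mderiv \<gamma> \<psi> x)) ` ({\<gamma>. mi_abs \<gamma> \<le> N} \<times> UNIV)
     = (\<Union>\<gamma>\<in>{\<gamma>. mi_abs \<gamma> \<le> N}. range (\<lambda>x. (1 + norm x) ^ N * norm (mderiv \<gamma> \<psi> x)))"
    by (auto simp: image_iff)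
  then show ?thesis using assms by (simp add: finite_multi_indices schwartz_def)
qed

lemma schwartz_seminorm_upper:
  assumes "\<psi> \<in> schwartz" "mi_abs \<gamma> \<le> N"
  shows "(1 + norm x) ^ N * norm (mderiv \<gamma> \<psi> x) \<le> schwartz_seminorm N \<psi>"
  unfolding schwartz_seminorm_def
  using cSUP_upper[OF _ schwartz_bdd_above[OF assms(1), of N], of "(\<gamma>, x)"] assms(2) by simp

lemma mi_abs_0 [simp]: "mi_abs 0 = 0" by (simp add: mi_abs_def)

lemma schwartz_seminorm_least:
  assumes "\<And>\<gamma> x. mi_abs \<gamma> \<le> N \<Longrightarrow> (1 + norm x) ^ N * norm (mderiv \<gamma> \<psi> x) \<le> B"
  shows "schwartz_seminorm N \<psi> \<le> B"
  unfolding schwartz_seminorm_def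
proof (rule cSUP_least)
  have "(0, 0) \<in> {\<gamma>. mi_abs \<gamma> \<le> N} \<times> UNIV" by simp
  then show "{\<gamma>. mi_abs \<gamma> \<le> N} \<times> UNIV \<noteq> {}" by blast
qed (use assms in auto)

lemma mderiv_0 [simp]:
  fixes \<psi> :: "real ^ 'd::finite \<Rightarrow> complex"
  shows "mderiv 0 \<psi> = \<psi>"
proof -
  obtain "is" where "mderiv (0::nat^'d) = pderivatives is" "length is = mi_abs (0::nat^'d)"
    using mderiv_eq by metis
  then show ?thesis by simp
qed

lemma schwartz_seminorm_nonneg: "\<psi> \<in> schwartz \<Longrightarrow> 0 \<le> schwartz_seminorm N \<psi>"
  using schwartz_seminorm_upper[of \<psi> 0 N 0] by (simp add: order_trans[OF norm_ge_zero])

lemma schwartz_seminorm_mono: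
  fixes \<psi> :: "real ^ 'd::finite \<Rightarrow> complex"
  assumes "\<psi> \<in> schwartz" "N \<le> M" shows "schwartz_seminorm N \<psi> \<le> schwartz_seminorm M \<psi>"
proof (rule schwartz_seminorm_least)
  fix \<gamma> :: "nat ^ 'd" and x assume "mi_abs \<gamma> \<le> N"
  then have "(1 + norm x) ^ M * norm (mderiv \<gamma> \<psi> x) \<le> schwartz_seminorm M \<psi>"
    using assms by (intro schwartz_seminorm_upper) auto
  moreover have "(1 + norm x) ^ N * norm (mderiv \<gamma> \<psi> x) \<le> (1 + norm x) ^ M * norm (mderiv \<gamma> \<psi> x)"
    using assms(2) by (intro mult_right_mono power_increasing) auto
  ultimately show "(1 + norm x) ^ N * norm (mderiv \<gamma> \<psi> x) \<le> schwartz_seminorm M \<psi>" by linarith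
qed

text \<open>Comes from \<open>1 + |x| \<le> (1 + (1 + |a|) / |c|) (1 + |c x + a|)\<close> and the chain rule.\<close>

lemma schwartz_affine_bound:
  fixes \<psi> :: "real ^ 'd::finite \<Rightarrow> complex"
  assumes "smooth \<psi>" "c \<noteq> 0"
  shows "(1 + norm x) ^ N * norm (mderiv \<gamma> (\<lambda>x. \<psi> (c *\<^sub>R x + a)) x)
    \<le> (1 + (1 + norm a) / \<bar>c\<bar>) ^ N * \<bar>c\<bar> ^ mi_abs \<gamma> * ((1 + norm (c *\<^sub>R x + a)) ^ N * norm (mderiv \<gamma> \<psi> (c *\<^sub>R x + a)))"
proof -
  obtain "is" where m: "mderiv \<gamma> = pderivatives is" "length is = mi_abs \<gamma>" using mderiv_eq by metis
  let ?K = "1 + (1 + norm a) / \<bar>c\<bar>" and ?y = "c *\<^sub>R x + a"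
  have "norm (c *\<^sub>R x) \<le> norm ?y + norm a" by (metis add_diff_cancel_right' norm_triangle_ineq4)
  then have "norm x \<le> (norm ?y + norm a) / \<bar>c\<bar>" using assms(2) by (simp add: field_simps)
  also have "\<dots> \<le> norm ?y * (1 + (1 + norm a) / \<bar>c\<bar>) + (1 + norm a) / \<bar>c\<bar>"
  proof -
    have "0 \<le> norm ?y + norm ?y * norm a / \<bar>c\<bar> + 1 / \<bar>c\<bar>" by simp
    then show ?thesis by (simp add: distrib_left add_divide_distrib)
  qed
  finally have "1 + norm x \<le> ?K * (1 + norm ?y)" by (simp add: algebra_simps)
  then have "(1 + norm x) ^ N \<le> (?K * (1 + norm ?y)) ^ N" by (intro power_mono) auto
  then have "(1 + norm x) ^ N * (\<bar>c\<bar> ^ mi_abs \<gamma> * norm (pderivatives is \<psi> ?y)) \<le>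
     (?K * (1 + norm ?y)) ^ N * (\<bar>c\<bar> ^ mi_abs \<gamma> * norm (pderivatives is \<psi> ?y))"
    by (intro mult_right_mono) auto
  then show ?thesis
    using m by (simp add: smooth_affine(2)[OF assms(1)] norm_mult norm_power power_mult_distrib mult_ac)
qed

lemma schwartz_affine:
  fixes \<psi> :: "real ^ 'd::finite \<Rightarrow> complex"
  assumes "\<psi> \<in> schwartz" "c \<noteq> 0"
  shows "(\<lambda>x. \<psi> (c *\<^sub>R x + a)) \<in> schwartz"
proof -
  have sm: "smooth \<psi>" using assms by (simp add: schwartz_def)
  have "bdd_above (range (\<lambda>x. (1 + norm x) ^ N * norm (mderiv \<gamma> (\<lambda>x. \<psi> (c *\<^sub>R x + a)) x)))" for N \<gamma>
  proof -
    have "bdd_above (range (\<lambda>x. (1 + norm x) ^ N * norm (mderiv \<gamma> \<psi> x)))"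
      using assms(1) by (simp add: schwartz_def)
    then obtain B where B: "\<And>x. (1 + norm x) ^ N * norm (mderiv \<gamma> \<psi> x) \<le> B"
      by (auto simp: bdd_above_def)
    have "(1 + norm x) ^ N * norm (mderiv \<gamma> (\<lambda>x. \<psi> (c *\<^sub>R x + a)) x)
      \<le> (1 + (1 + norm a) / \<bar>c\<bar>) ^ N * \<bar>c\<bar> ^ mi_abs \<gamma> * B" for x
      by (rule order_trans[OF schwartz_affine_bound[OF sm assms(2)] mult_left_mono[OF B]]) simp
    then show ?thesis by (auto simp: bdd_above_def)
  qed
  then show ?thesis using smooth_affine(1)[OF sm] by (simp add: schwartz_def)
qed

lemma schwartz_affine_seminorm:
  fixes a :: "real ^ 'd::finite"
  assumes "c \<noteq> 0"
  shows "\<exists>C\<ge>0. \<forall>\<psi>\<in>schwartz. schwartz_seminorm N (\<lambda>x. \<psi> (c *\<^sub>R x + a)) \<le> C * schwartz_seminorm N \<psi>"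
proof (intro exI conjI ballI)
  let ?K = "1 + (1 + norm a) / \<bar>c\<bar>"
  show "0 \<le> ?K ^ N * (1 + \<bar>c\<bar>) ^ N" by simp
  fix \<psi> :: "real ^ 'd \<Rightarrow> complex" assume psi: "\<psi> \<in> schwartz"
  show "schwartz_seminorm N (\<lambda>x. \<psi> (c *\<^sub>R x + a)) \<le> ?K ^ N * (1 + \<bar>c\<bar>) ^ N * schwartz_seminorm N \<psi>"
  proof (rule schwartz_seminorm_least)
    fix \<gamma> :: "nat ^ 'd" and x assume g: "mi_abs \<gamma> \<le> N"
    have "(1 + norm x) ^ N * norm (mderiv \<gamma> (\<lambda>x. \<psi> (c *\<^sub>R x + a)) x)
      \<le> ?K ^ N * \<bar>c\<bar> ^ mi_abs \<gamma> * ((1 + norm (c *\<^sub>R x + a)) ^ N * norm (mderiv \<gamma> \<psi> (c *\<^sub>R x + a)))"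
      using psi assms by (intro schwartz_affine_bound) (auto simp: schwartz_def)
    also have "\<dots> \<le> ?K ^ N * (1 + \<bar>c\<bar>) ^ N * schwartz_seminorm N \<psi>"
    proof (intro mult_mono schwartz_seminorm_upper psi g order_refl)
      have "\<bar>c\<bar> ^ mi_abs \<gamma> \<le> (1 + \<bar>c\<bar>) ^ mi_abs \<gamma>" by (intro power_mono) auto
      also have "\<dots> \<le> (1 + \<bar>c\<bar>) ^ N" using g by (intro power_increasing) auto
      finally show "\<bar>c\<bar> ^ mi_abs \<gamma> \<le> (1 + \<bar>c\<bar>) ^ N" .
    qed auto
    finally show "(1 + norm x) ^ N * norm (mderiv \<gamma> (\<lambda>x. \<psi> (c *\<^sub>R x + a)) x) \<le> ?K ^ N * (1 + \<bar>c\<bar>) ^ N * schwartz_seminorm N \<psi>" .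
  qed
qed

section \<open>Tempered distributions and Sobolev spaces\<close>

lemma tempered_bound:
  assumes "T \<in> tempered_distributions"
  obtains C N where "C \<ge> 0" "\<And>\<psi> M. \<psi> \<in> schwartz \<Longrightarrow> M \<ge> N \<Longrightarrow> norm (T \<psi>) \<le> C * schwartz_seminorm M \<psi>"
proof -
  obtain C N where C: "\<forall>\<psi>\<in>schwartz. norm (T \<psi>) \<le> C * schwartz_seminorm N \<psi>"
    using assms unfolding tempered_distributions_def by blast
  have "norm (T \<psi>) \<le> \<bar>C\<bar> * schwartz_seminorm M \<psi>" if "\<psi> \<in> schwartz" "M \<ge> N" for \<psi> M
  proof -
    have "norm (T \<psi>) \<le> C * schwartz_seminorm N \<psi>" using C that by blast
    also have "\<dots> \<le> \<bar>C\<bar> * schwartz_seminorm M \<psi>"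
      using that by (intro mult_mono schwartz_seminorm_mono schwartz_seminorm_nonneg) auto
    finally show ?thesis .
  qed
  then show thesis by (rule that[of "\<bar>C\<bar>", OF abs_ge_zero])
qed

lemma tempered_add:
  assumes "f \<in> tempered_distributions" "g \<in> tempered_distributions"
  shows "(\<lambda>\<psi>. f \<psi> + g \<psi>) \<in> tempered_distributions"
proof -
  obtain C N where C: "C \<ge> 0" "\<And>\<psi> M. \<psi> \<in> schwartz \<Longrightarrow> M \<ge> N \<Longrightarrow> norm (f \<psi>) \<le> C * schwartz_seminorm M \<psi>"
    using tempered_bound[OF assms(1)] by metis
  obtain D L where D: "D \<ge> 0" "\<And>\<psi> M. \<psi> \<in> schwartz \<Longrightarrow> M \<ge> L \<Longrightarrow> norm (g \<psi>) \<le> D * schwartz_seminorm M \<psi>"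
    using tempered_bound[OF assms(2)] by metis
  have "norm (f \<psi> + g \<psi>) \<le> (C + D) * schwartz_seminorm (max N L) \<psi>" if "\<psi> \<in> schwartz" for \<psi>
    unfolding distrib_right using that
    by (intro norm_triangle_le add_mono C D) auto
  then have "\<exists>C N. \<forall>\<psi>\<in>schwartz. norm (f \<psi> + g \<psi>) \<le> C * schwartz_seminorm N \<psi>" by blast
  then show ?thesis using assms by (simp add: tempered_distributions_def algebra_simps)
qed

lemma tempered_affine:
  fixes T :: "'d::finite dist"
  assumes T: "T \<in> tempered_distributions" and "c \<noteq> 0"
  shows "(\<lambda>\<psi>. b * T (\<lambda>x. \<psi> (c *\<^sub>R x + a))) \<in> tempered_distributions"
proof -
  obtain C N where C: "C \<ge> 0" "\<And>\<psi> M. \<psi> \<in> schwartz \<Longrightarrow> M \<ge> N \<Longrightarrow> norm (T \<psi>) \<le> C * schwartz_seminorm M \<psi>"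
    using tempered_bound[OF T] by metis
  obtain D where D: "D \<ge> 0" "\<forall>\<psi>\<in>schwartz. schwartz_seminorm N (\<lambda>x. \<psi> (c *\<^sub>R x + a)) \<le> D * schwartz_seminorm N \<psi>"
    using schwartz_affine_seminorm[OF assms(2), of N a] by blast
  have "norm (b * T (\<lambda>x. \<psi> (c *\<^sub>R x + a))) \<le> (norm b * C * D) * schwartz_seminorm N \<psi>" if "\<psi> \<in> schwartz" for \<psi>
  proof -
    have "norm (T (\<lambda>x. \<psi> (c *\<^sub>R x + a))) \<le> C * schwartz_seminorm N (\<lambda>x. \<psi> (c *\<^sub>R x + a))"
      by (rule C(2)[OF schwartz_affine[OF that assms(2)] order_refl])
    also have "\<dots> \<le> C * (D * schwartz_seminorm N \<psi>)" using D(2) that C(1) by (intro mult_left_mono) auto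
    finally show ?thesis by (simp add: norm_mult mult_left_mono mult.assoc)
  qed
  then have "\<exists>C N. \<forall>\<psi>\<in>schwartz. norm (b * T (\<lambda>x. \<psi> (c *\<^sub>R x + a))) \<le> C * schwartz_seminorm N \<psi>" by blast
  moreover have "T (\<lambda>x. \<psi> (c *\<^sub>R x + a)) = 0" if "\<psi> \<notin> schwartz" for \<psi>
  proof -
    have "(\<lambda>x. \<psi> (c *\<^sub>R x + a)) \<notin> schwartz"
    proof
      assume "(\<lambda>x. \<psi> (c *\<^sub>R x + a)) \<in> schwartz"
      then have "(\<lambda>x. \<psi> (c *\<^sub>R ((1 / c) *\<^sub>R x + (- (1 / c)) *\<^sub>R a) + a)) \<in> schwartz"
        by (rule schwartz_affine) (use assms(2) in simp)
      moreover have "c *\<^sub>R ((1 / c) *\<^sub>R x + (- (1 / c)) *\<^sub>R a) + a = x" for x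
        unfolding scaleR_right_distrib scaleR_scaleR using assms(2) by simp
      ultimately show False using that by simp
    qed
    then show ?thesis using T by (simp add: tempered_distributions_def)
  qed
  moreover have "T (\<lambda>x. \<psi> (c *\<^sub>R x + a) + \<theta> (c *\<^sub>R x + a)) = T (\<lambda>x. \<psi> (c *\<^sub>R x + a)) + T (\<lambda>x. \<theta> (c *\<^sub>R x + a))"
    "T (\<lambda>x. e * \<psi> (c *\<^sub>R x + a)) = e * T (\<lambda>x. \<psi> (c *\<^sub>R x + a))"
    if "\<psi> \<in> schwartz" "\<theta> \<in> schwartz" for \<psi> \<theta> e
    using T that[THEN schwartz_affine[OF _ assms(2)]] by (auto simp: tempered_distributions_def)
  ultimately show ?thesis
    unfolding tempered_distributions_def by (simp add: distrib_left mult.left_commute)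
qed

lemma tempered_scale: "T \<in> tempered_distributions \<Longrightarrow> (\<lambda>\<psi>. b * T \<psi>) \<in> tempered_distributions"
  using tempered_affine[of T 1 b 0] by simp

text \<open>The locally square-integrable representative of a distribution is determined almost everywhere,
since test functions separate; this gives meaning to the chosen function \<open>fhat\<close>.\<close>

lemma represents_unique:
  assumes "locally_L2 F" "locally_L2 G" "represents F T" "represents G T"
  shows "AE \<omega> in lborel. F \<omega> = G \<omega>"
proof -
  have "AE \<omega> in lborel. F \<omega> - G \<omega> = 0"
  proof (rule test_functions_separate)
    fix K :: "(real^'a) set" assume "compact K"
    then show "set_integrable lborel K (\<lambda>\<omega>. F \<omega> - G \<omega>)"
      by (intro set_integral_diff locally_L2_set_integrable assms)
  next
    fix \<psi> :: "real^'a \<Rightarrow> complex" assume psi: "\<psi> \<in> test_functions UNIV"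
    have "(LINT \<omega>|lborel. (F \<omega> - G \<omega>) * \<psi> \<omega>) = (LINT \<omega>|lborel. F \<omega> * \<psi> \<omega>) - (LINT \<omega>|lborel. G \<omega> * \<psi> \<omega>)"
      unfolding left_diff_distrib
      by (intro Bochner_Integration.integral_diff locally_L2_mult_test[OF _ psi] assms)
    then show "(LINT \<omega>|lborel. (F \<omega> - G \<omega>) * \<psi> \<omega>) = 0"
      using assms psi by (simp add: represents_def)
  qed
  then show ?thesis by simp
qed

lemma fhatD:
  assumes "\<exists>F. locally_L2 F \<and> represents F (fourier_dist T)"
  shows "locally_L2 (fhat T)" "represents (fhat T) (fourier_dist T)"
  using someI_ex[OF assms] by (auto simp: fhat_def)

lemma sobolevD:
  assumes "T \<in> sobolev s"
  shows "T \<in> tempered_distributions" "locally_L2 (fhat T)" "represents (fhat T) (fourier_dist T)"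
    "fhat T \<in> borel_measurable borel" "energy s (fhat T) < \<infinity>"
    "ennreal ((sobolev_norm s T)\<^sup>2) = energy s (fhat T)"
proof -
  show 1: "T \<in> tempered_distributions" "locally_L2 (fhat T)" "represents (fhat T) (fourier_dist T)"
    using assms fhatD[of T] by (auto simp: sobolev_def)
  then show "fhat T \<in> borel_measurable borel" by (simp add: locally_L2_def)
  have int: "integrable lborel (\<lambda>\<omega>. weight s \<omega> * (norm (fhat T \<omega>))\<^sup>2)"
    using assms by (simp add: sobolev_def weight_def)
  then have *: "energy s (fhat T) = ennreal (LINT \<omega>|lborel. weight s \<omega> * (norm (fhat T \<omega>))\<^sup>2)"
    unfolding energy_def by (intro nn_integral_eq_integral) auto
  then show "energy s (fhat T) < \<infinity>" by simp
  show "ennreal ((sobolev_norm s T)\<^sup>2) = energy s (fhat T)"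
    unfolding * sobolev_norm_def weight_def[symmetric] by (subst real_sqrt_pow2) auto
qed

text \<open>Membership and the transform at one stroke: any representing function of finite energy will do, and
it agrees almost everywhere with the chosen one.\<close>

lemma sobolevI:
  assumes T: "T \<in> tempered_distributions" and F: "F \<in> borel_measurable borel" "energy s F < \<infinity>"
    and r: "represents F (fourier_dist T)"
  shows "T \<in> sobolev s" "AE \<omega> in lborel. fhat T \<omega> = F \<omega>"
proof -
  have L: "locally_L2 F" by (rule locally_L2_if_energy[OF F])
  then have ex: "\<exists>F. locally_L2 F \<and> represents F (fourier_dist T)" using r by blast
  note fh = fhatD[OF ex]
  show *: "AE \<omega> in lborel. fhat T \<omega> = F \<omega>" by (rule represents_unique[OF fh(1) L fh(2) r])
  have [measurable]: "fhat T \<in> borel_measurable borel" using fh by (simp add: locally_L2_def)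
  have "energy s (fhat T) < \<infinity>" using energy_cong[OF *] F by simp
  then have "integrable lborel (\<lambda>\<omega>. weight s \<omega> * (norm (fhat T \<omega>))\<^sup>2)"
    unfolding energy_def by (intro integrableI_bounded) auto
  then show "T \<in> sobolev s" using T ex by (simp add: sobolev_def weight_def)
qed

lemma sobolev_mono:
  assumes "s \<le> t" "T \<in> sobolev t" shows "T \<in> sobolev s"
proof (rule sobolevI[of T "fhat T"])
  show "energy s (fhat T) < \<infinity>"
    using energy_mono[OF assms(1), of "fhat T"] sobolevD(5)[OF assms(2)] by auto
qed (use sobolevD[OF assms(2)] in auto)

lemma sobolev_add:
  assumes f: "f \<in> sobolev s" and g: "g \<in> sobolev s"
  shows "(\<lambda>\<psi>. f \<psi> + g \<psi>) \<in> sobolev s"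
    and "AE \<omega> in lborel. fhat (\<lambda>\<psi>. f \<psi> + g \<psi>) \<omega> = fhat f \<omega> + fhat g \<omega>"
proof -
  note F = sobolevD[OF f] note G = sobolevD[OF g]
  have "represents (\<lambda>\<omega>. fhat f \<omega> + fhat g \<omega>) (fourier_dist (\<lambda>\<psi>. f \<psi> + g \<psi>))"
    unfolding represents_def
  proof
    fix \<psi> :: "real^'a \<Rightarrow> complex" assume psi: "\<psi> \<in> test_functions UNIV"
    have "(LINT \<omega>|lborel. (fhat f \<omega> + fhat g \<omega>) * \<psi> \<omega>) = (LINT \<omega>|lborel. fhat f \<omega> * \<psi> \<omega>) + (LINT \<omega>|lborel. fhat g \<omega> * \<psi> \<omega>)"
      unfolding distrib_right
      by (intro Bochner_Integration.integral_add locally_L2_mult_test[OF _ psi] F G)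
    then show "fourier_dist (\<lambda>\<psi>. f \<psi> + g \<psi>) \<psi> = (LINT \<omega>|lborel. (fhat f \<omega> + fhat g \<omega>) * \<psi> \<omega>)"
      using F(3) G(3) psi by (simp add: represents_def fourier_dist_def test_schwartz)
  qed
  moreover have "energy s (\<lambda>\<omega>. fhat f \<omega> + fhat g \<omega>) < \<infinity>"
    using F(5) G(5) by (intro order.strict_trans1[OF energy_add_le[OF F(4) G(4)]]) (simp add: ennreal_mult_less_top)
  moreover have "(\<lambda>\<omega>. fhat f \<omega> + fhat g \<omega>) \<in> borel_measurable borel" using F(4) G(4) by measurable
  ultimately show "(\<lambda>\<psi>. f \<psi> + g \<psi>) \<in> sobolev s"
    "AE \<omega> in lborel. fhat (\<lambda>\<psi>. f \<psi> + g \<psi>) \<omega> = fhat f \<omega> + fhat g \<omega>"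
    using sobolevI[OF tempered_add[OF F(1) G(1)]] by blast+
qed

lemma sobolev_scale:
  assumes f: "f \<in> sobolev s"
  shows "(\<lambda>\<psi>. c * f \<psi>) \<in> sobolev s"
    and "AE \<omega> in lborel. fhat (\<lambda>\<psi>. c * f \<psi>) \<omega> = c * fhat f \<omega>"
proof -
  note F = sobolevD[OF f]
  have "represents (\<lambda>\<omega>. c * fhat f \<omega>) (fourier_dist (\<lambda>\<psi>. c * f \<psi>))"
    using F(3) by (auto simp: represents_def fourier_dist_def test_schwartz mult.assoc)
  moreover have "energy s (\<lambda>\<omega>. c * fhat f \<omega>) < \<infinity>"
    using F(5) by (simp add: energy_cmult[OF F(4)] ennreal_mult_less_top)
  moreover have "(\<lambda>\<omega>. c * fhat f \<omega>) \<in> borel_measurable borel" using F(4) by measurable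
  ultimately show "(\<lambda>\<psi>. c * f \<psi>) \<in> sobolev s" "AE \<omega> in lborel. fhat (\<lambda>\<psi>. c * f \<psi>) \<omega> = c * fhat f \<omega>"
    using sobolevI[OF tempered_scale[OF F(1)]] by blast+
qed

lemma sobolev_diff:
  assumes f: "f \<in> sobolev s" and g: "g \<in> sobolev s"
  shows "(\<lambda>\<psi>. f \<psi> - g \<psi>) \<in> sobolev s"
    and "AE \<omega> in lborel. fhat (\<lambda>\<psi>. f \<psi> - g \<psi>) \<omega> = fhat f \<omega> - fhat g \<omega>"
proof -
  show "(\<lambda>\<psi>. f \<psi> - g \<psi>) \<in> sobolev s"
    using sobolev_add(1)[OF f sobolev_scale(1)[OF g, of "-1"]] by simp
  show "AE \<omega> in lborel. fhat (\<lambda>\<psi>. f \<psi> - g \<psi>) \<omega> = fhat f \<omega> - fhat g \<omega>"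
    using sobolev_add(2)[OF f sobolev_scale(1)[OF g, of "-1"]] sobolev_scale(2)[OF g, of "-1"]
    by eventually_elim simp
qed

lemma translate_eq: "translate j g = (\<lambda>\<psi>. 1 * g (\<lambda>x. \<psi> (1 *\<^sub>R x + j)))"
  by (simp add: translate_def)

text \<open>Translation is modulation on the Fourier side. Only its effect on test functions matters, where it
is the identity \<open>\<psi>^(x + j) = (e\<^sub>- \<psi>)^(x)\<close> with \<open>e\<^sub>-(\<omega>) = exp (- \<i> j \<bullet> \<omega>)\<close>.\<close>

lemma sobolev_translate:
  fixes g :: "'d::finite dist"
  assumes g: "g \<in> sobolev s"
  shows "translate j g \<in> sobolev s"
    and "AE \<omega> in lborel. fhat (translate j g) \<omega> = cis ((- j) \<bullet> \<omega>) * fhat g \<omega>"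
proof -
  note G = sobolevD[OF g]
  have T: "translate j g \<in> tempered_distributions"
    unfolding translate_eq by (rule tempered_affine[OF G(1)]) simp
  have m: "(\<lambda>\<omega>. cis ((- j) \<bullet> \<omega>)) \<in> borel_measurable borel" by (rule smooth_measurable[OF smooth_cis_inner])
  have "represents (\<lambda>\<omega>. cis ((- j) \<bullet> \<omega>) * fhat g \<omega>) (fourier_dist (translate j g))"
    unfolding represents_def
  proof
    fix \<psi> :: "real^'d \<Rightarrow> complex" assume psi: "\<psi> \<in> test_functions UNIV"
    let ?q = "\<lambda>\<omega>. cis ((- j) \<bullet> \<omega>) * \<psi> \<omega>"
    have q: "?q \<in> test_functions UNIV" by (rule test_mult[OF smooth_cis_inner psi])
    have "fourier \<psi> (x + j) = fourier ?q x" for x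
      unfolding fourier_eq
      by (intro Bochner_Integration.integral_cong refl)
         (simp add: cis_mult inner_add_left inner_diff_left mult_ac minus_diff_commute)
    then have "fourier_dist (translate j g) \<psi> = fourier_dist g ?q"
      by (simp add: fourier_dist_def translate_def test_schwartz psi q del: inner_minus_left)
    also have "\<dots> = (LINT \<omega>|lborel. fhat g \<omega> * ?q \<omega>)" using G(3) q by (simp add: represents_def)
    finally show "fourier_dist (translate j g) \<psi> = (LINT \<omega>|lborel. cis ((- j) \<bullet> \<omega>) * fhat g \<omega> * \<psi> \<omega>)"
      by (simp add: mult_ac)
  qed
  moreover have "energy s (\<lambda>\<omega>. cis ((- j) \<bullet> \<omega>) * fhat g \<omega>) < \<infinity>"
    using G(5) energy_norm_cong[of "\<lambda>\<omega>. cis ((- j) \<bullet> \<omega>) * fhat g \<omega>" "fhat g" s] by (simp add: norm_mult)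
  moreover have "(\<lambda>\<omega>. cis ((- j) \<bullet> \<omega>) * fhat g \<omega>) \<in> borel_measurable borel"
    by (intro borel_measurable_times m G)
  ultimately show "translate j g \<in> sobolev s"
    "AE \<omega> in lborel. fhat (translate j g) \<omega> = cis ((- j) \<bullet> \<omega>) * fhat g \<omega>"
    using sobolevI[OF T] by blast+
qed

lemma dilate_eq: "dilate h (g :: 'd::finite dist) = (\<lambda>\<psi>. complex_of_real (h ^ CARD('d)) * g (\<lambda>x. \<psi> (h *\<^sub>R x + 0)))"
  by (simp add: dilate_def)

lemma fourier_scale:
  fixes \<psi> :: "real ^ 'd::finite \<Rightarrow> complex"
  assumes "\<psi> \<in> borel_measurable borel" "h > 0"
  shows "fourier (\<lambda>y. \<psi> ((1/h) *\<^sub>R y)) x = of_real (h ^ CARD('d)) * fourier \<psi> (h *\<^sub>R x)"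
proof -
  have m: "(\<lambda>y. \<psi> ((1/h) *\<^sub>R y) * cis ((- x) \<bullet> y)) \<in> borel_measurable borel"
    by (intro borel_measurable_times smooth_measurable[OF smooth_cis_inner] measurable_compose[OF _ assms(1)]) measurable
  have "fourier (\<lambda>y. \<psi> ((1/h) *\<^sub>R y)) x = of_real (\<bar>h\<bar> ^ CARD('d)) * (LINT y|lborel. \<psi> ((1/h) *\<^sub>R (0 + h *\<^sub>R y)) * cis ((- x) \<bullet> (0 + h *\<^sub>R y)))"
    unfolding fourier_eq using assms(2) by (intro integral_lborel_affine[OF m]) simp
  then show ?thesis using assms(2) by (simp add: fourier_eq)
qed

lemma sobolev_dilate:
  fixes g :: "'d::finite dist"
  assumes g: "g \<in> sobolev s" and h: "h > 0"
  shows "dilate h g \<in> sobolev s"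
    and "AE \<omega> in lborel. fhat (dilate h g) \<omega> = of_real (h ^ CARD('d)) * fhat g (h *\<^sub>R \<omega>)"
proof -
  note G = sobolevD[OF g]
  note [measurable] = G(4)
  have T: "dilate h g \<in> tempered_distributions"
    unfolding dilate_eq by (rule tempered_affine[OF G(1)]) (use h in simp)
  have gm: "(\<lambda>\<omega>. fhat g (h *\<^sub>R \<omega>)) \<in> borel_measurable borel" by measurable
  have "represents (\<lambda>\<omega>. of_real (h ^ CARD('d)) * fhat g (h *\<^sub>R \<omega>)) (fourier_dist (dilate h g))"
    unfolding represents_def
  proof
    fix \<psi> :: "real^'d \<Rightarrow> complex" assume psi: "\<psi> \<in> test_functions UNIV"
    let ?q = "\<lambda>\<omega>. \<psi> ((1/h) *\<^sub>R \<omega>)"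
    have q: "?q \<in> test_functions UNIV" using test_affine[OF psi, of "1/h" 0] h by simp
    have pm [measurable]: "\<psi> \<in> borel_measurable borel"
      by (rule smooth_measurable[OF test_functions_smooth[OF psi]])
    have sch: "(\<lambda>x. fourier \<psi> (h *\<^sub>R x)) \<in> schwartz"
      using schwartz_affine[OF fourier_schwartz[OF psi], of h 0] h by simp
    have "fourier_dist (dilate h g) \<psi> = of_real (h ^ CARD('d)) * g (\<lambda>x. fourier \<psi> (h *\<^sub>R x))"
      by (simp add: fourier_dist_def dilate_def test_schwartz psi)
    also have "\<dots> = g (\<lambda>x. of_real (h ^ CARD('d)) * fourier \<psi> (h *\<^sub>R x))"
      using G(1) sch by (simp add: tempered_distributions_def)
    also have "(\<lambda>x. of_real (h ^ CARD('d)) * fourier \<psi> (h *\<^sub>R x)) = fourier ?q"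
      by (rule ext) (rule fourier_scale[OF pm h, symmetric])
    also have "g (fourier ?q) = fourier_dist g ?q"
      by (simp add: fourier_dist_def test_schwartz q)
    also have "\<dots> = (LINT \<omega>|lborel. fhat g \<omega> * ?q \<omega>)" using G(3) q by (simp add: represents_def)
    also have "\<dots> = of_real (\<bar>h\<bar> ^ CARD('d)) * (LINT \<omega>|lborel. fhat g (0 + h *\<^sub>R \<omega>) * ?q (0 + h *\<^sub>R \<omega>))"
      using h by (intro integral_lborel_affine) auto
    finally show "fourier_dist (dilate h g) \<psi> = (LINT \<omega>|lborel. of_real (h ^ CARD('d)) * fhat g (h *\<^sub>R \<omega>) * \<psi> \<omega>)"
      using h by (simp add: mult.assoc)
  qed
  note r = this
  have e: "energy s (\<lambda>\<omega>. of_real (h ^ CARD('d)) * fhat g (h *\<^sub>R \<omega>)) < \<infinity>"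
    using energy_scale[OF G(4) h G(5)] by (subst energy_cmult[OF gm]) (simp add: ennreal_mult_less_top)
  have m: "(\<lambda>\<omega>. of_real (h ^ CARD('d)) * fhat g (h *\<^sub>R \<omega>)) \<in> borel_measurable borel"
    using gm by measurable
  show "dilate h g \<in> sobolev s"
    "AE \<omega> in lborel. fhat (dilate h g) \<omega> = of_real (h ^ CARD('d)) * fhat g (h *\<^sub>R \<omega>)"
    by (rule sobolevI[OF T m e r])+
qed

section \<open>Test functions as distributions\<close>

lemma nn_integral_decay_finite:
  "(\<integral>\<^sup>+(\<omega>::real^'d::finite). ennreal (1 / (1 + norm \<omega>) ^ (CARD('d) + 2)) \<partial>lborel) < \<infinity>"
proof -
  let ?m = "CARD('d) + 2" and ?c = "unit_ball_vol (real CARD('d))"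
  define g where "g n \<omega> = ennreal (1 / (1 + real n) ^ ?m) * indicator (cball 0 (1 + real n)) \<omega>" for n and \<omega> :: "real^'d"
  have [measurable]: "g n \<in> borel_measurable borel" for n unfolding g_def[abs_def]
    by (intro borel_measurable_times_ennreal borel_measurable_const borel_measurable_indicator) simp
  have "(\<integral>\<^sup>+(\<omega>::real^'d). ennreal (1 / (1 + norm \<omega>) ^ ?m) \<partial>lborel) \<le> (\<integral>\<^sup>+\<omega>. (\<Sum>n. g n \<omega>) \<partial>lborel)"
  proof (rule nn_integral_mono)
    fix \<omega> :: "real^'d"
    (* A shell decomposition: on n \<le> |\<omega>| \<le> n + 1 the integrand is at most (1 + n)^(-d-2), and
       the ball of radius n + 1 has volume c (1 + n)^d. *)
    define n where "n = nat \<lfloor>norm \<omega>\<rfloor>"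
    have n: "real n \<le> norm \<omega>" "norm \<omega> \<le> 1 + real n" unfolding n_def by (auto simp: of_nat_nat) linarith
    have "ennreal (1 / (1 + norm \<omega>) ^ ?m) \<le> ennreal (1 / (1 + real n) ^ ?m)"
      using n by (intro ennreal_leI divide_left_mono power_mono) auto
    also have "\<dots> = g n \<omega>" using n by (simp add: g_def)
    also have "\<dots> = (\<Sum>i\<in>{n}. g i \<omega>)" by simp
    also have "\<dots> \<le> (\<Sum>i. g i \<omega>)" by (rule sum_le_suminf) auto
    finally show "ennreal (1 / (1 + norm \<omega>) ^ ?m) \<le> (\<Sum>n. g n \<omega>)" .
  qed
  also have "\<dots> = (\<Sum>n. \<integral>\<^sup>+\<omega>. g n \<omega> \<partial>lborel)" by (rule nn_integral_suminf) measurable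
  also have "\<dots> = (\<Sum>n. ennreal (?c * (1 / (1 + real n)\<^sup>2)))"
  proof (rule suminf_cong)
    fix n
    have "(\<integral>\<^sup>+\<omega>. g n \<omega> \<partial>lborel) = ennreal (1 / (1 + real n) ^ ?m) * ennreal (?c * (1 + real n) ^ CARD('d))"
      unfolding g_def by (simp add: nn_integral_cmult_indicator emeasure_cball)
    also have "\<dots> = ennreal ((1 / (1 + real n) ^ ?m) * (?c * (1 + real n) ^ CARD('d)))"
      by (intro ennreal_mult[symmetric]) auto
    also have "(1 / (1 + real n) ^ ?m) * (?c * (1 + real n) ^ CARD('d)) = ?c * (1 / (1 + real n)\<^sup>2)"
      by (simp add: power_add power2_eq_square)
    finally show "(\<integral>\<^sup>+\<omega>. g n \<omega> \<partial>lborel) = ennreal (?c * (1 / (1 + real n)\<^sup>2))" .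
  qed
  also have "\<dots> < \<infinity>"
  proof -
    have "summable (\<lambda>n. inverse ((real (n + 1))\<^sup>2))"
      using inverse_power_summable[of 2, where 'a = real] by (subst summable_iff_shift) simp
    then have "summable (\<lambda>n. ?c * (1 / (1 + real n)\<^sup>2))"
      by (intro summable_mult) (simp add: inverse_eq_divide add.commute)
    then show ?thesis by (subst suminf_ennreal2) (auto simp: ennreal_less_top)
  qed
  finally show ?thesis .
qed

lemma energy_rapid_decay:
  fixes F :: "real ^ 'd::finite \<Rightarrow> complex"
  assumes [measurable]: "F \<in> borel_measurable borel" and "\<And>N. \<exists>C. \<forall>\<omega>. (1 + norm \<omega>) ^ N * norm (F \<omega>) \<le> C"
  shows "energy s F < \<infinity>"
proof -
  let ?m = "CARD('d) + 2"
  (* Decay of order N beats the weight and leaves an exponent of at least d + 2. *)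
  define N where "N = nat \<lceil>\<bar>s\<bar>\<rceil> + ?m"
  have N: "s + real ?m \<le> real N" unfolding N_def by linarith
  obtain C where C: "\<And>\<omega>. (1 + norm \<omega>) ^ N * norm (F \<omega>) \<le> C" using assms(2) by blast
  have "energy s F \<le> (\<integral>\<^sup>+(\<omega>::real^'d). ennreal (C\<^sup>2) * ennreal (1 / (1 + norm \<omega>) ^ ?m) \<partial>lborel)"
    unfolding energy_def
  proof (rule nn_integral_mono)
    fix \<omega> :: "real^'d"
    let ?a = "1 + norm \<omega>"
    have a: "?a \<ge> 1" by simp
    have "(?a ^ N * norm (F \<omega>))\<^sup>2 \<le> C\<^sup>2" by (intro power_mono C) auto
    then have "?a powr (2 * real N) * (norm (F \<omega>))\<^sup>2 \<le> C\<^sup>2"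
      using a by (simp add: power_mult_distrib powr_realpow[symmetric] powr_powr mult.commute
          flip: powr_numeral)
    moreover have "?a powr (2 * real N) > 0" using a by (simp only: powr_gt_zero)
    ultimately have 1: "(norm (F \<omega>))\<^sup>2 \<le> C\<^sup>2 * ?a powr (- (2 * real N))"
      by (simp add: powr_minus_divide pos_le_divide_eq mult.commute)
    have "weight s \<omega> * (norm (F \<omega>))\<^sup>2 \<le> ?a powr (2 * s) * (C\<^sup>2 * ?a powr (- (2 * real N)))"
      unfolding weight_def by (intro mult_left_mono 1) auto
    also have "\<dots> = C\<^sup>2 * ?a powr (2 * s - 2 * real N)" by (simp add: powr_diff powr_minus field_simps)
    also have "\<dots> \<le> C\<^sup>2 * ?a powr (- real ?m)"
      using N a by (intro mult_left_mono powr_mono) auto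
    also have "?a powr (- real ?m) = 1 / ?a ^ ?m"
      using a by (simp only: powr_minus_divide powr_realpow[of ?a ?m])
    finally show "ennreal (weight s \<omega> * (norm (F \<omega>))\<^sup>2) \<le> ennreal (C\<^sup>2) * ennreal (1 / ?a ^ ?m)"
      by (simp add: ennreal_leI flip: ennreal_mult)
  qed
  also have "\<dots> = ennreal (C\<^sup>2) * (\<integral>\<^sup>+(\<omega>::real^'d). ennreal (1 / (1 + norm \<omega>) ^ ?m) \<partial>lborel)"
    by (rule nn_integral_cmult) measurable
  also have "\<dots> < \<infinity>" using nn_integral_decay_finite[where 'd = 'd] by (simp add: ennreal_mult_less_top)
  finally show ?thesis .
qed

text \<open>Test functions as distributions; they supply elements of every Sobolev space, whose transforms are
honest functions.\<close>

definition test_dist :: "(real ^ 'd::finite \<Rightarrow> complex) \<Rightarrow> 'd dist" where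
  "test_dist f = (\<lambda>\<psi>. if \<psi> \<in> schwartz then LINT x|lborel. f x * \<psi> x else 0)"

lemma schwartz_add_scale:
  assumes "\<psi> \<in> schwartz" "\<theta> \<in> schwartz"
  shows "(\<lambda>x. \<psi> x + \<theta> x) \<in> schwartz" "(\<lambda>x. c * \<psi> x) \<in> schwartz"
proof -
  have sm: "smooth \<psi>" "smooth \<theta>" using assms by (auto simp: schwartz_def)
  have add: "pderivatives is (\<lambda>x. \<psi> x + \<theta> x) = (\<lambda>x. pderivatives is \<psi> x + pderivatives is \<theta> x)" for "is"
  proof (induction "is")
    case (Cons i "is")
    show ?case unfolding pderivatives_Cons Cons
      using sm by (auto simp: pderivative_add smooth_def)
  qed simp
  have scale: "pderivatives is (\<lambda>x. c * \<psi> x) = (\<lambda>x. c * pderivatives is \<psi> x)" for "is"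
  proof (induction "is")
    case (Cons i "is")
    show ?case unfolding pderivatives_Cons Cons
      using sm by (auto simp: pderivative_cmult smooth_def)
  qed simp
  have "bdd_above (range (\<lambda>x. (1 + norm x) ^ N * norm (mderiv \<gamma> (\<lambda>x. \<psi> x + \<theta> x) x)))" for N \<gamma>
  proof -
    obtain A B where AB: "\<And>x. (1 + norm x) ^ N * norm (mderiv \<gamma> \<psi> x) \<le> A" "\<And>x. (1 + norm x) ^ N * norm (mderiv \<gamma> \<theta> x) \<le> B"
      using assms by (force simp: schwartz_def bdd_above_def)
    have "(1 + norm x) ^ N * norm (mderiv \<gamma> (\<lambda>x. \<psi> x + \<theta> x) x) \<le> A + B" for x
    proof -
      have "(1 + norm x) ^ N * norm (mderiv \<gamma> (\<lambda>x. \<psi> x + \<theta> x) x) \<le> (1 + norm x) ^ N * (norm (mderiv \<gamma> \<psi> x) + norm (mderiv \<gamma> \<theta> x))"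
        unfolding mderiv_def add by (intro mult_left_mono norm_triangle_ineq) auto
      then show ?thesis using AB[of x] by (simp add: distrib_left)
    qed
    then show ?thesis by (auto simp: bdd_above_def)
  qed
  then show "(\<lambda>x. \<psi> x + \<theta> x) \<in> schwartz" using smooth_add[OF sm] by (simp add: schwartz_def)
  have "bdd_above (range (\<lambda>x. (1 + norm x) ^ N * norm (mderiv \<gamma> (\<lambda>x. c * \<psi> x) x)))" for N \<gamma>
  proof -
    obtain A where A: "\<And>x. (1 + norm x) ^ N * norm (mderiv \<gamma> \<psi> x) \<le> A"
      using assms by (force simp: schwartz_def bdd_above_def)
    have "(1 + norm x) ^ N * norm (mderiv \<gamma> (\<lambda>x. c * \<psi> x) x) \<le> norm c * A" for x
      using mult_left_mono[OF A[of x], of "norm c"] unfolding mderiv_def scale by (simp add: norm_mult mult_ac)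
    then show ?thesis by (auto simp: bdd_above_def)
  qed
  then show "(\<lambda>x. c * \<psi> x) \<in> schwartz" using smooth_mult[OF smooth_const sm(1)] by (simp add: schwartz_def)
qed

lemma test_dist_tempered:
  assumes f: "f \<in> test_functions UNIV"
  shows "test_dist f \<in> tempered_distributions"
proof -
  have bd: "norm (\<psi> x) \<le> schwartz_seminorm 0 \<psi>" if "\<psi> \<in> schwartz" for \<psi> x
    using schwartz_seminorm_upper[OF that, of 0 0 x] by simp
  have int: "integrable lborel (\<lambda>x. f x * \<psi> x)" if "\<psi> \<in> schwartz" for \<psi>
  proof -
    have "\<psi> \<in> borel_measurable lborel" using that by (simp add: schwartz_def smooth_measurable)
    from integrable_bounded_mult[OF test_integrable[OF f] this bd[OF that]] show ?thesis by (simp add: mult.commute)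
  qed
  have "norm (test_dist f \<psi>) \<le> (LINT x|lborel. norm (f x)) * schwartz_seminorm 0 \<psi>" if psi: "\<psi> \<in> schwartz" for \<psi>
  proof -
    have "norm (LINT x|lborel. f x * \<psi> x) \<le> (LINT x|lborel. norm (f x) * schwartz_seminorm 0 \<psi>)"
    proof (rule Bochner_Integration.integral_norm_bound_integral[OF int[OF psi]])
      show "integrable lborel (\<lambda>x. norm (f x) * schwartz_seminorm 0 \<psi>)"
        by (intro integrable_mult_left integrable_norm test_integrable[OF f])
    qed (simp add: norm_mult mult_left_mono bd[OF psi])
    then show ?thesis using psi by (simp add: test_dist_def)
  qed
  moreover have "test_dist f (\<lambda>x. \<psi> x + \<theta> x) = test_dist f \<psi> + test_dist f \<theta>" if "\<psi> \<in> schwartz" "\<theta> \<in> schwartz" for \<psi> \<theta>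
    using that schwartz_add_scale(1)[OF that] int[OF that(1)] int[OF that(2)]
    by (simp add: test_dist_def distrib_left)
  moreover have "test_dist f (\<lambda>x. c * \<psi> x) = c * test_dist f \<psi>" if "\<psi> \<in> schwartz" for \<psi> c
    using that schwartz_add_scale(2)[OF that that, of c]
    by (simp add: test_dist_def mult.left_commute)
  moreover have "test_dist f \<psi> = 0" if "\<psi> \<notin> schwartz" for \<psi> using that by (simp add: test_dist_def)
  ultimately show ?thesis unfolding tempered_distributions_def by blast
qed

text \<open>Fubini: both sides are the double integral of \<open>f x * g y * exp (- \<i> x \<bullet> y)\<close>.\<close>

lemma fourier_self_adjoint:
  fixes f g :: "real ^ 'd::finite \<Rightarrow> complex"
  assumes f: "integrable lborel f" and g: "integrable lborel g"
  shows "(LINT x|lborel. f x * fourier g x) = (LINT y|lborel. fourier f y * g y)"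
proof -
  have [measurable]: "f \<in> borel_measurable borel" "g \<in> borel_measurable borel" using f g by auto
  let ?k = "\<lambda>x y. f x * g y * cis ((- x) \<bullet> y)"
  have cm: "(\<lambda>p::(real^'d) \<times> (real^'d). cis ((- fst p) \<bullet> snd p)) \<in> borel_measurable borel"
    by (intro borel_measurable_continuous_onI continuous_intros)
  have [measurable]: "(\<lambda>p::(real^'d) \<times> (real^'d). cis ((- fst p) \<bullet> snd p)) \<in> borel_measurable (lborel \<Otimes>\<^sub>M lborel)"
    using cm by (simp add: lborel_prod del: inner_minus_left)
  have km: "(\<lambda>(x, y). ?k x y) \<in> borel_measurable (lborel \<Otimes>\<^sub>M lborel)"
    unfolding split_beta by measurable
  have "integrable (lborel \<Otimes>\<^sub>M lborel) (\<lambda>(x, y). ?k x y)"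
  proof (rule lborel_pair.Fubini_integrable[OF km])
    have "(\<lambda>x. LINT y|lborel. norm (case (x, y) of (x, y) \<Rightarrow> ?k x y)) = (\<lambda>x. norm (f x) * (LINT y|lborel. norm (g y)))"
      by (simp add: norm_mult)
    then show "integrable lborel (\<lambda>x. LINT y|lborel. norm (case (x, y) of (x, y) \<Rightarrow> ?k x y))"
      using f by simp
    have "integrable lborel (\<lambda>y. ?k x y)" for x
    proof -
      have "integrable lborel (\<lambda>y. cis ((- x) \<bullet> y) * (f x * g y))"
        using g by (intro integrable_bounded_mult[where B = 1] integrable_mult_right)
          (auto simp: smooth_measurable[OF smooth_cis_inner] simp del: inner_minus_left)
      then show ?thesis by (simp add: mult_ac)
    qed
    then show "AE x in lborel. integrable lborel (\<lambda>y. case (x, y) of (x, y) \<Rightarrow> ?k x y)" by simp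
  qed
  from lborel_pair.Fubini_integral[OF this]
  have "(LINT y|lborel. LINT x|lborel. ?k x y) = (LINT x|lborel. LINT y|lborel. ?k x y)" by simp
  moreover have "(LINT y|lborel. ?k x y) = f x * fourier g x" for x
    by (simp add: fourier_eq mult.assoc)
  moreover have "(LINT x|lborel. ?k x y) = fourier f y * g y" for y
  proof -
    have "(\<lambda>x. ?k x y) = (\<lambda>x. f x * cis ((- y) \<bullet> x) * g y)"
      by (simp add: fun_eq_iff inner_commute mult_ac)
    then show ?thesis by (simp only: fourier_eq integral_mult_left_zero)
  qed
  ultimately show ?thesis by simp
qed

lemma test_dist_sobolev:
  assumes f: "f \<in> test_functions UNIV"
  shows "test_dist f \<in> sobolev s" "AE \<omega> in lborel. fhat (test_dist f) \<omega> = fourier f \<omega>"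
proof -
  have "represents (fourier f) (fourier_dist (test_dist f))"
    unfolding represents_def fourier_dist_def test_dist_def
    using fourier_self_adjoint[OF test_integrable[OF f] test_integrable]
    by (auto simp: fourier_schwartz test_schwartz)
  moreover have m: "fourier f \<in> borel_measurable borel" by (rule smooth_measurable[OF smooth_fourier[OF f]])
  moreover have "energy s (fourier f) < \<infinity>" by (rule energy_rapid_decay[OF m fourier_decay[OF f]])
  ultimately show "test_dist f \<in> sobolev s" "AE \<omega> in lborel. fhat (test_dist f) \<omega> = fourier f \<omega>"
    using sobolevI[OF test_dist_tempered[OF f]] by blast+
qed

section \<open>Mollification\<close>

definition convol :: "(real ^ 'd::finite \<Rightarrow> complex) \<Rightarrow> (real ^ 'd \<Rightarrow> complex) \<Rightarrow> real ^ 'd \<Rightarrow> complex" where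
  "convol F \<eta> x = (LINT y|lborel. F y * \<eta> (x - y))"

lemma integrable_convol:
  fixes F :: "real ^ 'd::finite \<Rightarrow> complex"
  assumes "integrable lborel F" "\<eta> \<in> test_functions UNIV"
  shows "integrable lborel (\<lambda>y. F y * \<eta> (x - y))"
proof -
  obtain B where B: "\<And>x. norm (\<eta> x) \<le> B" using test_bounded[OF assms(2)] by blast
  have "(\<lambda>y. \<eta> (x - y)) \<in> borel_measurable lborel"
    using measurable_compose[of "\<lambda>y. x - y" borel borel \<eta> borel] smooth_measurable[OF test_functions_smooth[OF assms(2)]]
    by simp
  from integrable_bounded_mult[OF assms(1) this B] show ?thesis by (simp add: mult.commute)
qed

lemma convol_has_derivative:
  fixes F :: "real ^ 'd::finite \<Rightarrow> complex"
  assumes F: "integrable lborel F" and \<eta>: "\<eta> \<in> test_functions UNIV"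
  shows "(convol F \<eta> has_derivative (\<lambda>v. \<Sum>i\<in>UNIV. of_real (v $ i) * convol F (pderivative i \<eta>) x)) (at x)"
proof -
  obtain C where C: "C \<ge> 0" "\<And>x v. norm (\<eta> (x + v) - \<eta> x - (\<Sum>i\<in>UNIV. of_real (v $ i) * pderivative i \<eta> x)) \<le> C * (norm v)\<^sup>2"
    using test_first_order[OF \<eta>] by blast
  note int = integrable_convol[OF F]
  show ?thesis
  proof (rule has_derivative_quadratic)
    show "bounded_linear (\<lambda>v::real^'d. \<Sum>i\<in>UNIV. of_real (v $ i) * convol F (pderivative i \<eta>) x)"
      by (intro bounded_linear_sum bounded_linear_mult_const bounded_linear_compose[OF bounded_linear_of_real]
          bounded_linear_vec_nth)
    fix v :: "real^'d"
    let ?s = "\<lambda>y. \<Sum>i\<in>UNIV. of_real (v $ i) * (F y * pderivative i \<eta> (x - y))"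
    let ?r = "\<lambda>y. F y * \<eta> ((x + v) - y) - F y * \<eta> (x - y) - ?s y"
    have ri: "integrable lborel ?r"
      by (intro Bochner_Integration.integrable_diff Bochner_Integration.integrable_sum integrable_mult_right int pderivative_test \<eta>)
    have "convol F \<eta> (x + v) - convol F \<eta> x - (\<Sum>i\<in>UNIV. of_real (v $ i) * convol F (pderivative i \<eta>) x) = (LINT y|lborel. ?r y)"
    proof -
      have "(LINT y|lborel. ?r y) = (LINT y|lborel. F y * \<eta> ((x + v) - y) - F y * \<eta> (x - y)) - (LINT y|lborel. ?s y)"
        by (intro Bochner_Integration.integral_diff Bochner_Integration.integrable_diff
            Bochner_Integration.integrable_sum integrable_mult_right int pderivative_test \<eta>)
      also have "(LINT y|lborel. F y * \<eta> ((x + v) - y) - F y * \<eta> (x - y)) = convol F \<eta> (x + v) - convol F \<eta> x"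
        unfolding convol_def by (intro Bochner_Integration.integral_diff int \<eta>)
      also have "(LINT y|lborel. ?s y) = (\<Sum>i\<in>UNIV. LINT y|lborel. of_real (v $ i) * (F y * pderivative i \<eta> (x - y)))"
        by (intro Bochner_Integration.integral_sum integrable_mult_right int pderivative_test \<eta>)
      also have "\<dots> = (\<Sum>i\<in>UNIV. of_real (v $ i) * convol F (pderivative i \<eta>) x)"
        unfolding convol_def by (intro sum.cong refl integral_mult_right_zero)
      finally show ?thesis by (rule sym)
    qed
    also have "norm \<dots> \<le> (LINT y|lborel. norm (F y) * (C * (norm v)\<^sup>2))"
    proof (rule Bochner_Integration.integral_norm_bound_integral[OF ri])
      show "integrable lborel (\<lambda>y. norm (F y) * (C * (norm v)\<^sup>2))" using F by simp
      fix y
      have "?r y = F y * (\<eta> ((x - y) + v) - \<eta> (x - y) - (\<Sum>i\<in>UNIV. of_real (v $ i) * pderivative i \<eta> (x - y)))"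
        by (simp add: right_diff_distrib sum_distrib_left mult.left_commute add_diff_eq diff_add_eq)
      then show "norm (?r y) \<le> norm (F y) * (C * (norm v)\<^sup>2)"
        using C(2)[of "x - y" v] by (simp only: norm_mult mult_left_mono norm_ge_zero)
    qed
    finally show "norm (convol F \<eta> (x + v) - convol F \<eta> x - (\<Sum>i\<in>UNIV. of_real (v $ i) * convol F (pderivative i \<eta>) x))
      \<le> ((LINT y|lborel. norm (F y)) * C) * (norm v)\<^sup>2" by simp
  qed
qed

lemma pderivatives_convol:
  fixes F :: "real ^ 'd::finite \<Rightarrow> complex"
  assumes F: "integrable lborel F" and \<eta>: "\<eta> \<in> test_functions UNIV"
  shows "pderivatives is (convol F \<eta>) = convol F (pderivatives is \<eta>)"
proof (induction "is")
  case (Cons i "is")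
  have "pderivative i (convol F (pderivatives is \<eta>)) x = convol F (pderivative i (pderivatives is \<eta>)) x" for x
    by (subst pderivative_eqI[OF convol_has_derivative[OF F pderivatives_test[OF \<eta>]]])
       (simp add: axis_def if_distrib if_distribR cong: if_cong)
  then show ?case by (simp add: pderivatives_Cons Cons fun_eq_iff)
qed simp

lemma smooth_convol:
  fixes F :: "real ^ 'd::finite \<Rightarrow> complex"
  assumes F: "integrable lborel F" and \<eta>: "\<eta> \<in> test_functions UNIV"
  shows "smooth (convol F \<eta>)"
  unfolding smooth_def pderivatives_convol[OF F \<eta>]
  by (intro allI differentiableI[OF convol_has_derivative[OF F pderivatives_test[OF \<eta>]]])

definition mollifier :: "real \<Rightarrow> real ^ 'd::finite \<Rightarrow> real" where
  "mollifier \<epsilon> x = bump ((1 / \<epsilon>) *\<^sub>R x) / (LINT y|lborel. bump ((1 / \<epsilon>) *\<^sub>R (y :: real ^ 'd)))"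

lemma bump_scaled_test:
  assumes "\<epsilon> > 0"
  shows "(\<lambda>x. complex_of_real (bump ((1 / \<epsilon>) *\<^sub>R x))) \<in> test_functions UNIV"
  using test_affine[OF bump_test, of "1 / \<epsilon>" 0] assms by simp

lemma bump_scaled_integral:
  fixes \<epsilon> :: real
  assumes "\<epsilon> > 0"
  shows "integrable lborel (\<lambda>x::real^'d::finite. bump ((1 / \<epsilon>) *\<^sub>R x))"
    "(LINT x|lborel. bump ((1 / \<epsilon>) *\<^sub>R (x::real^'d))) > 0"
proof -
  note t = bump_scaled_test[OF assms, where 'a = 'd]
  from test_integrable[OF t] show int: "integrable lborel (\<lambda>x::real^'d. bump ((1 / \<epsilon>) *\<^sub>R x))"
    by (simp add: complex_of_real_integrable_eq)
  have nn: "AE x in lborel. 0 \<le> bump ((1 / \<epsilon>) *\<^sub>R (x::real^'d))" by (simp add: bump_nonneg)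
  have "(LINT x|lborel. bump ((1 / \<epsilon>) *\<^sub>R (x::real^'d))) \<noteq> 0"
  proof
    assume "(LINT x|lborel. bump ((1 / \<epsilon>) *\<^sub>R (x::real^'d))) = 0"
    then have "AE x in lborel. bump ((1 / \<epsilon>) *\<^sub>R (x::real^'d)) = 0"
      using integral_nonneg_eq_0_iff_AE[OF int nn] by simp
    then have "AE x in lborel. complex_of_real (bump ((1 / \<epsilon>) *\<^sub>R (x::real^'d))) = 0" by simp
    from continuous_AE_zero[OF smooth_continuous[OF test_functions_smooth[OF t]] this, of 0]
    show False using bump_pos_iff[of "0::real^'d"] by simp
  qed
  moreover have "(LINT x|lborel. bump ((1 / \<epsilon>) *\<^sub>R (x::real^'d))) \<ge> 0" by (intro integral_nonneg_AE nn)
  ultimately show "(LINT x|lborel. bump ((1 / \<epsilon>) *\<^sub>R (x::real^'d))) > 0" by simp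
qed

lemma mollifier:
  fixes x :: "real ^ 'd::finite"
  assumes "\<epsilon> > 0"
  shows "(\<lambda>x::real^'d. complex_of_real (mollifier \<epsilon> x)) \<in> test_functions UNIV"
    "mollifier \<epsilon> x \<ge> 0" "norm x \<ge> \<epsilon> \<Longrightarrow> mollifier \<epsilon> x = 0"
    "(\<integral>\<^sup>+x. ennreal (mollifier \<epsilon> (x::real^'d)) \<partial>lborel) = 1"
    "mollifier \<epsilon> \<in> borel_measurable (borel :: (real^'d) measure)"
proof -
  let ?c = "LINT x|lborel. bump ((1 / \<epsilon>) *\<^sub>R (x::real^'d))"
  note int = bump_scaled_integral[OF assms, where 'd = 'd]
  have "(\<lambda>x. complex_of_real (1 / ?c) * complex_of_real (bump ((1 / \<epsilon>) *\<^sub>R (x::real^'d)))) \<in> test_functions UNIV"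
    by (intro test_mult smooth_const bump_scaled_test assms)
  then show t: "(\<lambda>x::real^'d. complex_of_real (mollifier \<epsilon> x)) \<in> test_functions UNIV"
    by (simp add: mollifier_def)
  show nn: "mollifier \<epsilon> x \<ge> 0" for x :: "real^'d"
    using int(2) by (simp add: mollifier_def bump_nonneg)
  show "norm x \<ge> \<epsilon> \<Longrightarrow> mollifier \<epsilon> x = 0"
    using assms by (simp add: mollifier_def bump_eq_0)
  show "mollifier \<epsilon> \<in> borel_measurable (borel :: (real^'d) measure)"
    using smooth_measurable[OF test_functions_smooth[OF t]] by (simp add: borel_measurable_complex_iff)
  have "integrable lborel (mollifier \<epsilon> :: real^'d \<Rightarrow> real)"
    unfolding mollifier_def[abs_def] using int(1) by simp
  then have "(\<integral>\<^sup>+x. ennreal (mollifier \<epsilon> (x::real^'d)) \<partial>lborel) = ennreal (LINT x|lborel. mollifier \<epsilon> (x::real^'d))"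
    by (intro nn_integral_eq_integral) (auto simp: nn)
  also have "(LINT x|lborel. mollifier \<epsilon> (x::real^'d)) = 1"
    unfolding mollifier_def[abs_def] using int(2) by simp
  finally show "(\<integral>\<^sup>+x. ennreal (mollifier \<epsilon> (x::real^'d)) \<partial>lborel) = 1" by simp
qed

definition mollify :: "real \<Rightarrow> (real ^ 'd::finite \<Rightarrow> complex) \<Rightarrow> real ^ 'd \<Rightarrow> complex" where
  "mollify \<epsilon> F = convol F (\<lambda>x. of_real (mollifier \<epsilon> x))"

lemma mollify_diff:
  assumes "integrable lborel F" "integrable lborel G" "\<epsilon> > 0"
  shows "mollify \<epsilon> (\<lambda>x. F x - G x) x = mollify \<epsilon> F x - mollify \<epsilon> G x"
  unfolding mollify_def convol_def left_diff_distrib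
  by (intro Bochner_Integration.integral_diff integrable_convol mollifier(1) assms)

lemma mollify_add:
  assumes "integrable lborel F" "integrable lborel G" "\<epsilon> > 0"
  shows "mollify \<epsilon> (\<lambda>x. F x + G x) x = mollify \<epsilon> F x + mollify \<epsilon> G x"
  unfolding mollify_def convol_def distrib_right
  by (intro Bochner_Integration.integral_add integrable_convol mollifier(1) assms)

lemma mollify_measurable [measurable]:
  assumes "integrable lborel F" "\<epsilon> > 0"
  shows "mollify \<epsilon> F \<in> borel_measurable borel"
  unfolding mollify_def by (intro smooth_measurable smooth_convol mollifier(1) assms)

lemma nn_integral_reflect:
  fixes f :: "real ^ 'd::finite \<Rightarrow> ennreal"
  assumes "f \<in> borel_measurable borel"
  shows "(\<integral>\<^sup>+y. f (x - y) \<partial>lborel) = (\<integral>\<^sup>+y. f y \<partial>lborel)"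
  using nn_integral_lborel_affine[OF assms, of "-1" x] by simp

lemma nn_integral_shift:
  fixes f :: "real ^ 'd::finite \<Rightarrow> ennreal"
  assumes "f \<in> borel_measurable borel"
  shows "(\<integral>\<^sup>+y. f (y - x) \<partial>lborel) = (\<integral>\<^sup>+y. f y \<partial>lborel)"
  using nn_integral_lborel_affine[OF assms, of 1 "- x"] by simp

lemma mollify_L1_contraction:
  fixes F :: "real ^ 'd::finite \<Rightarrow> complex"
  assumes F: "integrable lborel F" and e: "\<epsilon> > 0"
  shows "(\<integral>\<^sup>+x. ennreal (norm (mollify \<epsilon> F x)) \<partial>lborel) \<le> (\<integral>\<^sup>+x. ennreal (norm (F x)) \<partial>lborel)"
proof -
  have [measurable]: "F \<in> borel_measurable borel" using F by auto
  note [measurable] = mollifier(5)[OF e, where 'd = 'd]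
  have "(\<integral>\<^sup>+x. ennreal (norm (mollify \<epsilon> F x)) \<partial>lborel) \<le>
     (\<integral>\<^sup>+x. \<integral>\<^sup>+y. ennreal (norm (F y)) * ennreal (mollifier \<epsilon> (x - y)) \<partial>lborel \<partial>lborel)"
  proof (rule nn_integral_mono)
    fix x
    have "ennreal (norm (mollify \<epsilon> F x)) \<le> (\<integral>\<^sup>+y. ennreal (norm (F y * of_real (mollifier \<epsilon> (x - y)))) \<partial>lborel)"
      unfolding mollify_def convol_def
      by (rule integral_norm_bound_ennreal) (rule integrable_convol[OF F mollifier(1)[OF e]])
    also have "\<dots> = (\<integral>\<^sup>+y. ennreal (norm (F y)) * ennreal (mollifier \<epsilon> (x - y)) \<partial>lborel)"
      by (intro nn_integral_cong) (simp add: norm_mult mollifier(2)[OF e] ennreal_mult)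
    finally show "ennreal (norm (mollify \<epsilon> F x)) \<le> (\<integral>\<^sup>+y. ennreal (norm (F y)) * ennreal (mollifier \<epsilon> (x - y)) \<partial>lborel)" .
  qed
  also have "\<dots> = (\<integral>\<^sup>+y. \<integral>\<^sup>+x. ennreal (norm (F y)) * ennreal (mollifier \<epsilon> (x - y)) \<partial>lborel \<partial>lborel)"
    by (rule lborel_pair.Fubini') measurable
  also have "\<dots> = (\<integral>\<^sup>+y. ennreal (norm (F y)) \<partial>lborel)"
    by (intro nn_integral_cong) (simp add: nn_integral_cmult nn_integral_shift[of "\<lambda>x. ennreal (mollifier \<epsilon> x)"] mollifier(4)[OF e])
  finally show ?thesis .
qed

definition \<epsilon>s :: "nat \<Rightarrow> real" where "\<epsilon>s n = inverse (real (Suc n))"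

lemma \<epsilon>s: "\<epsilon>s n > 0" "\<epsilon>s n \<le> 1" "\<epsilon>s \<longlonglongrightarrow> 0"
  using LIMSEQ_inverse_real_of_nat by (auto simp: \<epsilon>s_def[abs_def] inverse_le_1_iff)

text \<open>Convergence of the mollifications in \<open>L\<^sub>1\<close>, along a fixed sequence of scales: a sequence is all that is
needed to extract an almost everywhere convergent subsequence later on.\<close>

definition mollifiable :: "(real ^ 'd::finite \<Rightarrow> complex) \<Rightarrow> bool" where
  "mollifiable F \<longleftrightarrow> integrable lborel F \<and>
     (\<lambda>n. \<integral>\<^sup>+x. ennreal (norm (mollify (\<epsilon>s n) F x - F x)) \<partial>lborel) \<longlonglongrightarrow> 0"

lemma ennreal_null_le:
  fixes u v :: "nat \<Rightarrow> ennreal"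
  assumes "\<And>n. u n \<le> v n" "v \<longlonglongrightarrow> 0"
  shows "u \<longlonglongrightarrow> 0"
  by (rule tendsto_sandwich[OF _ _ tendsto_const assms(2)]) (simp_all add: assms(1))

lemma mollifiable_add:
  assumes F: "mollifiable F" and G: "mollifiable G"
  shows "mollifiable (\<lambda>x. F x + G x)"
proof -
  have int: "integrable lborel F" "integrable lborel G" using assms by (auto simp: mollifiable_def)
  have [measurable]: "F \<in> borel_measurable borel" "G \<in> borel_measurable borel" using int by auto
  note [measurable] = mollify_measurable[OF int(1) \<epsilon>s(1)] mollify_measurable[OF int(2) \<epsilon>s(1)]
  let ?D = "\<lambda>F n. \<integral>\<^sup>+x. ennreal (norm (mollify (\<epsilon>s n) F x - F x)) \<partial>lborel"
  have "?D (\<lambda>x. F x + G x) n \<le> ?D F n + ?D G n" for n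
  proof -
    have "?D (\<lambda>x. F x + G x) n \<le> (\<integral>\<^sup>+x. ennreal (norm (mollify (\<epsilon>s n) F x - F x)) + ennreal (norm (mollify (\<epsilon>s n) G x - G x)) \<partial>lborel)"
      by (intro nn_integral_mono)
         (simp add: mollify_add[OF int \<epsilon>s(1)] add_diff_add norm_triangle_ineq ennreal_leI flip: ennreal_plus)
    then show ?thesis by (simp add: nn_integral_add)
  qed
  moreover have "(\<lambda>n. ?D F n + ?D G n) \<longlonglongrightarrow> 0 + 0"
    using assms by (intro tendsto_add) (auto simp: mollifiable_def)
  ultimately have "?D (\<lambda>x. F x + G x) \<longlonglongrightarrow> 0"
    unfolding add_0_right by (rule ennreal_null_le)
  then show ?thesis using int by (simp add: mollifiable_def)
qed

lemma mollifiable_scale: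
  assumes F: "mollifiable F"
  shows "mollifiable (\<lambda>x. c * F x)"
proof -
  have int: "integrable lborel F" using assms by (auto simp: mollifiable_def)
  have [measurable]: "F \<in> borel_measurable borel" using int by auto
  note [measurable] = mollify_measurable[OF int \<epsilon>s(1)]
  have "(\<integral>\<^sup>+x. ennreal (norm (mollify (\<epsilon>s n) (\<lambda>x. c * F x) x - c * F x)) \<partial>lborel)
     = ennreal (norm c) * (\<integral>\<^sup>+x. ennreal (norm (mollify (\<epsilon>s n) F x - F x)) \<partial>lborel)" for n
  proof -
    have "mollify (\<epsilon>s n) (\<lambda>x. c * F x) x = c * mollify (\<epsilon>s n) F x" for x
      by (simp add: mollify_def convol_def mult.assoc)
    then have "norm (mollify (\<epsilon>s n) (\<lambda>x. c * F x) x - c * F x) = norm c * norm (mollify (\<epsilon>s n) F x - F x)" for x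
      by (simp add: norm_mult flip: right_diff_distrib)
    then show ?thesis by (simp add: ennreal_mult nn_integral_cmult)
  qed
  moreover have "(\<lambda>n. ennreal (norm c) * (\<integral>\<^sup>+x. ennreal (norm (mollify (\<epsilon>s n) F x - F x)) \<partial>lborel)) \<longlonglongrightarrow> ennreal (norm c) * 0"
    using F by (intro ennreal_tendsto_cmult) (auto simp: mollifiable_def)
  ultimately show ?thesis using int by (simp add: mollifiable_def)
qed

lemma mollifiable_L1_limit:
  assumes G: "\<And>n. mollifiable (G n)" and F: "integrable lborel F"
    and lim: "(\<lambda>n::nat. \<integral>\<^sup>+x. ennreal (norm (F x - G n x)) \<partial>lborel) \<longlonglongrightarrow> 0"
  shows "mollifiable F"
proof -
  have int: "integrable lborel (G m)" for m using G by (auto simp: mollifiable_def)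
  have [measurable]: "F \<in> borel_measurable borel" "\<And>m. G m \<in> borel_measurable borel" using F int by auto
  note [measurable] = mollify_measurable[OF F \<epsilon>s(1)] mollify_measurable[OF int \<epsilon>s(1)]
  let ?D = "\<lambda>F n. \<integral>\<^sup>+x. ennreal (norm (mollify (\<epsilon>s n) F x - F x)) \<partial>lborel"
  let ?N = "\<lambda>m. \<integral>\<^sup>+x. ennreal (norm (F x - G m x)) \<partial>lborel"
  (* Mollification contracts L1, hence F inherits the convergence from G m up to twice
     the distance of F and G m, uniformly in n. *)
  have key: "?D F n \<le> ?N m + ?D (G m) n + ?N m" for n m
  proof -
    have "?D F n \<le> (\<integral>\<^sup>+x. ennreal (norm (mollify (\<epsilon>s n) (\<lambda>x. F x - G m x) x)) + ennreal (norm (mollify (\<epsilon>s n) (G m) x - G m x)) + ennreal (norm (F x - G m x)) \<partial>lborel)"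
    proof (rule nn_integral_mono)
      fix x
      have "norm (mollify (\<epsilon>s n) F x - F x) \<le> norm (mollify (\<epsilon>s n) F x - mollify (\<epsilon>s n) (G m) x) + norm (mollify (\<epsilon>s n) (G m) x - G m x) + norm (F x - G m x)"
        using norm_triangle_ineq4[of "(mollify (\<epsilon>s n) F x - mollify (\<epsilon>s n) (G m) x) + (mollify (\<epsilon>s n) (G m) x - G m x)" "F x - G m x"]
          norm_triangle_ineq[of "mollify (\<epsilon>s n) F x - mollify (\<epsilon>s n) (G m) x" "mollify (\<epsilon>s n) (G m) x - G m x"]
        by simp
      then show "ennreal (norm (mollify (\<epsilon>s n) F x - F x)) \<le> ennreal (norm (mollify (\<epsilon>s n) (\<lambda>x. F x - G m x) x)) + ennreal (norm (mollify (\<epsilon>s n) (G m) x - G m x)) + ennreal (norm (F x - G m x))"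
        by (simp add: mollify_diff[OF F int \<epsilon>s(1)] ennreal_leI flip: ennreal_plus)
    qed
    also have "\<dots> = (\<integral>\<^sup>+x. ennreal (norm (mollify (\<epsilon>s n) (\<lambda>x. F x - G m x) x)) \<partial>lborel) + ?D (G m) n + ?N m"
      using mollify_measurable[OF Bochner_Integration.integrable_diff[OF F int[of m]] \<epsilon>s(1)] by (simp add: nn_integral_add)
    also have "\<dots> \<le> ?N m + ?D (G m) n + ?N m"
      by (intro add_right_mono mollify_L1_contraction Bochner_Integration.integrable_diff F int \<epsilon>s(1))
    finally show ?thesis .
  qed
  have "?D F \<longlonglongrightarrow> 0"
  proof (rule tendsto_0_if_Limsup_eq_0_ennreal)
    have "Limsup sequentially (?D F) \<le> ?N m + ?N m" for m
    proof -
      have "(\<lambda>n. ?N m + ?D (G m) n + ?N m) \<longlonglongrightarrow> ?N m + 0 + ?N m"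
        using G[of m] by (intro tendsto_add tendsto_const) (auto simp: mollifiable_def)
      then have "Limsup sequentially (\<lambda>n. ?N m + ?D (G m) n + ?N m) = ?N m + 0 + ?N m"
        by (intro lim_imp_Limsup) auto
      moreover have "Limsup sequentially (?D F) \<le> Limsup sequentially (\<lambda>n. ?N m + ?D (G m) n + ?N m)"
        by (intro Limsup_mono always_eventually allI key)
      ultimately show ?thesis by simp
    qed
    moreover have "(\<lambda>m. ?N m + ?N m) \<longlonglongrightarrow> 0 + 0" by (intro tendsto_add lim)
    ultimately have "Limsup sequentially (?D F) \<le> 0 + 0"
      by (intro LIMSEQ_le_const[of "\<lambda>m. ?N m + ?N m"]) auto
    then show "Limsup sequentially (?D F) = 0" by simp
  qed
  then show ?thesis using F by (simp add: mollifiable_def)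
qed

text \<open>A Lipschitz function changes by at most \<open>L \<epsilon>\<close> under averages over balls of radius \<open>\<epsilon>\<close>, and nothing
happens outside a fixed ball.\<close>

lemma mollifiable_test:
  fixes f :: "real ^ 'd::finite \<Rightarrow> complex"
  assumes f: "f \<in> test_functions UNIV"
  shows "mollifiable f"
proof -
  have int: "integrable lborel f" by (rule test_integrable[OF f])
  obtain L where L: "L \<ge> 0" "\<And>x y. norm (f x - f y) \<le> L * norm (x - y)" using test_Lipschitz[OF f] by blast
  obtain K where K: "smooth f" "compact K" "K \<subseteq> UNIV" "\<And>x. x \<notin> K \<Longrightarrow> f x = 0"
    by (rule test_functionsE[OF f]) (rule that)
  obtain R where R: "\<And>x. x \<in> K \<Longrightarrow> norm x \<le> R" using compact_imp_bounded[OF K(2)] by (auto simp: bounded_iff)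
  let ?B = "cball (0::real^'d) (R + 1)"
  have pt: "norm (mollify (\<epsilon>s n) f x - f x) \<le> L * \<epsilon>s n * indicator ?B x" for n x
  proof -
    let ?m = "\<lambda>y. mollifier (\<epsilon>s n) (x - y)"
    note [measurable] = mollifier(5)[OF \<epsilon>s(1), of n, where 'd = 'd]
    have [measurable]: "f \<in> borel_measurable borel" by (rule smooth_measurable[OF K(1)])
    have one: "(\<integral>\<^sup>+y. ennreal (?m y) \<partial>lborel) = 1"
      using nn_integral_reflect[of "\<lambda>x. ennreal (mollifier (\<epsilon>s n) x)" x] mollifier(4)[OF \<epsilon>s(1), of n, where 'd = 'd] by simp
    have mint: "integrable lborel ?m"
      by (rule integrableI_nonneg) (auto simp: one mollifier(2)[OF \<epsilon>s(1)])
    have "ennreal (LINT y|lborel. ?m y) = 1"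
      using nn_integral_eq_integral[OF mint AE_I2[OF mollifier(2)[OF \<epsilon>s(1)]]] one by simp
    then have m1: "(LINT y|lborel. ?m y) = 1" by simp
    have "mollify (\<epsilon>s n) f x - f x = (LINT y|lborel. f y * of_real (?m y)) - (LINT y|lborel. f x * of_real (?m y))"
      by (simp add: mollify_def convol_def m1)
    also have "\<dots> = (LINT y|lborel. (f y - f x) * of_real (?m y))"
      unfolding left_diff_distrib
      by (intro Bochner_Integration.integral_diff[symmetric] integrable_convol[OF int mollifier(1)[OF \<epsilon>s(1)]])
         (use mint in \<open>simp add: complex_of_real_integrable_eq\<close>)
    finally have eq: "mollify (\<epsilon>s n) f x - f x = (LINT y|lborel. (f y - f x) * of_real (?m y))" .
    have dint: "integrable lborel (\<lambda>y. (f y - f x) * of_real (?m y))"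
      unfolding left_diff_distrib
      by (intro Bochner_Integration.integrable_diff integrable_convol[OF int mollifier(1)[OF \<epsilon>s(1)]])
         (use mint in \<open>simp add: complex_of_real_integrable_eq\<close>)
    show ?thesis
    proof (cases "x \<in> ?B")
      case True
      have "norm (LINT y|lborel. (f y - f x) * of_real (?m y)) \<le> (LINT y|lborel. (L * \<epsilon>s n) * ?m y)"
      proof (rule Bochner_Integration.integral_norm_bound_integral[OF dint])
        show "integrable lborel (\<lambda>y. (L * \<epsilon>s n) * ?m y)" using mint by simp
        fix y
        show "norm ((f y - f x) * of_real (?m y)) \<le> (L * \<epsilon>s n) * ?m y"
        proof (cases "norm (x - y) \<ge> \<epsilon>s n")
          case True
          then show ?thesis by (simp add: mollifier(3)[OF \<epsilon>s(1)])
        next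
          case False
          then have "L * norm (y - x) \<le> L * \<epsilon>s n" using L(1) by (intro mult_left_mono) (auto simp: norm_minus_commute)
          then have "norm (f y - f x) \<le> L * \<epsilon>s n" using L(2)[of y x] by linarith
          then show ?thesis using mollifier(2)[OF \<epsilon>s(1), of n "x - y"] by (simp add: norm_mult mult_right_mono)
        qed
      qed
      then show ?thesis using True eq m1 by simp
    next
      case False
      then have n: "norm x > R + 1" by simp
      have z: "(f y - f x) * of_real (?m y) = 0" for y
      proof (cases "norm (x - y) \<ge> \<epsilon>s n")
        case True
        then show ?thesis by (simp add: mollifier(3)[OF \<epsilon>s(1)])
      next
        case False
        then have "norm (x - y) \<le> 1" using \<epsilon>s(2)[of n] by linarith
        moreover have "norm x \<le> norm y + norm (x - y)" by (metis norm_triangle_sub)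
        ultimately have "norm y > R" using n by linarith
        then have "f y = 0" "f x = 0" using R[of y] R[of x] n by (auto intro!: K(4))
        then show ?thesis by simp
      qed
      show ?thesis using eq False unfolding z by simp
    qed
  qed
  have le: "(\<integral>\<^sup>+x. ennreal (norm (mollify (\<epsilon>s n) f x - f x)) \<partial>lborel) \<le> ennreal (L * \<epsilon>s n) * emeasure lborel ?B" for n
  proof -
    have "(\<integral>\<^sup>+x. ennreal (norm (mollify (\<epsilon>s n) f x - f x)) \<partial>lborel) \<le> (\<integral>\<^sup>+x. ennreal (L * \<epsilon>s n) * indicator ?B x \<partial>lborel)"
      by (intro nn_integral_mono order_trans[OF ennreal_leI[OF pt]]) (auto simp: indicator_def)
    then show ?thesis by (simp add: nn_integral_cmult_indicator)
  qed
  have fin: "emeasure lborel ?B < \<infinity>" by (rule emeasure_bounded_finite) simp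
  have "(\<lambda>n. ennreal (L * \<epsilon>s n) * emeasure lborel ?B) \<longlonglongrightarrow> ennreal (L * 0) * emeasure lborel ?B"
    by (intro tendsto_mult_ennreal tendsto_const tendsto_ennrealI tendsto_mult \<epsilon>s(3)) (use fin in auto)
  then have "(\<lambda>n. \<integral>\<^sup>+x. ennreal (norm (mollify (\<epsilon>s n) f x - f x)) \<partial>lborel) \<longlonglongrightarrow> 0"
    by (intro ennreal_null_le[OF le]) simp
  then show ?thesis using int by (simp add: mollifiable_def)
qed

text \<open>The bounded factors that work form a space closed under bounded limits; it contains the characters
because a character times a test function is a test function.\<close>

lemma mollifiable_bounded_times_test:
  fixes \<chi>' :: "real ^ 'd::finite \<Rightarrow> complex"
  assumes t: "\<chi>' \<in> test_functions UNIV" and f: "f \<in> borel_measurable borel" "\<And>x. norm (f x) \<le> B"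
  shows "mollifiable (\<lambda>x. f x * \<chi>' x)"
proof -
  let ?H = "{f. f \<in> borel_measurable borel \<and> (\<exists>B. \<forall>x. norm (f x) \<le> B) \<and> mollifiable (\<lambda>x. f x * \<chi>' x)}"
  have int: "integrable lborel \<chi>'" by (rule test_integrable[OF t])
  have H: "bounded_limit_space ?H"
  proof
    fix f g assume f: "f \<in> ?H" and g: "g \<in> ?H"
    obtain A where A: "\<And>x. norm (f x) \<le> A" using f by blast
    obtain B where B: "\<And>x. norm (g x) \<le> B" using g by blast
    have "norm (f x + g x) \<le> A + B" for x by (rule norm_triangle_le) (intro add_mono A B)
    moreover have "mollifiable (\<lambda>x. (f x + g x) * \<chi>' x)"
      unfolding distrib_right using f g by (intro mollifiable_add) auto
    ultimately show "(\<lambda>x. f x + g x) \<in> ?H"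
      using f g by (intro CollectI conjI exI[of _ "A + B"] allI borel_measurable_add) blast+
  next
    fix f c assume f: "f \<in> ?H"
    obtain A where A: "\<And>x. norm (f x) \<le> A" using f by blast
    have "norm (c * f x) \<le> norm c * A" for x by (simp add: norm_mult mult_left_mono A)
    moreover have "mollifiable (\<lambda>x. (c * f x) * \<chi>' x)"
      unfolding mult.assoc using f by (intro mollifiable_scale) auto
    ultimately show "(\<lambda>x. c * f x) \<in> ?H"
      using f by (intro CollectI conjI exI[of _ "norm c * A"] allI borel_measurable_times borel_measurable_const) blast+
  next
    fix F :: "nat \<Rightarrow> _" and f B
    assume F: "\<And>n. F n \<in> ?H" and B: "\<And>n x. norm (F n x) \<le> B" and l: "\<And>x. (\<lambda>n. F n x) \<longlonglongrightarrow> f x"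
    have [measurable]: "F n \<in> borel_measurable borel" for n using F by blast
    have [measurable]: "f \<in> borel_measurable borel"
      by (rule borel_measurable_LIMSEQ_metric[where f = F]) (auto intro: l)
    have [measurable]: "\<chi>' \<in> borel_measurable borel" using int by auto
    have fB: "norm (f x) \<le> B" for x
      using B by (intro LIMSEQ_le_const2[OF tendsto_norm[OF l]]) auto
    have "mollifiable (\<lambda>x. f x * \<chi>' x)"
    proof (rule mollifiable_L1_limit)
      show "mollifiable (\<lambda>x. F n x * \<chi>' x)" for n using F by blast
      show "integrable lborel (\<lambda>x. f x * \<chi>' x)" by (rule integrable_bounded_mult[OF int _ fB]) measurable
      show "(\<lambda>n. \<integral>\<^sup>+x. ennreal (norm (f x * \<chi>' x - F n x * \<chi>' x)) \<partial>lborel) \<longlonglongrightarrow> 0"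
      proof (rule nn_integral_dominated_convergence_norm[where w = "\<lambda>x. B * norm (\<chi>' x)"])
        show "AE x in lborel. norm (F n x * \<chi>' x) \<le> B * norm (\<chi>' x)" for n
          by (intro AE_I2) (simp add: norm_mult mult_right_mono B)
        show "(\<integral>\<^sup>+x. ennreal (B * norm (\<chi>' x)) \<partial>lborel) < \<infinity>"
          using integrableD(2)[of lborel "\<lambda>x. B * norm (\<chi>' x)"] int fB[THEN order_trans[OF norm_ge_zero]]
          by (simp add: abs_mult top.not_eq_extremum)
        show "AE x in lborel. (\<lambda>n. F n x * \<chi>' x) \<longlonglongrightarrow> f x * \<chi>' x" by (intro AE_I2 tendsto_intros l)
      qed measurable
    qed
    then show "f \<in> ?H" using fB by (intro CollectI conjI exI[of _ B] allI) measurable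
  qed
  have "f \<in> ?H"
  proof (rule bounded_limit_space_all[OF H _ f])
    show "exp_sums UNIV \<subseteq> ?H"
    proof (rule exp_sums_subset[OF H])
      fix l :: "real^'d"
      show "(\<lambda>x. cis (l \<bullet> x)) \<in> ?H"
        using mollifiable_test[OF test_mult[OF smooth_cis_inner t, of l]]
        by (intro CollectI conjI exI[of _ 1] allI smooth_measurable[OF smooth_cis_inner]) auto
    qed
  qed
  then show ?thesis by blast
qed

lemma mollifiable_bounded_support:
  fixes F :: "real ^ 'd::finite \<Rightarrow> complex"
  assumes F: "integrable lborel F" and supp: "\<And>x. norm x \<ge> R \<Longrightarrow> F x = 0"
  shows "mollifiable F"
proof -
  (* The radius exceeds R, so that the bump is positive wherever F lives. *)
  let ?R = "\<bar>R\<bar> + 1"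
  define \<theta> where "\<theta> x = bump ((1 / ?R) *\<^sub>R x)" for x :: "real^'d"
  have t: "(\<lambda>x. complex_of_real (\<theta> x)) \<in> test_functions UNIV" unfolding \<theta>_def by (rule bump_scaled_test) simp
  have [measurable]: "F \<in> borel_measurable borel" using F by auto
  have [measurable]: "\<theta> \<in> borel_measurable borel"
    using smooth_measurable[OF test_functions_smooth[OF t]] by (simp add: borel_measurable_complex_iff)
  have pos: "\<theta> x > 0" if "norm x < R" for x
  proof -
    have "norm x < ?R" using that by linarith
    then show ?thesis unfolding \<theta>_def bump_pos_iff by (simp add: field_simps)
  qed
  (* Where \<theta> is tiny the quotient F / \<theta> is cut off; f n is bounded by n, and f n times \<theta>
     is either F or 0. *)
  define f where "f n x = (if norm (F x) \<le> real n * \<theta> x \<and> \<theta> x > 0 then F x / of_real (\<theta> x) else 0)" for n x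
  have fe: "f n x * of_real (\<theta> x) = (if norm (F x) \<le> real n * \<theta> x \<and> \<theta> x > 0 then F x else 0)" for n x
    by (simp add: f_def)
  show ?thesis
  proof (rule mollifiable_L1_limit[OF _ F])
    show "mollifiable (\<lambda>x. f n x * of_real (\<theta> x))" for n
    proof (rule mollifiable_bounded_times_test[OF t])
      show "f n \<in> borel_measurable borel" unfolding f_def[abs_def] by measurable
      show "norm (f n x) \<le> real n" for x
        by (auto simp: f_def norm_divide divide_le_eq)
    qed
    show "(\<lambda>n. \<integral>\<^sup>+x. ennreal (norm (F x - f n x * of_real (\<theta> x))) \<partial>lborel) \<longlonglongrightarrow> 0"
      unfolding fe
    proof (rule nn_integral_dominated_convergence_norm[where w = "\<lambda>x. norm (F x)"])
      show "(\<integral>\<^sup>+x. ennreal (norm (F x)) \<partial>lborel) < \<infinity>"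
        using F by (simp add: integrable_iff_bounded)
      show "AE x in lborel. (\<lambda>n. if norm (F x) \<le> real n * \<theta> x \<and> \<theta> x > 0 then F x else 0) \<longlonglongrightarrow> F x"
      proof (rule AE_I2)
        fix x
        show "(\<lambda>n. if norm (F x) \<le> real n * \<theta> x \<and> \<theta> x > 0 then F x else 0) \<longlonglongrightarrow> F x"
        proof (cases "norm x < R")
          case True
          obtain N where N: "norm (F x) / \<theta> x < real N" using reals_Archimedean2 by blast
          have "norm (F x) \<le> real n * \<theta> x" if "n \<ge> N" for n
          proof -
            have "norm (F x) / \<theta> x \<le> real n" using N that by linarith
            then show ?thesis using pos[OF True] by (simp add: divide_le_eq)
          qed
          then show ?thesis using pos[OF True]
            by (intro tendsto_eventually) (auto simp: eventually_sequentially)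
        next
          case False
          then have "F x = 0" using supp by simp
          then have "(\<lambda>n. if norm (F x) \<le> real n * \<theta> x \<and> \<theta> x > 0 then F x else 0) = (\<lambda>n. 0)" by auto
          then show ?thesis using \<open>F x = 0\<close> by (simp only: tendsto_const)
        qed
      qed
    qed (auto simp: measurable_If)
  qed
qed

section \<open>Taylor estimates from weak derivatives\<close>

text \<open>Iterated differences along the orbit \<open>x, x/2, x/4, \<dots>\<close>: the difference with parameter \<open>j\<close> kills the
homogeneous functions of degree \<open>j\<close>, so that \<open>dyadic [0..<k]\<close> kills all polynomials of degree below \<open>k\<close>.
It only uses finitely many values of the function and therefore passes to pointwise limits, which
the coefficients of a Taylor polynomial would not.\<close>

primrec dyadic :: "nat list \<Rightarrow> ('a::real_vector \<Rightarrow> complex) \<Rightarrow> 'a \<Rightarrow> complex" where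
  "dyadic [] G x = G x"
| "dyadic (j # js) G x = dyadic js G ((1/2) *\<^sub>R x) - (1/2) ^ j * dyadic js G x"

lemma dyadic_Nil [simp]: "dyadic [] G = G"
  by (rule ext) simp

lemma smooth_halve:
  assumes "smooth G"
  shows "smooth (\<lambda>x. G ((1/2) *\<^sub>R x))"
    "pderivative i (\<lambda>x. G ((1/2) *\<^sub>R x)) x = (1/2) * pderivative i G ((1/2) *\<^sub>R x)"
  using smooth_affine(1)[OF assms, of "1/2" 0] pderivative_affine(1)[of G "1/2" x 0 i] smooth_differentiable[OF assms]
  by simp_all

lemma smooth_dyadic: "smooth G \<Longrightarrow> smooth (dyadic js G)"
proof (induction js)
  case (Cons j js)
  then have "smooth (\<lambda>x. dyadic js G ((1/2) *\<^sub>R x) + (- ((1/2) ^ j)) * dyadic js G x)"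
    by (intro smooth_add smooth_mult smooth_const smooth_halve) auto
  moreover have "dyadic (j # js) G = (\<lambda>x. dyadic js G ((1/2) *\<^sub>R x) + (- ((1/2) ^ j)) * dyadic js G x)"
    by (simp add: fun_eq_iff)
  ultimately show ?case by simp
qed simp

lemma pderivative_dyadic:
  assumes "smooth G"
  shows "pderivative i (dyadic (map Suc js) G) x = (1/2) ^ length js * dyadic js (pderivative i G) x"
proof (induction js arbitrary: x)
  case (Cons j js)
  let ?H = "dyadic (map Suc js) G"
  have sm: "smooth ?H" by (rule smooth_dyadic[OF assms])
  have "dyadic (map Suc (j # js)) G = (\<lambda>x. ?H ((1/2) *\<^sub>R x) + (- ((1/2) ^ Suc j)) * ?H x)"
    by (simp add: fun_eq_iff)
  then have "pderivative i (dyadic (map Suc (j # js)) G) x = pderivative i (\<lambda>x. ?H ((1/2) *\<^sub>R x) + (- ((1/2) ^ Suc j)) * ?H x) x"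
    by simp
  also have "\<dots> = pderivative i (\<lambda>x. ?H ((1/2) *\<^sub>R x)) x + pderivative i (\<lambda>x. (- ((1/2) ^ Suc j)) * ?H x) x"
    by (intro pderivative_add smooth_differentiable smooth_mult smooth_const smooth_halve sm)
  also have "\<dots> = (1/2) * pderivative i ?H ((1/2) *\<^sub>R x) + (- ((1/2) ^ Suc j)) * pderivative i ?H x"
    by (simp only: smooth_halve(2)[OF sm] pderivative_cmult[OF smooth_differentiable[OF sm]])
  also have "\<dots> = (1/2) ^ length (j # js) * dyadic (j # js) (pderivative i G) x"
    by (simp add: Cons.IH algebra_simps)
  finally show ?case .
qed simp

text \<open>Taylor's theorem without a Taylor polynomial: a function whose derivatives of order \<open>k\<close> are bounded by
\<open>M\<close> has dyadic differences of size \<open>M |x|\<^sup>k\<close>. Differentiation turns the difference with parameter \<open>j + 1\<close>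
into half of the one with parameter \<open>j\<close>, which drives the induction on \<open>k\<close>.\<close>

lemma dyadic_taylor:
  fixes G :: "real ^ 'd::finite \<Rightarrow> complex"
  assumes "smooth G" "M \<ge> 0"
    and "\<And>is x. length is = k \<Longrightarrow> norm x < R \<Longrightarrow> norm (pderivatives is G x) \<le> M"
    and "norm x < R"
  shows "norm (dyadic [0..<k] G x) \<le> real CARD('d) ^ k * M * norm x ^ k"
  using assms
proof (induction k arbitrary: G x)
  case 0
  from 0(3)[of "[]" x] 0(4) show ?case by simp
next
  case (Suc k)
  (* The derivative of ?H is a (k-fold) dyadic difference of the derivative of G, to which the
     induction hypothesis applies; the remaining difference, of exponent 0, is then an
     increment of ?H along the segment from x / 2 to x. *)
  let ?H = "dyadic (map Suc [0..<k]) G"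
  define B where "B = real CARD('d) ^ k * M * norm x ^ k"
  have sm: "smooth ?H" by (rule smooth_dyadic[OF Suc.prems(1)])
  have B0: "B \<ge> 0" using Suc.prems(2) by (simp add: B_def)
  have bd: "norm (pderivative i ?H z) \<le> B" if z: "z \<in> cball 0 (norm x)" for i z
  proof -
    have zR: "norm z < R" using z Suc.prems(4) by simp
    have "norm (dyadic [0..<k] (pderivative i G) z) \<le> real CARD('d) ^ k * M * norm z ^ k"
    proof (rule Suc.IH[OF smooth_pderivative[OF Suc.prems(1)] Suc.prems(2) _ zR])
      fix "is" :: "'d list" and y :: "real^'d" assume "length is = k" "norm y < R"
      then show "norm (pderivatives is (pderivative i G) y) \<le> M"
        using Suc.prems(3)[of "is @ [i]" y] by (simp add: pderivatives_snoc)
    qed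
    also have "\<dots> \<le> B" unfolding B_def using z Suc.prems(2) by (intro mult_left_mono power_mono) auto
    finally have 1: "norm (dyadic [0..<k] (pderivative i G) z) \<le> B" .
    have "norm (pderivative i ?H z) = (1/2) ^ k * norm (dyadic [0..<k] (pderivative i G) z)"
      by (simp add: pderivative_dyadic[OF Suc.prems(1)] norm_mult norm_power norm_divide)
    also have "\<dots> \<le> 1 * norm (dyadic [0..<k] (pderivative i G) z)"
      by (intro mult_right_mono power_le_one) auto
    finally show ?thesis using 1 by simp
  qed
  have "norm (?H ((1/2) *\<^sub>R x) - ?H x) \<le> (real CARD('d) * B) * norm ((1/2) *\<^sub>R x - x)"
  proof (rule differentiable_bound[of "cball 0 (norm x)"])
    show "(?H has_derivative (\<lambda>v. \<Sum>i\<in>UNIV. of_real (v $ i) * pderivative i ?H z)) (at z within cball 0 (norm x))" for z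
      using has_derivative_pderivative[OF smooth_differentiable[OF sm]] by (rule has_derivative_at_withinI)
    show "onorm (\<lambda>v. \<Sum>i\<in>UNIV. of_real (v $ i) * pderivative i ?H z) \<le> real CARD('d) * B" if "z \<in> cball 0 (norm x)" for z
      by (rule onorm_le) (rule norm_sum_pderivative_le[OF bd[OF that]])
  qed auto
  also have "norm ((1/2) *\<^sub>R x - x) = norm x / 2"
  proof -
    have "(1/2) *\<^sub>R x - x = (1/2 - 1) *\<^sub>R x" by (simp only: scaleR_left_diff_distrib scaleR_one)
    then show ?thesis by (simp only: norm_scaleR) simp
  qed
  also have "(real CARD('d) * B) * (norm x / 2) \<le> (real CARD('d) * B) * norm x"
    using B0 by (intro mult_left_mono) auto
  also have "\<dots> = real CARD('d) ^ Suc k * M * norm x ^ Suc k" by (simp add: B_def)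
  also have "?H ((1/2) *\<^sub>R x) - ?H x = dyadic [0..<Suc k] G x"
    by (simp add: upt_conv_Cons map_Suc_upt del: upt_Suc)
  finally show ?case .
qed

lemma dyadic_tendsto:
  assumes "\<And>m. (\<lambda>n. G n ((1/2) ^ m *\<^sub>R x)) \<longlonglongrightarrow> G' ((1/2) ^ m *\<^sub>R x)"
  shows "(\<lambda>n. dyadic js (G n) x) \<longlonglongrightarrow> dyadic js G' x"
  using assms
proof (induction js arbitrary: x)
  case Nil
  from Nil[of 0] show ?case by simp
next
  case (Cons j js)
  have "(\<lambda>n. dyadic js (G n) ((1/2) *\<^sub>R x)) \<longlonglongrightarrow> dyadic js G' ((1/2) *\<^sub>R x)"
  proof (rule Cons.IH)
    fix m from Cons.prems[of "Suc m"]
    show "(\<lambda>n. G n ((1/2) ^ m *\<^sub>R ((1/2) *\<^sub>R x))) \<longlonglongrightarrow> G' ((1/2) ^ m *\<^sub>R ((1/2) *\<^sub>R x))" by (simp add: mult.commute)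
  qed
  moreover have "(\<lambda>n. dyadic js (G n) x) \<longlonglongrightarrow> dyadic js G' x" by (rule Cons.IH[OF Cons.prems])
  ultimately show ?case by (auto intro!: tendsto_intros)
qed

text \<open>A sequence of size \<open>2\<^sup>-\<^sup>k\<^sup>n\<close> contains no multiple of \<open>2\<^sup>-\<^sup>j\<^sup>n\<close> with \<open>j < k\<close>, so it is controlled by its difference. The
point is that the resulting bound depends on the size \<open>B\<close> of the difference but not on \<open>C\<close>.\<close>

lemma dyadic_difference_invert:
  fixes a :: "nat \<Rightarrow> complex"
  assumes j: "j < k" and B: "\<And>n. norm (a (Suc n) - (1/2) ^ j * a n) \<le> B * (1/2) ^ (k * n)"
    and C: "\<And>n. norm (a n) \<le> C * (1/2) ^ (k * n)"
  shows "norm (a n) \<le> 2 ^ k * B * (1/2) ^ (k * n)"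
proof -
  (* The rescaled sequence X is bounded by hypothesis, so its supremum S is finite and may be
     absorbed: each X n is at most S / 2 plus a constant independent of C. *)
  define X where "X n = norm (a n) * 2 ^ (k * n)" for n
  have pp: "(1/2::real) ^ m * 2 ^ m = 1" for m by (simp add: power_one_over)
  have XC: "X n \<le> C" for n
    using mult_right_mono[OF C[of n], of "2 ^ (k * n)"] by (simp add: X_def mult.assoc pp)
  have bdd: "bdd_above (range X)" using XC by (auto simp: bdd_above_def)
  define S where "S = (SUP n. X n)"
  have XS: "X n \<le> S" for n unfolding S_def by (rule cSUP_upper[OF _ bdd]) simp
  have B0: "B \<ge> 0" using order_trans[OF norm_ge_zero B[of 0]] by simp
  have step: "X n \<le> S / 2 + 2 ^ k * B / 2" for n
  proof -
    have eq: "u - (u - v) = v" for u v :: complex by simp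
    have "norm ((1/2) ^ j * a n) \<le> norm (a (Suc n)) + norm (a (Suc n) - (1/2) ^ j * a n)"
      using norm_triangle_ineq4[of "a (Suc n)" "a (Suc n) - (1/2) ^ j * a n"] unfolding eq .
    then have "(1/2) ^ j * norm (a n) \<le> norm (a (Suc n)) + B * (1/2) ^ (k * n)"
      using B[of n] by (simp only: norm_mult norm_power norm_divide norm_one norm_numeral)
    then have "2 ^ j * ((1/2) ^ j * norm (a n)) \<le> 2 ^ j * (norm (a (Suc n)) + B * (1/2) ^ (k * n))"
      by (intro mult_left_mono) auto
    moreover have "2 ^ j * ((1/2) ^ j * norm (a n)) = norm (a n)"
      by (simp only: mult.assoc[symmetric] mult.commute[of "2 ^ j"] pp mult_1_left)
    ultimately have "norm (a n) * 2 ^ (k * n) \<le> 2 ^ j * (norm (a (Suc n)) + B * (1/2) ^ (k * n)) * 2 ^ (k * n)"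
      by (intro mult_right_mono) auto
    also have "\<dots> = 2 ^ j * (norm (a (Suc n)) * 2 ^ (k * n) + B)"
      by (simp only: mult.assoc distrib_right pp mult_1_right)
    finally have "X n \<le> 2 ^ j * (norm (a (Suc n)) * 2 ^ (k * n) + B)" unfolding X_def .
    also have "\<dots> = 2 ^ j * (X (Suc n) / 2 ^ k + B)" by (simp add: X_def power_add)
    also have "\<dots> \<le> 2 ^ (k - 1) * (S / 2 ^ k + B)"
    proof (rule mult_mono)
      show "(2::real) ^ j \<le> 2 ^ (k - 1)" using j by (intro power_increasing) auto
      show "X (Suc n) / 2 ^ k + B \<le> S / 2 ^ k + B" using XS by (intro add_right_mono divide_right_mono) auto
      show "0 \<le> X (Suc n) / 2 ^ k + B" using B0 by (simp add: X_def)
    qed auto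
    also have "\<dots> = S / 2 + 2 ^ k * B / 2"
      using j by (cases k) (auto simp: field_simps)
    finally show ?thesis .
  qed
  have "(SUP n. X n) \<le> S / 2 + 2 ^ k * B / 2" by (rule cSUP_least) (use step in auto)
  then have "S \<le> S / 2 + 2 ^ k * B / 2" unfolding S_def[symmetric] .
  then have "X n \<le> 2 ^ k * B" using XS[of n] by linarith
  then have "X n * (1/2) ^ (k * n) \<le> 2 ^ k * B * (1/2) ^ (k * n)" by (intro mult_right_mono) auto
  then show ?thesis by (simp only: X_def mult.assoc mult.commute[of "2 ^ (k * n)"] pp mult_1_right)
qed

lemma dyadic_orbit_bound:
  assumes "\<And>n. norm (G ((1/2) ^ n *\<^sub>R x)) \<le> C * (1/2) ^ (k * n)"
  shows "\<exists>C. \<forall>n. norm (dyadic js G ((1/2) ^ n *\<^sub>R x)) \<le> C * (1/2) ^ (k * n)"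
proof (induction js)
  case Nil
  then show ?case using assms by auto
next
  case (Cons j js)
  then obtain D where D: "\<And>n. norm (dyadic js G ((1/2) ^ n *\<^sub>R x)) \<le> D * (1/2) ^ (k * n)" by blast
  have D0: "D \<ge> 0" using order_trans[OF norm_ge_zero D[of 0]] by simp
  have "norm (dyadic (j # js) G ((1/2) ^ n *\<^sub>R x)) \<le> (2 * D) * (1/2) ^ (k * n)" for n
  proof -
    have "norm (dyadic js G ((1/2) *\<^sub>R (1/2) ^ n *\<^sub>R x)) \<le> D * (1/2) ^ (k * n)"
    proof -
      have "norm (dyadic js G ((1/2) ^ Suc n *\<^sub>R x)) \<le> D * (1/2) ^ (k * Suc n)" by (rule D)
      also have "\<dots> \<le> D * (1/2) ^ (k * n)" using D0 by (intro mult_left_mono power_decreasing) auto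
      finally show ?thesis by simp
    qed
    moreover have "norm ((1/2) ^ j * dyadic js G ((1/2) ^ n *\<^sub>R x)) \<le> 1 * (D * (1/2) ^ (k * n))"
      unfolding norm_mult by (intro mult_mono D) (auto simp: norm_power norm_divide power_le_one)
    ultimately show ?thesis
      using norm_triangle_ineq4[of "dyadic js G ((1/2) *\<^sub>R (1/2) ^ n *\<^sub>R x)" "(1/2) ^ j * dyadic js G ((1/2) ^ n *\<^sub>R x)"]
      by simp
  qed
  then show ?case by blast
qed

lemma dyadic_invert:
  assumes "\<forall>j\<in>set js. j < k"
    and C: "\<And>n. norm (G ((1/2) ^ n *\<^sub>R x)) \<le> C * (1/2) ^ (k * n)"
    and B: "\<And>n. norm (dyadic js G ((1/2) ^ n *\<^sub>R x)) \<le> B * (1/2) ^ (k * n)"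
  shows "norm (G ((1/2) ^ n *\<^sub>R x)) \<le> (2 ^ k) ^ length js * B * (1/2) ^ (k * n)"
  using assms(1) B
proof (induction js arbitrary: B n)
  case (Cons j js)
  obtain D where D: "\<And>n. norm (dyadic js G ((1/2) ^ n *\<^sub>R x)) \<le> D * (1/2) ^ (k * n)"
    using dyadic_orbit_bound[OF C] by blast
  have "norm (dyadic js G ((1/2) ^ n *\<^sub>R x)) \<le> 2 ^ k * B * (1/2) ^ (k * n)" for n
  proof (rule dyadic_difference_invert[where a = "\<lambda>n. dyadic js G ((1/2) ^ n *\<^sub>R x)" and j = j, OF _ _ D])
    show "j < k" using Cons.prems by simp
    show "norm (dyadic js G ((1/2) ^ Suc n *\<^sub>R x) - (1/2) ^ j * dyadic js G ((1/2) ^ n *\<^sub>R x)) \<le> B * (1/2) ^ (k * n)" for n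
      using Cons.prems(2)[of n] by simp
  qed
  from Cons.IH[OF _ this] Cons.prems(1) show ?case by (simp add: mult.assoc mult.left_commute)
qed simp

lemma AE_lborel_affine:
  fixes P :: "real ^ 'd::finite \<Rightarrow> bool"
  assumes P: "AE y in lborel. P y" and c: "c \<noteq> 0"
  shows "AE x in lborel. P (t + c *\<^sub>R x)"
proof -
  obtain N where N: "N \<in> null_sets lborel" "{y. \<not> P y} \<subseteq> N"
    using P by (auto simp: eventually_ae_filter)
  have [measurable]: "N \<in> sets borel" using N by auto
  have "(\<integral>\<^sup>+y. indicator N y \<partial>lborel) = 0" using N by auto
  then have "ennreal (\<bar>c\<bar> ^ CARD('d)) * (\<integral>\<^sup>+x. indicator N (t + c *\<^sub>R x) \<partial>lborel) = 0"
    using nn_integral_lborel_affine[of "indicator N" c t] c by simp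
  then have "(\<integral>\<^sup>+x. indicator N (t + c *\<^sub>R x) \<partial>lborel) = 0" using c by simp
  then have "AE x in lborel. indicator N (t + c *\<^sub>R x) = (0::ennreal)"
    by (subst (asm) nn_integral_0_iff_AE) auto
  then show ?thesis
    by (rule AE_mp) (use N(2) in \<open>auto intro!: AE_I2 simp: indicator_def split: if_splits\<close>)
qed

text \<open>The classical derivative of a mollification is the mollification of the weak derivative, at all
points whose distance to the boundary exceeds the radius of the kernel.\<close>

lemma mollify_derivative_bound:
  fixes F G :: "real ^ 'd::finite \<Rightarrow> complex"
  assumes F: "locally_L2 F" and w: "weak_deriv_on (ball b \<rho>) \<gamma> F G"
    and M: "M \<ge> 0" "AE y in lborel. y \<in> ball b \<rho> \<longrightarrow> norm (G y) \<le> M"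
    and c: "\<And>i. count_list is i = \<gamma> $ i"
    and e: "\<epsilon> > 0" and x: "norm (x - b) < \<rho> - \<epsilon>"
  shows "norm (pderivatives is (mollify \<epsilon> (\<lambda>y. indicator (ball b \<rho>) y *\<^sub>R F y)) x) \<le> M"
proof -
  let ?U = "ball b \<rho>" and ?\<eta> = "\<lambda>x::real^'d. complex_of_real (mollifier \<epsilon> x)"
  let ?F = "\<lambda>y. indicator ?U y *\<^sub>R F y"
  have [measurable]: "F \<in> borel_measurable borel" using F by (simp add: locally_L2_def)
  have intF: "integrable lborel ?F"
    using set_integrable_subset[OF locally_L2_set_integrable[OF F compact_cball[of b \<rho>]], of ?U]
    by (auto simp: set_integrable_def)
  (* The kernel centred at x is supported in a ball inside U, so it is a legitimate test
     function for the weak derivative. *)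
  define \<psi> where "\<psi> y = ?\<eta> (x - y)" for y
  have \<psi>: "\<psi> \<in> test_functions ?U"
  proof (rule test_functionsI[of _ "cball x \<epsilon>"])
    show "smooth \<psi>" unfolding \<psi>_def[abs_def]
      using smooth_affine(1)[OF test_functions_smooth[OF mollifier(1)[OF e]], of "-1" x] by simp
    show "cball x \<epsilon> \<subseteq> ?U"
    proof
      fix y assume "y \<in> cball x \<epsilon>"
      then have "dist b y < \<rho>" using x dist_triangle[of b y x] by (simp add: dist_norm norm_minus_commute)
      then show "y \<in> ?U" by simp
    qed
    show "\<psi> y = 0" if "y \<notin> cball x \<epsilon>" for y
      using that by (simp add: \<psi>_def mollifier(3)[OF e] dist_norm)
  qed simp
  have \<psi>': "\<psi> \<in> test_functions UNIV" by (rule test_functions_mono[OF \<psi>]) simp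
  have pd: "pderivatives is ?\<eta> (x - y) = (-1) ^ length is * mderiv \<gamma> \<psi> y" for y
  proof -
    have 1: "mderiv \<gamma> \<psi> = pderivatives is \<psi>" by (rule mderiv_test[OF \<psi>' c])
    have 2: "\<psi> = (\<lambda>y. ?\<eta> ((-1) *\<^sub>R y + x))" by (simp add: \<psi>_def fun_eq_iff)
    have "mderiv \<gamma> \<psi> y = of_real (-1) ^ length is * pderivatives is ?\<eta> (x - y)"
      unfolding 1 by (subst 2, subst smooth_affine(2)[OF test_functions_smooth[OF mollifier(1)[OF e]]]) simp
    then show ?thesis by (simp add: power_mult_distrib[symmetric] flip: mult.assoc)
  qed
  have off: "mderiv \<gamma> \<psi> y = 0" if "y \<notin> ?U" for y
  proof -
    have "mderiv \<gamma> \<psi> \<in> test_functions ?U" unfolding mderiv_def by (rule pderivatives_test[OF \<psi>])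
    then show ?thesis using that by (metis test_functionsE subsetD)
  qed
  have "pderivatives is (mollify \<epsilon> ?F) x = (LINT y|lborel. ?F y * pderivatives is ?\<eta> (x - y))"
    unfolding mollify_def pderivatives_convol[OF intF mollifier(1)[OF e]] by (simp add: convol_def)
  also have "\<dots> = (LINT y|lborel. (-1) ^ length is * (F y * mderiv \<gamma> \<psi> y))"
    using off by (intro Bochner_Integration.integral_cong refl) (auto simp: pd indicator_def)
  also have "\<dots> = (-1) ^ length is * (LINT y|lborel. F y * mderiv \<gamma> \<psi> y)" by (rule integral_mult_right_zero)
  finally have "norm (pderivatives is (mollify \<epsilon> ?F) x) = norm (LINT y|lborel. F y * mderiv \<gamma> \<psi> y)"
    by (simp add: norm_mult norm_power)
  also have "\<dots> = norm (LINT y|lborel. G y * \<psi> y)"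
    using w \<psi> by (simp add: weak_deriv_on_def norm_mult norm_power)
  also have "\<dots> \<le> (LINT y|lborel. norm (G y * \<psi> y))" by (rule integral_norm_bound)
  also have "\<dots> \<le> (LINT y|lborel. M * mollifier \<epsilon> (x - y))"
  proof (rule integral_mono_AE)
    show "integrable lborel (\<lambda>y. norm (G y * \<psi> y))"
      using w by (intro integrable_norm integrable_mult_test[OF _ \<psi>]) (auto simp: weak_deriv_on_def)
    have "integrable lborel \<psi>" by (rule test_integrable[OF \<psi>'])
    then show "integrable lborel (\<lambda>y. M * mollifier \<epsilon> (x - y))" unfolding \<psi>_def[abs_def]
      by (simp add: complex_of_real_integrable_eq)
    show "AE y in lborel. norm (G y * \<psi> y) \<le> M * mollifier \<epsilon> (x - y)"
      using M(2)
    proof (rule AE_mp, intro AE_I2 impI)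
      fix y assume y: "y \<in> ?U \<longrightarrow> norm (G y) \<le> M"
      show "norm (G y * \<psi> y) \<le> M * mollifier \<epsilon> (x - y)"
      proof (cases "y \<in> ?U")
        case True
        then show ?thesis using y mollifier(2)[OF e, of "x - y"] by (simp add: \<psi>_def norm_mult mult_right_mono)
      next
        case False
        then have "\<psi> y = 0" using \<psi> by (metis test_functionsE subsetD)
        then show ?thesis using M(1) mollifier(2)[OF e, of "x - y"] by simp
      qed
    qed
  qed
  also have "\<dots> = M"
  proof -
    note [measurable] = mollifier(5)[OF e, where 'd = 'd]
    have one: "(\<integral>\<^sup>+y. ennreal (mollifier \<epsilon> (x - y)) \<partial>lborel) = 1"
      using nn_integral_reflect[of "\<lambda>x. ennreal (mollifier \<epsilon> x)" x] mollifier(4)[OF e, where 'd = 'd] by simp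
    have "(LINT y|lborel. mollifier \<epsilon> (x - y)) = 1"
      by (subst integral_eq_nn_integral) (auto simp: one mollifier(2)[OF e])
    then show ?thesis by simp
  qed
  finally show ?thesis .
qed

text \<open>A function that vanishes to order \<open>k\<close> at \<open>b\<close> in some neighbourhood, with some constant, satisfies the same
estimate on the whole ball with a constant governed by its weak derivatives of order \<open>k\<close>. The dyadic
differences of the mollifications are bounded by \<open>dyadic_taylor\<close>, the bound survives the limit, and
vanishing to order \<open>k\<close> is precisely what lets \<open>dyadic_invert\<close> undo the differences. No continuity of
the function is available, so everything is done for almost every orbit.\<close>

theorem weak_taylor:
  fixes F :: "real ^ 'd::finite \<Rightarrow> complex"
  assumes F: "locally_L2 F" and M: "M \<ge> 0"
    and w: "\<And>\<gamma>. mi_abs \<gamma> = k \<Longrightarrow> \<exists>G. weak_deriv_on (ball b \<rho>) \<gamma> F G \<and>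
         (AE y in lborel. y \<in> ball b \<rho> \<longrightarrow> norm (G y) \<le> M)"
    and r: "r > 0" "AE \<omega> in lborel. norm \<omega> < r \<longrightarrow> norm (F (\<omega> + b)) \<le> C * norm \<omega> ^ k"
  shows "AE \<omega> in lborel. norm \<omega> < \<rho> \<longrightarrow> norm (F (\<omega> + b)) \<le> (2 ^ k) ^ k * (real CARD('d) ^ k * M) * norm \<omega> ^ k"
proof -
  let ?U = "ball b \<rho>"
  let ?F = "\<lambda>y. indicator ?U y *\<^sub>R F y"
  let ?K = "real CARD('d) ^ k * M"
  have [measurable]: "F \<in> borel_measurable borel" using F by (simp add: locally_L2_def)
  have intF: "integrable lborel ?F"
    using set_integrable_subset[OF locally_L2_set_integrable[OF F compact_cball[of b \<rho>]], of ?U]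
    by (auto simp: set_integrable_def)
  have "mollifiable ?F"
  proof (rule mollifiable_bounded_support[OF intF, of "norm b + \<bar>\<rho>\<bar>"])
    fix x :: "real^'d" assume "norm b + \<bar>\<rho>\<bar> \<le> norm x"
    moreover have "norm x \<le> norm b + dist b x" by (metis dist_norm norm_minus_commute norm_triangle_sub)
    ultimately have "x \<notin> ?U" by auto
    then show "?F x = 0" by simp
  qed
  then have l: "(\<lambda>n. \<integral>\<^sup>+x. ennreal (norm (mollify (\<epsilon>s n) ?F x - ?F x)) \<partial>lborel) \<longlonglongrightarrow> 0"
    by (simp add: mollifiable_def)
  have "\<exists>q. strict_mono q \<and> (AE y in lborel. (\<lambda>n. mollify (\<epsilon>s (q n)) ?F y - ?F y) \<longlonglongrightarrow> 0)"
  proof (rule tendsto_L1_AE_subseq)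
    have im: "integrable lborel (mollify (\<epsilon>s n) ?F)" for n
    proof (rule integrableI_bounded)
      have "(\<integral>\<^sup>+x. ennreal (norm (?F x)) \<partial>lborel) < \<infinity>" using intF by (simp only: integrable_iff_bounded)
      then show "(\<integral>\<^sup>+x. ennreal (norm (mollify (\<epsilon>s n) ?F x)) \<partial>lborel) < \<infinity>"
        using mollify_L1_contraction[OF intF \<epsilon>s(1), of n] by (rule order.strict_trans1[rotated])
    qed (use mollify_measurable[OF intF \<epsilon>s(1)] in simp)
    show id: "integrable lborel (\<lambda>x. mollify (\<epsilon>s n) ?F x - ?F x)" for n
      by (intro Bochner_Integration.integrable_diff im intF)
    have "(LINT x|lborel. norm (mollify (\<epsilon>s n) ?F x - ?F x)) = enn2real (\<integral>\<^sup>+x. ennreal (norm (mollify (\<epsilon>s n) ?F x - ?F x)) \<partial>lborel)" for n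
      using borel_measurable_integrable[OF id[of n]] by (intro integral_eq_nn_integral) auto
    moreover have "(\<lambda>n. enn2real (\<integral>\<^sup>+x. ennreal (norm (mollify (\<epsilon>s n) ?F x - ?F x)) \<partial>lborel)) \<longlonglongrightarrow> 0"
      by (rule tendsto_enn2real) (use l in auto)
    ultimately show "(\<lambda>n. LINT x|lborel. norm (mollify (\<epsilon>s n) ?F x - ?F x)) \<longlonglongrightarrow> 0" by presburger
  qed
  then obtain q where q: "strict_mono q" "AE y in lborel. (\<lambda>n. mollify (\<epsilon>s (q n)) ?F y) \<longlonglongrightarrow> ?F y"
    unfolding LIM_zero_iff by blast
  let ?u = "\<lambda>n z. mollify (\<epsilon>s (q n)) ?F (z + b)"
  have half: "(1/2::real) ^ m \<noteq> 0" for m by simp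
  (* One null set has to serve the whole orbit x, x/2, x/4, ...; it is a countable union of
     dilated null sets. *)
  have conv: "AE x in lborel. \<forall>m. (\<lambda>n. ?u n ((1/2) ^ m *\<^sub>R x)) \<longlonglongrightarrow> ?F ((1/2) ^ m *\<^sub>R x + b)"
    unfolding AE_all_countable using AE_lborel_affine[OF q(2) half, of b] by (simp add: add.commute)
  have rsmall: "AE x in lborel. \<forall>m. norm ((1/2) ^ m *\<^sub>R x) < r \<longrightarrow> norm (F ((1/2) ^ m *\<^sub>R x + b)) \<le> C * norm ((1/2) ^ m *\<^sub>R x) ^ k"
    unfolding AE_all_countable using AE_lborel_affine[OF r(2) half, of 0] by simp
  have e0: "(\<lambda>n. \<epsilon>s (q n)) \<longlonglongrightarrow> 0" using LIMSEQ_subseq_LIMSEQ[OF \<epsilon>s(3) q(1)] by (simp add: o_def)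
  from conv have dy: "AE x in lborel. norm x < \<rho> \<longrightarrow> norm (dyadic [0..<k] (\<lambda>z. ?F (z + b)) x) \<le> ?K * norm x ^ k"
  proof (rule AE_mp, intro AE_I2 impI)
    fix x :: "real^'d"
    assume c: "\<forall>m. (\<lambda>n. ?u n ((1/2) ^ m *\<^sub>R x)) \<longlonglongrightarrow> ?F ((1/2) ^ m *\<^sub>R x + b)" and x: "norm x < \<rho>"
    have "(\<lambda>n. dyadic [0..<k] (?u n) x) \<longlonglongrightarrow> dyadic [0..<k] (\<lambda>z. ?F (z + b)) x"
      by (rule dyadic_tendsto) (use c in blast)
    moreover have "\<forall>\<^sub>F n in sequentially. norm (dyadic [0..<k] (?u n) x) \<le> ?K * norm x ^ k"
    proof -
      have "\<forall>\<^sub>F n in sequentially. \<epsilon>s (q n) < \<rho> - norm x"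
        using x by (intro order_tendstoD(2)[OF e0]) simp
      then show ?thesis
      proof eventually_elim
        case (elim n)
        have sm: "smooth (mollify (\<epsilon>s (q n)) ?F)"
          unfolding mollify_def by (intro smooth_convol intF mollifier(1) \<epsilon>s(1))
        show ?case
        proof (rule dyadic_taylor[OF _ M])
          show "smooth (?u n)" using smooth_affine(1)[OF sm, of 1 b] by simp
          show "norm x < \<rho> - \<epsilon>s (q n)" using elim by simp
          fix "is" :: "'d list" and z :: "real^'d" assume "is": "length is = k" and z: "norm z < \<rho> - \<epsilon>s (q n)"
          (* Any list of k directions is a listing of some multi-index of order k. *)
          define \<gamma> where "\<gamma> = (\<chi> i. count_list is i)"
          have "mi_abs \<gamma> = k" using sum_count_set[of "is" UNIV] "is" by (simp add: mi_abs_def \<gamma>_def)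
          then obtain G where G: "weak_deriv_on ?U \<gamma> F G" "AE y in lborel. y \<in> ?U \<longrightarrow> norm (G y) \<le> M"
            using w by blast
          have "norm (pderivatives is (mollify (\<epsilon>s (q n)) ?F) (z + b)) \<le> M"
            by (rule mollify_derivative_bound[OF F G(1) M G(2) _ \<epsilon>s(1)]) (use z in \<open>auto simp: \<gamma>_def\<close>)
          moreover have "pderivatives is (?u n) z = pderivatives is (mollify (\<epsilon>s (q n)) ?F) (z + b)"
            using smooth_affine(2)[OF sm, of "is" 1 b] by (simp add: fun_eq_iff)
          ultimately show "norm (pderivatives is (?u n) z) \<le> M" by simp
        qed
      qed
    qed
    ultimately show "norm (dyadic [0..<k] (\<lambda>z. ?F (z + b)) x) \<le> ?K * norm x ^ k"
      by (intro tendsto_upperbound[OF tendsto_norm]) auto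
  qed
  have dyall: "AE x in lborel. \<forall>m. norm ((1/2) ^ m *\<^sub>R x) < \<rho> \<longrightarrow>
     norm (dyadic [0..<k] (\<lambda>z. ?F (z + b)) ((1/2) ^ m *\<^sub>R x)) \<le> ?K * norm ((1/2) ^ m *\<^sub>R x) ^ k"
    unfolding AE_all_countable using AE_lborel_affine[OF dy half, of 0] by simp
  from dyall rsmall show ?thesis
  proof (eventually_elim, intro impI)
    fix x :: "real^'d"
    assume d: "\<forall>m. norm ((1/2) ^ m *\<^sub>R x) < \<rho> \<longrightarrow>
       norm (dyadic [0..<k] (\<lambda>z. ?F (z + b)) ((1/2) ^ m *\<^sub>R x)) \<le> ?K * norm ((1/2) ^ m *\<^sub>R x) ^ k"
      and s: "\<forall>m. norm ((1/2) ^ m *\<^sub>R x) < r \<longrightarrow> norm (F ((1/2) ^ m *\<^sub>R x + b)) \<le> C * norm ((1/2) ^ m *\<^sub>R x) ^ k"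
      and x: "norm x < \<rho>"
    have nm: "norm ((1/2) ^ m *\<^sub>R x) ^ k = norm x ^ k * (1/2) ^ (k * m)" for m
      by (simp add: norm_power power_mult_distrib mult.commute flip: power_mult)
    have le: "norm ((1/2) ^ m *\<^sub>R x) \<le> norm x" for m
      by (simp add: mult_left_le_one_le power_le_one)
    then have lt: "norm ((1/2) ^ m *\<^sub>R x) < \<rho>" for m using x order.strict_trans1 by blast
    have FF: "?F ((1/2) ^ m *\<^sub>R x + b) = F ((1/2) ^ m *\<^sub>R x + b)" for m
      using lt[of m] by (simp add: dist_norm norm_minus_commute)
    have "\<exists>D. \<forall>n. norm (?F ((1/2) ^ n *\<^sub>R x + b)) \<le> D * (1/2) ^ (k * n)"
    proof -
      have "(\<lambda>m. (1/2) ^ m * norm x) \<longlonglongrightarrow> 0 * norm x"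
        by (intro tendsto_mult tendsto_const LIMSEQ_realpow_zero) auto
      then have "\<forall>\<^sub>F m in sequentially. (1/2) ^ m * norm x < r" using r(1) by (intro order_tendstoD(2)) auto
      then obtain N where N: "\<And>m. m \<ge> N \<Longrightarrow> norm ((1/2) ^ m *\<^sub>R x) < r" by (auto simp: eventually_sequentially)
      define X where "X m = norm (F ((1/2) ^ m *\<^sub>R x + b)) * 2 ^ (k * m)" for m
      (* The constant may depend on x: the hypothesis near 0 covers all but finitely many points
         of the orbit. *)
      define D where "D = \<bar>C\<bar> * norm x ^ k + (\<Sum>m<N. X m)"
      have X0: "X m \<ge> 0" for m by (simp add: X_def)
      have pp: "(1/2::real) ^ m * 2 ^ m = 1" for m by (simp add: power_one_over)
      have "X m \<le> D" for m
      proof (cases "m < N")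
        case True
        then have "X m \<le> (\<Sum>m<N. X m)" using X0 by (intro member_le_sum) auto
        then show ?thesis by (simp add: D_def add_increasing)
      next
        case False
        then have "norm (F ((1/2) ^ m *\<^sub>R x + b)) \<le> C * (norm x ^ k * (1/2) ^ (k * m))" using s[rule_format, OF N[of m]] unfolding nm by simp
        then have "X m \<le> C * (norm x ^ k * (1/2) ^ (k * m)) * 2 ^ (k * m)" unfolding X_def by (intro mult_right_mono) auto
        also have "\<dots> = C * norm x ^ k" using pp[of "k * m"] by (simp add: mult.assoc)
        also have "\<dots> \<le> \<bar>C\<bar> * norm x ^ k" by (intro mult_right_mono) auto
        also have "\<dots> \<le> D" using X0 by (simp add: D_def sum_nonneg)
        finally show ?thesis .
      qed
      then have XD: "X m * (1/2) ^ (k * m) \<le> D * (1/2) ^ (k * m)" for m by (intro mult_right_mono) auto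
      have "X m * (1/2) ^ (k * m) = norm (F ((1/2) ^ m *\<^sub>R x + b))" for m
        by (simp only: X_def mult.assoc mult.commute[of "2 ^ (k * m)"] pp mult_1_right)
      then have "norm (?F ((1/2) ^ m *\<^sub>R x + b)) \<le> D * (1/2) ^ (k * m)" for m
        using XD[of m] unfolding FF by presburger
      then show ?thesis by blast
    qed
    then obtain D where D: "\<And>n. norm (?F ((1/2) ^ n *\<^sub>R x + b)) \<le> D * (1/2) ^ (k * n)" by blast
    have "norm ((\<lambda>z. ?F (z + b)) ((1/2) ^ 0 *\<^sub>R x)) \<le> (2 ^ k) ^ length [0..<k] * (?K * norm x ^ k) * (1/2) ^ (k * 0)"
    proof (rule dyadic_invert[where G = "\<lambda>z. ?F (z + b)"])
      show "norm (?F ((1/2) ^ n *\<^sub>R x + b)) \<le> D * (1/2) ^ (k * n)" for n by (rule D)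
      show "norm (dyadic [0..<k] (\<lambda>z. ?F (z + b)) ((1/2) ^ n *\<^sub>R x)) \<le> ?K * norm x ^ k * (1/2) ^ (k * n)" for n
        using d[rule_format, OF lt[of n]] unfolding nm mult.assoc .
    qed auto
    moreover have "x + b \<in> ball b \<rho>" using x by (simp add: dist_norm)
    ultimately show "norm (F (x + b)) \<le> (2 ^ k) ^ k * ?K * norm x ^ k"
      by (simp add: mult.assoc)
  qed
qed

text \<open>The last factor bounds \<open>\<gamma>!\<close> for \<open>|\<gamma>| = k\<close> and thereby accounts for the normalization of \<open>Linf_norm_D\<close>.\<close>

definition taylor_const :: "nat \<Rightarrow> nat \<Rightarrow> real" where
  "taylor_const d k = (2 ^ k) ^ k * real d ^ k * fact k ^ d"

lemma mi_fact_le: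
  fixes \<gamma> :: "nat ^ 'd::finite"
  assumes "mi_abs \<gamma> = k"
  shows "real (mi_fact \<gamma>) \<le> fact k ^ CARD('d)"
proof -
  have "\<gamma> $ i \<le> k" for i
    using member_le_sum[of i UNIV "($) \<gamma>"] assms by (simp add: mi_abs_def)
  then have "(\<Prod>i\<in>UNIV. fact (\<gamma> $ i) :: real) \<le> (\<Prod>i\<in>(UNIV::'d set). fact k)"
    by (intro prod_mono) (auto intro: fact_mono)
  then show ?thesis by (simp add: mi_fact_def)
qed

text \<open>The quantitative form of \<open>weak_taylor\<close>: the unspecified constant \<open>C\<close> and radius \<open>r\<close> in the hypothesis leave no
trace in the conclusion. This is why a condition at each lattice point separately, together with one
summable series, controls all lattice points at once.\<close>

theorem Linf_taylor:
  fixes F :: "real ^ 'd::finite \<Rightarrow> complex"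
  assumes F: "locally_L2 F" and m: "m \<ge> 0"
    and L: "\<And>\<gamma>. mi_abs \<gamma> = k \<Longrightarrow> Linf_norm_D \<gamma> F (ball b \<rho>) \<le> ennreal m"
    and r: "r > 0" "AE \<omega> in lborel. norm \<omega> < r \<longrightarrow> norm (F (\<omega> + b)) \<le> C * norm \<omega> ^ k"
  shows "AE \<omega> in lborel. norm \<omega> < \<rho> \<longrightarrow> norm (F (\<omega> + b)) \<le> taylor_const CARD('d) k * m * norm \<omega> ^ k"
proof -
  let ?U = "ball b \<rho>" and ?f = "fact k ^ CARD('d) :: real"
  have "AE \<omega> in lborel. norm \<omega> < \<rho> \<longrightarrow> norm (F (\<omega> + b)) \<le> taylor_const CARD('d) k * (m + \<epsilon>s n) * norm \<omega> ^ k" for n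
  proof -
    (* The norm is an infimum over weak derivatives, so one of them obeys any bound above m. *)
    let ?m = "m + \<epsilon>s n"
    have m': "m < ?m" using \<epsilon>s(1)[of n] by simp
    have "AE \<omega> in lborel. norm \<omega> < \<rho> \<longrightarrow> norm (F (\<omega> + b)) \<le> (2 ^ k) ^ k * (real CARD('d) ^ k * (?m * ?f)) * norm \<omega> ^ k"
    proof (rule weak_taylor[OF F _ _ r])
      show "0 \<le> ?m * ?f" using m m' by simp
      fix \<gamma> :: "nat^'d" assume g: "mi_abs \<gamma> = k"
      have "Linf_norm_D \<gamma> F ?U < ennreal ?m"
      proof (rule order.strict_trans1[OF L[OF g]], rule ennreal_lessI)
        show "0 < ?m" using m m' by linarith
      qed (rule m')
      then obtain G where G: "weak_deriv_on ?U \<gamma> F G"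
        "esssup (restrict_space lborel ?U) (\<lambda>x. ennreal (norm (G x / of_nat (mi_fact \<gamma>)))) < ennreal ?m"
        unfolding Linf_norm_D_def INF_less_iff by blast
      have "AE x in restrict_space lborel ?U. ennreal (norm (G x / of_nat (mi_fact \<gamma>))) \<le>
          esssup (restrict_space lborel ?U) (\<lambda>x. ennreal (norm (G x / of_nat (mi_fact \<gamma>))))"
        by (rule esssup_AE)
      then have "AE x in restrict_space lborel ?U. norm (G x) \<le> ?m * ?f"
      proof (rule AE_mp, intro AE_I2 impI)
        fix x assume "ennreal (norm (G x / of_nat (mi_fact \<gamma>))) \<le>
          esssup (restrict_space lborel ?U) (\<lambda>x. ennreal (norm (G x / of_nat (mi_fact \<gamma>))))"
        then have "ennreal (norm (G x / of_nat (mi_fact \<gamma>))) < ennreal ?m" using G(2) by (rule order.strict_trans1)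
        then have "norm (G x / of_nat (mi_fact \<gamma>)) \<le> ?m" by (subst (asm) ennreal_less_iff) simp_all
        moreover have pos: "real (mi_fact \<gamma>) > 0" by (simp add: mi_fact_def prod_pos)
        ultimately have "norm (G x) \<le> ?m * real (mi_fact \<gamma>)" by (simp add: norm_divide divide_le_eq)
        also have "\<dots> \<le> ?m * ?f" using m m' mi_fact_le[OF g] by (intro mult_left_mono) auto
        finally show "norm (G x) \<le> ?m * ?f" .
      qed
      then have "AE x in lborel. x \<in> ?U \<longrightarrow> norm (G x) \<le> ?m * ?f"
        by (subst (asm) AE_restrict_space_iff) auto
      then show "\<exists>G. weak_deriv_on ?U \<gamma> F G \<and> (AE y in lborel. y \<in> ?U \<longrightarrow> norm (G y) \<le> ?m * ?f)"
        using G(1) by blast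
    qed
    then show ?thesis by (simp add: taylor_const_def mult_ac)
  qed
  then have "AE \<omega> in lborel. \<forall>n. norm \<omega> < \<rho> \<longrightarrow> norm (F (\<omega> + b)) \<le> taylor_const CARD('d) k * (m + \<epsilon>s n) * norm \<omega> ^ k"
    unfolding AE_all_countable by blast
  then show ?thesis
  proof (rule AE_mp, intro AE_I2 impI)
    fix \<omega> :: "real^'d" assume *: "\<forall>n. norm \<omega> < \<rho> \<longrightarrow> norm (F (\<omega> + b)) \<le> taylor_const CARD('d) k * (m + \<epsilon>s n) * norm \<omega> ^ k"
      and w: "norm \<omega> < \<rho>"
    have "(\<lambda>n. taylor_const CARD('d) k * (m + \<epsilon>s n) * norm \<omega> ^ k) \<longlonglongrightarrow> taylor_const CARD('d) k * (m + 0) * norm \<omega> ^ k"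
      by (intro tendsto_intros \<epsilon>s(3))
    then show "norm (F (\<omega> + b)) \<le> taylor_const CARD('d) k * m * norm \<omega> ^ k"
      using * w by (intro tendsto_lowerbound[of _ _ sequentially]) auto
  qed
qed

section \<open>Principal shift-invariant spaces\<close>

lemma AE_shift:
  fixes P :: "real ^ 'd::finite \<Rightarrow> bool"
  shows "AE y in lborel. P y \<Longrightarrow> AE x in lborel. P (x + a)"
  using AE_lborel_affine[of P 1 a] by (simp add: add.commute)

lemma AE_scale:
  fixes P :: "real ^ 'd::finite \<Rightarrow> bool"
  shows "AE y in lborel. P y \<Longrightarrow> c \<noteq> 0 \<Longrightarrow> AE x in lborel. P (c *\<^sub>R x)"
  using AE_lborel_affine[of P c 0] by simp

lemma cis_inner_dual:
  assumes "j \<in> integer_points" "\<alpha> \<in> dual_lattice"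
  shows "cis (j \<bullet> \<alpha>) = 1"
proof -
  obtain a where a: "a \<in> integer_points" "\<alpha> = (2 * pi) *\<^sub>R a" using assms(2) by (auto simp: dual_lattice_def)
  have "j \<bullet> a = (\<Sum>i\<in>UNIV. j $ i * a $ i)" by (simp add: inner_vec_def)
  also have "\<dots> \<in> \<int>" using a(1) assms(1) by (intro Ints_sum Ints_mult) (auto simp: integer_points_def)
  finally have "cis (2 * pi * (j \<bullet> a)) = 1" by (rule cis_multiple_2pi)
  then show ?thesis by (simp add: a(2))
qed

lemma dual_lattice_norm:
  assumes "\<alpha> \<in> dual_lattice" "\<alpha> \<noteq> 0"
  shows "norm \<alpha> \<ge> 2 * pi"
proof -
  obtain a where a: "a \<in> integer_points" "\<alpha> = (2 * pi) *\<^sub>R a" using assms(1) by (auto simp: dual_lattice_def)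
  then have "a \<noteq> 0" using assms(2) by auto
  then obtain i where i: "a $ i \<noteq> 0" by (auto simp: vec_eq_iff)
  have "a $ i \<in> \<int>" using a(1) by (simp add: integer_points_def)
  then have "1 \<le> \<bar>a $ i\<bar>" using i by (rule Ints_nonzero_abs_ge1)
  also have "\<dots> \<le> norm a" by (rule component_le_norm_cart)
  finally show ?thesis by (simp add: a(2))
qed

text \<open>The distributions whose transform \<open>g^\<close> has the ratio \<open>g^ / \<phi>^\<close> invariant under the shift \<open>\<alpha>\<close>, with the
denominators cleared.\<close>

definition proportional :: "real \<Rightarrow> 'd::finite dist \<Rightarrow> real ^ 'd \<Rightarrow> 'd dist set" where
  "proportional s \<phi> \<alpha> = {g \<in> sobolev s. AE u in lborel. fhat g u * fhat \<phi> (u + \<alpha>) = fhat g (u + \<alpha>) * fhat \<phi> u}"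

lemma sobolev_null_subseq:
  fixes d :: "nat \<Rightarrow> 'd::finite dist"
  assumes d: "\<And>n. d n \<in> sobolev s" and lim: "(\<lambda>n. sobolev_norm s (d n)) \<longlonglongrightarrow> 0"
  shows "\<exists>r. strict_mono r \<and> (AE \<omega> in lborel. (\<lambda>n. fhat (d (r n)) \<omega>) \<longlonglongrightarrow> 0)"
proof -
  let ?u = "\<lambda>n \<omega>. weight s \<omega> * (norm (fhat (d n) \<omega>))\<^sup>2"
  have "\<exists>r::nat \<Rightarrow> nat. strict_mono r \<and> (AE \<omega> in lborel. (\<lambda>n. ?u (r n) \<omega>) \<longlonglongrightarrow> 0)"
  proof (rule tendsto_L1_AE_subseq)
    show "integrable lborel (?u n)" for n
      using d[of n] by (simp add: sobolev_def weight_def)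
    have "(LINT \<omega>|lborel. norm (?u n \<omega>)) = (sobolev_norm s (d n))\<^sup>2" for n
      unfolding sobolev_norm_def weight_def[symmetric] by (subst real_sqrt_pow2) (auto simp: abs_mult)
    moreover have "(\<lambda>n. (sobolev_norm s (d n))\<^sup>2) \<longlonglongrightarrow> 0\<^sup>2" by (intro tendsto_power lim)
    ultimately show "(\<lambda>n. LINT \<omega>|lborel. norm (?u n \<omega>)) \<longlonglongrightarrow> 0" by simp
  qed
  then obtain r where r: "strict_mono r" "AE \<omega> in lborel. (\<lambda>n. ?u (r n) \<omega>) \<longlonglongrightarrow> 0" by blast
  from r(2) have "AE \<omega> in lborel. (\<lambda>n. fhat (d (r n)) \<omega>) \<longlonglongrightarrow> 0"
  proof (rule AE_mp, intro AE_I2 impI)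
    fix \<omega> :: "real^'d" assume "(\<lambda>n. ?u (r n) \<omega>) \<longlonglongrightarrow> 0"
    then have "(\<lambda>n. sqrt ((1 / weight s \<omega>) * ?u (r n) \<omega>)) \<longlonglongrightarrow> sqrt ((1 / weight s \<omega>) * 0)"
      by (intro tendsto_real_sqrt tendsto_mult tendsto_const)
    moreover have "sqrt ((1 / weight s \<omega>) * ?u (r n) \<omega>) = norm (fhat (d (r n)) \<omega>)" for n
      using weight_pos[of s \<omega>] by (simp add: field_simps del: weight_pos)
    ultimately have "(\<lambda>n. norm (fhat (d (r n)) \<omega>)) \<longlonglongrightarrow> 0" by simp
    then show "(\<lambda>n. fhat (d (r n)) \<omega>) \<longlonglongrightarrow> 0" by (simp add: tendsto_norm_zero_iff)
  qed
  then show ?thesis using r(1) by blast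
qed

lemma proportional_closed:
  fixes \<phi> :: "'d::finite dist"
  assumes \<phi>: "\<phi> \<in> sobolev s" and \<alpha>: "\<alpha> \<in> dual_lattice"
  shows "sobolev_closed_subspace s (proportional s \<phi> \<alpha>)"
    and "\<forall>j\<in>integer_points. \<forall>g\<in>proportional s \<phi> \<alpha>. translate j g \<in> proportional s \<phi> \<alpha>"
    and "\<phi> \<in> proportional s \<phi> \<alpha>"
proof -
  let ?V = "proportional s \<phi> \<alpha>"
  have VD: "g \<in> sobolev s" "AE u in lborel. fhat g u * fhat \<phi> (u + \<alpha>) = fhat g (u + \<alpha>) * fhat \<phi> u" if "g \<in> ?V" for g
    using that by (auto simp: proportional_def)
  show phi: "\<phi> \<in> ?V" using \<phi> by (simp add: proportional_def mult.commute)
  have add: "(\<lambda>\<psi>. f \<psi> + g \<psi>) \<in> ?V" if f: "f \<in> ?V" and g: "g \<in> ?V" for f g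
  proof -
    note S = sobolev_add[OF VD(1)[OF f] VD(1)[OF g]]
    from S(2) AE_shift[OF S(2), of \<alpha>] VD(2)[OF f] VD(2)[OF g]
    have "AE u in lborel. fhat (\<lambda>\<psi>. f \<psi> + g \<psi>) u * fhat \<phi> (u + \<alpha>) = fhat (\<lambda>\<psi>. f \<psi> + g \<psi>) (u + \<alpha>) * fhat \<phi> u"
      by eventually_elim (simp add: distrib_right)
    then show ?thesis using S(1) by (simp add: proportional_def)
  qed
  have scale: "(\<lambda>\<psi>. c * f \<psi>) \<in> ?V" if f: "f \<in> ?V" for f c
  proof -
    note S = sobolev_scale[OF VD(1)[OF f], of c]
    from S(2) AE_shift[OF S(2), of \<alpha>] VD(2)[OF f]
    have "AE u in lborel. fhat (\<lambda>\<psi>. c * f \<psi>) u * fhat \<phi> (u + \<alpha>) = fhat (\<lambda>\<psi>. c * f \<psi>) (u + \<alpha>) * fhat \<phi> u"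
      by eventually_elim (simp add: mult.assoc)
    then show ?thesis using S(1) by (simp add: proportional_def)
  qed
  show "\<forall>j\<in>integer_points. \<forall>g\<in>?V. translate j g \<in> ?V"
  proof (intro ballI)
    fix j :: "real ^ 'd" and g assume j: "j \<in> integer_points" and g: "g \<in> ?V"
    note S = sobolev_translate[OF VD(1)[OF g], of j]
    (* Integer translations act by functions of period \<alpha>. *)
    have ce: "cis ((- j) \<bullet> (u + \<alpha>)) = cis ((- j) \<bullet> u)" for u
    proof -
      have "cis ((- j) \<bullet> (u + \<alpha>)) = cis ((- j) \<bullet> u) * cis ((- j) \<bullet> \<alpha>)"
        unfolding inner_add_right cis_mult ..
      then show ?thesis using cis_inner_dual[of "- j" \<alpha>] j \<alpha> by simp
    qed
    from S(2) AE_shift[OF S(2), of \<alpha>] VD(2)[OF g]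
    have "AE u in lborel. fhat (translate j g) u * fhat \<phi> (u + \<alpha>) = fhat (translate j g) (u + \<alpha>) * fhat \<phi> u"
      by eventually_elim (simp add: mult.assoc ce del: inner_minus_left)
    then show "translate j g \<in> ?V" using S(1) by (simp add: proportional_def)
  qed
  have closed: "f \<in> ?V" if g: "\<forall>n. g n \<in> ?V" and f: "f \<in> sobolev s"
    and l: "(\<lambda>n::nat. sobolev_norm s (\<lambda>\<psi>. g n \<psi> - f \<psi>)) \<longlonglongrightarrow> 0" for g f
  proof -
    have gs: "g n \<in> sobolev s" for n using g VD(1) by blast
    note S = sobolev_diff[OF gs f]
    (* Convergence in norm gives pointwise convergence of the transforms along a subsequence,
       and the defining identity survives pointwise limits. *)
    obtain r where r: "strict_mono r" "AE \<omega> in lborel. (\<lambda>n. fhat (\<lambda>\<psi>. g (r n) \<psi> - f \<psi>) \<omega>) \<longlonglongrightarrow> 0"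
      using sobolev_null_subseq[of "\<lambda>n \<psi>. g n \<psi> - f \<psi>", OF S(1) l] by blast
    have "AE \<omega> in lborel. \<forall>n. fhat (\<lambda>\<psi>. g n \<psi> - f \<psi>) \<omega> = fhat (g n) \<omega> - fhat f \<omega>"
      unfolding AE_all_countable using S(2) by blast
    with r(2) have lim: "AE \<omega> in lborel. (\<lambda>n. fhat (g (r n)) \<omega>) \<longlonglongrightarrow> fhat f \<omega>"
      by eventually_elim (simp add: LIM_zero_iff)
    have "AE u in lborel. \<forall>n. fhat (g n) u * fhat \<phi> (u + \<alpha>) = fhat (g n) (u + \<alpha>) * fhat \<phi> u"
      unfolding AE_all_countable using g VD(2) by blast
    with lim AE_shift[OF lim, of \<alpha>]
    have "AE u in lborel. fhat f u * fhat \<phi> (u + \<alpha>) = fhat f (u + \<alpha>) * fhat \<phi> u"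
    proof eventually_elim
      case (elim u)
      have "(\<lambda>n. fhat (g (r n)) u * fhat \<phi> (u + \<alpha>)) \<longlonglongrightarrow> fhat f u * fhat \<phi> (u + \<alpha>)"
        by (intro tendsto_intros elim)
      moreover have "(\<lambda>n. fhat (g (r n)) (u + \<alpha>) * fhat \<phi> u) \<longlonglongrightarrow> fhat f (u + \<alpha>) * fhat \<phi> u"
        by (intro tendsto_intros elim)
      ultimately show ?case using elim(3) LIMSEQ_unique by fastforce
    qed
    then show ?thesis using f by (simp add: proportional_def)
  qed
  have zero: "(\<lambda>\<psi>. 0) \<in> ?V" using scale[OF phi, of 0] by simp
  show "sobolev_closed_subspace s ?V"
    unfolding sobolev_closed_subspace_def
    using VD(1) zero add scale closed by blast
qed

lemma zero_dual_lattice: "0 \<in> dual_lattice"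
  unfolding dual_lattice_def by (rule image_eqI[of _ _ 0]) simp_all

text \<open>The shift-invariant space is the least closed one, and the proportional distributions form a closed
invariant space that contains the generator.\<close>

lemma PSI_space_proportional:
  assumes "\<phi> \<in> sobolev s" "\<alpha> \<in> dual_lattice"
  shows "PSI_space s \<phi> \<subseteq> proportional s \<phi> \<alpha>"
  unfolding PSI_space_def using proportional_closed[OF assms] by blast

lemma PSI_space_sobolev: "\<phi> \<in> sobolev s \<Longrightarrow> PSI_space s \<phi> \<subseteq> sobolev s"
  using PSI_space_proportional[OF _ zero_dual_lattice] by (auto simp: proportional_def)

lemma PSI_space_generator: "\<phi> \<in> PSI_space s \<phi>"
  by (auto simp: PSI_space_def)

lemma PSI_space_closed:
  "f \<in> PSI_space s \<phi> \<Longrightarrow> g \<in> PSI_space s \<phi> \<Longrightarrow> (\<lambda>\<psi>. f \<psi> + g \<psi>) \<in> PSI_space s \<phi>"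
  "f \<in> PSI_space s \<phi> \<Longrightarrow> (\<lambda>\<psi>. c * f \<psi>) \<in> PSI_space s \<phi>"
  "f \<in> PSI_space s \<phi> \<Longrightarrow> j \<in> integer_points \<Longrightarrow> translate j f \<in> PSI_space s \<phi>"
  "(\<lambda>\<psi>. 0) \<in> PSI_space s \<phi>"
  by (auto simp: PSI_space_def sobolev_closed_subspace_def)

text \<open>Linear combinations of translates of \<open>T\<close> have transforms \<open>p T^\<close> with an exponential sum \<open>p\<close>. Integer
frequencies give elements of the shift-invariant space, arbitrary ones give approximations to cut-offs
of \<open>T^\<close>.\<close>

lemma exp_sums_action:
  assumes p: "p \<in> exp_sums \<Lambda>" and VS: "V \<subseteq> sobolev s" and T: "T \<in> sobolev s"
    and add: "\<And>f g. f \<in> V \<Longrightarrow> g \<in> V \<Longrightarrow> (\<lambda>\<psi>. f \<psi> + g \<psi>) \<in> V"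
    and scale: "\<And>f c. f \<in> V \<Longrightarrow> (\<lambda>\<psi>. c * f \<psi>) \<in> V"
    and tr: "\<And>l. l \<in> \<Lambda> \<Longrightarrow> translate (- l) T \<in> V"
  shows "\<exists>g\<in>V. AE \<omega> in lborel. fhat g \<omega> = p \<omega> * fhat T \<omega>"
  using p
proof induction
  case (exp_sums_cis l)
  show ?case using sobolev_translate(2)[OF T, of "- l"] tr[OF exp_sums_cis] by auto
next
  case (exp_sums_add p q)
  then obtain f g where f: "f \<in> V" "AE \<omega> in lborel. fhat f \<omega> = p \<omega> * fhat T \<omega>"
    and g: "g \<in> V" "AE \<omega> in lborel. fhat g \<omega> = q \<omega> * fhat T \<omega>" by blast
  have "AE \<omega> in lborel. fhat (\<lambda>\<psi>. f \<psi> + g \<psi>) \<omega> = fhat f \<omega> + fhat g \<omega>"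
    using f(1) g(1) VS by (intro sobolev_add(2)[of f s]) auto
  with f(2) g(2) have "AE \<omega> in lborel. fhat (\<lambda>\<psi>. f \<psi> + g \<psi>) \<omega> = (p \<omega> + q \<omega>) * fhat T \<omega>"
    by eventually_elim (simp add: distrib_right)
  then show ?case using add[OF f(1) g(1)] by blast
next
  case (exp_sums_scale p c)
  then obtain f where f: "f \<in> V" "AE \<omega> in lborel. fhat f \<omega> = p \<omega> * fhat T \<omega>" by blast
  have "AE \<omega> in lborel. fhat (\<lambda>\<psi>. c * f \<psi>) \<omega> = c * fhat f \<omega>"
    using f(1) VS by (intro sobolev_scale(2)[of f s]) auto
  with f(2) have "AE \<omega> in lborel. fhat (\<lambda>\<psi>. c * f \<psi>) \<omega> = (c * p \<omega>) * fhat T \<omega>"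
    by eventually_elim (simp add: mult.assoc)
  then show ?case using scale[OF f(1)] by blast
qed

lemma PSI_space_multiplier:
  assumes \<phi>: "\<phi> \<in> sobolev s" and p: "p \<in> exp_sums integer_points"
  shows "\<exists>g\<in>PSI_space s \<phi>. AE \<omega> in lborel. fhat g \<omega> = p \<omega> * fhat \<phi> \<omega>"
  by (rule exp_sums_action[OF p PSI_space_sobolev[OF \<phi>] \<phi>])
     (auto intro: PSI_space_closed PSI_space_generator)

lemma finite_energy_measure:
  fixes F :: "real ^ 'd::finite \<Rightarrow> complex"
  assumes [measurable]: "F \<in> borel_measurable borel" and "energy s F < \<infinity>"
  shows "finite_measure (density lborel (\<lambda>\<omega>. ennreal (weight s \<omega> * (norm (F \<omega>))\<^sup>2)))"
  using assms(2) by (intro finite_measureI) (simp add: emeasure_density energy_def)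

lemma energy_mult_eq:
  fixes F :: "real ^ 'd::finite \<Rightarrow> complex"
  assumes [measurable]: "F \<in> borel_measurable borel" "G \<in> borel_measurable borel"
  shows "(\<integral>\<^sup>+\<omega>. ennreal ((norm (G \<omega>))\<^sup>2) \<partial>density lborel (\<lambda>\<omega>. ennreal (weight s \<omega> * (norm (F \<omega>))\<^sup>2))) = energy s (\<lambda>\<omega>. G \<omega> * F \<omega>)"
proof -
  have "(\<integral>\<^sup>+\<omega>. ennreal ((norm (G \<omega>))\<^sup>2) \<partial>density lborel (\<lambda>\<omega>. ennreal (weight s \<omega> * (norm (F \<omega>))\<^sup>2)))
    = (\<integral>\<^sup>+\<omega>. ennreal (weight s \<omega> * (norm (F \<omega>))\<^sup>2) * ennreal ((norm (G \<omega>))\<^sup>2) \<partial>lborel)"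
    by (rule nn_integral_density) measurable
  also have "\<dots> = energy s (\<lambda>\<omega>. G \<omega> * F \<omega>)"
    unfolding energy_def
    by (intro nn_integral_cong) (simp add: norm_mult power_mult_distrib mult_ac flip: ennreal_mult)
  finally show ?thesis .
qed

text \<open>A product \<open>\<tau> T^\<close> is close to the transform of an element of the Sobolev space. Exponential sums in
place of \<open>\<tau>\<close> make this element explicit, as a combination of translates of \<open>T\<close>.\<close>

lemma approximate_multiplier:
  fixes \<tau> :: "real ^ 'd::finite \<Rightarrow> complex"
  assumes T: "T \<in> sobolev s" and \<tau>: "\<tau> \<in> borel_measurable borel" "\<And>\<omega>. norm (\<tau> \<omega>) \<le> B" and e: "\<epsilon> > 0"
  shows "\<exists>f\<in>sobolev s. energy s (\<lambda>\<omega>. \<tau> \<omega> * fhat T \<omega> - fhat f \<omega>) < ennreal \<epsilon>"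
proof -
  note TD = sobolevD[OF T]
  note [measurable] = TD(4) \<tau>(1)
  obtain p where p: "p \<in> exp_sums UNIV"
    "(\<integral>\<^sup>+\<omega>. ennreal ((norm (\<tau> \<omega> - p \<omega>))\<^sup>2) \<partial>density lborel (\<lambda>\<omega>. ennreal (weight s \<omega> * (norm (fhat T \<omega>))\<^sup>2))) < ennreal \<epsilon>"
    by (rule exponential_density[OF finite_energy_measure[OF TD(4,5)] _ \<tau> e]) simp_all
  note [measurable] = exp_sums_measurable[OF p(1)]
  have "\<exists>f\<in>sobolev s. AE \<omega> in lborel. fhat f \<omega> = p \<omega> * fhat T \<omega>"
    by (rule exp_sums_action[OF p(1) order_refl T]) (auto intro: sobolev_add sobolev_scale sobolev_translate T)
  then obtain f where f: "f \<in> sobolev s" "AE \<omega> in lborel. fhat f \<omega> = p \<omega> * fhat T \<omega>" by blast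
  have "energy s (\<lambda>\<omega>. \<tau> \<omega> * fhat T \<omega> - fhat f \<omega>) = energy s (\<lambda>\<omega>. (\<tau> \<omega> - p \<omega>) * fhat T \<omega>)"
    by (rule energy_cong) (use f(2) in eventually_elim, simp add: left_diff_distrib)
  also have "\<dots> < ennreal \<epsilon>" using p(2) by (simp add: energy_mult_eq)
  finally show ?thesis using f(1) by blast
qed

lemma sobolev_norm_nonneg: "sobolev_norm s T \<ge> 0"
  unfolding sobolev_norm_def by (intro real_sqrt_ge_zero integral_nonneg_AE) auto

lemma approximant_exists:
  fixes S :: "'d::finite dist set"
  assumes "(INF g\<in>dilate h ` S. sobolev_norm s (\<lambda>\<psi>. f \<psi> - g \<psi>)) \<le> X" "S \<noteq> {}" "\<delta> > 0"
  shows "\<exists>g\<in>S. sobolev_norm s (\<lambda>\<psi>. f \<psi> - dilate h g \<psi>) < X + \<delta>"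
proof -
  have "(INF g\<in>dilate h ` S. sobolev_norm s (\<lambda>\<psi>. f \<psi> - g \<psi>)) < X + \<delta>" using assms by linarith
  moreover have "bdd_below ((\<lambda>g. sobolev_norm s (\<lambda>\<psi>. f \<psi> - g \<psi>)) ` dilate h ` S)"
    by (intro bdd_belowI[of _ 0]) (auto simp: sobolev_norm_nonneg)
  ultimately show ?thesis using assms(2) by (subst (asm) cINF_less_iff) auto
qed

section \<open>Necessity of the order condition\<close>

text \<open>The order inequality extends by approximation to targets \<open>\<tau> T^\<close>, in particular to transforms cut off to a
Borel set, for which it can be localized.\<close>

lemma order_for_multipliers:
  fixes \<phi> T :: "'d::finite dist" and \<tau> :: "real ^ 'd \<Rightarrow> complex"
  assumes \<phi>: "\<phi> \<in> sobolev s" and sk: "s < k" and h: "h > 0"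
    and ord: "\<And>f. f \<in> sobolev k \<Longrightarrow> (INF g\<in>dilate h ` PSI_space s \<phi>. sobolev_norm s (\<lambda>\<psi>. f \<psi> - g \<psi>))
          \<le> C * h powr (k - s) * sobolev_norm k f"
    and T: "T \<in> sobolev k" and \<tau>: "\<tau> \<in> borel_measurable borel" "\<And>\<omega>. norm (\<tau> \<omega>) \<le> 1" and e: "\<epsilon> > 0"
  shows "\<exists>g\<in>PSI_space s \<phi>. energy s (\<lambda>\<omega>. \<tau> \<omega> * fhat T \<omega> - fhat (dilate h g) \<omega>)
     \<le> ennreal (8 * (C * h powr (k - s))\<^sup>2) * energy k (\<lambda>\<omega>. \<tau> \<omega> * fhat T \<omega>) + ennreal \<epsilon>"
proof -
  let ?v = "\<lambda>\<omega>. \<tau> \<omega> * fhat T \<omega>"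
  define a where "a = (C * h powr (k - s))\<^sup>2"
  have a0: "a \<ge> 0" by (simp add: a_def)
  (* Chosen so that the accumulated error (6 + 8 a) \<delta> equals \<epsilon>. *)
  define \<delta> where "\<delta> = \<epsilon> / (6 + 8 * a)"
  have \<delta>: "\<delta> > 0" using e a0 by (simp add: \<delta>_def)
  note TD = sobolevD[OF T]
  note [measurable] = TD(4) \<tau>(1)
  have "energy k ?v \<le> energy k (fhat T)"
    unfolding energy_def
    by (intro nn_integral_mono ennreal_leI mult_left_mono power_mono) (auto simp: norm_mult mult_left_le_one_le \<tau>(2))
  then obtain e where ev: "energy k ?v = ennreal e" "e \<ge> 0" using TD(5) by (cases "energy k ?v") auto
  (* The order inequality speaks about elements of the Sobolev space, so it is applied to an f
     whose transform is close to the target. *)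
  obtain f where f: "f \<in> sobolev k" "energy k (\<lambda>\<omega>. ?v \<omega> - fhat f \<omega>) < ennreal \<delta>"
    using approximate_multiplier[OF T \<tau> \<delta>] by blast
  note FD = sobolevD[OF f(1)]
  note [measurable] = FD(4)
  have fs: "f \<in> sobolev s" by (rule sobolev_mono[OF _ f(1)]) (use sk in simp)
  have "energy k (fhat f) \<le> 2 * energy k (\<lambda>\<omega>. fhat f \<omega> - ?v \<omega>) + 2 * energy k ?v"
    using energy_diff_le[of "fhat f" ?v "\<lambda>_. 0" k] by simp
  also have "energy k (\<lambda>\<omega>. fhat f \<omega> - ?v \<omega>) = energy k (\<lambda>\<omega>. ?v \<omega> - fhat f \<omega>)"
    by (rule energy_norm_cong) (rule norm_minus_commute)
  also have "2 * energy k (\<lambda>\<omega>. ?v \<omega> - fhat f \<omega>) + 2 * energy k ?v \<le> 2 * ennreal \<delta> + 2 * ennreal e"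
    using f(2) ev by (intro add_mono mult_left_mono) auto
  also have "\<dots> = ennreal (2 * \<delta> + 2 * e)" using \<delta> ev by (simp add: ennreal_plus ennreal_mult)
  finally have "ennreal ((sobolev_norm k f)\<^sup>2) \<le> ennreal (2 * \<delta> + 2 * e)" by (simp only: FD(6))
  then have fk: "(sobolev_norm k f)\<^sup>2 \<le> 2 * \<delta> + 2 * e"
    by (subst (asm) ennreal_le_iff) (use \<delta> ev in auto)
  have "PSI_space s \<phi> \<noteq> {}" using PSI_space_generator by blast
  then obtain g where g: "g \<in> PSI_space s \<phi>"
    "sobolev_norm s (\<lambda>\<psi>. f \<psi> - dilate h g \<psi>) < C * h powr (k - s) * sobolev_norm k f + sqrt \<delta>"
    using approximant_exists[OF ord[OF f(1)], of "sqrt \<delta>"] \<delta> by auto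
  have gs: "g \<in> sobolev s" using g(1) PSI_space_sobolev[OF \<phi>] by blast
  note D = sobolev_dilate[OF gs h]
  note [measurable] = sobolevD(4)[OF D(1)]
  note FG = sobolev_diff[OF fs D(1)]
  have "(sobolev_norm s (\<lambda>\<psi>. f \<psi> - dilate h g \<psi>))\<^sup>2 \<le> (C * h powr (k - s) * sobolev_norm k f + sqrt \<delta>)\<^sup>2"
    by (rule power_mono[OF less_imp_le[OF g(2)] sobolev_norm_nonneg])
  also have "\<dots> \<le> 2 * (C * h powr (k - s) * sobolev_norm k f)\<^sup>2 + 2 * (sqrt \<delta>)\<^sup>2"
    using sum_squares_bound[of "C * h powr (k - s) * sobolev_norm k f" "sqrt \<delta>"] by (simp add: power2_sum)
  also have "\<dots> = 2 * a * (sobolev_norm k f)\<^sup>2 + 2 * \<delta>"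
    using \<delta> by (simp add: a_def power_mult_distrib)
  also have "\<dots> \<le> 2 * a * (2 * \<delta> + 2 * e) + 2 * \<delta>"
    using fk a0 by (intro add_right_mono mult_left_mono) auto
  finally have n: "(sobolev_norm s (\<lambda>\<psi>. f \<psi> - dilate h g \<psi>))\<^sup>2 \<le> 2 * a * (2 * \<delta> + 2 * e) + 2 * \<delta>" .
  have "energy s (\<lambda>\<omega>. ?v \<omega> - fhat (dilate h g) \<omega>) \<le> 2 * energy s (\<lambda>\<omega>. ?v \<omega> - fhat f \<omega>) + 2 * energy s (\<lambda>\<omega>. fhat f \<omega> - fhat (dilate h g) \<omega>)"
    by (rule energy_diff_le) measurable
  also have "energy s (\<lambda>\<omega>. fhat f \<omega> - fhat (dilate h g) \<omega>) = ennreal ((sobolev_norm s (\<lambda>\<psi>. f \<psi> - dilate h g \<psi>))\<^sup>2)"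
    unfolding sobolevD(6)[OF FG(1)] by (rule energy_cong) (use FG(2) in eventually_elim, simp)
  also have "2 * energy s (\<lambda>\<omega>. ?v \<omega> - fhat f \<omega>) + 2 * ennreal ((sobolev_norm s (\<lambda>\<psi>. f \<psi> - dilate h g \<psi>))\<^sup>2)
     \<le> 2 * ennreal \<delta> + 2 * ennreal (2 * a * (2 * \<delta> + 2 * e) + 2 * \<delta>)"
    using f(2) energy_mono[of s k "\<lambda>\<omega>. ?v \<omega> - fhat f \<omega>"] sk n
    by (intro add_mono mult_left_mono ennreal_leI) auto
  also have "\<dots> = ennreal (2 * \<delta> + 2 * (2 * a * (2 * \<delta> + 2 * e) + 2 * \<delta>))"
  proof -
    have *: "0 \<le> 2 * a * (2 * \<delta> + 2 * e) + 2 * \<delta>" using a0 \<delta> ev(2) by (intro add_nonneg_nonneg mult_nonneg_nonneg) auto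
    have gen: "2 * ennreal x + 2 * ennreal y = ennreal (2 * x + 2 * y)" if "x \<ge> 0" "y \<ge> 0" for x y
      using that by (simp add: ennreal_plus ennreal_mult)
    show ?thesis by (rule gen[OF less_imp_le[OF \<delta>] *])
  qed
  also have "2 * \<delta> + 2 * (2 * a * (2 * \<delta> + 2 * e) + 2 * \<delta>) = (8 * a) * e + (6 + 8 * a) * \<delta>" by (simp add: algebra_simps)
  also have "(6 + 8 * a) * \<delta> = \<epsilon>" using a0 by (simp add: \<delta>_def)
  also have "ennreal (8 * a * e + \<epsilon>) = ennreal (8 * a) * energy k ?v + ennreal \<epsilon>"
    using a0 ev assms(8) by (simp add: ennreal_plus ennreal_mult)
  finally show ?thesis using g(1) unfolding a_def by blast
qed

text \<open>\<open>G\<close> and \<open>G'\<close> are the values of an approximant at two points congruent modulo the lattice, \<open>P\<close> and \<open>Q\<close> those of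
the generator. If the target has value \<open>v\<close> at the first point and \<open>0\<close> at the second, then either \<open>G\<close> is less
than half of \<open>v\<close>, or \<open>G'\<close> is at least \<open>|v Q| / (2 \<eta>)\<close>, and an error occurs in either case.\<close>

lemma two_point_lower_bound:
  fixes v G G' P Q :: complex
  assumes "a \<ge> 0" "b \<ge> 0" "\<eta> > 0" "norm P \<le> \<eta>" "P \<noteq> 0" "G * Q = G' * P"
  shows "(norm v)\<^sup>2 * (min a (b * (norm Q)\<^sup>2 / \<eta>\<^sup>2) / 4) \<le> a * (norm (v - G))\<^sup>2 + b * (norm G')\<^sup>2"
proof (cases "norm G \<ge> norm v / 2")
  case True
  (* G is at least half of v, and proportionality transports this size to G'. *)
  have "norm v / 2 * norm Q \<le> norm G * norm Q" using True by (intro mult_right_mono) auto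
  also have "\<dots> = norm G' * norm P" using assms(6) by (simp flip: norm_mult)
  also have "\<dots> \<le> norm G' * \<eta>" using assms(4) by (intro mult_left_mono) auto
  finally have "(norm v / 2 * norm Q)\<^sup>2 \<le> (norm G' * \<eta>)\<^sup>2" by (intro power_mono) auto
  then have 1: "(norm v)\<^sup>2 * ((norm Q)\<^sup>2 / \<eta>\<^sup>2) / 4 \<le> (norm G')\<^sup>2"
    using assms(3) by (simp add: power_mult_distrib power_divide divide_le_eq mult_ac)
  have "(norm v)\<^sup>2 * (min a (b * (norm Q)\<^sup>2 / \<eta>\<^sup>2) / 4) \<le> (norm v)\<^sup>2 * ((b * (norm Q)\<^sup>2 / \<eta>\<^sup>2) / 4)"
    by (intro mult_left_mono divide_right_mono) auto
  also have "\<dots> = b * ((norm v)\<^sup>2 * ((norm Q)\<^sup>2 / \<eta>\<^sup>2) / 4)" by simp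
  also have "\<dots> \<le> b * (norm G')\<^sup>2" by (rule mult_left_mono[OF 1 assms(2)])
  finally show ?thesis using assms(1) by (simp add: add_increasing)
next
  case False
  then have "norm v / 2 \<le> norm (v - G)" using norm_triangle_ineq2[of v G] by linarith
  then have "(norm v / 2)\<^sup>2 \<le> (norm (v - G))\<^sup>2" by (intro power_mono) auto
  then have 1: "(norm v)\<^sup>2 / 4 \<le> (norm (v - G))\<^sup>2" by (simp add: power_divide)
  have "(norm v)\<^sup>2 * (min a (b * (norm Q)\<^sup>2 / \<eta>\<^sup>2) / 4) \<le> (norm v)\<^sup>2 * (a / 4)"
    by (intro mult_left_mono divide_right_mono) auto
  also have "\<dots> = a * ((norm v)\<^sup>2 / 4)" by simp
  also have "\<dots> \<le> a * (norm (v - G))\<^sup>2" by (rule mult_left_mono[OF 1 assms(1)])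
  finally show ?thesis using assms(2) by (simp add: add_increasing2)
qed

lemma ennreal_add_le_self_imp_0: "a + d \<le> a \<Longrightarrow> a < \<infinity> \<Longrightarrow> d = (0::ennreal)"
  by (cases a; cases d) (auto simp: top_unique simp flip: ennreal_plus)

text \<open>The cut-off of \<open>T^\<close> to the set \<open>B\<close> of frequencies violating the claim would be approximated too well: by
\<open>two_point_lower_bound\<close> its error is at least the integral of the left-hand side against \<open>|T^|\<^sup>2\<close> over \<open>B\<close>,
and by the order inequality at most that of the right-hand side. Hence \<open>B\<close> is null.\<close>

lemma annulus_estimate:
  fixes \<phi> T :: "'d::finite dist" and Z :: "(real ^ 'd) set"
  assumes \<phi>: "\<phi> \<in> sobolev s" and sk: "s < k" and h: "h > 0"
    and ord: "\<And>f. f \<in> sobolev k \<Longrightarrow> (INF g\<in>dilate h ` PSI_space s \<phi>. sobolev_norm s (\<lambda>\<psi>. f \<psi> - g \<psi>))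
          \<le> C * h powr (k - s) * sobolev_norm k f"
    and T: "T \<in> sobolev k" "AE \<omega> in lborel. \<omega> \<in> Z \<longrightarrow> fhat T \<omega> \<noteq> 0"
    and Z: "Z \<in> sets borel" and \<alpha>: "\<alpha> \<in> dual_lattice"
    and disj: "\<And>\<omega>. \<omega> \<in> Z \<Longrightarrow> \<omega> + (1 / h) *\<^sub>R \<alpha> \<notin> Z"
    and \<eta>: "\<eta> > 0" "AE \<omega> in lborel. \<omega> \<in> Z \<longrightarrow> norm (fhat \<phi> (h *\<^sub>R \<omega>)) \<le> \<eta> \<and> fhat \<phi> (h *\<^sub>R \<omega>) \<noteq> 0"
  shows "AE \<omega> in lborel. \<omega> \<in> Z \<longrightarrow>
     min (weight s \<omega>) (weight s (\<omega> + (1 / h) *\<^sub>R \<alpha>) * (norm (fhat \<phi> (h *\<^sub>R \<omega> + \<alpha>)))\<^sup>2 / \<eta>\<^sup>2) / 4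
       \<le> 8 * (C * h powr (k - s))\<^sup>2 * weight k \<omega>"
proof -
  let ?\<alpha> = "(1 / h) *\<^sub>R \<alpha>"
  define m where "m \<omega> = min (weight s \<omega>) (weight s (\<omega> + ?\<alpha>) * (norm (fhat \<phi> (h *\<^sub>R \<omega> + \<alpha>)))\<^sup>2 / \<eta>\<^sup>2) / 4" for \<omega>
  define K where "K = 8 * (C * h powr (k - s))\<^sup>2"
  (* The set of counterexamples in Z; it is shown to be null. *)
  define B where "B = {\<omega>\<in>Z. K * weight k \<omega> < m \<omega>}"
  define \<tau> :: "real^'d \<Rightarrow> complex" where "\<tau> = indicator B"
  have K0: "K \<ge> 0" by (simp add: K_def)
  have m0: "m \<omega> \<ge> 0" for \<omega> by (simp add: m_def)
  note TD = sobolevD[OF T(1)] and PD = sobolevD[OF \<phi>]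
  note [measurable] = TD(4) PD(4) Z
  have [measurable]: "m \<in> borel_measurable borel" unfolding m_def[abs_def] by measurable
  have Bm [measurable]: "B \<in> sets borel" unfolding B_def by measurable
  have \<tau>m [measurable]: "\<tau> \<in> borel_measurable borel" unfolding \<tau>_def by measurable
  have \<tau>1: "norm (\<tau> \<omega>) \<le> 1" for \<omega> by (simp add: \<tau>_def indicator_def)
  let ?v = "\<lambda>\<omega>. \<tau> \<omega> * fhat T \<omega>"
  let ?L = "\<integral>\<^sup>+\<omega>. ennreal (indicator B \<omega> * (norm (fhat T \<omega>))\<^sup>2 * m \<omega>) \<partial>lborel"
  have fin: "energy k ?v < \<infinity>"
  proof -
    have "energy k ?v \<le> energy k (fhat T)"
      unfolding energy_def
      by (intro nn_integral_mono ennreal_leI mult_left_mono power_mono) (auto simp: norm_mult mult_left_le_one_le \<tau>1)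
    then show ?thesis using TD(5) by (rule order.strict_trans1)
  qed
  (* The order inequality for the target ?v, bounded below by pairing the points \<omega> and \<omega> + \<alpha>/h. *)
  have "?L \<le> ennreal K * energy k ?v"
  proof (rule ennreal_le_epsilon)
    fix \<epsilon> :: real assume e: "\<epsilon> > 0"
    obtain g where g: "g \<in> PSI_space s \<phi>"
      "energy s (\<lambda>\<omega>. ?v \<omega> - fhat (dilate h g) \<omega>) \<le> ennreal K * energy k ?v + ennreal \<epsilon>"
      unfolding K_def using order_for_multipliers[OF \<phi> sk h ord T(1) \<tau>m \<tau>1 e] by blast
    have gs: "g \<in> sobolev s" using g(1) PSI_space_sobolev[OF \<phi>] by blast
    note D = sobolev_dilate[OF gs h]
    let ?G = "fhat (dilate h g)"
    note [measurable] = sobolevD(4)[OF D(1)]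
    have ppt: "AE u in lborel. fhat g u * fhat \<phi> (u + \<alpha>) = fhat g (u + \<alpha>) * fhat \<phi> u"
      using g(1) PSI_space_proportional[OF \<phi> \<alpha>] by (auto simp: proportional_def)
    have rel: "AE \<omega> in lborel. ?G \<omega> * fhat \<phi> (h *\<^sub>R \<omega> + \<alpha>) = ?G (\<omega> + ?\<alpha>) * fhat \<phi> (h *\<^sub>R \<omega>)"
    proof -
      have "AE \<omega> in lborel. fhat g (h *\<^sub>R \<omega>) * fhat \<phi> (h *\<^sub>R \<omega> + \<alpha>) = fhat g (h *\<^sub>R \<omega> + \<alpha>) * fhat \<phi> (h *\<^sub>R \<omega>)"
        using AE_scale[OF ppt, of h] h by simp
      with D(2) AE_shift[OF D(2), of ?\<alpha>] show ?thesis
        by eventually_elim (use h in \<open>simp add: scaleR_right_distrib mult.assoc\<close>)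
    qed
    let ?H = "\<lambda>\<omega>. ennreal (weight s \<omega> * (norm (?v \<omega> - ?G \<omega>))\<^sup>2)"
    have "?L \<le> (\<integral>\<^sup>+\<omega>. indicator Z \<omega> * (?H \<omega> + ?H (\<omega> + ?\<alpha>)) \<partial>lborel)"
    proof (rule nn_integral_mono_AE)
      from rel \<eta>(2)
      show "AE \<omega> in lborel. ennreal (indicator B \<omega> * (norm (fhat T \<omega>))\<^sup>2 * m \<omega>) \<le> indicator Z \<omega> * (?H \<omega> + ?H (\<omega> + ?\<alpha>))"
      proof eventually_elim
        case (elim \<omega>)
        show ?case
        proof (cases "\<omega> \<in> B")
          case True
          then have zZ: "\<omega> \<in> Z" by (simp add: B_def)
          then have "\<omega> + ?\<alpha> \<notin> B" using disj by (auto simp: B_def)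
          then have v0: "?v (\<omega> + ?\<alpha>) = 0" by (simp add: \<tau>_def)
          have v1: "?v \<omega> = fhat T \<omega>" using True by (simp add: \<tau>_def)
          have "(norm (fhat T \<omega>))\<^sup>2 * m \<omega> \<le> weight s \<omega> * (norm (fhat T \<omega> - ?G \<omega>))\<^sup>2 + weight s (\<omega> + ?\<alpha>) * (norm (?G (\<omega> + ?\<alpha>)))\<^sup>2"
            unfolding m_def using elim zZ \<eta>(1) by (intro two_point_lower_bound) auto
          then have "ennreal ((norm (fhat T \<omega>))\<^sup>2 * m \<omega>) \<le> ?H \<omega> + ?H (\<omega> + ?\<alpha>)"
            unfolding v0 v1 by (simp add: ennreal_leI flip: ennreal_plus)
          then show ?thesis using True zZ by simp
        qed simp
      qed
    qed
    also have "\<dots> = (\<integral>\<^sup>+\<omega>. indicator Z \<omega> * ?H \<omega> \<partial>lborel) + (\<integral>\<^sup>+\<omega>. indicator Z \<omega> * ?H (\<omega> + ?\<alpha>) \<partial>lborel)"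
      by (simp add: distrib_left nn_integral_add)
    also have "(\<integral>\<^sup>+\<omega>. indicator Z \<omega> * ?H (\<omega> + ?\<alpha>) \<partial>lborel) = (\<integral>\<^sup>+\<omega>. indicator Z (\<omega> - ?\<alpha>) * ?H \<omega> \<partial>lborel)"
      using nn_integral_shift[of "\<lambda>\<omega>. indicator Z \<omega> * ?H (\<omega> + ?\<alpha>)" ?\<alpha>] by simp
    also have "(\<integral>\<^sup>+\<omega>. indicator Z \<omega> * ?H \<omega> \<partial>lborel) + (\<integral>\<^sup>+\<omega>. indicator Z (\<omega> - ?\<alpha>) * ?H \<omega> \<partial>lborel)
      = (\<integral>\<^sup>+\<omega>. indicator Z \<omega> * ?H \<omega> + indicator Z (\<omega> - ?\<alpha>) * ?H \<omega> \<partial>lborel)"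
      by (rule nn_integral_add[symmetric]) measurable
    also have "\<dots> \<le> energy s (\<lambda>\<omega>. ?v \<omega> - ?G \<omega>)"
      unfolding energy_def
    proof (rule nn_integral_mono)
      fix \<omega>
      have "\<not> (\<omega> \<in> Z \<and> \<omega> - ?\<alpha> \<in> Z)" using disj[of "\<omega> - ?\<alpha>"] by auto
      then show "indicator Z \<omega> * ?H \<omega> + indicator Z (\<omega> - ?\<alpha>) * ?H \<omega> \<le> ?H \<omega>"
        by (auto simp: indicator_def)
    qed
    also have "\<dots> \<le> ennreal K * energy k ?v + ennreal \<epsilon>" by (rule g(2))
    finally show "?L \<le> ennreal K * energy k ?v + ennreal \<epsilon>" .
  qed
  moreover have "ennreal K * energy k ?v = (\<integral>\<^sup>+\<omega>. ennreal (indicator B \<omega> * (norm (fhat T \<omega>))\<^sup>2 * (K * weight k \<omega>)) \<partial>lborel)" (is "_ = ?A")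
  proof -
    have "ennreal K * energy k ?v = (\<integral>\<^sup>+\<omega>. ennreal K * ennreal (weight k \<omega> * (norm (?v \<omega>))\<^sup>2) \<partial>lborel)"
      unfolding energy_def by (rule nn_integral_cmult[symmetric]) measurable
    also have "\<dots> = ?A"
      by (intro nn_integral_cong) (simp add: K0 \<tau>_def indicator_def mult_ac flip: ennreal_mult)
    finally show ?thesis .
  qed
  ultimately have LA: "?L \<le> ?A" by simp
  have Afin: "?A < \<infinity>"
    using \<open>ennreal K * energy k ?v = ?A\<close> fin by (metis ennreal_less_top ennreal_mult_less_top infinity_ennreal_def)
  (* On B the integrand of ?L exceeds that of ?A; as ?L is at most ?A and finite, the excess
     ?D vanishes. *)
  let ?D = "\<integral>\<^sup>+\<omega>. ennreal (indicator B \<omega> * (norm (fhat T \<omega>))\<^sup>2 * (m \<omega> - K * weight k \<omega>)) \<partial>lborel"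
  have "?A + ?D = (\<integral>\<^sup>+\<omega>. ennreal (indicator B \<omega> * (norm (fhat T \<omega>))\<^sup>2 * (K * weight k \<omega>)) + ennreal (indicator B \<omega> * (norm (fhat T \<omega>))\<^sup>2 * (m \<omega> - K * weight k \<omega>)) \<partial>lborel)"
    by (rule nn_integral_add[symmetric]) measurable
  also have "\<dots> = ?L"
  proof (rule nn_integral_cong)
    fix \<omega>
    show "ennreal (indicator B \<omega> * (norm (fhat T \<omega>))\<^sup>2 * (K * weight k \<omega>)) + ennreal (indicator B \<omega> * (norm (fhat T \<omega>))\<^sup>2 * (m \<omega> - K * weight k \<omega>))
      = ennreal (indicator B \<omega> * (norm (fhat T \<omega>))\<^sup>2 * m \<omega>)"
    proof (cases "\<omega> \<in> B")
      case True
      then have "m \<omega> - K * weight k \<omega> \<ge> 0" by (simp add: B_def)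
      then show ?thesis using K0 True by (subst ennreal_plus[symmetric]) (simp_all flip: distrib_left)
    qed simp
  qed
  finally have "?A + ?D \<le> ?A" using LA by simp
  then have "?D = 0" using Afin by (rule ennreal_add_le_self_imp_0)
  then have "AE \<omega> in lborel. ennreal (indicator B \<omega> * (norm (fhat T \<omega>))\<^sup>2 * (m \<omega> - K * weight k \<omega>)) = 0"
    by (subst (asm) nn_integral_0_iff_AE) auto
  with T(2) have "AE \<omega> in lborel. \<omega> \<in> Z \<longrightarrow> m \<omega> \<le> K * weight k \<omega>"
  proof eventually_elim
    case (elim \<omega>)
    show ?case
    proof (intro impI, rule ccontr)
      assume z: "\<omega> \<in> Z" and "\<not> m \<omega> \<le> K * weight k \<omega>"
      then have "\<omega> \<in> B" "m \<omega> - K * weight k \<omega> > 0" by (auto simp: B_def)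
      moreover from this have "(norm (fhat T \<omega>))\<^sup>2 * (m \<omega> - K * weight k \<omega>) \<le> 0" using elim(2) by (simp add: ennreal_eq_0_iff)
      moreover have "(norm (fhat T \<omega>))\<^sup>2 > 0" using elim(1) z by simp
      ultimately show False by (metis mult_pos_pos not_le)
    qed
  qed
  then show ?thesis unfolding m_def K_def .
qed

text \<open>On the scale \<open>h\<close> the annulus estimate says \<open>|\<phi>^(h \<omega> + \<alpha>)|\<^sup>2 = O(h\<^sup>2\<^sup>k)\<close> for \<open>\<omega>\<close> in a fixed annulus: the weight at
\<open>\<omega> + \<alpha>/h\<close> is of size \<open>h\<^sup>-\<^sup>2\<^sup>s\<close>, which cancels against the factor \<open>h\<^sup>-\<^sup>2\<^sup>s\<close> in the squared rate. The dyadic scales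
assemble these annuli to a ball.\<close>

theorem approximation_order_necessary:
  fixes \<phi> :: "'d::finite dist" and k :: nat
  assumes sk: "s < real k" and \<phi>: "\<phi> \<in> sobolev s" and \<eta>: "\<eta> > 0" and \<rho>: "\<rho> > 0"
    and bd: "AE \<omega> in lborel. \<omega> \<in> ball 0 \<rho> \<longrightarrow> norm (fhat \<phi> \<omega>) \<le> \<eta> \<and> fhat \<phi> \<omega> \<noteq> 0"
    and order: "provides_approximation_order s (PSI_space s \<phi>) (real k)"
    and \<alpha>: "\<alpha> \<in> dual_lattice" "\<alpha> \<noteq> 0"
  shows "\<exists>C r. r > 0 \<and> (AE \<omega> in lborel. norm \<omega> < r \<longrightarrow> norm (fhat \<phi> (\<omega> + \<alpha>)) \<le> C * norm \<omega> ^ k)"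
proof -
  obtain C where C: "\<And>f h. f \<in> sobolev (real k) \<Longrightarrow> h > 0 \<Longrightarrow>
      (INF g\<in>dilate h ` PSI_space s \<phi>. sobolev_norm s (\<lambda>\<psi>. f \<psi> - g \<psi>)) \<le> C * h powr (real k - s) * sobolev_norm (real k) f"
    using order unfolding provides_approximation_order_def by blast
  (* The transform of the bump is continuous with positive value at 0, hence free of zeros near
     the origin. *)
  let ?f0 = "\<lambda>x::real^'d. complex_of_real (bump x)"
  define T where "T = test_dist ?f0"
  have Ts: "T \<in> sobolev (real k)" and Tf: "AE \<omega> in lborel. fhat T \<omega> = fourier ?f0 \<omega>"
    unfolding T_def by (rule test_dist_sobolev[OF bump_test])+
  have "fourier ?f0 0 \<noteq> 0"
    using bump_scaled_integral(2)[of 1, where 'd = 'd] by (simp add: fourier_eq)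
  moreover have "isCont (fourier ?f0) 0"
    by (rule differentiable_imp_continuous_within) (rule smooth_differentiable[OF smooth_fourier[OF bump_test]])
  ultimately obtain r1 where r1: "r1 > 0" "\<And>\<omega>. norm \<omega> < r1 \<Longrightarrow> fourier ?f0 \<omega> \<noteq> 0"
    using continuous_at_avoid[of 0 "fourier ?f0" 0] by (auto simp: dist_norm)
  define r0 where "r0 = min r1 (min 1 \<rho>)"
  have r0: "r0 > 0" "r0 \<le> 1" "r0 \<le> \<rho>" "r0 \<le> r1" using r1(1) \<rho> by (auto simp: r0_def)
  (* Annuli of ratio 2: their dilates by powers of 1/2 cover a punctured ball. *)
  define Z where "Z = {\<omega>::real^'d. r0 / 2 \<le> norm \<omega> \<and> norm \<omega> < r0}"
  have Zm: "Z \<in> sets borel" unfolding Z_def by measurable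
  have TZ: "AE \<omega> in lborel. \<omega> \<in> Z \<longrightarrow> fhat T \<omega> \<noteq> 0"
    using Tf by eventually_elim (use r1(2) r0 in \<open>auto simp: Z_def\<close>)
  have a2: "norm \<alpha> \<ge> 2" using dual_lattice_norm[OF \<alpha>] pi_ge_two by linarith
  define K' where "K' = 8 * C\<^sup>2 * 2 powr (2 * real k)"
  define a0 where "a0 = (2::real) powr (- \<bar>2 * s\<bar>)"
  define K2 where "K2 = sqrt (4 * K' * \<eta>\<^sup>2 * 2 powr \<bar>2 * s\<bar> * norm \<alpha> powr (- (2 * s)))"
  have K'0: "K' \<ge> 0" by (simp add: K'_def)
  have main: "AE \<omega> in lborel. \<omega> \<in> Z \<longrightarrow> norm (fhat \<phi> (h *\<^sub>R \<omega> + \<alpha>)) \<le> K2 * h ^ k"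
    if h: "0 < h" "h \<le> 1" and small: "4 * K' * h powr (2 * (real k - s)) < a0" for h
  proof -
    (* Since |\<alpha>|/h \<ge> 2, the two points cannot lie in Z at once. *)
    have disj: "\<omega> + (1 / h) *\<^sub>R \<alpha> \<notin> Z" if "\<omega> \<in> Z" for \<omega>
    proof
      assume "\<omega> + (1 / h) *\<^sub>R \<alpha> \<in> Z"
      then have "norm ((1 / h) *\<^sub>R \<alpha>) < 2"
        using that r0 norm_triangle_ineq4[of "\<omega> + (1 / h) *\<^sub>R \<alpha>" \<omega>] by (simp add: Z_def)
      moreover have "norm \<alpha> \<le> norm ((1 / h) *\<^sub>R \<alpha>)" 
        using mult_left_le_one_le[of "norm \<alpha>" h] h by (simp add: pos_le_divide_eq mult.commute)
      ultimately show False using a2 by linarith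
    qed
    have bdZ: "AE \<omega> in lborel. \<omega> \<in> Z \<longrightarrow> norm (fhat \<phi> (h *\<^sub>R \<omega>)) \<le> \<eta> \<and> fhat \<phi> (h *\<^sub>R \<omega>) \<noteq> 0"
    proof -
      have "AE \<omega> in lborel. h *\<^sub>R \<omega> \<in> ball 0 \<rho> \<longrightarrow> norm (fhat \<phi> (h *\<^sub>R \<omega>)) \<le> \<eta> \<and> fhat \<phi> (h *\<^sub>R \<omega>) \<noteq> 0"
        using AE_scale[OF bd, of h] h by simp
      then show ?thesis
      proof eventually_elim
        case (elim \<omega>)
        have "h *\<^sub>R \<omega> \<in> ball 0 \<rho>" if "\<omega> \<in> Z"
        proof -
          have "h * norm \<omega> \<le> 1 * norm \<omega>" using h by (intro mult_right_mono) auto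
          also have "\<dots> < \<rho>" using that r0 by (simp add: Z_def)
          finally show ?thesis using h by simp
        qed
        then show ?case using elim by blast
      qed
    qed
    have "AE \<omega> in lborel. \<omega> \<in> Z \<longrightarrow>
     min (weight s \<omega>) (weight s (\<omega> + (1 / h) *\<^sub>R \<alpha>) * (norm (fhat \<phi> (h *\<^sub>R \<omega> + \<alpha>)))\<^sup>2 / \<eta>\<^sup>2) / 4
       \<le> 8 * (C * h powr (real k - s))\<^sup>2 * weight (real k) \<omega>"
      by (rule annulus_estimate[OF \<phi> sk h(1) C[OF _ h(1)] Ts TZ Zm \<alpha>(1) disj \<eta> bdZ])
    then show ?thesis
    proof (eventually_elim, intro impI)
      fix \<omega> assume z: "\<omega> \<in> Z" and "\<omega> \<in> Z \<longrightarrow>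
     min (weight s \<omega>) (weight s (\<omega> + (1 / h) *\<^sub>R \<alpha>) * (norm (fhat \<phi> (h *\<^sub>R \<omega> + \<alpha>)))\<^sup>2 / \<eta>\<^sup>2) / 4
       \<le> 8 * (C * h powr (real k - s))\<^sup>2 * weight (real k) \<omega>"
      then have le: "min (weight s \<omega>) (weight s (\<omega> + (1 / h) *\<^sub>R \<alpha>) * (norm (fhat \<phi> (h *\<^sub>R \<omega> + \<alpha>)))\<^sup>2 / \<eta>\<^sup>2) / 4
       \<le> 8 * (C * h powr (real k - s))\<^sup>2 * weight (real k) \<omega>" by blast
      let ?b = "weight s (\<omega> + (1 / h) *\<^sub>R \<alpha>)" and ?Q = "norm (fhat \<phi> (h *\<^sub>R \<omega> + \<alpha>))" and ?t = "h powr (2 * (real k - s))"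
      have w: "1 \<le> 1 + norm \<omega>" "1 + norm \<omega> \<le> 2" using z r0 by (auto simp: Z_def)
      have wk: "weight (real k) \<omega> \<le> 2 powr (2 * real k)"
        unfolding weight_def using w by (intro powr_mono2) auto
      have ws: "a0 \<le> weight s \<omega>"
      proof -
        have "a0 \<le> (1 + norm \<omega>) powr (- \<bar>2 * s\<bar>)" unfolding a0_def using w by (intro powr_mono2') (auto simp: add_pos_nonneg)
        also have "\<dots> \<le> weight s \<omega>" unfolding weight_def using w by (intro powr_mono) auto
        finally show ?thesis .
      qed
      have sq: "(C * h powr (real k - s))\<^sup>2 = C\<^sup>2 * ?t"
        using h by (simp add: power_mult_distrib powr_powr mult.commute flip: powr_numeral)
      have "8 * (C * h powr (real k - s))\<^sup>2 * weight (real k) \<omega> \<le> 8 * (C * h powr (real k - s))\<^sup>2 * 2 powr (2 * real k)"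
        by (intro mult_left_mono wk) simp
      also have "\<dots> = K' * ?t" by (simp add: K'_def sq)
      finally have "min (weight s \<omega>) (?b * ?Q\<^sup>2 / \<eta>\<^sup>2) / 4 \<le> K' * ?t" by (rule order_trans[OF le])
      then have "min (weight s \<omega>) (?b * ?Q\<^sup>2 / \<eta>\<^sup>2) \<le> 4 * K' * ?t" by simp
      (* For small h the minimum cannot be the first argument. *)
      moreover have "4 * K' * ?t < weight s \<omega>" using small ws by (rule order.strict_trans2)
      ultimately have bQ: "?b * ?Q\<^sup>2 / \<eta>\<^sup>2 \<le> 4 * K' * ?t" by (simp add: min_le_iff_disj)
      have b: "(norm \<alpha> / h) powr (2 * s) \<le> 2 powr \<bar>2 * s\<bar> * ?b"
        unfolding weight_def
      proof (rule powr_comparable)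
        have na: "norm ((1 / h) *\<^sub>R \<alpha>) = norm \<alpha> / h" using h by simp
        have ge: "norm \<alpha> / h \<ge> 2" using a2 h by (simp add: pos_le_divide_eq)
        have up: "norm (\<omega> + (1 / h) *\<^sub>R \<alpha>) \<le> norm \<omega> + norm \<alpha> / h" using norm_triangle_ineq[of \<omega> "(1 / h) *\<^sub>R \<alpha>"] unfolding na .
        have lo: "norm \<alpha> / h \<le> norm (\<omega> + (1 / h) *\<^sub>R \<alpha>) + norm \<omega>"
          using norm_triangle_ineq4[of "\<omega> + (1 / h) *\<^sub>R \<alpha>" \<omega>] by (simp only: add_diff_cancel_left' na)
        show "norm \<alpha> / h > 0" using ge by linarith
        show "1 + norm (\<omega> + (1 / h) *\<^sub>R \<alpha>) > 0" by (simp add: add_pos_nonneg)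
        show "norm \<alpha> / h \<le> 2 * (1 + norm (\<omega> + (1 / h) *\<^sub>R \<alpha>))" using lo w norm_ge_zero[of "\<omega> + (1 / h) *\<^sub>R \<alpha>"] unfolding distrib_left by linarith
        show "1 + norm (\<omega> + (1 / h) *\<^sub>R \<alpha>) \<le> 2 * (norm \<alpha> / h)" using up w ge by linarith
      qed
      have "?b * ?Q\<^sup>2 \<le> 4 * K' * ?t * \<eta>\<^sup>2" using bQ \<eta> by (simp add: pos_divide_le_eq)
      then have "2 powr \<bar>2 * s\<bar> * (?b * ?Q\<^sup>2) \<le> 2 powr \<bar>2 * s\<bar> * (4 * K' * ?t * \<eta>\<^sup>2)" by (rule mult_left_mono) simp
      moreover have "(norm \<alpha> / h) powr (2 * s) * ?Q\<^sup>2 \<le> 2 powr \<bar>2 * s\<bar> * (?b * ?Q\<^sup>2)" unfolding mult.assoc[symmetric] by (intro mult_right_mono b) simp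
      ultimately have q1: "(norm \<alpha> / h) powr (2 * s) * ?Q\<^sup>2 \<le> 2 powr \<bar>2 * s\<bar> * (4 * K' * ?t * \<eta>\<^sup>2)" by (rule order_trans[rotated])
      have inv: "(norm \<alpha> / h) powr (2 * s) * (norm \<alpha> powr (- (2 * s)) * h powr (2 * s)) = 1"
      proof -
        have "norm \<alpha> > 0" using a2 by linarith
        then show ?thesis using h(1) by (simp add: powr_divide powr_minus field_simps)
      qed
      have "(norm \<alpha> powr (- (2 * s)) * h powr (2 * s)) * ((norm \<alpha> / h) powr (2 * s) * ?Q\<^sup>2) \<le> (norm \<alpha> powr (- (2 * s)) * h powr (2 * s)) * (2 powr \<bar>2 * s\<bar> * (4 * K' * ?t * \<eta>\<^sup>2))"
        by (intro mult_left_mono q1) auto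
      also have "(norm \<alpha> powr (- (2 * s)) * h powr (2 * s)) * ((norm \<alpha> / h) powr (2 * s) * ?Q\<^sup>2) = ((norm \<alpha> / h) powr (2 * s) * (norm \<alpha> powr (- (2 * s)) * h powr (2 * s))) * ?Q\<^sup>2"
        by (simp only: mult_ac)
      also have "\<dots> = ?Q\<^sup>2" unfolding inv by simp
      also have "(norm \<alpha> powr (- (2 * s)) * h powr (2 * s)) * (2 powr \<bar>2 * s\<bar> * (4 * K' * ?t * \<eta>\<^sup>2))
         = (4 * K' * \<eta>\<^sup>2 * 2 powr \<bar>2 * s\<bar> * norm \<alpha> powr (- (2 * s))) * (h powr (2 * s) * ?t)" by (simp only: mult_ac)
      also have "h powr (2 * s) * ?t = h powr (2 * real k)" using h by (simp add: right_diff_distrib flip: powr_add)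
      also have "h powr (2 * real k) = (h ^ k)\<^sup>2" using h by (simp add: powr_realpow[symmetric] powr_powr mult.commute flip: powr_numeral)
      also have "4 * K' * \<eta>\<^sup>2 * 2 powr \<bar>2 * s\<bar> * norm \<alpha> powr (- (2 * s)) = K2\<^sup>2"
        unfolding K2_def using K'0 by (subst real_sqrt_pow2) auto
      finally have "?Q\<^sup>2 \<le> (K2 * h ^ k)\<^sup>2" by (simp add: power_mult_distrib)
      moreover have "K2 * h ^ k \<ge> 0" using h K'0 by (simp add: K2_def)
      ultimately show "?Q \<le> K2 * h ^ k" by (rule power2_le_imp_le)
    qed
  qed
  have "((\<lambda>h. 4 * K' * h powr (2 * (real k - s))) \<longlongrightarrow> 4 * K' * 0) (at_right 0)"
    by (intro tendsto_mult tendsto_const tendsto_zero_powrI[of "\<lambda>h. h"]) (use sk in \<open>auto simp: eventually_at_filter\<close>)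
  then have "eventually (\<lambda>h. 4 * K' * h powr (2 * (real k - s)) < a0) (at_right 0)"
    by (rule order_tendstoD(2)) (simp add: a0_def)
  then obtain h1' where h1': "h1' > 0" "\<And>h. 0 < h \<Longrightarrow> h < h1' \<Longrightarrow> 4 * K' * h powr (2 * (real k - s)) < a0"
    by (auto simp: eventually_at_right_field)
  define h1 where "h1 = min 1 (h1' / 2)"
  have h1: "h1 > 0" "h1 \<le> 1" "h1 < h1'" using h1'(1) by (auto simp: h1_def)
  (* Countably many dilations suffice, so one null set is enough. *)
  define hh where "hh n = h1 * (1/2) ^ n" for n :: nat
  have hh: "0 < hh n" "hh n \<le> h1" for n
    using h1 by (auto simp: hh_def power_le_one mult_left_le)
  define K3 where "K3 = K2 * (2 / r0) ^ k"
  have K20: "K2 \<ge> 0" using K'0 by (simp add: K2_def)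
  have "AE u in lborel. \<forall>n. (1 / hh n) *\<^sub>R u \<in> Z \<longrightarrow> norm (fhat \<phi> (u + \<alpha>)) \<le> K2 * hh n ^ k"
    unfolding AE_all_countable
  proof
    fix n
    have "AE \<omega> in lborel. \<omega> \<in> Z \<longrightarrow> norm (fhat \<phi> (hh n *\<^sub>R \<omega> + \<alpha>)) \<le> K2 * hh n ^ k"
      using hh[of n] h1 by (intro main h1'(2)) auto
    from AE_scale[OF this, of "1 / hh n"] show "AE u in lborel. (1 / hh n) *\<^sub>R u \<in> Z \<longrightarrow> norm (fhat \<phi> (u + \<alpha>)) \<le> K2 * hh n ^ k"
      using hh(1)[of n] by simp
  qed
  moreover have "AE u in lborel. u \<noteq> (0::real^'d)" by (rule AE_lborel_singleton)
  ultimately have "AE u in lborel. norm u < h1 * r0 \<longrightarrow> norm (fhat \<phi> (u + \<alpha>)) \<le> K3 * norm u ^ k"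
  proof (eventually_elim, intro impI)
    fix u :: "real^'d"
    assume u: "\<forall>n. (1 / hh n) *\<^sub>R u \<in> Z \<longrightarrow> norm (fhat \<phi> (u + \<alpha>)) \<le> K2 * hh n ^ k" and u0: "u \<noteq> 0" and ul: "norm u < h1 * r0"
    have "(\<lambda>n. h1 * (1/2) ^ n * r0) \<longlonglongrightarrow> h1 * 0 * r0"
      by (intro tendsto_mult tendsto_const LIMSEQ_realpow_zero) auto
    then have "\<forall>\<^sub>F n in sequentially. h1 * (1/2) ^ n * r0 < norm u" by (rule order_tendstoD(2)) (use u0 in simp)
    then have ex: "\<exists>n. hh n * r0 \<le> norm u" by (auto simp: eventually_sequentially hh_def intro: less_imp_le)
    (* The first dyadic annulus reaching down to u; l = n - 1 is the one that contains u. *)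
    define n where "n = (LEAST n. hh n * r0 \<le> norm u)"
    have n: "hh n * r0 \<le> norm u" unfolding n_def using ex by (rule LeastI_ex)
    have "n \<noteq> 0" 
    proof
      assume "n = 0"
      from n[unfolded this] ul show False by (simp add: hh_def)
    qed
    then obtain l where l: "n = Suc l" by (cases n) auto
    have "\<not> hh l * r0 \<le> norm u" using not_less_Least[of l "\<lambda>n. hh n * r0 \<le> norm u"] l n_def by simp
    then have "norm u < hh l * r0" by simp
    moreover have "hh l * (r0 / 2) = hh n * r0" by (simp add: l hh_def)
    ultimately have bounds: "hh l * (r0 / 2) \<le> norm u" "norm u < hh l * r0" using n by (simp_all only:)
    then have "(1 / hh l) *\<^sub>R u \<in> Z" using hh(1)[of l] by (simp add: Z_def field_simps)
    then have "norm (fhat \<phi> (u + \<alpha>)) \<le> K2 * hh l ^ k" using u by blast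
    also have "\<dots> \<le> K2 * ((2 / r0) * norm u) ^ k"
    proof (intro mult_left_mono power_mono K20)
      show "hh l \<le> (2 / r0) * norm u" using bounds r0 by (simp add: field_simps)
    qed (use hh(1)[of l] in simp)
    also have "\<dots> = K3 * norm u ^ k" unfolding K3_def power_mult_distrib by (simp only: mult.assoc)
    finally show "norm (fhat \<phi> (u + \<alpha>)) \<le> K3 * norm u ^ k" .
  qed
  then show ?thesis using h1 r0 by (intro exI[of _ K3] exI[of _ "h1 * r0"]) auto
qed

section \<open>Periodization\<close>

lemma nn_integral_count_space_le_infsum:
  fixes f :: "'a \<Rightarrow> ennreal"
  assumes "countable A"
  shows "(\<integral>\<^sup>+x. f x \<partial>count_space A) \<le> infsum f A"
proof (cases "finite A")
  case True
  then show ?thesis by (simp add: nn_integral_count_space_finite)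
next
  case False
  then have bij: "bij_betw (from_nat_into A) UNIV A" by (rule bij_betw_from_nat_into[OF assms])
  have "(\<integral>\<^sup>+x. f x \<partial>count_space A) = (\<integral>\<^sup>+n. f (from_nat_into A n) \<partial>count_space UNIV)"
    by (rule nn_integral_bij_count_space[OF bij, symmetric])
  also have "\<dots> = (\<Sum>n. f (from_nat_into A n))" by (rule nn_integral_count_space_nat)
  also have "\<dots> \<le> infsum f A"
  proof (rule suminf_le_const)
    fix n
    have inj: "inj_on (from_nat_into A) {..<n}" using bij by (auto simp: bij_betw_def intro: inj_on_subset)
    have "(\<Sum>i<n. f (from_nat_into A i)) = sum f (from_nat_into A ` {..<n})" by (simp add: sum.reindex[OF inj])
    also have "\<dots> \<le> infsum f A"
      unfolding nonneg_infsum_complete[of A f, OF zero_le] using bij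
      by (intro SUP_upper) (auto simp: bij_betw_def)
    finally show "(\<Sum>i<n. f (from_nat_into A i)) \<le> infsum f A" .
  qed simp
  finally show ?thesis .
qed

lemma ennreal_power2_le_imp_le:
  assumes "x\<^sup>2 \<le> (ennreal m)\<^sup>2" "m \<ge> 0"
  shows "x \<le> ennreal m"
proof (cases x)
  case (real a)
  then have "ennreal (a\<^sup>2) \<le> ennreal (m\<^sup>2)" using assms by (simp add: ennreal_power)
  then have "a\<^sup>2 \<le> m\<^sup>2" by (subst (asm) ennreal_le_iff) simp_all
  then have "a \<le> m" using assms(2) by (rule power2_le_imp_le)
  then show ?thesis unfolding real by (rule ennreal_leI)
next
  case top
  then have "top \<le> ennreal (m\<^sup>2)" using assms(1) by (simp add: ennreal_power[OF assms(2)] ennreal_top_eq_mult_iff power2_eq_square[of top])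
  then show ?thesis by (simp add: top_unique)
qed

lemma countable_integer_points: "countable (integer_points :: (real ^ 'd::finite) set)"
proof (rule countable_subset)
  show "(integer_points :: (real^'d) set) \<subseteq> vec_lambda ` (\<Pi>\<^sub>E i\<in>UNIV. \<int>)"
  proof
    fix x :: "real^'d" assume "x \<in> integer_points"
    then show "x \<in> vec_lambda ` (\<Pi>\<^sub>E i\<in>UNIV. \<int>)"
      by (intro image_eqI[of _ _ "($) x"]) (auto simp: integer_points_def)
  qed
  show "countable (vec_lambda ` (\<Pi>\<^sub>E i\<in>(UNIV :: 'd set). (\<int> :: real set)))"
    by (intro countable_image countable_PiE) (auto simp: Ints_def)
qed

lemma countable_dual_lattice: "countable (dual_lattice :: (real ^ 'd::finite) set)"
  unfolding dual_lattice_def by (intro countable_image countable_integer_points)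

text \<open>The representative modulo \<open>2 \<pi> \<int>\<^sup>d\<close> in the cube centred at the origin.\<close>

definition residue_rep :: "real ^ 'd::finite \<Rightarrow> real ^ 'd" where
  "residue_rep u = (\<chi> i. u $ i - 2 * pi * of_int \<lfloor>u $ i / (2 * pi) + 1 / 2\<rfloor>)"

lemma residue_rep_measurable [measurable]: "residue_rep \<in> borel_measurable borel"
  unfolding residue_rep_def[abs_def] by (intro borel_measurable_vec_lambda) measurable

lemma residue_rep_periodic:
  assumes "j \<in> integer_points"
  shows "residue_rep (u + (2 * pi) *\<^sub>R j) = residue_rep u"
proof -
  have "(u $ i + 2 * pi * j $ i) - 2 * pi * of_int \<lfloor>(u $ i + 2 * pi * j $ i) / (2 * pi) + 1 / 2\<rfloor>
     = u $ i - 2 * pi * of_int \<lfloor>u $ i / (2 * pi) + 1 / 2\<rfloor>" for i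
  proof -
    obtain n :: int where n: "j $ i = of_int n" using assms by (auto simp: integer_points_def Ints_def)
    have "(u $ i + 2 * pi * j $ i) / (2 * pi) + 1 / 2 = (u $ i / (2 * pi) + 1 / 2) + of_int n"
      by (simp add: n add_divide_distrib)
    then have "\<lfloor>(u $ i + 2 * pi * j $ i) / (2 * pi) + 1 / 2\<rfloor> = \<lfloor>u $ i / (2 * pi) + 1 / 2\<rfloor> + n"
      by (simp only: floor_add_int)
    then show ?thesis by (simp add: n algebra_simps)
  qed
  then show ?thesis by (simp add: residue_rep_def vec_eq_iff)
qed

lemma residue_rep_dual: "u - residue_rep u \<in> dual_lattice"
proof -
  have "u - residue_rep u = (2 * pi) *\<^sub>R (\<chi> i. of_int \<lfloor>u $ i / (2 * pi) + 1 / 2\<rfloor>)"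
    by (simp add: residue_rep_def vec_eq_iff)
  then show ?thesis unfolding dual_lattice_def by (auto simp: integer_points_def)
qed

lemma residue_rep_id:
  assumes "norm u < 1" shows "residue_rep u = u"
proof -
  have "\<lfloor>u $ i / (2 * pi) + 1 / 2\<rfloor> = 0" for i
  proof -
    have "\<bar>u $ i\<bar> < 1" using component_le_norm_cart[of u i] assms by linarith
    then have "\<bar>u $ i / (2 * pi)\<bar> < 1 / 2" using pi_ge_two by (simp add: abs_divide divide_less_eq)
    then have "0 \<le> u $ i / (2 * pi) + 1 / 2" "u $ i / (2 * pi) + 1 / 2 < 1" by linarith+
    then show ?thesis by (simp add: floor_eq_iff)
  qed
  then show ?thesis by (simp add: residue_rep_def vec_eq_iff)
qed

lemma residue_rep_dual_shift:
  assumes "\<alpha> \<in> dual_lattice" shows "residue_rep (u + \<alpha>) = residue_rep u"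
  using assms residue_rep_periodic by (auto simp: dual_lattice_def)

text \<open>Cutting off large values makes the multiplier of \<open>approximation_step\<close> bounded, as the density theorem
requires.\<close>

lemma energy_truncation:
  fixes F :: "real ^ 'd::finite \<Rightarrow> complex"
  assumes [measurable]: "F \<in> borel_measurable borel" and fin: "energy s F < \<infinity>" and e: "\<epsilon> > 0"
  shows "\<exists>M::nat. energy s (\<lambda>\<omega>. F \<omega> - (if norm (F \<omega>) \<le> real M then F \<omega> else 0)) < ennreal \<epsilon>"
proof -
  (* Cut off at height M and let M grow: dominated convergence. *)
  let ?t = "\<lambda>(M::nat) \<omega>. if norm (F \<omega>) \<le> real M then F \<omega> else 0"
  have "(\<lambda>M. energy s (\<lambda>\<omega>. F \<omega> - ?t M \<omega>)) \<longlonglongrightarrow> (\<integral>\<^sup>+\<omega>. 0 \<partial>(lborel :: (real^'d) measure))"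
    unfolding energy_def
  proof (rule nn_integral_dominated_convergence[where w = "\<lambda>\<omega>. ennreal (weight s \<omega> * (norm (F \<omega>))\<^sup>2)"])
    show "AE \<omega> in lborel. ennreal (weight s \<omega> * (norm (F \<omega> - ?t M \<omega>))\<^sup>2) \<le> ennreal (weight s \<omega> * (norm (F \<omega>))\<^sup>2)" for M
      by (intro AE_I2 ennreal_leI mult_left_mono power_mono) auto
    show "(\<integral>\<^sup>+\<omega>. ennreal (weight s \<omega> * (norm (F \<omega>))\<^sup>2) \<partial>lborel) < \<infinity>" using fin by (simp add: energy_def)
    show "AE \<omega> in lborel. (\<lambda>M. ennreal (weight s \<omega> * (norm (F \<omega> - ?t M \<omega>))\<^sup>2)) \<longlonglongrightarrow> 0"
    proof (rule AE_I2)
      fix \<omega> :: "real^'d"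
      obtain N where N: "norm (F \<omega>) < real N" using reals_Archimedean2 by blast
      have "ennreal (weight s \<omega> * (norm (F \<omega> - ?t M \<omega>))\<^sup>2) = 0" if "M \<ge> N" for M
      proof -
        have "norm (F \<omega>) \<le> real M" using N that by linarith
        then show ?thesis by simp
      qed
      then have "\<forall>\<^sub>F M in sequentially. ennreal (weight s \<omega> * (norm (F \<omega> - ?t M \<omega>))\<^sup>2) = 0"
        unfolding eventually_sequentially by blast
      then show "(\<lambda>M. ennreal (weight s \<omega> * (norm (F \<omega> - ?t M \<omega>))\<^sup>2)) \<longlonglongrightarrow> 0"
        by (rule tendsto_eventually)
    qed
  qed measurable
  then have "(\<lambda>M. energy s (\<lambda>\<omega>. F \<omega> - ?t M \<omega>)) \<longlonglongrightarrow> 0" by simp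
  then have "\<forall>\<^sub>F M in sequentially. energy s (\<lambda>\<omega>. F \<omega> - ?t M \<omega>) < ennreal \<epsilon>"
    by (rule order_tendstoD(2)) (use e in simp)
  then show ?thesis using eventually_happens'[OF sequentially_bot] by blast
qed

text \<open>Substituting \<open>u = h \<omega>\<close> turns the weighted error into an \<open>L\<^sub>2\<close> error for the image of the finite measure with
density \<open>(1 + |\<omega>|)\<^sup>2\<^sup>s |\<Phi>|\<^sup>2\<close>, to which \<open>trigonometric_density\<close> applies.\<close>

lemma approximate_periodic_multiplier:
  fixes \<tau> :: "real ^ 'd::finite \<Rightarrow> complex"
  assumes \<Phi> [measurable]: "\<Phi> \<in> borel_measurable borel" and fin: "energy s \<Phi> < \<infinity>"
    and \<tau> [measurable]: "\<tau> \<in> borel_measurable borel" and B: "\<And>u. norm (\<tau> u) \<le> B"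
    and per: "\<And>u j. j \<in> integer_points \<Longrightarrow> \<tau> (u + (2 * pi) *\<^sub>R j) = \<tau> u" and e: "\<epsilon> > 0"
  shows "\<exists>p\<in>exp_sums integer_points. energy s (\<lambda>\<omega>. (\<tau> (h *\<^sub>R \<omega>) - p (h *\<^sub>R \<omega>)) * \<Phi> \<omega>) < ennreal \<epsilon>"
proof -
  let ?\<nu> = "density lborel (\<lambda>\<omega>. ennreal (weight s \<omega> * (norm (\<Phi> \<omega>))\<^sup>2))"
  let ?\<mu> = "distr ?\<nu> borel (\<lambda>\<omega>. h *\<^sub>R \<omega>)"
  interpret \<nu>: finite_measure ?\<nu> by (rule finite_energy_measure[OF \<Phi> fin])
  have "finite_measure ?\<mu>" by (rule \<nu>.finite_measure_distr) simp
  then obtain p where p: "p \<in> exp_sums integer_points" "(\<integral>\<^sup>+u. ennreal ((norm (\<tau> u - p u))\<^sup>2) \<partial>?\<mu>) < ennreal \<epsilon>"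
    by (rule trigonometric_density[OF _ _ \<tau> B per e]) simp_all
  note [measurable] = exp_sums_measurable[OF p(1)]
  have "(\<integral>\<^sup>+u. ennreal ((norm (\<tau> u - p u))\<^sup>2) \<partial>?\<mu>) = (\<integral>\<^sup>+\<omega>. ennreal ((norm (\<tau> (h *\<^sub>R \<omega>) - p (h *\<^sub>R \<omega>)))\<^sup>2) \<partial>?\<nu>)"
    by (rule nn_integral_distr) measurable
  also have "\<dots> = energy s (\<lambda>\<omega>. (\<tau> (h *\<^sub>R \<omega>) - p (h *\<^sub>R \<omega>)) * \<Phi> \<omega>)"
    by (rule energy_mult_eq) measurable
  finally show ?thesis using p by (intro bexI[of _ p]) auto
qed

section \<open>Sufficiency of the order condition\<close>

text \<open>The tail of the target: for \<open>|\<omega>| \<ge> r / h\<close> the surplus of \<open>k - s\<close> derivatives is worth \<open>h\<^sup>2\<^sup>(\<^sup>k\<^sup>-\<^sup>s\<^sup>)\<close>.\<close>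

lemma weight_far:
  assumes "r > 0" "h > 0" "s < k" "r \<le> h * norm \<omega>"
  shows "weight s \<omega> \<le> r powr (- 2 * (k - s)) * h powr (2 * (k - s)) * weight k \<omega>"
proof -
  let ?a = "1 + norm \<omega>"
  have a: "r / h \<le> ?a" using assms by (simp add: pos_divide_le_eq) (simp add: algebra_simps)
  have ap: "?a > 0" by (simp add: add_pos_nonneg)
  have "?a powr (- 2 * (k - s)) \<le> (r / h) powr (- 2 * (k - s))"
    by (rule powr_mono2') (use a assms in auto)
  also have "\<dots> = r powr (- 2 * (k - s)) * h powr (2 * (k - s))"
  proof -
    have "(r / h) powr (- 2 * (k - s)) = r powr (- 2 * (k - s)) / h powr (- 2 * (k - s))"
      by (rule powr_divide)
    moreover have "h powr (- 2 * (k - s)) = inverse (h powr (2 * (k - s)))" by (simp only: mult_minus_left powr_minus)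
    ultimately show ?thesis by (simp only: divide_inverse inverse_inverse_eq)
  qed
  finally have "?a powr (- 2 * (k - s)) * ?a powr (2 * k) \<le> r powr (- 2 * (k - s)) * h powr (2 * (k - s)) * ?a powr (2 * k)"
    by (intro mult_right_mono) auto
  moreover have "?a powr (- 2 * (k - s)) * ?a powr (2 * k) = ?a powr (2 * s)"
    by (simp add: algebra_simps flip: powr_add)
  ultimately show ?thesis by (simp add: weight_def)
qed

lemma weight_lattice_shift:
  fixes \<alpha> \<omega> :: "real ^ 'd::finite"
  assumes "0 < h" "h \<le> 1" "norm \<alpha> \<ge> 2" "h * norm \<omega> \<le> 1"
  shows "weight s (\<omega> + (1 / h) *\<^sub>R \<alpha>) \<le> 2 powr \<bar>2 * s\<bar> * (norm \<alpha> powr (2 * s) * h powr (- (2 * s)))"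
proof -
  let ?y = "\<omega> + (1 / h) *\<^sub>R \<alpha>"
  have w: "h * norm ?y \<le> h * norm \<omega> + norm \<alpha>" "norm \<alpha> \<le> h * norm ?y + h * norm \<omega>"
  proof -
    have "h *\<^sub>R ?y = h *\<^sub>R \<omega> + \<alpha>" using assms by (simp add: scaleR_right_distrib)
    then have "h * norm ?y = norm (h *\<^sub>R \<omega> + \<alpha>)" using assms by (metis abs_of_pos norm_scaleR)
    moreover have "h * norm \<omega> = norm (h *\<^sub>R \<omega>)" using assms by simp
    moreover have "norm \<alpha> \<le> norm (h *\<^sub>R \<omega> + \<alpha>) + norm (h *\<^sub>R \<omega>)"
      using norm_triangle_ineq4[of "h *\<^sub>R \<omega> + \<alpha>" "h *\<^sub>R \<omega>"] by (simp only: add_diff_cancel_left')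
    ultimately show "h * norm ?y \<le> h * norm \<omega> + norm \<alpha>" "norm \<alpha> \<le> h * norm ?y + h * norm \<omega>"
      using norm_triangle_ineq[of "h *\<^sub>R \<omega>" \<alpha>] by (simp_all only:)
  qed
  have "weight s ?y \<le> 2 powr \<bar>2 * s\<bar> * (norm \<alpha> / h) powr (2 * s)"
    unfolding weight_def
  proof (rule powr_comparable)
    show "0 < 1 + norm ?y" by (simp add: add_pos_nonneg)
    show "0 < norm \<alpha> / h" using assms by (intro divide_pos_pos) linarith+
    have "h * (1 + norm ?y) \<le> 2 * norm \<alpha>" unfolding distrib_left using w assms by linarith
    then show "1 + norm ?y \<le> 2 * (norm \<alpha> / h)" using assms by (simp add: pos_le_divide_eq mult.commute)
    have "norm \<alpha> \<le> 2 * (h * norm ?y)" using w assms by linarith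
    also have "\<dots> \<le> (2 * (1 + norm ?y)) * h" using assms by (simp add: algebra_simps)
    finally show "norm \<alpha> / h \<le> 2 * (1 + norm ?y)" using assms by (simp add: pos_divide_le_eq)
  qed
  also have "(norm \<alpha> / h) powr (2 * s) = norm \<alpha> powr (2 * s) * h powr (- (2 * s))"
    unfolding powr_divide powr_minus by (rule divide_inverse)
  finally show ?thesis .
qed

lemma norm_power_le_weight: "(norm \<omega> ^ k)\<^sup>2 \<le> weight (real k) \<omega>"
proof -
  have "(norm \<omega> ^ k)\<^sup>2 \<le> ((1 + norm \<omega>) ^ k)\<^sup>2" by (intro power_mono) auto
  also have "\<dots> = weight (real k) \<omega>"
  proof -
    have p: "1 + norm \<omega> > 0" by (simp add: add_pos_nonneg)
    have "((1 + norm \<omega>) ^ k)\<^sup>2 = (1 + norm \<omega>) ^ (2 * k)" by (simp add: power_mult[symmetric] mult.commute)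
    also have "\<dots> = (1 + norm \<omega>) powr real (2 * k)" by (rule powr_realpow[OF p, symmetric])
    finally show ?thesis by (simp add: weight_def)
  qed
  finally show ?thesis .
qed

text \<open>The approximant has transform \<open>\<tau>(h \<omega>) \<Phi>(\<omega>)\<close>, up to \<open>\<epsilon>\<close>, where \<open>\<Phi>\<close> is the transform of the dilated generator and
\<open>\<tau>\<close> the periodic extension of the quotient of target and generator from the ball of radius \<open>r\<close>. On the ball
\<open>|\<omega>| < r / h\<close> it reproduces the target, so the error consists of the tail of the target, bounded by
\<open>weight_far\<close>, and of the copies of the quotient around the other lattice points. The copy around \<open>\<alpha>\<close>
carries the factor \<open>\<phi>^(h \<omega> + \<alpha>) / \<phi>^(h \<omega>) = O(N\<^sub>\<alpha> |h \<omega>|\<^sup>k)\<close>, whence its energy is \<open>h\<^sup>2\<^sup>(\<^sup>k\<^sup>-\<^sup>s\<^sup>) |\<alpha>|\<^sup>2\<^sup>s N\<^sub>\<alpha>\<^sup>2\<close> times the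
energy of order \<open>k\<close> of the target.\<close>

lemma approximation_step:
  fixes \<phi> f :: "'d::finite dist" and k :: nat
  assumes sk: "s < real k" and \<phi>: "\<phi> \<in> sobolev s" and \<eta>: "\<eta> > 0"
    and r: "0 < r" "r \<le> 1"
    and low: "AE \<omega> in lborel. norm \<omega> < r \<longrightarrow> \<eta> \<le> norm (fhat \<phi> \<omega>)"
    and N0: "\<And>\<alpha>. N \<alpha> \<ge> 0"
    and N: "\<And>\<alpha>. \<alpha> \<in> dual_lattice - {0} \<Longrightarrow> AE \<omega> in lborel. norm \<omega> < r \<longrightarrow> norm (fhat \<phi> (\<omega> + \<alpha>)) \<le> N \<alpha> * norm \<omega> ^ k"
    and \<Sigma>: "(\<integral>\<^sup>+\<alpha>. ennreal (norm \<alpha> powr (2 * s) * (N \<alpha>)\<^sup>2) \<partial>count_space (dual_lattice - {0})) = ennreal \<sigma>" "\<sigma> \<ge> 0"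
    and h: "0 < h" "h \<le> 1" and f: "f \<in> sobolev (real k)" and e: "\<epsilon> > 0"
  defines "K \<equiv> 4 * r powr (- 2 * (real k - s)) + 4 * (2 powr \<bar>2 * s\<bar> / \<eta>\<^sup>2) * \<sigma>"
  shows "\<exists>g\<in>PSI_space s \<phi>. energy s (\<lambda>\<omega>. fhat f \<omega> - fhat (dilate h g) \<omega>)
     \<le> ennreal (K * h powr (2 * (real k - s))) * energy (real k) (fhat f) + ennreal \<epsilon>"
proof -
  let ?A = "dual_lattice - {0 :: real^'d}"
  let ?hk = "h powr (2 * (real k - s))"
  let ?c = "2 powr \<bar>2 * s\<bar> / \<eta>\<^sup>2"
  define v where "v = fhat f"
  note FD = sobolevD[OF f] and PD = sobolevD[OF \<phi>]
  have [measurable]: "v \<in> borel_measurable borel" using FD(4) by (simp add: v_def)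
  note [measurable] = PD(4)
  have vk: "energy (real k) v < \<infinity>" using FD(5) by (simp add: v_def)
  have vs: "energy s v < \<infinity>" using energy_mono[of s "real k" v] sk vk by (auto intro: order.strict_trans1)
  define \<Phi> where "\<Phi> \<omega> = of_real (h ^ CARD('d)) * fhat \<phi> (h *\<^sub>R \<omega>)" for \<omega>
  have \<Phi>m [measurable]: "\<Phi> \<in> borel_measurable borel" unfolding \<Phi>_def[abs_def] by measurable
  have hd: "h ^ CARD('d) > 0" using h by simp
  have \<Phi>fin: "energy s \<Phi> < \<infinity>"
  proof -
    have "(\<lambda>\<omega>. fhat \<phi> (h *\<^sub>R \<omega>)) \<in> borel_measurable borel" by measurable
    from energy_cmult[OF this] show ?thesis
      unfolding \<Phi>_def[abs_def] using energy_scale[OF PD(4) h(1) PD(5)] by (simp add: ennreal_mult_less_top)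
  qed
  have "\<epsilon> / 4 > 0" using e by simp
  from energy_truncation[OF _ vs this] obtain M :: nat where
    M: "energy s (\<lambda>\<omega>. v \<omega> - (if norm (v \<omega>) \<le> real M then v \<omega> else 0)) < ennreal (\<epsilon> / 4)" by auto
  define vM where "vM \<omega> = (if norm (v \<omega>) \<le> real M then v \<omega> else 0)" for \<omega>
  have [measurable]: "vM \<in> borel_measurable borel" unfolding vM_def[abs_def] by measurable
  (* The quotient of the truncated target by the dilated generator, cut off where it might be
     unbounded; \<tau> is its
     periodic extension. *)
  define \<tau>0 where "\<tau>0 u = (if norm u < r \<and> \<eta> \<le> norm (fhat \<phi> u) then vM ((1 / h) *\<^sub>R u) / (of_real (h ^ CARD('d)) * fhat \<phi> u) else 0)" for u
  define \<tau> where "\<tau> u = \<tau>0 (residue_rep u)" for u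
  have [measurable]: "\<tau>0 \<in> borel_measurable borel" unfolding \<tau>0_def[abs_def] by measurable
  have \<tau>m [measurable]: "\<tau> \<in> borel_measurable borel" unfolding \<tau>_def[abs_def] by measurable
  have vM: "norm (vM \<omega>) \<le> real M" "norm (vM \<omega>) \<le> norm (v \<omega>)" for \<omega> by (auto simp: vM_def)
  have \<tau>0le: "norm (\<tau>0 u) \<le> norm (vM ((1 / h) *\<^sub>R u)) / (h ^ CARD('d) * \<eta>)" for u
  proof (cases "norm u < r \<and> \<eta> \<le> norm (fhat \<phi> u)")
    case True
    then have "norm (\<tau>0 u) = norm (vM ((1 / h) *\<^sub>R u)) / (h ^ CARD('d) * norm (fhat \<phi> u))"
      using h by (simp add: \<tau>0_def norm_divide norm_mult norm_power)
    also have "\<dots> \<le> norm (vM ((1 / h) *\<^sub>R u)) / (h ^ CARD('d) * \<eta>)"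
      using True hd \<eta> by (intro divide_left_mono mult_left_mono mult_pos_pos) auto
    finally show ?thesis .
  next
    case False
    then have "\<tau>0 u = 0" by (auto simp: \<tau>0_def)
    then show ?thesis using hd \<eta> by simp
  qed
  have \<tau>B: "norm (\<tau> u) \<le> real M / (h ^ CARD('d) * \<eta>)" for u
    unfolding \<tau>_def using hd \<eta> by (intro order_trans[OF \<tau>0le divide_right_mono[OF vM(1)]]) auto
  have per: "\<tau> (u + (2 * pi) *\<^sub>R j) = \<tau> u" if "j \<in> integer_points" for u j
    unfolding \<tau>_def by (simp add: residue_rep_periodic[OF that])
  have perd: "\<tau> (u + \<alpha>) = \<tau> u" if "\<alpha> \<in> dual_lattice" for u \<alpha>
    unfolding \<tau>_def by (simp add: residue_rep_dual_shift[OF that])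
  define \<Omega> where "\<Omega> = {\<omega>::real^'d. h * norm \<omega> < r}"
  have [measurable]: "\<Omega> \<in> sets borel" unfolding \<Omega>_def by measurable
  have inside: "AE \<omega> in lborel. \<omega> \<in> \<Omega> \<longrightarrow> \<tau> (h *\<^sub>R \<omega>) * \<Phi> \<omega> = vM \<omega>"
  proof -
    have "AE \<omega> in lborel. norm (h *\<^sub>R \<omega>) < r \<longrightarrow> \<eta> \<le> norm (fhat \<phi> (h *\<^sub>R \<omega>))"
      using AE_scale[OF low, of h] h by simp
    then show ?thesis
    proof (eventually_elim, intro impI)
      fix \<omega> :: "real^'d" assume a: "norm (h *\<^sub>R \<omega>) < r \<longrightarrow> \<eta> \<le> norm (fhat \<phi> (h *\<^sub>R \<omega>))" and "\<omega> \<in> \<Omega>"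
      then have n: "norm (h *\<^sub>R \<omega>) < r" using h by (simp add: \<Omega>_def)
      then have l: "\<eta> \<le> norm (fhat \<phi> (h *\<^sub>R \<omega>))" using a by blast
      have "residue_rep (h *\<^sub>R \<omega>) = h *\<^sub>R \<omega>" using n r by (intro residue_rep_id) linarith
      then have "\<tau> (h *\<^sub>R \<omega>) = vM \<omega> / (of_real (h ^ CARD('d)) * fhat \<phi> (h *\<^sub>R \<omega>))"
        using n l h by (simp add: \<tau>_def \<tau>0_def)
      moreover have "fhat \<phi> (h *\<^sub>R \<omega>) \<noteq> 0" using l \<eta> by auto
      ultimately show "\<tau> (h *\<^sub>R \<omega>) * \<Phi> \<omega> = vM \<omega>" using h by (simp add: \<Phi>_def)
    qed
  qed
  have \<tau>in: "norm (\<tau> (h *\<^sub>R \<omega>)) \<le> norm (v \<omega>) / (h ^ CARD('d) * \<eta>)" if "\<omega> \<in> \<Omega>" for \<omega>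
  proof -
    have "norm (h *\<^sub>R \<omega>) < 1" using that r h by (simp add: \<Omega>_def)
    then have "norm (\<tau> (h *\<^sub>R \<omega>)) \<le> norm (vM \<omega>) / (h ^ CARD('d) * \<eta>)"
      using \<tau>0le[of "h *\<^sub>R \<omega>"] h by (simp add: \<tau>_def residue_rep_id)
    also have "\<dots> \<le> norm (v \<omega>) / (h ^ CARD('d) * \<eta>)" using hd \<eta> by (intro divide_right_mono vM) auto
    finally show ?thesis .
  qed
  (* R \<alpha> is the error at \<omega> + \<alpha>/h caused by the copy of \<tau> around \<alpha>, written as a function of \<omega>. *)
  define R where "R \<alpha> \<omega> = ennreal (indicator \<Omega> \<omega> * (weight s (\<omega> + (1 / h) *\<^sub>R \<alpha>) * (norm (\<tau> (h *\<^sub>R \<omega>) * \<Phi> (\<omega> + (1 / h) *\<^sub>R \<alpha>)))\<^sup>2))" for \<alpha> \<omega>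
  have Rm [measurable]: "R \<alpha> \<in> borel_measurable borel" for \<alpha> unfolding R_def[abs_def] by measurable
  have Rle: "(\<integral>\<^sup>+\<omega>. R \<alpha> \<omega> \<partial>lborel) \<le> ennreal (norm \<alpha> powr (2 * s) * (N \<alpha>)\<^sup>2) * (ennreal (?c * ?hk) * energy (real k) v)"
    if \<alpha>: "\<alpha> \<in> ?A" for \<alpha>
  proof -
    have a2: "norm \<alpha> \<ge> 2" using dual_lattice_norm[of \<alpha>] \<alpha> pi_ge_two by fastforce
    have "AE \<omega> in lborel. norm (h *\<^sub>R \<omega>) < r \<longrightarrow> norm (fhat \<phi> (h *\<^sub>R \<omega> + \<alpha>)) \<le> N \<alpha> * norm (h *\<^sub>R \<omega>) ^ k"
      using AE_scale[OF N[OF \<alpha>], of h] h by simp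
    then have "AE \<omega> in lborel. R \<alpha> \<omega> \<le> ennreal ((norm \<alpha> powr (2 * s) * (N \<alpha>)\<^sup>2) * (?c * ?hk)) * ennreal (weight (real k) \<omega> * (norm (v \<omega>))\<^sup>2)"
    proof eventually_elim
      case (elim \<omega>)
      show ?case
      proof (cases "\<omega> \<in> \<Omega>")
        case True
        then have n: "norm (h *\<^sub>R \<omega>) < r" using h by (simp add: \<Omega>_def)
        let ?Q = "norm (fhat \<phi> (h *\<^sub>R \<omega> + \<alpha>))"
        have Q: "?Q \<le> N \<alpha> * (h ^ k * norm \<omega> ^ k)" using elim n h by (simp add: power_mult_distrib)
        have eq: "\<Phi> (\<omega> + (1 / h) *\<^sub>R \<alpha>) = of_real (h ^ CARD('d)) * fhat \<phi> (h *\<^sub>R \<omega> + \<alpha>)"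
          using h by (simp add: \<Phi>_def scaleR_right_distrib)
        have "norm (\<tau> (h *\<^sub>R \<omega>) * \<Phi> (\<omega> + (1 / h) *\<^sub>R \<alpha>)) \<le> (norm (v \<omega>) / (h ^ CARD('d) * \<eta>)) * (h ^ CARD('d) * (N \<alpha> * (h ^ k * norm \<omega> ^ k)))"
          unfolding eq norm_mult using h Q \<tau>in[OF True] hd \<eta> by (intro mult_mono) (auto simp: norm_power)
        also have "\<dots> = norm (v \<omega>) / \<eta> * (N \<alpha> * (h ^ k * norm \<omega> ^ k))" using h by (simp add: field_simps)
        finally have "(norm (\<tau> (h *\<^sub>R \<omega>) * \<Phi> (\<omega> + (1 / h) *\<^sub>R \<alpha>)))\<^sup>2 \<le> (norm (v \<omega>) / \<eta> * (N \<alpha> * (h ^ k * norm \<omega> ^ k)))\<^sup>2"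
          by (intro power_mono) auto
        also have "\<dots> = ((norm (v \<omega>))\<^sup>2 / \<eta>\<^sup>2 * (N \<alpha>)\<^sup>2 * (h ^ k)\<^sup>2) * (norm \<omega> ^ k)\<^sup>2"
          by (simp add: power_mult_distrib power_divide)
        also have "\<dots> \<le> ((norm (v \<omega>))\<^sup>2 / \<eta>\<^sup>2 * (N \<alpha>)\<^sup>2 * (h ^ k)\<^sup>2) * weight (real k) \<omega>"
          by (intro mult_left_mono norm_power_le_weight) auto
        finally have 1: "(norm (\<tau> (h *\<^sub>R \<omega>) * \<Phi> (\<omega> + (1 / h) *\<^sub>R \<alpha>)))\<^sup>2 \<le> ((norm (v \<omega>))\<^sup>2 / \<eta>\<^sup>2 * (N \<alpha>)\<^sup>2 * (h ^ k)\<^sup>2) * weight (real k) \<omega>" .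
        have 2: "weight s (\<omega> + (1 / h) *\<^sub>R \<alpha>) \<le> 2 powr \<bar>2 * s\<bar> * (norm \<alpha> powr (2 * s) * h powr (- (2 * s)))"
          using n r h a2 by (intro weight_lattice_shift) auto
        have hh: "h powr (- (2 * s)) * (h ^ k)\<^sup>2 = ?hk"
        proof -
          have "(h ^ k)\<^sup>2 = h ^ (2 * k)" by (simp add: power_mult[symmetric] mult.commute)
          also have "\<dots> = h powr (2 * real k)" using powr_realpow[OF h(1), of "2 * k"] by simp
          finally show ?thesis by (simp add: algebra_simps flip: powr_add)
        qed
        have "weight s (\<omega> + (1 / h) *\<^sub>R \<alpha>) * (norm (\<tau> (h *\<^sub>R \<omega>) * \<Phi> (\<omega> + (1 / h) *\<^sub>R \<alpha>)))\<^sup>2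
          \<le> (2 powr \<bar>2 * s\<bar> * (norm \<alpha> powr (2 * s) * h powr (- (2 * s)))) * (((norm (v \<omega>))\<^sup>2 / \<eta>\<^sup>2 * (N \<alpha>)\<^sup>2 * (h ^ k)\<^sup>2) * weight (real k) \<omega>)"
          by (intro mult_mono 1 2) auto
        also have "\<dots> = (norm \<alpha> powr (2 * s) * (N \<alpha>)\<^sup>2) * (?c * (h powr (- (2 * s)) * (h ^ k)\<^sup>2)) * (weight (real k) \<omega> * (norm (v \<omega>))\<^sup>2)"
          by (simp add: mult_ac)
        finally have "weight s (\<omega> + (1 / h) *\<^sub>R \<alpha>) * (norm (\<tau> (h *\<^sub>R \<omega>) * \<Phi> (\<omega> + (1 / h) *\<^sub>R \<alpha>)))\<^sup>2
          \<le> (norm \<alpha> powr (2 * s) * (N \<alpha>)\<^sup>2) * (?c * ?hk) * (weight (real k) \<omega> * (norm (v \<omega>))\<^sup>2)" unfolding hh .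
        then show ?thesis using True by (simp add: R_def ennreal_leI flip: ennreal_mult)
      qed (simp add: R_def)
    qed
    then have "(\<integral>\<^sup>+\<omega>. R \<alpha> \<omega> \<partial>lborel) \<le> (\<integral>\<^sup>+\<omega>. ennreal ((norm \<alpha> powr (2 * s) * (N \<alpha>)\<^sup>2) * (?c * ?hk)) * ennreal (weight (real k) \<omega> * (norm (v \<omega>))\<^sup>2) \<partial>lborel)"
      by (rule nn_integral_mono_AE)
    also have "\<dots> = ennreal ((norm \<alpha> powr (2 * s) * (N \<alpha>)\<^sup>2) * (?c * ?hk)) * energy (real k) v"
      unfolding energy_def by (rule nn_integral_cmult) measurable
    also have "ennreal ((norm \<alpha> powr (2 * s) * (N \<alpha>)\<^sup>2) * (?c * ?hk)) = ennreal (norm \<alpha> powr (2 * s) * (N \<alpha>)\<^sup>2) * ennreal (?c * ?hk)"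
      by (rule ennreal_mult) simp_all
    finally show ?thesis by (simp only: mult.assoc)
  qed
  let ?E = "\<integral>\<^sup>+\<omega>. indicator (- \<Omega>) \<omega> * ennreal (weight s \<omega> * (norm (\<tau> (h *\<^sub>R \<omega>) * \<Phi> \<omega>))\<^sup>2) \<partial>lborel"
  have E: "?E \<le> ennreal (?c * \<sigma> * ?hk) * energy (real k) v"
  proof -
    have "?E \<le> (\<integral>\<^sup>+\<omega>. \<integral>\<^sup>+\<alpha>. R \<alpha> (\<omega> - (1 / h) *\<^sub>R \<alpha>) \<partial>count_space ?A \<partial>lborel)"
    proof (rule nn_integral_mono)
      fix \<omega> :: "real^'d"
      show "indicator (- \<Omega>) \<omega> * ennreal (weight s \<omega> * (norm (\<tau> (h *\<^sub>R \<omega>) * \<Phi> \<omega>))\<^sup>2) \<le> (\<integral>\<^sup>+\<alpha>. R \<alpha> (\<omega> - (1 / h) *\<^sub>R \<alpha>) \<partial>count_space ?A)"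
      proof (cases "\<omega> \<notin> \<Omega> \<and> \<tau> (h *\<^sub>R \<omega>) \<noteq> 0")
        case False
        then show ?thesis by auto
      next
        case True
        (* The lattice point whose copy of the small ball contains h \<omega>. *)
        define \<alpha> where "\<alpha> = h *\<^sub>R \<omega> - residue_rep (h *\<^sub>R \<omega>)"
        have ad: "\<alpha> \<in> dual_lattice" unfolding \<alpha>_def by (rule residue_rep_dual)
        have nr: "norm (residue_rep (h *\<^sub>R \<omega>)) < r" using True by (auto simp: \<tau>_def \<tau>0_def split: if_splits)
        have a0: "\<alpha> \<noteq> 0"
        proof
          assume "\<alpha> = 0"
          then have "residue_rep (h *\<^sub>R \<omega>) = h *\<^sub>R \<omega>" by (simp add: \<alpha>_def)
          then have "h * norm \<omega> < r" using nr h by simp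
          then show False using True by (simp add: \<Omega>_def)
        qed
        have hs: "h *\<^sub>R (\<omega> - (1 / h) *\<^sub>R \<alpha>) = residue_rep (h *\<^sub>R \<omega>)"
          using h by (simp add: scaleR_right_diff_distrib \<alpha>_def)
        have "\<omega> - (1 / h) *\<^sub>R \<alpha> \<in> \<Omega>"
        proof -
          have "h * norm (\<omega> - (1 / h) *\<^sub>R \<alpha>) = norm (h *\<^sub>R (\<omega> - (1 / h) *\<^sub>R \<alpha>))" using h by simp
          then show ?thesis unfolding hs \<Omega>_def using nr by simp
        qed
        moreover have "\<tau> (h *\<^sub>R (\<omega> - (1 / h) *\<^sub>R \<alpha>)) = \<tau> (h *\<^sub>R \<omega>)"
          using perd[OF ad, of "residue_rep (h *\<^sub>R \<omega>)"] unfolding hs by (simp add: \<alpha>_def)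
        ultimately have "ennreal (weight s \<omega> * (norm (\<tau> (h *\<^sub>R \<omega>) * \<Phi> \<omega>))\<^sup>2) = R \<alpha> (\<omega> - (1 / h) *\<^sub>R \<alpha>)"
          by (simp add: R_def)
        also have "\<dots> \<le> (\<integral>\<^sup>+\<alpha>. R \<alpha> (\<omega> - (1 / h) *\<^sub>R \<alpha>) \<partial>count_space ?A)"
          using ad a0 by (intro nn_integral_ge_point) simp
        finally show ?thesis using True by simp
      qed
    qed
    also have "\<dots> = (\<integral>\<^sup>+\<alpha>. \<integral>\<^sup>+\<omega>. R \<alpha> (\<omega> - (1 / h) *\<^sub>R \<alpha>) \<partial>lborel \<partial>count_space ?A)"
      by (rule nn_integral_count_space_nn_integral) (auto intro: countable_subset[OF _ countable_dual_lattice])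
    also have "\<dots> = (\<integral>\<^sup>+\<alpha>. \<integral>\<^sup>+\<omega>. R \<alpha> \<omega> \<partial>lborel \<partial>count_space ?A)"
      by (simp add: nn_integral_shift)
    also have "\<dots> \<le> (\<integral>\<^sup>+\<alpha>. ennreal (norm \<alpha> powr (2 * s) * (N \<alpha>)\<^sup>2) * (ennreal (?c * ?hk) * energy (real k) v) \<partial>count_space ?A)"
      by (rule nn_integral_mono) (use Rle in simp)
    also have "\<dots> = (\<integral>\<^sup>+\<alpha>. ennreal (norm \<alpha> powr (2 * s) * (N \<alpha>)\<^sup>2) \<partial>count_space ?A) * (ennreal (?c * ?hk) * energy (real k) v)"
      by (rule nn_integral_multc) simp
    also have "\<dots> = ennreal \<sigma> * ennreal (?c * ?hk) * energy (real k) v" by (simp only: \<Sigma>(1) mult.assoc)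
    also have "ennreal \<sigma> * ennreal (?c * ?hk) = ennreal (\<sigma> * (?c * ?hk))" using \<Sigma>(2) by (intro ennreal_mult[symmetric]) auto
    also have "\<sigma> * (?c * ?hk) = ?c * \<sigma> * ?hk" by (simp only: mult_ac)
    finally show ?thesis .
  qed
  let ?rk = "r powr (- 2 * (real k - s)) * ?hk"
  let ?F = "\<integral>\<^sup>+\<omega>. indicator (- \<Omega>) \<omega> * ennreal (weight s \<omega> * (norm (v \<omega>))\<^sup>2) \<partial>lborel"
  have F: "?F \<le> ennreal ?rk * energy (real k) v"
  proof -
    have "?F \<le> (\<integral>\<^sup>+\<omega>. ennreal ?rk * ennreal (weight (real k) \<omega> * (norm (v \<omega>))\<^sup>2) \<partial>lborel)"
    proof (rule nn_integral_mono)
      fix \<omega> :: "real^'d"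
      show "indicator (- \<Omega>) \<omega> * ennreal (weight s \<omega> * (norm (v \<omega>))\<^sup>2) \<le> ennreal ?rk * ennreal (weight (real k) \<omega> * (norm (v \<omega>))\<^sup>2)"
      proof (cases "\<omega> \<in> \<Omega>")
        case False
        then have "weight s \<omega> \<le> ?rk * weight (real k) \<omega>"
          using r h sk by (intro weight_far) (auto simp: \<Omega>_def)
        then have "weight s \<omega> * (norm (v \<omega>))\<^sup>2 \<le> ?rk * weight (real k) \<omega> * (norm (v \<omega>))\<^sup>2" by (intro mult_right_mono) auto
        then show ?thesis using False by (simp add: ennreal_leI mult.assoc flip: ennreal_mult)
      qed simp
    qed
    also have "\<dots> = ennreal ?rk * energy (real k) v"
      unfolding energy_def by (rule nn_integral_cmult) measurable
    finally show ?thesis .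
  qed
  let ?G = "\<lambda>\<omega>. \<tau> (h *\<^sub>R \<omega>) * \<Phi> \<omega>"
  have main: "energy s (\<lambda>\<omega>. v \<omega> - ?G \<omega>) \<le> ennreal (\<epsilon> / 4) + (2 * ?F + 2 * ?E)"
  proof -
    have "energy s (\<lambda>\<omega>. v \<omega> - ?G \<omega>) \<le> (\<integral>\<^sup>+\<omega>. ennreal (weight s \<omega> * (norm (v \<omega> - vM \<omega>))\<^sup>2) +
       (2 * (indicator (- \<Omega>) \<omega> * ennreal (weight s \<omega> * (norm (v \<omega>))\<^sup>2)) + 2 * (indicator (- \<Omega>) \<omega> * ennreal (weight s \<omega> * (norm (?G \<omega>))\<^sup>2))) \<partial>lborel)"
      unfolding energy_def
    proof (rule nn_integral_mono_AE)
      from inside show "AE \<omega> in lborel. ennreal (weight s \<omega> * (norm (v \<omega> - ?G \<omega>))\<^sup>2) \<le> ennreal (weight s \<omega> * (norm (v \<omega> - vM \<omega>))\<^sup>2) +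
       (2 * (indicator (- \<Omega>) \<omega> * ennreal (weight s \<omega> * (norm (v \<omega>))\<^sup>2)) + 2 * (indicator (- \<Omega>) \<omega> * ennreal (weight s \<omega> * (norm (?G \<omega>))\<^sup>2)))"
      proof eventually_elim
        case (elim \<omega>)
        show ?case
        proof (cases "\<omega> \<in> \<Omega>")
          case True
          then have "?G \<omega> = vM \<omega>" using elim by blast
          then show ?thesis by (simp add: True)
        next
          case False
          have "weight s \<omega> * (norm (v \<omega> - ?G \<omega>))\<^sup>2 \<le> weight s \<omega> * (2 * (norm (v \<omega>))\<^sup>2 + 2 * (norm (?G \<omega>))\<^sup>2)"
            using norm_diff_square_le[of "v \<omega>" "?G \<omega>" 0] by (intro mult_left_mono) auto
          also have "\<dots> = 2 * (weight s \<omega> * (norm (v \<omega>))\<^sup>2) + 2 * (weight s \<omega> * (norm (?G \<omega>))\<^sup>2)" by (simp add: algebra_simps)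
          finally have "ennreal (weight s \<omega> * (norm (v \<omega> - ?G \<omega>))\<^sup>2) \<le> ennreal (2 * (weight s \<omega> * (norm (v \<omega>))\<^sup>2) + 2 * (weight s \<omega> * (norm (?G \<omega>))\<^sup>2))"
            by (rule ennreal_leI)
          also have "\<dots> = 2 * ennreal (weight s \<omega> * (norm (v \<omega>))\<^sup>2) + 2 * ennreal (weight s \<omega> * (norm (?G \<omega>))\<^sup>2)"
            by (subst ennreal_plus) (simp_all add: ennreal_mult)
          also have "\<dots> \<le> ennreal (weight s \<omega> * (norm (v \<omega> - vM \<omega>))\<^sup>2) + \<dots>" by (rule add_increasing) simp_all
          finally show ?thesis using False by simp
        qed
      qed
    qed
    also have "\<dots> = energy s (\<lambda>\<omega>. v \<omega> - vM \<omega>) + (2 * ?F + 2 * ?E)"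
      unfolding energy_def by (simp add: nn_integral_add nn_integral_cmult)
    also have "\<dots> \<le> ennreal (\<epsilon> / 4) + (2 * ?F + 2 * ?E)"
      using M by (intro add_right_mono) (simp add: vM_def[abs_def])
    finally show ?thesis .
  qed
  obtain p where p: "p \<in> exp_sums integer_points" "energy s (\<lambda>\<omega>. (\<tau> (h *\<^sub>R \<omega>) - p (h *\<^sub>R \<omega>)) * \<Phi> \<omega>) < ennreal (\<epsilon> / 4)"
    using approximate_periodic_multiplier[OF \<Phi>m \<Phi>fin \<tau>m \<tau>B per \<open>\<epsilon> / 4 > 0\<close>] by blast
  obtain g where g: "g \<in> PSI_space s \<phi>" "AE \<omega> in lborel. fhat g \<omega> = p \<omega> * fhat \<phi> \<omega>"
    using PSI_space_multiplier[OF \<phi> p(1)] by blast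
  have gs: "g \<in> sobolev s" using g(1) PSI_space_sobolev[OF \<phi>] by blast
  note D = sobolev_dilate[OF gs h(1)]
  note [measurable] = sobolevD(4)[OF D(1)] exp_sums_measurable[OF p(1)]
  have DG: "AE \<omega> in lborel. fhat (dilate h g) \<omega> = p (h *\<^sub>R \<omega>) * \<Phi> \<omega>"
  proof -
    have "AE \<omega> in lborel. fhat g (h *\<^sub>R \<omega>) = p (h *\<^sub>R \<omega>) * fhat \<phi> (h *\<^sub>R \<omega>)" using AE_scale[OF g(2), of h] h by simp
    with D(2) show ?thesis by eventually_elim (simp add: \<Phi>_def mult_ac)
  qed
  have "energy s (\<lambda>\<omega>. v \<omega> - fhat (dilate h g) \<omega>) = energy s (\<lambda>\<omega>. v \<omega> - p (h *\<^sub>R \<omega>) * \<Phi> \<omega>)"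
    by (rule energy_cong) (use DG in eventually_elim, simp)
  also have "\<dots> \<le> 2 * energy s (\<lambda>\<omega>. v \<omega> - ?G \<omega>) + 2 * energy s (\<lambda>\<omega>. ?G \<omega> - p (h *\<^sub>R \<omega>) * \<Phi> \<omega>)"
    by (rule energy_diff_le) measurable
  also have "\<dots> \<le> 2 * (ennreal (\<epsilon> / 4) + (2 * (ennreal ?rk * energy (real k) v) + 2 * (ennreal (?c * \<sigma> * ?hk) * energy (real k) v))) + 2 * ennreal (\<epsilon> / 4)"
  proof (intro add_mono mult_left_mono)
    show "energy s (\<lambda>\<omega>. v \<omega> - ?G \<omega>) \<le> ennreal (\<epsilon> / 4) + (2 * (ennreal ?rk * energy (real k) v) + 2 * (ennreal (?c * \<sigma> * ?hk) * energy (real k) v))"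
      by (rule order_trans[OF main]) (intro add_mono mult_left_mono order_refl E F; simp)
    show "energy s (\<lambda>\<omega>. ?G \<omega> - p (h *\<^sub>R \<omega>) * \<Phi> \<omega>) \<le> ennreal (\<epsilon> / 4)"
      using p(2) by (simp add: left_diff_distrib)
  qed simp_all
  also have "\<dots> = ennreal (K * ?hk) * energy (real k) v + ennreal \<epsilon>"
  proof -
    obtain w where w: "energy (real k) v = ennreal w" "w \<ge> 0" using vk by (cases "energy (real k) v") auto
    have K: "K * ?hk = 4 * ?rk + 4 * (?c * \<sigma> * ?hk)" by (simp add: K_def algebra_simps)
    have nn: "?rk \<ge> 0" "?c * \<sigma> * ?hk \<ge> 0" using \<Sigma>(2) by auto
    have gen: "2 * (ennreal a + (2 * (ennreal b * ennreal w) + 2 * (ennreal c * ennreal w))) + 2 * ennreal a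
        = ennreal (4 * b + 4 * c) * ennreal w + ennreal (4 * a)" if "a \<ge> 0" "b \<ge> 0" "c \<ge> 0" for a b c
    proof -
      have "2 * (ennreal a + (2 * (ennreal b * ennreal w) + 2 * (ennreal c * ennreal w))) + 2 * ennreal a
        = ennreal (2 * (a + (2 * (b * w) + 2 * (c * w))) + 2 * a)"
      proof -
        have "2 * e + 2 * e = 4 * e" for e :: ennreal using distrib_right[of 2 2 e] by simp
        then show ?thesis using that w(2) by (simp add: ennreal_plus ennreal_mult)
      qed
      also have "2 * (a + (2 * (b * w) + 2 * (c * w))) + 2 * a = (4 * b + 4 * c) * w + 4 * a" by (simp add: algebra_simps)
      also have "ennreal \<dots> = ennreal (4 * b + 4 * c) * ennreal w + ennreal (4 * a)"
      proof -
        have "ennreal ((4 * b + 4 * c) * w) = ennreal (4 * b + 4 * c) * ennreal w"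
          using that w(2) by (intro ennreal_mult) auto
        moreover have "ennreal ((4 * b + 4 * c) * w + 4 * a) = ennreal ((4 * b + 4 * c) * w) + ennreal (4 * a)"
          using that w(2) by (intro ennreal_plus) auto
        ultimately show ?thesis by (simp only:)
      qed
      finally show ?thesis .
    qed
    have "ennreal (4 * (\<epsilon> / 4)) = ennreal \<epsilon>" by simp
    moreover have "\<epsilon> / 4 \<ge> 0" using e by simp
    ultimately show ?thesis unfolding K w(1) using gen[of "\<epsilon> / 4" ?rk "?c * \<sigma> * ?hk"] nn by (simp only:)
  qed
  finally show ?thesis using g(1) unfolding v_def by blast
qed

theorem approximation_order_sufficient:
  fixes \<phi> :: "'d::finite dist" and k :: nat
  assumes sk: "s < real k" and \<phi>: "\<phi> \<in> sobolev s" and \<eta>: "\<eta> > 0" and r: "0 < r" "r \<le> 1"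
    and low: "AE \<omega> in lborel. norm \<omega> < r \<longrightarrow> \<eta> \<le> norm (fhat \<phi> \<omega>)"
    and N0: "\<And>\<alpha>. N \<alpha> \<ge> 0"
    and N: "\<And>\<alpha>. \<alpha> \<in> dual_lattice - {0} \<Longrightarrow> AE \<omega> in lborel. norm \<omega> < r \<longrightarrow> norm (fhat \<phi> (\<omega> + \<alpha>)) \<le> N \<alpha> * norm \<omega> ^ k"
    and \<Sigma>: "(\<integral>\<^sup>+\<alpha>. ennreal (norm \<alpha> powr (2 * s) * (N \<alpha>)\<^sup>2) \<partial>count_space (dual_lattice - {0})) < \<infinity>"
  shows "provides_approximation_order s (PSI_space s \<phi>) (real k)"
proof -
  obtain \<sigma> where \<sigma>: "(\<integral>\<^sup>+\<alpha>. ennreal (norm \<alpha> powr (2 * s) * (N \<alpha>)\<^sup>2) \<partial>count_space (dual_lattice - {0})) = ennreal \<sigma>" "\<sigma> \<ge> 0"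
    using \<Sigma> by (cases "\<integral>\<^sup>+\<alpha>. ennreal (norm \<alpha> powr (2 * s) * (N \<alpha>)\<^sup>2) \<partial>count_space (dual_lattice - {0})") auto
  define K where "K = 4 * r powr (- 2 * (real k - s)) + 4 * (2 powr \<bar>2 * s\<bar> / \<eta>\<^sup>2) * \<sigma>"
  have K0: "K \<ge> 0" using \<sigma>(2) by (simp add: K_def)
  (* The maximum with 1 serves h > 1, where the zero approximant is enough. *)
  define C where "C = max 1 (sqrt K)"
  have bdd: "bdd_below ((\<lambda>g. sobolev_norm s (\<lambda>\<psi>. f \<psi> - g \<psi>)) ` dilate h ` PSI_space s \<phi>)" for f h
    by (intro bdd_belowI[of _ 0]) (auto simp: sobolev_norm_nonneg)
  have "(INF g\<in>dilate h ` PSI_space s \<phi>. sobolev_norm s (\<lambda>\<psi>. f \<psi> - g \<psi>)) \<le> C * h powr (real k - s) * sobolev_norm (real k) f"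
    (is "?I \<le> _") if f: "f \<in> sobolev (real k)" and h: "h > 0" for f h
  proof -
    have fs: "f \<in> sobolev s" by (rule sobolev_mono[OF _ f]) (use sk in simp)
    have nk: "sobolev_norm (real k) f \<ge> 0" by (rule sobolev_norm_nonneg)
    show ?thesis
    proof (cases "h \<le> 1")
      case True
      have I0: "?I \<ge> 0"
        using PSI_space_generator[of \<phi> s] by (intro cINF_greatest) (auto simp: sobolev_norm_nonneg)
      have "ennreal (?I\<^sup>2) \<le> ennreal (K * h powr (2 * (real k - s)) * (sobolev_norm (real k) f)\<^sup>2)"
      proof (rule ennreal_le_epsilon)
        fix \<epsilon> :: real assume e: "\<epsilon> > 0"
        obtain g where g: "g \<in> PSI_space s \<phi>" "energy s (\<lambda>\<omega>. fhat f \<omega> - fhat (dilate h g) \<omega>)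
           \<le> ennreal (K * h powr (2 * (real k - s))) * energy (real k) (fhat f) + ennreal \<epsilon>"
          using approximation_step[OF sk \<phi> \<eta> r low N0 N \<sigma> h True f e] unfolding K_def by blast
        have gs: "g \<in> sobolev s" using g(1) PSI_space_sobolev[OF \<phi>] by blast
        note FG = sobolev_diff[OF fs sobolev_dilate(1)[OF gs h]]
        have "?I \<le> sobolev_norm s (\<lambda>\<psi>. f \<psi> - dilate h g \<psi>)"
          by (rule cINF_lower[OF bdd]) (use g(1) in blast)
        then have "ennreal (?I\<^sup>2) \<le> ennreal ((sobolev_norm s (\<lambda>\<psi>. f \<psi> - dilate h g \<psi>))\<^sup>2)"
          using I0 by (intro ennreal_leI power_mono)
        also have "\<dots> = energy s (\<lambda>\<omega>. fhat f \<omega> - fhat (dilate h g) \<omega>)"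
          unfolding sobolevD(6)[OF FG(1)] by (rule energy_cong[OF FG(2)])
        also have "\<dots> \<le> ennreal (K * h powr (2 * (real k - s))) * energy (real k) (fhat f) + ennreal \<epsilon>" by (rule g(2))
        also have "energy (real k) (fhat f) = ennreal ((sobolev_norm (real k) f)\<^sup>2)" by (rule sobolevD(6)[OF f, symmetric])
        also have "ennreal (K * h powr (2 * (real k - s))) * ennreal ((sobolev_norm (real k) f)\<^sup>2) = ennreal (K * h powr (2 * (real k - s)) * (sobolev_norm (real k) f)\<^sup>2)"
          using K0 by (intro ennreal_mult[symmetric]) auto
        finally show "ennreal (?I\<^sup>2) \<le> ennreal (K * h powr (2 * (real k - s)) * (sobolev_norm (real k) f)\<^sup>2) + ennreal \<epsilon>" .
      qed
      then have "?I\<^sup>2 \<le> K * h powr (2 * (real k - s)) * (sobolev_norm (real k) f)\<^sup>2"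
        by (subst (asm) ennreal_le_iff) (use K0 in auto)
      also have "\<dots> = (sqrt K * h powr (real k - s) * sobolev_norm (real k) f)\<^sup>2"
      proof -
        have "(h powr (real k - s))\<^sup>2 = h powr (2 * (real k - s))"
          using h by (simp add: powr_powr mult.commute flip: powr_numeral)
        then show ?thesis using K0 by (simp add: power_mult_distrib)
      qed
      finally have "?I \<le> sqrt K * h powr (real k - s) * sobolev_norm (real k) f"
        by (rule power2_le_imp_le) (use K0 nk in auto)
      also have "\<dots> \<le> C * h powr (real k - s) * sobolev_norm (real k) f"
        using nk by (intro mult_right_mono) (auto simp: C_def)
      finally show ?thesis .
    next
      case False
      have "?I \<le> sobolev_norm s (\<lambda>\<psi>. f \<psi> - dilate h (\<lambda>\<psi>. 0) \<psi>)"
        by (rule cINF_lower[OF bdd]) (use PSI_space_closed(4) in blast)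
      also have "\<dots> = sobolev_norm s f" by (simp add: dilate_def)
      also have "\<dots> \<le> sobolev_norm (real k) f"
      proof -
        have "ennreal ((sobolev_norm s f)\<^sup>2) \<le> ennreal ((sobolev_norm (real k) f)\<^sup>2)"
          unfolding sobolevD(6)[OF fs] sobolevD(6)[OF f] by (rule energy_mono) (use sk in simp)
        then have "(sobolev_norm s f)\<^sup>2 \<le> (sobolev_norm (real k) f)\<^sup>2" by (subst (asm) ennreal_le_iff) auto
        then show ?thesis by (rule power2_le_imp_le[OF _ nk])
      qed
      also have "\<dots> = 1 * sobolev_norm (real k) f" by simp
      also have "\<dots> \<le> (C * h powr (real k - s)) * sobolev_norm (real k) f"
      proof (intro mult_right_mono nk)
        have "1 \<le> h powr (real k - s)" using False sk by (intro ge_one_powr_ge_zero) auto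
        moreover have "1 \<le> C" by (simp add: C_def)
        ultimately show "1 \<le> C * h powr (real k - s)" using mult_mono[of 1 C 1 "h powr (real k - s)"] by simp
      qed
      finally show ?thesis .
    qed
  qed
  then show ?thesis unfolding provides_approximation_order_def by blast
qed

section \<open>The characterization of approximation order\<close>

theorem theorem9:
  fixes k :: nat and s :: real and \<phi> :: "'d::finite dist"
    and \<eta>1 \<eta>2 \<rho> :: real and \<Omega> :: "(real ^ 'd) set"
  assumes "s < real k"
    and "\<phi> \<in> sobolev s"
    and "\<eta>1 > 0" and "\<eta>2 > 0"
    and "\<rho> > 0" and "\<Omega> = ball 0 \<rho>"
    and "AE \<omega> in lborel. \<omega> \<in> \<Omega> \<longrightarrow> \<eta>1 \<le> norm (fhat \<phi> \<omega>) \<and> norm (fhat \<phi> \<omega>) \<le> \<eta>2"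
    and "(\<Sum>\<^sub>\<infinity>\<beta>\<in>dual_lattice - {0}. ennreal (norm \<beta> powr (2 * s)) *
            (SUP \<gamma>\<in>{\<gamma>. mi_abs \<gamma> \<le> k}. (Linf_norm_D \<gamma> (fhat \<phi>) ((+) \<beta> ` \<Omega>))\<^sup>2)) < \<infinity>"
  shows "provides_approximation_order s (PSI_space s \<phi>) (real k) \<longleftrightarrow>
    (\<forall>\<alpha>\<in>dual_lattice - {0}. \<exists>C r. r > 0 \<and>
       (AE \<omega> in lborel. norm \<omega> < r \<longrightarrow> norm (fhat \<phi> (\<omega> + \<alpha>)) \<le> C * norm \<omega> ^ k))"
proof
  assume order: "provides_approximation_order s (PSI_space s \<phi>) (real k)"
  have "AE \<omega> in lborel. \<omega> \<in> ball 0 \<rho> \<longrightarrow> norm (fhat \<phi> \<omega>) \<le> \<eta>2 \<and> fhat \<phi> \<omega> \<noteq> 0"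
    using assms(7) by eventually_elim (use assms(3,6) in auto)
  then show "\<forall>\<alpha>\<in>dual_lattice - {0}. \<exists>C r. r > 0 \<and>
       (AE \<omega> in lborel. norm \<omega> < r \<longrightarrow> norm (fhat \<phi> (\<omega> + \<alpha>)) \<le> C * norm \<omega> ^ k)"
    using approximation_order_necessary[OF assms(1,2,4,5) _ order] by blast
next
  assume O: "\<forall>\<alpha>\<in>dual_lattice - {0}. \<exists>C r. r > 0 \<and>
       (AE \<omega> in lborel. norm \<omega> < r \<longrightarrow> norm (fhat \<phi> (\<omega> + \<alpha>)) \<le> C * norm \<omega> ^ k)"
  let ?A = "dual_lattice - {0 :: real^'d}" and ?c = "taylor_const CARD('d) k"
  define S where "S \<beta> = (SUP \<gamma>\<in>{\<gamma>. mi_abs \<gamma> \<le> k}. (Linf_norm_D \<gamma> (fhat \<phi>) ((+) \<beta> ` \<Omega>))\<^sup>2)" for \<beta>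
  have c0: "?c \<ge> 0" by (simp add: taylor_const_def)
  have cnt: "countable ?A" by (rule countable_subset[OF _ countable_dual_lattice]) auto
  have total: "(\<integral>\<^sup>+\<beta>. ennreal (norm \<beta> powr (2 * s)) * S \<beta> \<partial>count_space ?A) < \<infinity>"
    using nn_integral_count_space_le_infsum[OF cnt, of "\<lambda>\<beta>. ennreal (norm \<beta> powr (2 * s)) * S \<beta>"] assms(8)
    unfolding S_def by (rule order.strict_trans1)
  (* Convergence of the series makes each term finite, hence provides weak derivatives. *)
  have Sfin: "S \<beta> < \<infinity>" if "\<beta> \<in> ?A" for \<beta>
  proof -
    have "ennreal (norm \<beta> powr (2 * s)) * S \<beta> < \<infinity>"
      by (rule order.strict_trans1[OF _ total]) (rule nn_integral_ge_point[OF that])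
    moreover have "norm \<beta> powr (2 * s) > 0" using that by simp
    ultimately show ?thesis by (auto simp: ennreal_mult_less_top)
  qed
  (* m \<beta> is the maximum of the norms, a bound for every derivative of order k on the ball
     around \<beta>. *)
  define m where "m \<beta> = sqrt (enn2real (S \<beta>))" for \<beta>
  have m0: "m \<beta> \<ge> 0" for \<beta> by (simp add: m_def)
  have mS: "ennreal ((m \<beta>)\<^sup>2) = S \<beta>" if "\<beta> \<in> ?A" for \<beta>
    using Sfin[OF that] by (simp add: m_def)
  define N where "N \<beta> = ?c * m \<beta>" for \<beta>
  define r where "r = min \<rho> 1"
  show "provides_approximation_order s (PSI_space s \<phi>) (real k)"
  proof (rule approximation_order_sufficient[OF assms(1,2,3)])
    show "0 < r" "r \<le> 1" using assms(5) by (auto simp: r_def)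
    show "AE \<omega> in lborel. norm \<omega> < r \<longrightarrow> \<eta>1 \<le> norm (fhat \<phi> \<omega>)"
      using assms(7) by eventually_elim (auto simp: assms(6) r_def)
    show "N \<alpha> \<ge> 0" for \<alpha> using c0 m0 by (simp add: N_def)
    show "AE \<omega> in lborel. norm \<omega> < r \<longrightarrow> norm (fhat \<phi> (\<omega> + \<alpha>)) \<le> N \<alpha> * norm \<omega> ^ k" if \<alpha>: "\<alpha> \<in> ?A" for \<alpha>
    proof -
      obtain C q where q: "q > 0" "AE \<omega> in lborel. norm \<omega> < q \<longrightarrow> norm (fhat \<phi> (\<omega> + \<alpha>)) \<le> C * norm \<omega> ^ k"
        using O \<alpha> by blast
      have ball: "(+) \<alpha> ` \<Omega> = ball \<alpha> \<rho>" unfolding assms(6) by simp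
      have "AE \<omega> in lborel. norm \<omega> < \<rho> \<longrightarrow> norm (fhat \<phi> (\<omega> + \<alpha>)) \<le> ?c * m \<alpha> * norm \<omega> ^ k"
      proof (rule Linf_taylor[OF sobolevD(2)[OF assms(2)] m0 _ q])
        fix \<gamma> :: "nat^'d" assume "mi_abs \<gamma> = k"
        then have "(Linf_norm_D \<gamma> (fhat \<phi>) (ball \<alpha> \<rho>))\<^sup>2 \<le> S \<alpha>"
          unfolding S_def ball by (intro SUP_upper) simp
        also have "\<dots> = (ennreal (m \<alpha>))\<^sup>2" using mS[OF \<alpha>] m0 by (simp add: ennreal_power)
        finally show "Linf_norm_D \<gamma> (fhat \<phi>) (ball \<alpha> \<rho>) \<le> ennreal (m \<alpha>)"
          by (rule ennreal_power2_le_imp_le[OF _ m0])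
      qed
      then show ?thesis by eventually_elim (auto simp: N_def r_def)
    qed
    have "(\<integral>\<^sup>+\<alpha>. ennreal (norm \<alpha> powr (2 * s) * (N \<alpha>)\<^sup>2) \<partial>count_space ?A) = (\<integral>\<^sup>+\<alpha>. ennreal (?c\<^sup>2) * (ennreal (norm \<alpha> powr (2 * s)) * S \<alpha>) \<partial>count_space ?A)"
      by (intro nn_integral_cong) (simp add: mS[symmetric] N_def power_mult_distrib mult_ac flip: ennreal_mult)
    also have "\<dots> = ennreal (?c\<^sup>2) * (\<integral>\<^sup>+\<alpha>. ennreal (norm \<alpha> powr (2 * s)) * S \<alpha> \<partial>count_space ?A)"
      by (rule nn_integral_cmult) simp
    also have "\<dots> < \<infinity>" using total by (simp add: ennreal_mult_less_top)
    finally show "(\<integral>\<^sup>+\<alpha>. ennreal (norm \<alpha> powr (2 * s) * (N \<alpha>)\<^sup>2) \<partial>count_space ?A) < \<infinity>" .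
  qed
qed

end
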